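(* Let $r\ge1$, $a\ge0$, $b\ge0$, $\iota\ge0$. For $f\in C_0^\infty(\mathbb R^r)^W$ and $\Re\delta>-1-\iota-2b$ let $$\zeta_\delta(f)=\frac1{z_\delta}\int_{\mathbb R^r}|\mathrm{SH}(t)|^\delta f(t)\,d\mu(t),$$ $$z_\delta=\Gamma_a\Big(\frac\delta2+\frac a2(r-1)+1\Big)\,\Gamma_a\Big(\frac{\delta-1+\iota+2b}2+\frac a2(r-1)+1\Big).$$ Then the distribution $\zeta_\delta$ on $C_0^\infty(\mathbb R^r)^W$ has an analytic continuation in $\delta$ from $\Re\delta>-1-\iota-2b$ to all $\delta\in\mathbb C$, and $$\mathcal M_\delta\zeta_\delta=2^{2r}\zeta_{\delta-2},$$ where $\mathcal M_\delta=\prod_{j=1}^r\big(D_j^2-(\delta+\rho_1)^2\big)$.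
   Context: $\mathrm{SH}(t)=\prod_{j=1}^r\sinh t_j$ for $t=t_1\xi_1+\dots+t_r\xi_r\in\mathfrak a=\mathbb R^r$. $\Sigma$ is the root system on $\mathfrak a$ of type B, D or BC with roots $\pm\xi_i^*\pm\xi_j^*$ ($i\neq j$), $\pm\xi_j^*$, $\pm2\xi_j^*$ with multiplicities $a$, $2b$, $\iota$ respectively (roots with multiplicity zero are absent), where $\{\xi_j^*\}$ is the dual basis; $W$ is its Weyl group, and positive roots are taken with respect to $\xi_1^*>\dots>\xi_r^*>0$. With $k_\alpha$ the multiplicity of $\alpha$, $$d\mu(t)=\prod_{\alpha\in\Sigma_+}|2\sinh\alpha(t)|^{k_\alpha}dt .$$ $C_0^\infty(\mathbb R^r)^W$ denotes the $W$-invariant smooth compactly supported functions. $\Gamma_a(\lambda)=\prod_{j=1}^r\Gamma(\lambda-\frac a2(j-1))$ is the Gindikin Gamma function. Let $\rho_j=\iota+b+a(r-j)$ (coefficients of the half sum of positive roots). The Cherednik operators are $$D_j=\partial_j-a\sum_{i<j}\frac{1-s_{ij}}{1-e^{-2(t_i-t_j)}}+a\sum_{j<k}\frac{1-s_{jk}}{1-e^{-2(t_j-t_k)}}+a\sum_{k\ne j}\frac{1-\sigma_{jk}}{1-e^{-2(t_j+t_k)}}+2\iota\frac{1-\sigma_j}{1-e^{-4t_j}}+2b\frac{1-\sigma_j}{1-e^{-2t_j}}-\rho_j,$$ where $s_{ij}$ interchanges $\xi_i$ and $\xi_j$; $\sigma_{ij}$ sends $\xi_i\mapsto-\xi_j$,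 $\xi_j\mapsto-\xi_i$; $\sigma_j$ sends $\xi_j\mapsto-\xi_j$ (all other $\xi_k$ fixed). $\mathcal M_\delta$ acts on distributions on $C_0^\infty(\mathbb R^r)^W$ by duality with respect to $d\mu$: $(\mathcal M_\delta\zeta)(f)=\zeta(\mathcal M_\delta f)$. Analytic continuation means that for each $f\in C_0^\infty(\mathbb R^r)^W$ the function $\delta\mapsto\zeta_\delta(f)$ extends to an entire function. *)

theory Defs
  imports "HOL-Analysis.Analysis"
begin

text \<open>
  The space is \<open>real^'n\<close> with \<open>r = CARD('n)\<close>; the linear order of the index type plays the role of
  \<open>1 < \<dots> < r\<close>.  Linear forms are identified with vectors by the standard inner product, so that
  the dual basis element of index \<open>j\<close> is \<open>axis j 1\<close> and a root \<open>\<alpha>\<close> takes the value \<open>\<alpha> \<bullet> t\<close> at \<open>t\<close>.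
\<close>

subsection \<open>Root system, Weyl group, measure\<close>

definition root_mult :: "real \<Rightarrow> real \<Rightarrow> real \<Rightarrow> real^'n \<Rightarrow> real" where
  "root_mult a b \<iota> \<alpha> =
    (if \<exists>i j. i \<noteq> j \<and> (\<exists>e\<in>{1, -1}. \<exists>e'\<in>{1, -1}. \<alpha> = e *\<^sub>R axis i 1 + e' *\<^sub>R axis j 1) then a
     else if \<exists>j. \<exists>e\<in>{1, -1}. \<alpha> = e *\<^sub>R axis j 1 then 2 * b
     else if \<exists>j. \<exists>e\<in>{2, -2}. \<alpha> = e *\<^sub>R axis j 1 then \<iota>
     else 0)"

definition roots :: "real \<Rightarrow> real \<Rightarrow> real \<Rightarrow> (real^'n) set" where
  "roots a b \<iota> = {\<alpha>. root_mult a b \<iota> \<alpha> \<noteq> 0}"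

text \<open>Lexicographic order: the leading nonzero coordinate is positive.\<close>

definition positive_roots :: "real \<Rightarrow> real \<Rightarrow> real \<Rightarrow> (real^'n::{finite,wellorder}) set" where
  "positive_roots a b \<iota> = {\<alpha> \<in> roots a b \<iota>. \<exists>i. \<alpha> $ i > 0 \<and> (\<forall>j<i. \<alpha> $ j = 0)}"

definition root_reflection :: "real^'n \<Rightarrow> real^'n \<Rightarrow> real^'n" where
  "root_reflection \<alpha> t = t - (2 * (\<alpha> \<bullet> t) / (\<alpha> \<bullet> \<alpha>)) *\<^sub>R \<alpha>"

text \<open>Inverses need not be added because the generators are involutions.\<close>

inductive_set weyl_group :: "real \<Rightarrow> real \<Rightarrow> real \<Rightarrow> (real^'n \<Rightarrow> real^'n) set"
  for a b \<iota> :: real where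
  weyl_id: "id \<in> weyl_group a b \<iota>"
| weyl_step: "w \<in> weyl_group a b \<iota> \<Longrightarrow> \<alpha> \<in> roots a b \<iota> \<Longrightarrow> root_reflection \<alpha> \<circ> w \<in> weyl_group a b \<iota>"

definition root_measure :: "real \<Rightarrow> real \<Rightarrow> real \<Rightarrow> (real^'n::{finite,wellorder}) measure" where
  "root_measure a b \<iota> = density lborel
     (\<lambda>t. ennreal (\<Prod>\<alpha>\<in>positive_roots a b \<iota>. \<bar>2 * sinh (\<alpha> \<bullet> t)\<bar> powr root_mult a b \<iota> \<alpha>))"

subsection \<open>Test functions\<close>

definition partial :: "'n \<Rightarrow> (real^'n \<Rightarrow> complex) \<Rightarrow> real^'n \<Rightarrow> complex" where
  "partial j f t = frechet_derivative f (at t) (axis j 1)"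

primrec times_cont_diff :: "nat \<Rightarrow> (real^'n \<Rightarrow> complex) \<Rightarrow> bool" where
  "times_cont_diff 0 f \<longleftrightarrow> continuous_on UNIV f"
| "times_cont_diff (Suc k) f \<longleftrightarrow>
     (\<forall>t. f differentiable (at t)) \<and> (\<forall>j. times_cont_diff k (partial j f))"

definition smooth :: "(real^'n \<Rightarrow> complex) \<Rightarrow> bool" where
  "smooth f \<longleftrightarrow> (\<forall>k. times_cont_diff k f)"

definition test_functions :: "real \<Rightarrow> real \<Rightarrow> real \<Rightarrow> (real^'n \<Rightarrow> complex) set" where
  "test_functions a b \<iota> =
     {f. smooth f \<and> compact (closure {t. f t \<noteq> 0}) \<and> (\<forall>w\<in>weyl_group a b \<iota>. \<forall>t. f (w t) = f t)}"

subsection \<open>Cherednik operators\<close>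

definition swap_coords :: "'n \<Rightarrow> 'n \<Rightarrow> real^'n \<Rightarrow> real^'n" where
  "swap_coords i j t = (\<chi> k. if k = i then t $ j else if k = j then t $ i else t $ k)"

definition neg_swap_coords :: "'n \<Rightarrow> 'n \<Rightarrow> real^'n \<Rightarrow> real^'n" where
  "neg_swap_coords i j t = (\<chi> k. if k = i then - (t $ j) else if k = j then - (t $ i) else t $ k)"

definition neg_coord :: "'n \<Rightarrow> real^'n \<Rightarrow> real^'n" where
  "neg_coord j t = (\<chi> k. if k = j then - (t $ k) else t $ k)"

text \<open>
  The operator \<open>(1 - s) / (1 - exp (- p))\<close> for a reflection \<open>s\<close> in the hyperplane \<open>p = 0\<close>.
  On that hyperplane the formula is \<open>0 / 0\<close>, and the value is the continuous extension.
\<close>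

definition refl_quotient ::
  "(real^'n \<Rightarrow> real^'n) \<Rightarrow> (real^'n \<Rightarrow> real) \<Rightarrow> (real^'n \<Rightarrow> complex) \<Rightarrow> real^'n \<Rightarrow> complex" where
  "refl_quotient s p f t =
    (let q = (\<lambda>u. (f u - f (s u)) / of_real (1 - exp (- p u)))
     in if p t \<noteq> 0 then q t else Lim (at t within {u. p u \<noteq> 0}) q)"

text \<open>The number of indices above \<open>j\<close> is \<open>r - j\<close>.\<close>

definition rho :: "real \<Rightarrow> real \<Rightarrow> real \<Rightarrow> 'n::{finite,wellorder} \<Rightarrow> real" where
  "rho a b \<iota> j = \<iota> + b + a * real (card {k. j < k})"

definition cherednik ::
  "real \<Rightarrow> real \<Rightarrow> real \<Rightarrow> 'n::{finite,wellorder} \<Rightarrow>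
     (real^'n::{finite,wellorder} \<Rightarrow> complex) \<Rightarrow> real^'n::{finite,wellorder} \<Rightarrow> complex" where
  "cherednik a b \<iota> j f t =
     partial j f t
     - of_real a * (\<Sum>i | i < j. refl_quotient (swap_coords i j) (\<lambda>u. 2 * (u $ i - u $ j)) f t)
     + of_real a * (\<Sum>k | j < k. refl_quotient (swap_coords j k) (\<lambda>u. 2 * (u $ j - u $ k)) f t)
     + of_real a * (\<Sum>k | k \<noteq> j. refl_quotient (neg_swap_coords j k) (\<lambda>u. 2 * (u $ j + u $ k)) f t)
     + of_real (2 * \<iota>) * refl_quotient (neg_coord j) (\<lambda>u. 4 * u $ j) f t
     + of_real (2 * b) * refl_quotient (neg_coord j) (\<lambda>u. 2 * u $ j) f t
     - of_real (rho a b \<iota> j) * f t"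

definition bs_factor ::
  "real \<Rightarrow> real \<Rightarrow> real \<Rightarrow> complex \<Rightarrow> 'n::{finite,wellorder} \<Rightarrow>
     (real^'n::{finite,wellorder} \<Rightarrow> complex) \<Rightarrow> real^'n::{finite,wellorder} \<Rightarrow> complex" where
  "bs_factor a b \<iota> \<delta> j f t =
     cherednik a b \<iota> j (cherednik a b \<iota> j f) t - (\<delta> + of_real (rho a b \<iota> (Min (UNIV :: 'n set))))\<^sup>2 * f t"

text \<open>
  The operators of different index commute on smooth functions; the composition is taken in
  increasing order of the indices, the last factor being applied first.
\<close>

definition bs_operator ::
  "real \<Rightarrow> real \<Rightarrow> real \<Rightarrow> complex \<Rightarrow>
     (real^'n::{finite,wellorder} \<Rightarrow> complex) \<Rightarrow> real^'n::{finite,wellorder} \<Rightarrow> complex" where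
  "bs_operator a b \<iota> \<delta> = foldr (bs_factor a b \<iota> \<delta>) (sorted_list_of_set UNIV)"

subsection \<open>The zeta distribution\<close>

definition SH :: "real^'n \<Rightarrow> real" where
  "SH t = (\<Prod>j\<in>UNIV. sinh (t $ j))"

definition gindikin_Gamma :: "nat \<Rightarrow> real \<Rightarrow> complex \<Rightarrow> complex" where
  "gindikin_Gamma r a l = (\<Prod>j=1..r. Gamma (l - of_real (a / 2 * (real j - 1))))"

text \<open>
  \<open>Gamma\<close> is \<open>0\<close> at its poles, so \<open>1 / zeta_norm\<close> vanishes there, which is the value of the entire
  function that it denotes.
\<close>

definition zeta_norm :: "nat \<Rightarrow> real \<Rightarrow> real \<Rightarrow> real \<Rightarrow> complex \<Rightarrow> complex" where
  "zeta_norm r a b \<iota> \<delta> =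
     gindikin_Gamma r a (\<delta> / 2 + of_real (a / 2 * (real r - 1)) + 1) *
     gindikin_Gamma r a ((\<delta> - 1 + of_real (\<iota> + 2 * b)) / 2 + of_real (a / 2 * (real r - 1)) + 1)"

definition zeta_integrand :: "complex \<Rightarrow> (real^'n \<Rightarrow> complex) \<Rightarrow> real^'n \<Rightarrow> complex" where
  "zeta_integrand \<delta> f t = of_real \<bar>SH t\<bar> powr \<delta> * f t"

definition zeta ::
  "real \<Rightarrow> real \<Rightarrow> real \<Rightarrow> complex \<Rightarrow> (real^'n::{finite,wellorder} \<Rightarrow> complex) \<Rightarrow> complex" where
  "zeta a b \<iota> \<delta> f =
     1 / zeta_norm CARD('n) a b \<iota> \<delta> * integral\<^sup>L (root_measure a b \<iota>) (zeta_integrand \<delta> f)"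

end

theory Submission
  imports Defs "HOL-Complex_Analysis.Complex_Analysis"
begin

text \<open>
  The Cherednik operators commute and factor as \<open>D\<^sub>j\<^sup>2 - c\<^sup>2 = (D\<^sub>j + c) (D\<^sub>j - c)\<close> with \<open>c = \<delta> + \<rho>\<^sub>1\<close>.
  The adjoint of \<open>D\<^sub>j\<close> with respect to \<open>\<mu>\<close> is its conjugate by \<open>t \<mapsto> - t\<close>.  For large real \<open>\<delta>\<close> the
  adjoint of \<open>D\<^sub>j + c\<close> turns \<open>(\<Prod>i<j. 1 - coth t\<^sub>i) * \<bar>SH t\<bar> powr \<delta>\<close> into a multiple of the same function
  with one more factor, and, once all factors are present, the adjoints of \<open>D\<^sub>j - c\<close>, taken with \<open>j\<close>
  decreasing, multiply by the factors \<open>- 1 - coth t\<^sub>j\<close>.  As \<open>(coth\<^sup>2 - 1) * sinh\<^sup>2 = 1\<close>, the result is a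
  multiple of \<open>\<bar>SH t\<bar> powr (\<delta> - 2)\<close>, and the normalization absorbs the constants.  This recursion, read
  from right to left, continues the zeta distribution in steps of width \<open>2\<close>.  For the continuation it
  has to be available on all compactly supported smooth functions: the operator is a polynomial in
  \<open>(\<delta> + \<rho>\<^sub>1)\<^sup>2\<close> whose coefficients preserve that class.
\<close>

subsection \<open>Smooth functions and division by linear forms\<close>

text \<open>On the walls the reflection quotients of \<open>D\<^sub>j\<close> are
  \<open>0 / 0\<close>. Division by linear forms shows that the operators preserve smoothness; from
  then on identities are checked off the walls, where
  \<open>1 / (1 - exp (- 2 * z)) = (1 + coth z) / 2\<close> gives closed formulas, and carried to
  the walls by density. Integration by parts differentiates the density of \<open>\<mu>\<close>,
  whose logarithmic derivative has simple poles on the walls. At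
  \<open>t\<^sub>i = t\<^sub>j\<close> and \<open>t\<^sub>i = - t\<^sub>j\<close> they are
  integrable against the density, which behaves like \<open>\<bar>x\<bar> powr a\<close> with
  \<open>a > 0\<close>, and absent for \<open>a = 0\<close>. At \<open>t\<^sub>j = 0\<close> the
  high power of SH compensates them; hence the restriction to large real \<delta>, lifted by the
  identity theorem. The scalars of the recursion are \<open>\<delta> + a (j - 1)\<close> and
  \<open>\<delta> - 1 + \<iota> + 2 b + a (r - j)\<close>, each twice the ratio of the corresponding
  Gamma factors at \<delta> and \<open>\<delta> - 2\<close>; the \<open>2 r\<close> factors
  \<open>2\<close> make up the constant of the theorem. A single \<open>D\<^sub>j\<close> is not
  equivariant under the Weyl group. Only the symmetric product is, and this keeps it acting on
  invariant functions.\<close>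

lemma tcd_Suc_mono: "times_cont_diff (Suc k) f \<Longrightarrow> times_cont_diff k f"
proof (induction k arbitrary: f)
  case 0
  then have "\<forall>t. f differentiable (at t)" by simp
  then have "continuous_on UNIV f"
    by (simp add: continuous_at_imp_continuous_on differentiable_imp_continuous_within)
  then show ?case by simp
next
  case (Suc k)
  have d: "\<forall>t. f differentiable (at t)" and p: "\<And>j. times_cont_diff (Suc k) (partial j f)"
    using Suc.prems by (metis times_cont_diff.simps(2))+
  have "\<And>j. times_cont_diff k (partial j f)" using Suc.IH[OF p] .
  then show ?case using d by simp
qed

lemma tcd_has_derivative: "times_cont_diff (Suc k) f \<Longrightarrow> (f has_derivative frechet_derivative f (at t)) (at t)"
  by (simp add: frechet_derivative_works)

text \<open>Any explicit derivative may stand in for \<open>frechet_derivative\<close>; closure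
  proofs then only have to recognise its values on the basis vectors as functions of order
  \<open>k\<close>.\<close>

lemma tcd_Suc_I:
  assumes "\<And>t. (f has_derivative f' t) (at t)"
    and "\<And>j. times_cont_diff k (\<lambda>t. f' t (axis j 1))"
  shows "times_cont_diff (Suc k) f"
proof -
  have "partial j f = (\<lambda>t. f' t (axis j 1))" for j
    unfolding partial_def fun_eq_iff using frechet_derivative_at[OF assms(1)] by metis
  moreover have "\<forall>t. f differentiable (at t)" using assms(1) differentiableI by blast
  ultimately show ?thesis using assms(2) by simp
qed

lemma tcd_partial: "times_cont_diff (Suc k) f \<Longrightarrow> times_cont_diff k (partial j f)"
  by simp

lemma tcd_const: "times_cont_diff k (\<lambda>t. c)"
proof (induction k arbitrary: c)
  case (Suc k) show ?case by (rule tcd_Suc_I[where f'="\<lambda>t h. 0"]) (auto intro: Suc)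
qed auto

lemma tcd_add: "times_cont_diff k f \<Longrightarrow> times_cont_diff k g \<Longrightarrow> times_cont_diff k (\<lambda>t. f t + g t)"
proof (induction k arbitrary: f g)
  case (Suc k)
  show ?case
    by (rule tcd_Suc_I[OF has_derivative_add[OF tcd_has_derivative[OF Suc.prems(1)] tcd_has_derivative[OF Suc.prems(2)]]])
       (use Suc in \<open>auto simp: partial_def[symmetric]\<close>)
qed (auto intro: continuous_intros)

lemma tcd_mult: "times_cont_diff k f \<Longrightarrow> times_cont_diff k g \<Longrightarrow> times_cont_diff k (\<lambda>t. f t * g t)"
proof (induction k arbitrary: f g)
  case (Suc k)
  have m: "times_cont_diff k f" "times_cont_diff k g" using Suc.prems tcd_Suc_mono by blast+
  show ?case
    by (rule tcd_Suc_I[OF has_derivative_mult[OF tcd_has_derivative[OF Suc.prems(1)] tcd_has_derivative[OF Suc.prems(2)]]])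
       (use Suc m in \<open>auto simp: partial_def[symmetric] intro!: tcd_add\<close>)
qed (auto intro: continuous_intros)

lemma tcd_sum: "(\<And>i. i \<in> A \<Longrightarrow> times_cont_diff k (f i)) \<Longrightarrow> times_cont_diff k (\<lambda>t. \<Sum>i\<in>A. f i t)"
  by (induction A rule: infinite_finite_induct) (auto intro: tcd_const tcd_add)

lemma tcd_inverse:
  "times_cont_diff k f \<Longrightarrow> (\<And>t. f t \<noteq> 0) \<Longrightarrow> times_cont_diff k (\<lambda>t. inverse (f t))"
proof (induction k arbitrary: f)
  case (Suc k)
  have m: "times_cont_diff k f" using Suc.prems tcd_Suc_mono by blast
  have i: "times_cont_diff k (\<lambda>t. inverse (f t))" using Suc m by blast
  have p: "times_cont_diff k (\<lambda>t. frechet_derivative f (at t) (axis j 1))" for j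
    using tcd_partial[OF Suc.prems(1)] by (simp add: partial_def[abs_def])
  have e: "(\<lambda>t. - (a t * p t * a t)) = (\<lambda>t. (-1) * ((a t * p t) * a t))" for a p :: "real^'b \<Rightarrow> complex" by simp
  show ?case
    by (rule tcd_Suc_I[OF Deriv.has_derivative_inverse[OF Suc.prems(2) tcd_has_derivative[OF Suc.prems(1)]]])
      (unfold e, intro tcd_mult tcd_const i p)
qed (auto intro!: continuous_intros)

lemma vec_axis_expand: "(v::real^'n) = (\<Sum>i\<in>UNIV. (v $ i) *\<^sub>R axis i 1)"
  using basis_expansion[of v] by (simp add: scalar_mult_eq_scaleR)

lemma linear_as_inner:
  fixes p :: "real^'n \<Rightarrow> real"
  assumes p: "linear p"
  shows "p h = (\<chi> l. p (axis l 1)) \<bullet> h"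
proof -
  have "p h = p (\<Sum>i\<in>UNIV. (h $ i) *\<^sub>R axis i 1)" using vec_axis_expand[of h] by simp
  then show ?thesis by (simp add: linear_sum[OF p] linear_cmul[OF p] inner_vec_def mult.commute)
qed

lemma frechet_expand:
  fixes f :: "real^'n \<Rightarrow> complex"
  assumes "f differentiable (at t)"
  shows "frechet_derivative f (at t) v = (\<Sum>i\<in>UNIV. of_real (v $ i) * partial i f t)"
proof -
  have lin: "linear (frechet_derivative f (at t))"
    using assms by (rule linear_frechet_derivative)
  have "frechet_derivative f (at t) v = frechet_derivative f (at t) (\<Sum>i\<in>UNIV. (v $ i) *\<^sub>R axis i 1)"
    using vec_axis_expand[of v] by simp
  also have "\<dots> = (\<Sum>i\<in>UNIV. (v $ i) *\<^sub>R frechet_derivative f (at t) (axis i 1))"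
    by (simp add: linear_sum[OF lin] linear_cmul[OF lin])
  finally show ?thesis by (simp add: partial_def scaleR_conv_of_real)
qed

lemma has_derivative_partials:
  fixes f :: "real^'n \<Rightarrow> complex"
  assumes "f differentiable (at t)"
  shows "(f has_derivative (\<lambda>v. \<Sum>i\<in>UNIV. of_real (v $ i) * partial i f t)) (at t)"
  using assms frechet_expand[OF assms] by (simp add: frechet_derivative_works fun_eq_iff flip: frechet_expand)

text \<open>With the derivative of \<open>f\<close> written through partial derivatives, the chain
  rule yields functions \<open>partial i f \<circ> L\<close> of the same shape, one order
  lower.\<close>

lemma tcd_compose_linear:
  fixes f :: "real^'n \<Rightarrow> complex"
  assumes L: "linear (L :: real^'n \<Rightarrow> real^'n)"
  shows "times_cont_diff k f \<Longrightarrow> times_cont_diff k (\<lambda>t. f (L t))"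
proof (induction k arbitrary: f)
  case 0
  have "continuous_on UNIV L" using L by (simp add: linear_continuous_on linear_conv_bounded_linear)
  with 0 show ?case by (auto intro: continuous_on_compose2)
next
  case (Suc k)
  have dL: "(L has_derivative L) (at t)" for t
    using L by (simp add: linear_conv_bounded_linear bounded_linear_imp_has_derivative)
  have df: "(f has_derivative (\<lambda>v. \<Sum>i\<in>UNIV. of_real (v $ i) * partial i f t)) (at t)" for t
    using Suc.prems by (intro has_derivative_partials) simp
  show ?case
    by (rule tcd_Suc_I[OF has_derivative_compose[OF dL df]])
      (intro tcd_sum tcd_mult tcd_const Suc.IH tcd_partial Suc.prems)
qed

lemma smooth_const [intro]: "smooth (\<lambda>t. c)"
  and smooth_add [intro]: "smooth f \<Longrightarrow> smooth g \<Longrightarrow> smooth (\<lambda>t. f t + g t)"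
  and smooth_mult [intro]: "smooth f \<Longrightarrow> smooth g \<Longrightarrow> smooth (\<lambda>t. f t * g t)"
  and smooth_sum [intro]: "(\<And>i. i \<in> A \<Longrightarrow> smooth (h i)) \<Longrightarrow> smooth (\<lambda>t. \<Sum>i\<in>A. h i t)"
  and smooth_inverse [intro]: "smooth f \<Longrightarrow> (\<And>t. f t \<noteq> 0) \<Longrightarrow> smooth (\<lambda>t. inverse (f t))"
  unfolding smooth_def
  by (blast intro: tcd_const tcd_add tcd_mult tcd_sum tcd_inverse)+

lemma smooth_compose_linear: "linear (L :: real^'n \<Rightarrow> real^'n) \<Longrightarrow> smooth f \<Longrightarrow> smooth (\<lambda>t. f (L t))"
  by (simp add: smooth_def tcd_compose_linear)

lemma smooth_diff [intro]: "smooth f \<Longrightarrow> smooth g \<Longrightarrow> smooth (\<lambda>t. f t - g t)"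
  using smooth_add[OF _ smooth_mult[OF smooth_const[of "-1"]], of f g] by simp

lemma smooth_partial [intro]: "smooth f \<Longrightarrow> smooth (partial j f)"
  unfolding smooth_def by (metis times_cont_diff.simps(2))

lemma smooth_differentiable: "smooth f \<Longrightarrow> f differentiable (at t)"
  unfolding smooth_def by (metis times_cont_diff.simps(2))

lemma smooth_continuous: "smooth f \<Longrightarrow> continuous_on UNIV f"
  unfolding smooth_def by (metis times_cont_diff.simps(1))

lemma smooth_has_derivative:
  "smooth f \<Longrightarrow> (f has_derivative (\<lambda>v. \<Sum>i\<in>UNIV. of_real (v $ i) * partial i f t)) (at t)"
  by (intro has_derivative_partials smooth_differentiable)

lemma has_derivative_partial_eq: "(f has_derivative f') (at t) \<Longrightarrow> partial j f t = f' (axis j 1)"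
  unfolding partial_def using frechet_derivative_at by metis

lemma smooth_exp_linear:
  fixes c :: "real^'n"
  shows "smooth (\<lambda>t. of_real (exp (c \<bullet> t)))"
proof -
  have "times_cont_diff k (\<lambda>t. complex_of_real (exp (c \<bullet> t)))" for k
  proof (induction k)
    case (Suc k)
    have d: "((\<lambda>t. complex_of_real (exp (c \<bullet> t))) has_derivative (\<lambda>h. of_real (exp (c \<bullet> t) * (c \<bullet> h)))) (at t)" for t
      by (auto intro!: derivative_eq_intros simp: mult.commute)
    show ?case
      by (rule tcd_Suc_I[OF d]) (auto intro!: tcd_mult tcd_const Suc)
  qed (auto intro!: continuous_intros)
  then show ?thesis by (simp add: smooth_def)
qed

text \<open>The factor \<open>u ^ m\<close> makes this class of parameter integrals closed under partial derivatives.\<close>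

definition segment_integral :: "(real^'n \<Rightarrow> real) \<Rightarrow> real^'n \<Rightarrow> nat \<Rightarrow> (real^'n \<Rightarrow> complex) \<Rightarrow> real^'n \<Rightarrow> complex" where
  "segment_integral p v m F t = integral {0..1} (\<lambda>u. of_real (u ^ m) * F (t - (u * p t) *\<^sub>R v))"

lemma segment_integrand_continuous:
  fixes p :: "real^'n \<Rightarrow> real"
  assumes p: "linear p" and F: "continuous_on UNIV F"
  shows "continuous_on A (\<lambda>(t, u). complex_of_real (u ^ m) * F (t - (u * p t) *\<^sub>R v))"
proof -
  have "continuous_on UNIV p" using p by (simp add: linear_continuous_on linear_conv_bounded_linear)
  then have "continuous_on A (\<lambda>x. p (fst x))" by (rule continuous_on_compose2) (auto intro: continuous_intros)
  then show ?thesis unfolding split_beta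
    by (intro continuous_intros continuous_on_compose2[OF F]) auto
qed

text \<open>Differentiation under the integral sign. The argument depends on \<open>t\<close> also
  through \<open>u * p t\<close>, so part of the derivative carries an additional factor
  \<open>u\<close>; hence \<open>Suc m\<close>, and the induction has to run over all
  \<open>F\<close> and \<open>m\<close>.\<close>

lemma tcd_segment_integral:
  fixes p :: "real^'n \<Rightarrow> real"
  assumes p: "linear p"
  shows "smooth F \<Longrightarrow> times_cont_diff k (segment_integral p v m F)"
proof (induction k arbitrary: F m)
  case 0
  have "continuous_on (UNIV \<times> cbox 0 1) (\<lambda>(t, u). complex_of_real (u ^ m) * F (t - (u * p t) *\<^sub>R v))"
    by (rule segment_integrand_continuous[OF p smooth_continuous[OF 0]])
  from integral_continuous_on_param[OF this]
  show ?case by (simp add: segment_integral_def[abs_def])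
next
  case (Suc k)
  let ?y = "\<lambda>t u. t - (u * p t) *\<^sub>R v"
  \<comment> \<open>The derivative is encoded as a bounded linear map because its continuity in
    \<open>(t, u)\<close> is required in the operator norm; the vector of the values
    \<open>p (axis l 1)\<close> is the gradient of \<open>p\<close>.\<close>
  define fx where "fx t u = (\<Sum>i\<in>UNIV. blinfun_scaleR_left (complex_of_real (u ^ m) * partial i F (?y t u))
      o\<^sub>L (blinfun_inner_right (axis i 1 - (u * v $ i) *\<^sub>R (\<chi> l. p (axis l 1)))))" for t u
  have pe: "p h = (\<chi> l. p (axis l 1)) \<bullet> h" for h
    by (rule linear_as_inner[OF p])
  have fxa: "fx t u h = of_real (u ^ m) * (\<Sum>i\<in>UNIV. of_real ((?y h u) $ i) * partial i F (?y t u))" for t u h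
    unfolding fx_def blinfun.sum_left sum_distrib_left
    by (rule sum.cong) (auto simp: inner_diff_left pe[of h] inner_axis' inner_commute inner_axis scaleR_conv_of_real[where 'a=complex] algebra_simps)
  have dy: "((\<lambda>t. ?y t u) has_derivative (\<lambda>h. ?y h u)) (at t)" for t u
  proof -
    have "(p has_derivative p) (at t)" using p by (simp add: linear_conv_bounded_linear bounded_linear_imp_has_derivative)
    then show ?thesis by (auto intro!: derivative_eq_intros)
  qed
  have der: "((\<lambda>t. of_real (u ^ m) * F (?y t u)) has_derivative fx t u) (at t within UNIV)" for t u
    unfolding fxa using has_derivative_compose[OF dy smooth_has_derivative[OF Suc.prems]]
    by (auto intro!: derivative_eq_intros)
  have cP: "continuous_on A (\<lambda>x. partial i F (?y (fst x) (snd x)))" for i A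
    using segment_integrand_continuous[OF p smooth_continuous[OF smooth_partial[OF Suc.prems]], of A 0 i v]
    by (simp add: split_beta)
  have cfx: "continuous_on (UNIV \<times> cbox 0 1) (\<lambda>(t, u). fx t u)"
    unfolding fx_def split_beta by (intro continuous_intros cP)
  have int: "(\<lambda>u. of_real (u ^ n) * G (?y t u)) integrable_on cbox 0 1" if "continuous_on UNIV G" for n t and G :: "real^'n \<Rightarrow> complex"
  proof -
    have "continuous_on (cbox 0 1) (\<lambda>u. of_real (u ^ n) * G (?y t u))"
      by (intro continuous_intros continuous_on_compose2[OF that]) auto
    then show ?thesis by (rule integrable_continuous)
  qed
  have D: "(segment_integral p v m F has_derivative integral (cbox 0 1) (fx t)) (at t)" for t
    using leibniz_rule[OF der int[OF smooth_continuous[OF Suc.prems]] cfx] by (simp add: segment_integral_def[abs_def])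
  have cfxt: "continuous_on (cbox 0 1) (fx t)" for t
  proof -
    have "continuous_on (cbox 0 1) (\<lambda>u. case (t, u) of (t, u) \<Rightarrow> fx t u)"
      by (rule continuous_on_compose2[OF cfx]) (auto intro: continuous_intros)
    then show ?thesis by simp
  qed
  have E: "integral (cbox 0 1) (fx t) h = (\<Sum>i\<in>UNIV. of_real (h $ i) * segment_integral p v m (partial i F) t
       + of_real (- (p h * v $ i)) * segment_integral p v (Suc m) (partial i F) t)" for t h
  proof -
    have "integral (cbox 0 1) (fx t) h = integral (cbox 0 1) (\<lambda>u. fx t u h)"
      by (rule blinfun_apply_integral) (rule integrable_continuous[OF cfxt])
    also have "\<dots> = integral (cbox 0 1) (\<lambda>u. \<Sum>i\<in>UNIV. of_real (h $ i) * (of_real (u ^ m) * partial i F (?y t u))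
         + of_real (- (p h * v $ i)) * (of_real (u ^ Suc m) * partial i F (?y t u)))"
      by (intro integral_cong) (auto simp: fxa sum_distrib_left algebra_simps intro!: sum.cong)
    also have "\<dots> = (\<Sum>i\<in>UNIV. integral (cbox 0 1) (\<lambda>u. of_real (h $ i) * (of_real (u ^ m) * partial i F (?y t u))
         + of_real (- (p h * v $ i)) * (of_real (u ^ Suc m) * partial i F (?y t u))))"
      by (intro integral_sum integrable_add integrable_on_mult_right int smooth_continuous smooth_partial Suc.prems) auto
    also have "\<dots> = (\<Sum>i\<in>UNIV. of_real (h $ i) * integral (cbox 0 1) (\<lambda>u. of_real (u ^ m) * partial i F (?y t u))
         + of_real (- (p h * v $ i)) * integral (cbox 0 1) (\<lambda>u. of_real (u ^ Suc m) * partial i F (?y t u)))"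
      by (intro sum.cong refl, subst integral_add)
        (intro integrable_on_mult_right int smooth_continuous smooth_partial Suc.prems, intro integrable_on_mult_right int smooth_continuous smooth_partial Suc.prems, simp only: integral_mult_right)
    finally show ?thesis by (simp add: segment_integral_def)
  qed
  show ?case
    by (rule tcd_Suc_I[OF D]) (unfold E, intro tcd_sum tcd_add tcd_mult tcd_const Suc.IH smooth_partial Suc.prems)
qed

lemma smooth_segment_integral: "linear p \<Longrightarrow> smooth F \<Longrightarrow> smooth (segment_integral p v m F)"
  by (simp add: smooth_def[of "segment_integral p v m F"] tcd_segment_integral)

text \<open>The fundamental theorem of calculus on a segment whose length is proportional to
  \<open>p t\<close>, so that \<open>p t\<close> factors out. For \<open>p v = 2\<close> the end
  point is a reflection of \<open>t\<close>, for \<open>p v = 1\<close> a projection onto the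
  hyperplane \<open>p = 0\<close>.\<close>

lemma hadamard:
  fixes F :: "real^'n \<Rightarrow> complex"
  assumes F: "smooth F"
  shows "F t - F (t - p t *\<^sub>R v) =
    of_real (p t) * segment_integral p v 0 (\<lambda>t. \<Sum>i\<in>UNIV. of_real (v $ i) * partial i F t) t"
proof -
  let ?G = "\<lambda>u::real. F (t - (u * p t) *\<^sub>R v)"
  have d: "(?G has_vector_derivative - of_real (p t) * (\<Sum>i\<in>UNIV. of_real (v $ i) * partial i F (t - (u * p t) *\<^sub>R v))) (at u within {0..1})" for u
  proof -
    have "((\<lambda>u. t - (u * p t) *\<^sub>R v) has_derivative (\<lambda>h. - (h * p t) *\<^sub>R v)) (at u within {0..1})"
      by (auto intro!: derivative_eq_intros)
    from has_derivative_compose[OF this smooth_has_derivative[OF F]] show ?thesis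
      unfolding has_vector_derivative_def by (rule has_derivative_eq_rhs) (auto simp: fun_eq_iff sum_distrib_left scaleR_conv_of_real[where 'a=complex] algebra_simps simp flip: sum_negf)
  qed
  have "((\<lambda>u. - of_real (p t) * (\<Sum>i\<in>UNIV. of_real (v $ i) * partial i F (t - (u * p t) *\<^sub>R v))) has_integral ?G 1 - ?G 0) {0..1}"
    by (rule fundamental_theorem_of_calculus) (use d in auto)
  then have "integral {0..1} (\<lambda>u. - of_real (p t) * (\<Sum>i\<in>UNIV. of_real (v $ i) * partial i F (t - (u * p t) *\<^sub>R v))) = ?G 1 - ?G 0"
    by (rule integral_unique)
  then show ?thesis by (simp add: segment_integral_def algebra_simps)
qed

lemma smooth_line_derivative:
  fixes F :: "real^'n \<Rightarrow> complex"
  assumes "smooth F"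
  shows "((\<lambda>x. F (y + x *\<^sub>R axis i 1)) has_vector_derivative partial i F (y + x *\<^sub>R axis i 1)) (at x within S)"
proof -
  have "((\<lambda>x. y + x *\<^sub>R axis i (1::real)) has_derivative (\<lambda>h. h *\<^sub>R axis i 1)) (at x within S)"
    by (auto intro!: derivative_eq_intros)
  from has_derivative_compose[OF this smooth_has_derivative[OF assms]] show ?thesis
    unfolding has_vector_derivative_def
    by (rule has_derivative_eq_rhs)
      (auto simp: fun_eq_iff axis_def if_distrib if_distribR scaleR_conv_of_real[where 'a=complex] cong: if_cong)
qed

lemma smooth_continuous_compose:
  "smooth F \<Longrightarrow> continuous_on S h \<Longrightarrow> continuous_on S (\<lambda>x. F (h x))"
  by (rule continuous_on_compose2[OF smooth_continuous]) auto

text \<open>Both orders are compared through \<open>F (?p x y) - F (?p x 0)\<close>, the integral of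
  \<open>partial j F\<close>: it is differentiated in \<open>x\<close> under the integral sign and
  then in the upper limit \<open>y\<close>.\<close>

lemma partial_commute:
  fixes F :: "real^'n \<Rightarrow> complex"
  assumes F: "smooth F"
  shows "partial i (partial j F) t = partial j (partial i F) t"
proof -
  let ?p = "\<lambda>x s. t + x *\<^sub>R axis i 1 + s *\<^sub>R axis j (1::real)"
  have c: "continuous_on S (\<lambda>z. G (?p (h z) (k z)))" if "smooth G" "continuous_on S h" "continuous_on S k"
    for G :: "real^'n \<Rightarrow> complex" and S :: "'c::topological_space set" and h k :: "'c \<Rightarrow> real"
    using that by (intro smooth_continuous_compose continuous_intros)
  have ftc: "integral {0..y} (\<lambda>s. partial j F (?p x s)) = F (?p x y) - F (?p x 0)" if "0 \<le> y" for x y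
    using that smooth_line_derivative[OF F] by (intro integral_unique fundamental_theorem_of_calculus) auto
  have swap: "?p x s = (t + s *\<^sub>R axis j 1) + x *\<^sub>R axis i 1" for x s by simp
  have key: "partial i F (?p 0 y) - partial i F (?p 0 0) = integral {0..y} (\<lambda>s. partial i (partial j F) (?p 0 s))"
    if y: "0 \<le> y" for y
  proof -
    have "((\<lambda>x. integral (cbox 0 y) (\<lambda>s. partial j F (?p x s))) has_vector_derivative
        integral (cbox 0 y) (\<lambda>s. partial i (partial j F) (?p 0 s))) (at 0 within UNIV)"
    proof (rule leibniz_rule_vector_derivative)
      show "((\<lambda>x. partial j F (?p x s)) has_vector_derivative partial i (partial j F) (?p x s)) (at x within UNIV)" for x s
        unfolding swap by (intro smooth_line_derivative smooth_partial F)
      show "(\<lambda>s. partial j F (?p x s)) integrable_on cbox 0 y" for x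
        by (intro integrable_continuous c smooth_partial F continuous_intros)
      show "continuous_on (UNIV \<times> cbox 0 y) (\<lambda>(x, s). partial i (partial j F) (?p x s))"
        unfolding split_beta by (intro c smooth_partial F continuous_intros)
    qed auto
    then have 1: "((\<lambda>x. F (?p x y) - F (?p x 0)) has_vector_derivative
        integral {0..y} (\<lambda>s. partial i (partial j F) (?p 0 s))) (at 0)"
      using ftc[OF y] by simp
    have 2: "((\<lambda>x. F (?p x y) - F (?p x 0)) has_vector_derivative partial i F (?p 0 y) - partial i F (?p 0 0)) (at 0)"
      unfolding swap by (intro has_vector_derivative_diff smooth_line_derivative F)
    show ?thesis using vector_derivative_unique_at[OF 2 1] .
  qed
  \<comment> \<open>The formula \<open>key\<close> is available for \<open>0 \<le> y\<close> only,
    so the derivative at \<open>0\<close> is taken within \<open>{0..1}\<close>.\<close>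
  have "((\<lambda>y. integral {0..y} (\<lambda>s. partial i (partial j F) (?p 0 s))) has_vector_derivative
      partial i (partial j F) (?p 0 0)) (at 0 within {0..1})"
    by (intro integral_has_vector_derivative c smooth_partial F continuous_intros) auto
  then have 1: "((\<lambda>y. partial i F (?p 0 y) - partial i F (?p 0 0)) has_vector_derivative
      partial i (partial j F) (?p 0 0)) (at 0 within {0..1})"
    by (rule has_vector_derivative_transform[rotated 2]) (auto simp: key[simplified])
  have 2: "((\<lambda>y. partial i F (?p 0 y) - partial i F (?p 0 0)) has_vector_derivative
      partial j (partial i F) (?p 0 0) - 0) (at 0 within {0..1})"
    by (intro has_vector_derivative_diff smooth_line_derivative F smooth_partial has_vector_derivative_const)
  have "partial i (partial j F) (?p 0 0) = partial j (partial i F) (?p 0 0) - 0"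
    by (rule vector_derivative_unique_within_closed_interval[OF _ _ 1[folded cbox_interval] 2[folded cbox_interval]]) auto
  then show ?thesis by simp
qed

text \<open>Numerator and denominator both vanish on the hyperplane \<open>P = 0\<close>. Hadamard's
  lemma splits the factor \<open>P\<close> off each of them, and the remaining factor
  \<open>E\<close> of the denominator has no zero, so the quotient of the remaining factors is
  smooth and also gives the value on the hyperplane.\<close>

lemma smooth_refl_quotient:
  fixes P :: "real^'n \<Rightarrow> real"
  assumes P: "linear P" and v: "P v = 2" and s: "\<And>t. s t = t - P t *\<^sub>R v" and f: "smooth f"
  shows "smooth (refl_quotient s P f)"
proof -
  define g where "g = segment_integral P v 0 (\<lambda>t. \<Sum>i\<in>UNIV. of_real (v $ i) * partial i f t)"
  \<comment> \<open>Since \<open>P w = 1\<close>, the segment from \<open>t\<close> in direction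
    \<open>w\<close> ends on the hyperplane, where \<open>e = 1\<close>. This brings the denominator
    \<open>1 - e t\<close> into the form of \<open>hadamard\<close>.\<close>
  define w where "w = (1/2) *\<^sub>R v"
  define e where "e = (\<lambda>t. complex_of_real (exp (- P t)))"
  define E where "E = segment_integral P w 0 (\<lambda>t. \<Sum>i\<in>UNIV. of_real (w $ i) * partial i e t)"
  have Pw: "P w = 1" using v by (simp add: w_def linear_cmul[OF P])
  obtain c where c: "\<And>t. P t = c \<bullet> t"
    using linear_as_inner[OF P] by blast
  have se: "smooth e" unfolding e_def c using smooth_exp_linear[of "- c"] by simp
  have sg: "smooth g" unfolding g_def
    by (intro smooth_segment_integral P smooth_sum smooth_mult smooth_const smooth_partial f)
  have sE: "smooth E" unfolding E_def
    by (intro smooth_segment_integral P smooth_sum smooth_mult smooth_const smooth_partial se)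
  have fg: "f t - f (s t) = of_real (P t) * g t" for t
    unfolding g_def s by (rule hadamard[OF f])
  have eE: "1 - e t = - (of_real (P t) * E t)" for t
    using hadamard[OF se, of t P w] Pw by (simp add: E_def e_def linear_diff[OF P] linear_cmul[OF P] algebra_simps)
  \<comment> \<open>On the hyperplane the segment degenerates to a point, and \<open>E\<close> is
    the derivative of \<open>exp (- P)\<close> in direction \<open>w\<close>.\<close>
  have E0: "E t = - 1" if "P t = 0" for t
  proof -
    have "((\<lambda>x. e (t + x *\<^sub>R w)) has_vector_derivative - 1) (at 0)"
      using that Pw unfolding e_def has_vector_derivative_def linear_add[OF P] linear_cmul[OF P]
      by (auto intro!: derivative_eq_intros simp: scaleR_conv_of_real[where 'a=complex])
    moreover have "((\<lambda>x. e (t + x *\<^sub>R w)) has_vector_derivative (\<Sum>i\<in>UNIV. of_real (w $ i) * partial i e t)) (at 0)"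
    proof -
      have d: "((\<lambda>x. t + x *\<^sub>R w) has_derivative (\<lambda>h. h *\<^sub>R w)) (at (0::real))"
        by (auto intro!: derivative_eq_intros)
      have d2: "(e has_derivative (\<lambda>v. \<Sum>i\<in>UNIV. of_real (v $ i) * partial i e t)) (at (t + 0 *\<^sub>R w))"
        using smooth_has_derivative[OF se, of t] by simp
      show ?thesis using has_derivative_compose[OF d d2] unfolding has_vector_derivative_def
        by (rule has_derivative_eq_rhs) (auto simp: fun_eq_iff sum_distrib_left scaleR_conv_of_real[where 'a=complex] algebra_simps)
    qed
    ultimately have "(\<Sum>i\<in>UNIV. of_real (w $ i) * partial i e t) = - 1"
      using vector_derivative_unique_at by blast
    then show ?thesis using that by (simp add: E_def segment_integral_def)
  qed
  have En0: "E t \<noteq> 0" for t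
  proof (cases "P t = 0")
    case False
    then have "e t \<noteq> 1" by (simp add: e_def)
    then show ?thesis using eE[of t] by auto
  qed (simp add: E0)
  define q where "q = (\<lambda>t. - (g t * inverse (E t)))"
  have sq: "smooth q" unfolding q_def using smooth_mult[OF smooth_const[of "-1"] smooth_mult[OF sg smooth_inverse[OF sE En0]]] by simp
  have *: "(f u - f (s u)) / of_real (1 - exp (- P u)) = q u" if "P u \<noteq> 0" for u
  proof -
    have d: "complex_of_real (1 - exp (- P u)) = - (of_real (P u) * E u)"
      using eE[of u] by (simp add: e_def)
    show ?thesis unfolding fg d using that En0[of u] by (simp add: q_def field_simps)
  qed
  have "refl_quotient s P f = q"
  proof
    fix t
    show "refl_quotient s P f t = q t"
    proof (cases "P t = 0")
      case True
      \<comment> \<open>\<open>Lim\<close> is determined only at a limit point of the complement of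
        the hyperplane; moving along \<open>w\<close> leaves the hyperplane.\<close>
      have nt: "at t within {u. P u \<noteq> 0} \<noteq> bot"
      proof -
        have "t islimpt {u. P u \<noteq> 0}" unfolding islimpt_approachable
        proof (intro allI impI)
          fix d :: real assume d: "d > 0"
          have w0: "w \<noteq> 0" using Pw linear_0[OF P] by auto
          show "\<exists>x'\<in>{u. P u \<noteq> 0}. x' \<noteq> t \<and> dist x' t < d"
            using d w0 True Pw by (intro bexI[of _ "t + (d / (2 * norm w)) *\<^sub>R w"])
              (auto simp: dist_norm linear_add[OF P] linear_cmul[OF P] field_simps)
        qed
        then show ?thesis by (simp add: trivial_limit_within)
      qed
      have "(q \<longlongrightarrow> q t) (at t within {u. P u \<noteq> 0})"
        using smooth_continuous[OF sq] by (meson continuous_on_eq_continuous_within continuous_within continuous_on_subset continuous_within_subset subset_UNIV UNIV_I)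
      then have "((\<lambda>u. (f u - f (s u)) / of_real (1 - exp (- P u))) \<longlongrightarrow> q t) (at t within {u. P u \<noteq> 0})"
        by (rule tendsto_cong[THEN iffD1, rotated]) (auto simp: eventually_at_filter simp flip: * intro!: always_eventually)
      then have "Lim (at t within {u. P u \<noteq> 0}) (\<lambda>u. (f u - f (s u)) / of_real (1 - exp (- P u))) = q t"
        using nt by (intro tendsto_Lim) auto
      then show ?thesis using True by (simp add: refl_quotient_def Let_def)
    qed (simp add: refl_quotient_def Let_def flip: *)
  qed
  then show ?thesis using sq by simp
qed

lemma swap_coords_eq: "swap_coords i j t = t - (2 * (t $ i - t $ j)) *\<^sub>R ((1/2) *\<^sub>R (axis i 1 - axis j 1))"
  and neg_swap_coords_eq: "i \<noteq> j \<Longrightarrow> neg_swap_coords i j t = t - (2 * (t $ i + t $ j)) *\<^sub>R ((1/2) *\<^sub>R (axis i 1 + axis j 1))"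
  and neg_coord_eq: "neg_coord j t = t - (2 * t $ j) *\<^sub>R axis j 1"
  by (auto simp: swap_coords_def neg_swap_coords_def neg_coord_def vec_eq_iff axis_def field_simps)

lemma linear_swap_coords: "linear (swap_coords i j)"
  and linear_neg_swap_coords: "linear (neg_swap_coords i j)"
  and linear_neg_coord: "linear (neg_coord j)"
  by (rule linearI; auto simp: swap_coords_def neg_swap_coords_def neg_coord_def vec_eq_iff)+

lemma smooth_refl_quotients:
  assumes f: "smooth f"
  shows "i \<noteq> j \<Longrightarrow> smooth (refl_quotient (swap_coords i j) (\<lambda>u. 2 * (u $ i - u $ j)) f)"
    and "i \<noteq> j \<Longrightarrow> smooth (refl_quotient (neg_swap_coords i j) (\<lambda>u. 2 * (u $ i + u $ j)) f)"
    and "smooth (refl_quotient (neg_coord j) (\<lambda>u. 4 * u $ j) f)"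
    and "smooth (refl_quotient (neg_coord j) (\<lambda>u. 2 * u $ j) f)"
proof -
  show "i \<noteq> j \<Longrightarrow> smooth (refl_quotient (swap_coords i j) (\<lambda>u. 2 * (u $ i - u $ j)) f)"
    by (rule smooth_refl_quotient[OF _ _ swap_coords_eq f]) (auto intro!: linearI simp: axis_def algebra_simps)
  show "i \<noteq> j \<Longrightarrow> smooth (refl_quotient (neg_swap_coords i j) (\<lambda>u. 2 * (u $ i + u $ j)) f)"
    by (rule smooth_refl_quotient[OF _ _ neg_swap_coords_eq f]) (auto intro!: linearI simp: axis_def algebra_simps)
  \<comment> \<open>For the form \<open>4 * u $ j\<close> the vector is halved, which restores
    \<open>P v = 2\<close>.\<close>
  have "neg_coord j t = t - (4 * t $ j) *\<^sub>R ((1/2) *\<^sub>R axis j 1)" for t by (simp add: neg_coord_eq)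
  then show "smooth (refl_quotient (neg_coord j) (\<lambda>u. 4 * u $ j) f)"
    by (intro smooth_refl_quotient[where v="(1/2) *\<^sub>R axis j 1", OF _ _ _ f]) (auto intro!: linearI simp: axis_def algebra_simps)
  show "smooth (refl_quotient (neg_coord j) (\<lambda>u. 2 * u $ j) f)"
    by (rule smooth_refl_quotient[OF _ _ neg_coord_eq f]) (auto intro!: linearI simp: axis_def algebra_simps)
qed

lemma smooth_cherednik: "smooth f \<Longrightarrow> smooth (cherednik a b \<iota> j f)"
  unfolding cherednik_def[abs_def]
  by (intro smooth_add smooth_diff smooth_mult smooth_const smooth_sum smooth_partial smooth_refl_quotients) auto

subsection \<open>Commutativity of the Cherednik operators\<close>

definition coth :: "real \<Rightarrow> real" where "coth x = cosh x / sinh x"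

lemma coth_minus [simp]: "coth (- x) = - coth x"
  by (simp add: coth_def)

lemma coth_diff_commute: "coth (y - x) = - coth (x - y)"
  using coth_minus[of "x - y"] by simp

lemma coth_add_relation:
  assumes "x \<noteq> 0" "y \<noteq> 0" "x + y \<noteq> 0"
  shows "coth x * coth y - coth (x + y) * (coth x + coth y) = -1"
proof -
  have *: "sinh x \<noteq> 0" "sinh y \<noteq> 0" "sinh x * cosh y + cosh x * sinh y \<noteq> 0"
    using assms by (auto simp flip: sinh_add)
  show ?thesis unfolding coth_def sinh_add cosh_add using * by (simp add: divide_simps) (simp add: algebra_simps)
qed

text \<open>The rank-two identity behind type BC. Over the common denominator
  \<open>sinh (x - y) * sinh (x + y)\<close> the two brackets become \<open>sinh (2 * x)\<close> and
  \<open>- sinh (2 * y)\<close>, which cancel the denominators of the other factors. What remains is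
  \<open>cosh (2 * x) - cosh (2 * y)\<close> or
  \<open>2 * (cosh x)\<^sup>2 - 2 * (cosh y)\<^sup>2\<close>, each of them twice the common
  denominator.\<close>

lemma coth_pair_relation:
  assumes "x \<noteq> y" "x \<noteq> - y" "x \<noteq> 0" "y \<noteq> 0"
  shows "(p * coth (2 * x) + q * coth x) * (coth (x - y) + coth (x + y)) +
    (p * coth (2 * y) + q * coth y) * (coth (x + y) - coth (x - y)) = 2 * (p + q)"
proof -
  have nz: "sinh (x - y) \<noteq> 0" "sinh (x + y) \<noteq> 0" "sinh x \<noteq> 0" "sinh y \<noteq> 0" "sinh (2*x) \<noteq> 0" "sinh (2*y) \<noteq> 0"
    using assms by (auto simp: add_eq_0_iff)
  let ?D = "sinh (x - y) * sinh (x + y)"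
  have s: "coth (x - y) + coth (x + y) = sinh (2 * x) / ?D"
    using nz sinh_add[of "x - y" "x + y"] by (simp add: coth_def field_simps)
  have d: "coth (x + y) - coth (x - y) = - sinh (2 * y) / ?D"
  proof -
    have "coth (x + y) - coth (x - y) = (cosh (x + y) * sinh (x - y) - cosh (x - y) * sinh (x + y)) / ?D"
      using nz by (simp add: coth_def divide_simps)
    moreover have "cosh (x + y) * sinh (x - y) - cosh (x - y) * sinh (x + y) = - sinh (2 * y)"
      using sinh_diff[of "x + y" "x - y"] by (simp add: algebra_simps)
    ultimately show ?thesis by simp
  qed
  have D1: "cosh (2 * x) - cosh (2 * y) = 2 * ?D"
    using cosh_add[of "x + y" "x - y"] cosh_diff[of "x + y" "x - y"] by (simp add: algebra_simps)
  have D2: "2 * (cosh x)\<^sup>2 - 2 * (cosh y)\<^sup>2 = 2 * ?D"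
    using D1 by (simp add: cosh_double_cosh)
  have 1: "coth (2 * x) * sinh (2 * x) = cosh (2 * x)" "coth (2 * y) * sinh (2 * y) = cosh (2 * y)"
    "coth x * sinh (2 * x) = 2 * (cosh x)\<^sup>2" "coth y * sinh (2 * y) = 2 * (cosh y)\<^sup>2"
    using nz by (auto simp: coth_def sinh_double power2_eq_square)
  have "(p * coth (2 * x) + q * coth x) * (coth (x - y) + coth (x + y)) +
    (p * coth (2 * y) + q * coth y) * (coth (x + y) - coth (x - y)) =
    (p * (coth (2 * x) * sinh (2 * x) - coth (2 * y) * sinh (2 * y)) +
     q * (coth x * sinh (2 * x) - coth y * sinh (2 * y))) / ?D"
    unfolding s d by (simp add: diff_divide_distrib add_divide_distrib algebra_simps)
  also have "\<dots> = (p * (2 * ?D) + q * (2 * ?D)) / ?D" unfolding 1 D1 D2 ..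
  also have "\<dots> = 2 * (p + q)" using nz by (simp add: field_simps)
  finally show ?thesis .
qed

section \<open>Reflection operators and their rank-two relations\<close>

definition regular :: "real^'n \<Rightarrow> bool" where
  "regular t \<longleftrightarrow> (\<forall>j. t $ j \<noteq> 0) \<and> (\<forall>i j. i \<noteq> j \<longrightarrow> t $ i \<noteq> t $ j \<and> t $ i \<noteq> - t $ j)"

text \<open>The operator \<open>c (1 - s) - e s\<close>. Every reflection term of
  \<open>cherednik\<close> takes this form once a multiple of the identity is split off.\<close>

definition refl_op :: "(real^'n \<Rightarrow> real) \<Rightarrow> real \<Rightarrow> (real^'n \<Rightarrow> real^'n) \<Rightarrow> (real^'n \<Rightarrow> complex) \<Rightarrow> real^'n \<Rightarrow> complex" where
  "refl_op c e s f t = of_real (c t) * (f t - f (s t)) - of_real e * f (s t)"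

definition linear_op :: "((real^'n \<Rightarrow> complex) \<Rightarrow> real^'n \<Rightarrow> complex) \<Rightarrow> bool" where
  "linear_op X \<longleftrightarrow> (\<forall>F G t. X (\<lambda>t. F t + G t) t = X F t + X G t) \<and> (\<forall>c F t. X (\<lambda>t. c * F t) t = c * X F t)"

lemma linear_op_add: "linear_op X \<Longrightarrow> X (\<lambda>t. F t + G t) t = X F t + X G t"
  and linear_op_cmult: "linear_op X \<Longrightarrow> X (\<lambda>t. c * F t) t = c * X F t"
  by (auto simp: linear_op_def)

lemma linear_op_sum:
  fixes X :: "(real^'n \<Rightarrow> complex) \<Rightarrow> real^'n \<Rightarrow> complex" and F :: "'k \<Rightarrow> real^'n \<Rightarrow> complex"
  shows "linear_op X \<Longrightarrow> X (\<lambda>t. \<Sum>k\<in>K. F k t) t = (\<Sum>k\<in>K. X (F k) t)"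
proof (induction K rule: infinite_finite_induct)
  case (insert x K)
  then show ?case using linear_op_add[OF insert.prems, of "F x" "\<lambda>t. \<Sum>k\<in>K. F k t" t] by simp
qed (use linear_op_cmult[of X 0] in auto)

lemma linear_op_refl_op: "linear_op (refl_op c e s)"
  by (simp add: linear_op_def refl_op_def algebra_simps)

lemma refl_op_commute:
  assumes "s1 (s2 t) = s2 (s1 t)" "c1 (s2 t) = c1 t" "c2 (s1 t) = c2 t"
  shows "refl_op c1 e1 s1 (refl_op c2 e2 s2 f) t = refl_op c2 e2 s2 (refl_op c1 e1 s1 f) t"
  by (simp add: refl_op_def assms algebra_simps)

text \<open>
  The classical Yang--Baxter equation in a subsystem of type \<open>A\<^sub>2\<close> whose positive roots are
  \<open>\<alpha>\<close>, \<open>\<beta>\<close> and \<open>\<gamma> = \<alpha> + \<beta>\<close>, with reflections \<open>s1\<close>, \<open>s2\<close>, \<open>s3\<close>.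
\<close>

lemma refl_op_yang_baxter:
  assumes "s1 (s3 t) = s2 (s1 t)" "s3 (s2 t) = s2 (s1 t)" "s3 (s1 t) = s1 (s2 t)" "s2 (s3 t) = s1 (s2 t)"
    and "c1 (s2 t) = c3 t" "c3 (s2 t) = c1 t" "c2 (s1 t) = c3 t" "c3 (s1 t) = c2 t"
      "c1 (s3 t) = - c2 t" "c2 (s3 t) = - c1 t"
    and c: "c1 t * c2 t - c3 t * (c1 t + c2 t) = -1" and e: "e1 * e2 - e3 * (e1 + e2) = -1"
  shows "refl_op c1 e1 s1 (refl_op c2 e2 s2 f) t - refl_op c2 e2 s2 (refl_op c1 e1 s1 f) t
    + (refl_op c3 e3 s3 (refl_op c2 e2 s2 f) t - refl_op c2 e2 s2 (refl_op c3 e3 s3 f) t)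
    + (refl_op c1 e1 s1 (refl_op c3 e3 s3 f) t - refl_op c3 e3 s3 (refl_op c1 e1 s1 f) t) = 0"
proof -
  have c': "complex_of_real (c1 t) * of_real (c2 t) - of_real (c3 t) * (of_real (c1 t) + of_real (c2 t)) = -1"
    using arg_cong[OF c, of complex_of_real] by simp
  have e': "complex_of_real e1 * of_real e2 - of_real e3 * (of_real e1 + of_real e2) = -1"
    using arg_cong[OF e, of complex_of_real] by simp
  show ?thesis unfolding refl_op_def assms(1-10) of_real_minus using c' e' by algebra
qed

definition ord_sign :: "'n::linorder \<Rightarrow> 'n \<Rightarrow> real" where
  "ord_sign i j = (if i < j then 1 else - 1)"

definition minus_op :: "'n::{finite,wellorder} \<Rightarrow> 'n \<Rightarrow> (real^'n::{finite,wellorder} \<Rightarrow> complex) \<Rightarrow> real^'n::{finite,wellorder} \<Rightarrow> complex" where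
  "minus_op i j = refl_op (\<lambda>t. coth (t $ i - t $ j)) (ord_sign i j) (swap_coords i j)"

definition plus_op :: "'n \<Rightarrow> 'n \<Rightarrow> (real^'n \<Rightarrow> complex) \<Rightarrow> real^'n \<Rightarrow> complex" where
  "plus_op i j = refl_op (\<lambda>t. coth (t $ i + t $ j)) 1 (neg_swap_coords i j)"

definition sign_op :: "real \<Rightarrow> real \<Rightarrow> 'n \<Rightarrow> (real^'n \<Rightarrow> complex) \<Rightarrow> real^'n \<Rightarrow> complex" where
  "sign_op b \<iota> j = refl_op (\<lambda>t. \<iota> * coth (2 * t $ j) + b * coth (t $ j)) (\<iota> + b) (neg_coord j)"

definition pair_op :: "'n::{finite,wellorder} \<Rightarrow> 'n \<Rightarrow> (real^'n::{finite,wellorder} \<Rightarrow> complex) \<Rightarrow> real^'n::{finite,wellorder} \<Rightarrow> complex" where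
  "pair_op i j f t = minus_op i j f t + plus_op i j f t"

definition dunkl_part ::
  "real \<Rightarrow> real \<Rightarrow> real \<Rightarrow> 'n::{finite,wellorder} \<Rightarrow> (real^'n::{finite,wellorder} \<Rightarrow> complex) \<Rightarrow> real^'n::{finite,wellorder} \<Rightarrow> complex" where
  "dunkl_part a b \<iota> j f t = of_real (a / 2) * (\<Sum>k\<in>UNIV - {j}. pair_op j k f t) + sign_op b \<iota> j f t"

lemma linear_ops: "linear_op (minus_op i j)" "linear_op (plus_op i j)" "linear_op (sign_op b \<iota> j)"
  by (simp_all add: minus_op_def plus_op_def sign_op_def linear_op_refl_op)

lemma linear_op_pair_op: "linear_op (pair_op i j)"
  unfolding linear_op_def pair_op_def by (simp add: linear_op_add linear_op_cmult linear_ops algebra_simps)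

lemma linear_op_dunkl_part: "linear_op (dunkl_part a b \<iota> j)"
  unfolding linear_op_def dunkl_part_def
  by (simp add: linear_op_add linear_op_cmult linear_ops linear_op_pair_op sum.distrib sum_distrib_left algebra_simps)

lemma swap_coords_commute: "swap_coords i j = swap_coords j i"
  and neg_swap_coords_commute: "neg_swap_coords i j = neg_swap_coords j i"
  by (auto simp: swap_coords_def neg_swap_coords_def fun_eq_iff vec_eq_iff)

lemma minus_op_swap: "i \<noteq> j \<Longrightarrow> minus_op j i f t = - minus_op i j f t"
  unfolding minus_op_def refl_op_def
  by (auto simp: swap_coords_commute[of j i] coth_diff_commute[of "t $ j" "t $ i"] ord_sign_def)

lemma plus_op_swap: "plus_op j i = plus_op i j"
  unfolding plus_op_def by (simp add: neg_swap_coords_commute[of j i] add.commute)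

lemma reflection_nth:
  "swap_coords i j t $ k = (if k = i then t $ j else if k = j then t $ i else t $ k)"
  "neg_swap_coords i j t $ k = (if k = i then - (t $ j) else if k = j then - (t $ i) else t $ k)"
  "neg_coord j t $ k = (if k = j then - (t $ k) else t $ k)"
  by (simp_all add: swap_coords_def neg_swap_coords_def neg_coord_def)

text \<open>The addition theorem for coth at infinity: \<open>ord_sign i j\<close> is the limit of
  \<open>coth (M * (x i - x j))\<close> for \<open>M\<close> tending to infinity and
  \<open>x\<close> strictly decreasing.\<close>

lemma ord_sign_relation:
  "i \<noteq> j \<Longrightarrow> j \<noteq> k \<Longrightarrow> i \<noteq> k \<Longrightarrow> ord_sign i j * ord_sign j k - ord_sign i k * (ord_sign i j + ord_sign j k) = -1"
  by (auto simp: ord_sign_def)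

lemma coth_relation_triple:
  assumes "z = x + y" "x \<noteq> 0" "y \<noteq> 0" "z \<noteq> 0"
  shows "coth x * coth y - coth z * (coth x + coth y) = -1"
  using assms coth_add_relation by blast

text \<open>The roots in three indices form a system of type \<open>D\<^sub>3 = A\<^sub>3\<close>,
  which has four subsystems of type \<open>A\<^sub>2\<close>. Expanding \<open>pair_op\<close> turns
  the expression into the sum of their four Yang--Baxter equations, with \<open>\<gamma>\<close>
  equal to \<open>i - k\<close>, \<open>i + j\<close>, \<open>i + k\<close> and \<open>i + j\<close>
  in turn.\<close>

lemma yang_baxter:
  assumes reg: "regular t" and d: "i \<noteq> j" "j \<noteq> k" "i \<noteq> k"
  shows "pair_op i j (pair_op j k f) t - pair_op j k (pair_op i j f) t
    + (pair_op i k (pair_op j i f) t - pair_op j i (pair_op i k f) t)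
    + (pair_op i k (pair_op j k f) t - pair_op j k (pair_op i k f) t) = 0"
proof -
  have r: "t $ i - t $ j \<noteq> 0" "t $ i + t $ j \<noteq> 0" "t $ j - t $ k \<noteq> 0" "t $ j + t $ k \<noteq> 0" "t $ i - t $ k \<noteq> 0" "t $ i + t $ k \<noteq> 0"
    using reg d unfolding regular_def by (auto simp: add_eq_0_iff2)
  note d' = d d[symmetric]
  note pts = reflection_nth vec_eq_iff d' coth_diff_commute[of "t $ j" "t $ i"] coth_diff_commute[of "t $ k" "t $ j"] coth_diff_commute[of "t $ k" "t $ i"]
    add.commute[of "t $ j" "t $ i"] add.commute[of "t $ k" "t $ j"] add.commute[of "t $ k" "t $ i"]
  have neg: "coth (- x - y) = - coth (x + y)" for x y using coth_minus[of "x + y"] by simp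
  have neg2: "coth (- x + y) = - coth (x - y)" for x y using coth_minus[of "x - y"] by simp
  have 1: "minus_op i j (minus_op j k f) t - minus_op j k (minus_op i j f) t
    + (minus_op i k (minus_op j k f) t - minus_op j k (minus_op i k f) t)
    + (minus_op i j (minus_op i k f) t - minus_op i k (minus_op i j f) t) = 0"
    unfolding minus_op_def
    by (rule refl_op_yang_baxter; (rule coth_relation_triple[OF _ r(1,3,5)] ord_sign_relation d)?; auto simp: pts neg neg2)
  have 2: "minus_op i k (plus_op j k f) t - plus_op j k (minus_op i k f) t
    + (plus_op i j (plus_op j k f) t - plus_op j k (plus_op i j f) t)
    + (minus_op i k (plus_op i j f) t - plus_op i j (minus_op i k f) t) = 0"
    unfolding minus_op_def plus_op_def
    by (rule refl_op_yang_baxter; (rule coth_relation_triple[OF _ r(5,4,2)])?; auto simp: pts neg neg2)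
  have 3: "minus_op i j (plus_op j k f) t - plus_op j k (minus_op i j f) t
    + (plus_op i k (plus_op j k f) t - plus_op j k (plus_op i k f) t)
    + (minus_op i j (plus_op i k f) t - plus_op i k (minus_op i j f) t) = 0"
    unfolding minus_op_def plus_op_def
    by (rule refl_op_yang_baxter; (rule coth_relation_triple[OF _ r(1,4,6)])?; auto simp: pts neg neg2)
  have 4: "plus_op i k (minus_op j k f) t - minus_op j k (plus_op i k f) t
    + (plus_op i j (minus_op j k f) t - minus_op j k (plus_op i j f) t)
    + (plus_op i k (plus_op i j f) t - plus_op i j (plus_op i k f) t) = 0"
    unfolding minus_op_def plus_op_def
    by (rule refl_op_yang_baxter; (rule coth_relation_triple[OF _ r(6,3,2)])?; auto simp: pts neg neg2)
  have n: "X (minus_op j i f) t = - X (minus_op i j f) t" if "linear_op X" for X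
  proof -
    have "minus_op j i f = (\<lambda>t. -1 * minus_op i j f t)" using minus_op_swap[OF d(1)] by auto
    then show ?thesis using linear_op_cmult[OF that, of "-1" "minus_op i j f" t] by simp
  qed
  have X: "X (pair_op p q f) t = X (minus_op p q f) t + X (plus_op p q f) t" if "linear_op X" for X p q
    unfolding pair_op_def[abs_def] by (rule linear_op_add[OF that])
  have Y: "pair_op p q g t = minus_op p q g t + plus_op p q g t" for p q g
    by (rule pair_op_def)
  note m = minus_op_swap[OF d(1)] plus_op_swap[of j i] n[OF linear_ops(1)] n[OF linear_ops(2)]
    X[OF linear_ops(1)] X[OF linear_ops(2)]
  show ?thesis
    unfolding Y[of i j "pair_op j k f"] Y[of j k "pair_op i j f"] Y[of i k "pair_op j i f"] Y[of j i "pair_op i k f"]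
      Y[of i k "pair_op j k f"] Y[of j k "pair_op i k f"] m
    using 1 2 3 4 by algebra
qed

text \<open>The relation of the rank-two system in the indices \<open>i\<close> and
  \<open>j\<close>. All products cancel except a multiple of
  \<open>f (neg_coord j (s t)) - f (neg_coord i (s t))\<close>, whose coefficient vanishes by
  \<open>coth_pair_relation\<close>.\<close>

lemma sign_pair_relation:
  assumes reg: "regular t" and d: "i \<noteq> j"
  shows "pair_op i j (sign_op b \<iota> j f) t - sign_op b \<iota> j (pair_op i j f) t
    + (sign_op b \<iota> i (pair_op j i f) t - pair_op j i (sign_op b \<iota> i f) t) = 0"
proof -
  define c d' g h e where "c = complex_of_real (coth (t $ i - t $ j))" and "d' = complex_of_real (coth (t $ i + t $ j))"
    and "g = complex_of_real (\<iota> * coth (2 * t $ i) + b * coth (t $ i))"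
    and "h = complex_of_real (\<iota> * coth (2 * t $ j) + b * coth (t $ j))"
    and "e = complex_of_real (ord_sign i j)"
  define k where "k = complex_of_real (\<iota> + b)"
  have rel: "g * (c + d') + h * (d' - c) = 2 * k"
  proof -
    have "(\<iota> * coth (2 * t $ i) + b * coth (t $ i)) * (coth (t $ i - t $ j) + coth (t $ i + t $ j))
      + (\<iota> * coth (2 * t $ j) + b * coth (t $ j)) * (coth (t $ i + t $ j) - coth (t $ i - t $ j)) = 2 * (\<iota> + b)"
      using reg d unfolding regular_def by (intro coth_pair_relation) auto
    from arg_cong[OF this, of complex_of_real] show ?thesis
      by (simp add: c_def d'_def g_def h_def k_def)
  qed
  define s \<sigma> where "s = swap_coords i j" and "\<sigma> = neg_swap_coords i j"
  have comp: "neg_coord j (\<sigma> t) = neg_coord i (s t)" "s (neg_coord j t) = neg_coord i (s t)"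
    "\<sigma> (neg_coord j t) = neg_coord j (s t)" "s (neg_coord i t) = neg_coord j (s t)"
    "\<sigma> (neg_coord i t) = neg_coord i (s t)" "neg_coord i (\<sigma> t) = neg_coord j (s t)"
    using d by (auto simp: s_def \<sigma>_def vec_eq_iff reflection_nth)
  have neg: "coth (- x - y) = - coth (x + y)" "coth (- x + y) = - coth (x - y)" for x y
    using coth_minus[of "x + y"] coth_minus[of "x - y"] by simp_all
  have U: "minus_op i j F t = c * (F t - F (s t)) - e * F (s t)" for F
    by (simp add: minus_op_def refl_op_def c_def e_def s_def)
  have V: "plus_op i j F t = d' * (F t - F (\<sigma> t)) - F (\<sigma> t)" for F
    by (simp add: plus_op_def refl_op_def d'_def \<sigma>_def)
  have Ui: "minus_op i j F (neg_coord i t) = - d' * (F (neg_coord i t) - F (s (neg_coord i t))) - e * F (s (neg_coord i t))" for F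
    using d by (simp add: minus_op_def refl_op_def d'_def e_def s_def reflection_nth neg)
  have Vi: "plus_op i j F (neg_coord i t) = - c * (F (neg_coord i t) - F (\<sigma> (neg_coord i t))) - F (\<sigma> (neg_coord i t))" for F
    using d by (simp add: plus_op_def refl_op_def c_def \<sigma>_def reflection_nth neg coth_diff_commute[of "t $ j" "t $ i"])
  have Uj: "minus_op i j F (neg_coord j t) = d' * (F (neg_coord j t) - F (s (neg_coord j t))) - e * F (s (neg_coord j t))" for F
    using d by (simp add: minus_op_def refl_op_def d'_def e_def s_def reflection_nth)
  have Vj: "plus_op i j F (neg_coord j t) = c * (F (neg_coord j t) - F (\<sigma> (neg_coord j t))) - F (\<sigma> (neg_coord j t))" for F
    using d by (simp add: plus_op_def refl_op_def c_def \<sigma>_def reflection_nth)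
  have Bi: "sign_op b \<iota> i F t = g * (F t - F (neg_coord i t)) - k * F (neg_coord i t)"
    and Bj: "sign_op b \<iota> j F t = h * (F t - F (neg_coord j t)) - k * F (neg_coord j t)"
    and Bis: "sign_op b \<iota> i F (s t) = h * (F (s t) - F (neg_coord i (s t))) - k * F (neg_coord i (s t))"
    and Bjs: "sign_op b \<iota> j F (s t) = g * (F (s t) - F (neg_coord j (s t))) - k * F (neg_coord j (s t))"
    and Bi\<sigma>: "sign_op b \<iota> i F (\<sigma> t) = - h * (F (\<sigma> t) - F (neg_coord i (\<sigma> t))) - k * F (neg_coord i (\<sigma> t))"
    and Bj\<sigma>: "sign_op b \<iota> j F (\<sigma> t) = - g * (F (\<sigma> t) - F (neg_coord j (\<sigma> t))) - k * F (neg_coord j (\<sigma> t))" for F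
    using d by (simp_all add: sign_op_def refl_op_def g_def h_def k_def s_def \<sigma>_def reflection_nth algebra_simps)
  have A: "pair_op i j F u = minus_op i j F u + plus_op i j F u"
    "pair_op j i F u = - minus_op i j F u + plus_op i j F u" for F u
    by (simp_all add: pair_op_def minus_op_swap[OF d] plus_op_swap[of j i])
  show ?thesis
    unfolding A U V Bi Bj Bis Bjs Bi\<sigma> Bj\<sigma> Ui Vi Uj Vj comp
    by (rule trans[of _ "(g * (c + d') + h * (d' - c) - 2 * k) * (f (neg_coord j (s t)) - f (neg_coord i (s t)))"])
      (simp add: algebra_simps, simp add: rel)
qed

lemma minus_plus_commute: "i \<noteq> j \<Longrightarrow> minus_op i j (plus_op i j f) t = plus_op i j (minus_op i j f) t"
  unfolding minus_op_def plus_op_def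
  by (rule refl_op_commute) (auto simp: reflection_nth vec_eq_iff add.commute intro: arg_cong[of _ _ coth])

text \<open>With \<open>U = minus_op i j\<close> and \<open>V = plus_op i j\<close> the two
  operators are \<open>V + U\<close> and \<open>V - U\<close>; their roots are orthogonal, so
  \<open>U\<close> and \<open>V\<close> commute.\<close>

lemma pair_op_commute_opposite: "i \<noteq> j \<Longrightarrow> pair_op i j (pair_op j i f) t = pair_op j i (pair_op i j f) t"
proof -
  assume d: "i \<noteq> j"
  have 1: "pair_op j i F = (\<lambda>u. - 1 * minus_op i j F u + plus_op i j F u)" for F
    by (auto simp: pair_op_def minus_op_swap[OF d] plus_op_swap[of j i])
  have 2: "pair_op i j F = (\<lambda>u. minus_op i j F u + plus_op i j F u)" for F
    by (auto simp: pair_op_def)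
  have L: "X (\<lambda>u. - 1 * minus_op i j f u + plus_op i j f u) t = - X (minus_op i j f) t + X (plus_op i j f) t"
    "X (\<lambda>u. minus_op i j f u + plus_op i j f u) t = X (minus_op i j f) t + X (plus_op i j f) t" if "linear_op X" for X
    using linear_op_add[OF that, of "\<lambda>u. - 1 * minus_op i j f u" "plus_op i j f" t] linear_op_cmult[OF that, of "-1" "minus_op i j f" t]
      linear_op_add[OF that, of "minus_op i j f" "plus_op i j f" t] by simp_all
  show ?thesis unfolding 1 2 L[OF linear_ops(1)] L[OF linear_ops(2)] using minus_plus_commute[OF d, of f t] by simp
qed

lemma pair_op_commute_distinct:
  assumes "i \<noteq> j" "i \<noteq> l" "k \<noteq> j" "k \<noteq> l" "i \<noteq> k" "j \<noteq> l"
  shows "pair_op i k (pair_op j l f) t = pair_op j l (pair_op i k f) t"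
proof -
  note a = assms assms[symmetric]
  have 1: "minus_op i k (minus_op j l f) t = minus_op j l (minus_op i k f) t"
    "minus_op i k (plus_op j l f) t = plus_op j l (minus_op i k f) t"
    "plus_op i k (minus_op j l f) t = minus_op j l (plus_op i k f) t"
    "plus_op i k (plus_op j l f) t = plus_op j l (plus_op i k f) t"
    unfolding minus_op_def plus_op_def
    by (rule refl_op_commute; use a in \<open>auto simp: reflection_nth vec_eq_iff\<close>)+
  have 2: "pair_op p q F = (\<lambda>u. minus_op p q F u + plus_op p q F u)" for F p q
    by (auto simp: pair_op_def)
  show ?thesis unfolding 2 linear_op_add[OF linear_ops(1)] linear_op_add[OF linear_ops(2)] 1 by simp
qed

lemma sign_op_commute: "sign_op b \<iota> i (sign_op b \<iota> j f) t = sign_op b \<iota> j (sign_op b \<iota> i f) t" if "i \<noteq> j"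
  unfolding sign_op_def by (rule refl_op_commute) (use that in \<open>auto simp: reflection_nth vec_eq_iff\<close>)

lemma pair_sign_commute:
  assumes "i \<noteq> j" "i \<noteq> k" "j \<noteq> k"
  shows "pair_op i k (sign_op b \<iota> j f) t = sign_op b \<iota> j (pair_op i k f) t"
proof -
  note a = assms assms[symmetric]
  have 1: "minus_op i k (sign_op b \<iota> j f) t = sign_op b \<iota> j (minus_op i k f) t"
    "plus_op i k (sign_op b \<iota> j f) t = sign_op b \<iota> j (plus_op i k f) t"
    unfolding minus_op_def plus_op_def sign_op_def
    by (rule refl_op_commute; use a in \<open>auto simp: reflection_nth vec_eq_iff\<close>)+
  have 2: "pair_op p q F = (\<lambda>u. minus_op p q F u + plus_op p q F u)" for F p q
    by (auto simp: pair_op_def)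
  show ?thesis unfolding 2 linear_op_add[OF linear_ops(3)] 1 by simp
qed

text \<open>The commutator is expanded over the indices \<open>K\<close> other than \<open>i\<close>
  and \<open>j\<close>. The terms quadratic in pair operators group into one Yang--Baxter equation
  for each \<open>k \<in> K\<close>, those mixing the pair \<open>i\<close>, \<open>j\<close> with
  sign changes into \<open>sign_pair_relation\<close>; operators in disjoint indices
  commute.\<close>

lemma dunkl_part_commute:
  fixes t :: "real^'n::{finite,wellorder}"
  assumes reg: "regular t" and d: "i \<noteq> j"
  shows "dunkl_part a b \<iota> i (dunkl_part a b \<iota> j f) t = dunkl_part a b \<iota> j (dunkl_part a b \<iota> i f) t"
proof -
  define K where "K = UNIV - {i, j}"
  define h where "h = complex_of_real (a / 2)"
  have K: "UNIV - {i} = insert j K" "UNIV - {j} = insert i K" "i \<notin> K" "j \<notin> K" "finite K"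
    using d by (auto simp: K_def)
  have Kd: "k \<noteq> i" "k \<noteq> j" "i \<noteq> k" "j \<noteq> k" if "k \<in> K" for k using that by (auto simp: K_def)
  let ?A = pair_op and ?B = "sign_op b \<iota>"
  have Si: "dunkl_part a b \<iota> i F u = h * (?A i j F u + (\<Sum>k\<in>K. ?A i k F u)) + ?B i F u"
    and Sj: "dunkl_part a b \<iota> j F u = h * (?A j i F u + (\<Sum>k\<in>K. ?A j k F u)) + ?B j F u" for F u
    using K by (simp_all add: dunkl_part_def h_def)
  have LSi: "X (dunkl_part a b \<iota> i f) t = h * (X (?A i j f) t + (\<Sum>k\<in>K. X (?A i k f) t)) + X (?B i f) t"
    and LSj: "X (dunkl_part a b \<iota> j f) t = h * (X (?A j i f) t + (\<Sum>k\<in>K. X (?A j k f) t)) + X (?B j f) t"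
    if X: "linear_op X" for X
  proof -
    have "dunkl_part a b \<iota> i f = (\<lambda>u. h * (?A i j f u + (\<Sum>k\<in>K. ?A i k f u)) + ?B i f u)" using Si by auto
    then show "X (dunkl_part a b \<iota> i f) t = h * (X (?A i j f) t + (\<Sum>k\<in>K. X (?A i k f) t)) + X (?B i f) t"
      by (simp add: linear_op_add[OF X] linear_op_cmult[OF X] linear_op_sum[OF X])
    have "dunkl_part a b \<iota> j f = (\<lambda>u. h * (?A j i f u + (\<Sum>k\<in>K. ?A j k f u)) + ?B j f u)" using Sj by auto
    then show "X (dunkl_part a b \<iota> j f) t = h * (X (?A j i f) t + (\<Sum>k\<in>K. X (?A j k f) t)) + X (?B j f) t"
      by (simp add: linear_op_add[OF X] linear_op_cmult[OF X] linear_op_sum[OF X])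
  qed
  note La = LSi[OF linear_op_pair_op] LSj[OF linear_op_pair_op] LSi[OF linear_ops(3)] LSj[OF linear_ops(3)]
  have ij: "dunkl_part a b \<iota> i (dunkl_part a b \<iota> j f) t =
      h * h * (?A i j (?A j i f) t + (\<Sum>k\<in>K. ?A i j (?A j k f) t + ?A i k (?A j i f) t) + (\<Sum>k\<in>K. \<Sum>l\<in>K. ?A i k (?A j l f) t))
    + h * (?A i j (?B j f) t + ?B i (?A j i f) t) + h * (\<Sum>k\<in>K. ?A i k (?B j f) t + ?B i (?A j k f) t)
    + ?B i (?B j f) t"
    unfolding Si[of "dunkl_part a b \<iota> j f"] La by (simp add: sum.distrib sum_distrib_left algebra_simps)
  have ji: "dunkl_part a b \<iota> j (dunkl_part a b \<iota> i f) t =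
      h * h * (?A j i (?A i j f) t + (\<Sum>k\<in>K. ?A j k (?A i j f) t + ?A j i (?A i k f) t) + (\<Sum>k\<in>K. \<Sum>l\<in>K. ?A j l (?A i k f) t))
    + h * (?B j (?A i j f) t + ?A j i (?B i f) t) + h * (\<Sum>k\<in>K. ?B j (?A i k f) t + ?A j k (?B i f) t)
    + ?B j (?B i f) t"
  proof -
    have sw: "(\<Sum>k\<in>K. \<Sum>l\<in>K. ?A j l (?A i k f) t) = (\<Sum>k\<in>K. \<Sum>l\<in>K. ?A j k (?A i l f) t)"
      by (rule sum.swap)
    show ?thesis
      unfolding Sj[of "dunkl_part a b \<iota> i f"] La sw by (simp add: sum.distrib sum_distrib_left algebra_simps)
  qed
  have 1: "?A i j (?A j i f) t = ?A j i (?A i j f) t" using pair_op_commute_opposite[OF d] .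
  have 2: "?A i j (?B j f) t + ?B i (?A j i f) t = ?B j (?A i j f) t + ?A j i (?B i f) t"
    using sign_pair_relation[OF reg d, of b \<iota> f] by algebra
  have 3: "(\<Sum>k\<in>K. ?A i k (?B j f) t + ?B i (?A j k f) t) = (\<Sum>k\<in>K. ?B j (?A i k f) t + ?A j k (?B i f) t)"
    using d Kd by (intro sum.cong refl) (simp add: pair_sign_commute)
  \<comment> \<open>Operators with \<open>l \<noteq> k\<close> act on disjoint indices and commute,
    so only \<open>l = k\<close> survives; it supplies the third commutator of
    \<open>yang_baxter\<close>.\<close>
  have D: "(\<Sum>l\<in>K. ?A i k (?A j l f) t) - (\<Sum>l\<in>K. ?A j l (?A i k f) t) = ?A i k (?A j k f) t - ?A j k (?A i k f) t"
    if k: "k \<in> K" for k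
  proof -
    have "(\<Sum>l\<in>K. ?A i k (?A j l f) t) - (\<Sum>l\<in>K. ?A j l (?A i k f) t) =
        (\<Sum>l\<in>K. if l = k then ?A i k (?A j k f) t - ?A j k (?A i k f) t else 0)"
      unfolding sum_subtractf[symmetric] by (intro sum.cong refl) (use d Kd k in \<open>auto simp: pair_op_commute_distinct\<close>)
    then show ?thesis using k K by simp
  qed
  have "(\<Sum>k\<in>K. ?A i j (?A j k f) t + ?A i k (?A j i f) t) + (\<Sum>k\<in>K. \<Sum>l\<in>K. ?A i k (?A j l f) t)
     - ((\<Sum>k\<in>K. ?A j k (?A i j f) t + ?A j i (?A i k f) t) + (\<Sum>k\<in>K. \<Sum>l\<in>K. ?A j l (?A i k f) t))
     = (\<Sum>k\<in>K. ?A i j (?A j k f) t - ?A j k (?A i j f) t + (?A i k (?A j i f) t - ?A j i (?A i k f) t)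
        + ((\<Sum>l\<in>K. ?A i k (?A j l f) t) - (\<Sum>l\<in>K. ?A j l (?A i k f) t)))"
    by (simp add: sum_subtractf sum.distrib)
  also have "\<dots> = (\<Sum>k\<in>K. ?A i j (?A j k f) t - ?A j k (?A i j f) t + (?A i k (?A j i f) t - ?A j i (?A i k f) t)
        + (?A i k (?A j k f) t - ?A j k (?A i k f) t))"
    by (intro sum.cong refl arg_cong2[of _ _ _ _ "(+)"] D)
  also have "\<dots> = 0"
    using d Kd by (intro sum.neutral ballI yang_baxter reg) auto
  finally have 4: "(\<Sum>k\<in>K. ?A i j (?A j k f) t + ?A i k (?A j i f) t) + (\<Sum>k\<in>K. \<Sum>l\<in>K. ?A i k (?A j l f) t)
     = (\<Sum>k\<in>K. ?A j k (?A i j f) t + ?A j i (?A i k f) t) + (\<Sum>k\<in>K. \<Sum>l\<in>K. ?A j l (?A i k f) t)"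
    by simp
  show ?thesis
    unfolding ij ji 1 2 3 add.assoc 4 using sign_op_commute[OF d] by simp
qed

lemma exp_quotient_coth: "z \<noteq> 0 \<Longrightarrow> 1 / (1 - exp (- (2 * z))) = (1 + coth z) / (2::real)"
proof -
  assume z: "z \<noteq> 0"
  define E F where "E = exp z" and "F = exp (- z)"
  have EF: "E * F = 1" "E \<noteq> F" "F \<noteq> 0" using z by (auto simp: E_def F_def simp flip: exp_add)
  have "exp (-(2*z)) = F * F" by (simp add: F_def flip: exp_add)
  then have 1: "1 - exp (-(2*z)) = F * (E - F)" using EF by (simp add: algebra_simps)
  have "coth z = ((E + F) / 2) / ((E - F) / 2)"
    unfolding coth_def cosh_field_def sinh_field_def E_def F_def ..
  also have "\<dots> = (E + F) / (E - F)" using EF by (simp add: divide_simps) (simp add: algebra_simps)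
  finally have "coth z = (E + F) / (E - F)" .
  then have "(1 + coth z) / 2 = E / (E - F)" using EF by (simp add: field_simps)
  moreover have "1 / (F * (E - F)) = E / (E - F)" using EF by (simp add: divide_simps)
  ultimately show ?thesis unfolding 1 by (simp only:)
qed

text \<open>Replacing \<open>1 / (1 - exp (- p))\<close> by coth leaves multiples of the identity:
  \<open>\<iota>\<close> and \<open>b\<close> from the sign change, and from the two roots of a pair
  \<open>a / 2 + a / 2\<close> for \<open>k > j\<close> but \<open>- a / 2 + a / 2\<close> for
  \<open>k < j\<close>. Their total is exactly \<open>rho\<close>, which removes it.\<close>

lemma cherednik_regular:
  fixes t :: "real^'n::{finite,wellorder}"
  assumes reg: "regular t"
  shows "cherednik a b \<iota> j f t = partial j f t + dunkl_part a b \<iota> j f t"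
proof -
  have q: "refl_quotient s p f t = of_real ((1 + coth z) / 2) * (f t - f (s t))" if "p t = 2 * z" "z \<noteq> 0" for s p z
  proof -
    have "refl_quotient s p f t = of_real (1 / (1 - exp (- (2 * z)))) * (f t - f (s t))"
      using that by (simp add: refl_quotient_def Let_def)
    then show ?thesis unfolding exp_quotient_coth[OF that(2)] .
  qed
  have r: "t $ j \<noteq> 0" "\<And>i k. i \<noteq> k \<Longrightarrow> t $ i - t $ k \<noteq> 0 \<and> t $ i + t $ k \<noteq> 0"
    using reg by (auto simp: regular_def add_eq_0_iff2)
  have q1: "refl_quotient (swap_coords i j) (\<lambda>u. 2 * (u $ i - u $ j)) f t =
      of_real ((1 - coth (t $ j - t $ i)) / 2) * (f t - f (swap_coords j i t))" if "i \<noteq> j" for i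
    using q[of "\<lambda>u. 2 * (u $ i - u $ j)" "t $ i - t $ j" "swap_coords i j"] r(2)[OF that]
    unfolding swap_coords_commute[of i j] coth_diff_commute[of "t $ i" "t $ j"] by simp
  have q2: "refl_quotient (swap_coords j k) (\<lambda>u. 2 * (u $ j - u $ k)) f t =
      of_real ((1 + coth (t $ j - t $ k)) / 2) * (f t - f (swap_coords j k t))" if "j \<noteq> k" for k
    using q[of "\<lambda>u. 2 * (u $ j - u $ k)" "t $ j - t $ k" "swap_coords j k"] r(2)[OF that] by simp
  have q3: "refl_quotient (neg_swap_coords j k) (\<lambda>u. 2 * (u $ j + u $ k)) f t =
      of_real ((1 + coth (t $ j + t $ k)) / 2) * (f t - f (neg_swap_coords j k t))" if "j \<noteq> k" for k
    using q[of "\<lambda>u. 2 * (u $ j + u $ k)" "t $ j + t $ k" "neg_swap_coords j k"] r(2)[OF that] by simp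
  have s1: "(\<Sum>i | i < j. refl_quotient (swap_coords i j) (\<lambda>u. 2 * (u $ i - u $ j)) f t) =
      (\<Sum>k\<in>UNIV - {j}. if k < j then of_real ((1 - coth (t $ j - t $ k)) / 2) * (f t - f (swap_coords j k t)) else 0)"
    by (rule sum.mono_neutral_cong_left) (use q1 in auto)
  have s2: "(\<Sum>k | j < k. refl_quotient (swap_coords j k) (\<lambda>u. 2 * (u $ j - u $ k)) f t) =
      (\<Sum>k\<in>UNIV - {j}. if j < k then of_real ((1 + coth (t $ j - t $ k)) / 2) * (f t - f (swap_coords j k t)) else 0)"
    by (rule sum.mono_neutral_cong_left) (use q2 in auto)
  have s3: "(\<Sum>k | k \<noteq> j. refl_quotient (neg_swap_coords j k) (\<lambda>u. 2 * (u $ j + u $ k)) f t) =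
      (\<Sum>k\<in>UNIV - {j}. of_real ((1 + coth (t $ j + t $ k)) / 2) * (f t - f (neg_swap_coords j k t)))"
    by (rule sum.mono_neutral_cong_left) (use q3 in auto)
  have s4: "refl_quotient (neg_coord j) (\<lambda>u. 4 * u $ j) f t = of_real ((1 + coth (2 * t $ j)) / 2) * (f t - f (neg_coord j t))"
    "refl_quotient (neg_coord j) (\<lambda>u. 2 * u $ j) f t = of_real ((1 + coth (t $ j)) / 2) * (f t - f (neg_coord j t))"
    using q[of "\<lambda>u. 4 * u $ j" "2 * t $ j" "neg_coord j"] q[of "\<lambda>u. 2 * u $ j" "t $ j" "neg_coord j"] r(1) by simp_all
  have s5: "complex_of_real (rho a b \<iota> j) = of_real (\<iota> + b) + of_real a * (\<Sum>k\<in>UNIV - {j}. if j < k then 1 else 0)"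
  proof -
    have "(\<Sum>k\<in>UNIV - {j}. if j < k then 1 else 0 :: complex) = (\<Sum>k | j < k. 1)"
      by (rule sum.mono_neutral_cong_right) auto
    then show ?thesis by (simp add: rho_def)
  qed
  have P: "of_real (a / 2) * (\<Sum>k\<in>UNIV - {j}. pair_op j k f t) =
     - of_real a * (\<Sum>k\<in>UNIV - {j}. if k < j then of_real ((1 - coth (t $ j - t $ k)) / 2) * (f t - f (swap_coords j k t)) else 0)
     + of_real a * (\<Sum>k\<in>UNIV - {j}. if j < k then of_real ((1 + coth (t $ j - t $ k)) / 2) * (f t - f (swap_coords j k t)) else 0)
     + of_real a * (\<Sum>k\<in>UNIV - {j}. of_real ((1 + coth (t $ j + t $ k)) / 2) * (f t - f (neg_swap_coords j k t)))
     - of_real a * (\<Sum>k\<in>UNIV - {j}. if j < k then 1 else 0) * f t"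
    unfolding sum_distrib_left sum_distrib_right sum.distrib[symmetric] sum_subtractf[symmetric]
    by (intro sum.cong refl)
      (auto simp: pair_op_def minus_op_def plus_op_def refl_op_def ord_sign_def field_simps)
  have Q: "sign_op b \<iota> j f t = of_real (2 * \<iota>) * (of_real ((1 + coth (2 * t $ j)) / 2) * (f t - f (neg_coord j t)))
      + of_real (2 * b) * (of_real ((1 + coth (t $ j)) / 2) * (f t - f (neg_coord j t))) - of_real (\<iota> + b) * f t"
    unfolding sign_op_def refl_op_def by (simp add: field_simps)
  show ?thesis
    unfolding cherednik_def dunkl_part_def s1 s2 s3 s4 s5 P Q by algebra
qed


section \<open>Density of the regular points\<close>

lemma open_regular: "open {t. regular t}"
proof -
  have "{t::real^'n. regular t} = (\<Inter>j. {t. t $ j \<noteq> 0}) \<inter> (\<Inter>i. \<Inter>j\<in>UNIV - {i}. {t. t $ i \<noteq> t $ j} \<inter> {t. t $ i \<noteq> - t $ j})"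
    by (auto simp: regular_def)
  also have "open \<dots>" by (intro open_Int open_INT finite ballI open_Collect_neq continuous_intros)
  finally show ?thesis .
qed

lemma negligible_not_regular: "negligible {t::real^'n. \<not> regular t}"
proof -
  have "{t::real^'n. \<not> regular t} \<subseteq> (\<Union>j. {t. axis j 1 \<bullet> t = 0}) \<union>
      (\<Union>i. \<Union>j\<in>UNIV - {i}. {t. (axis i 1 - axis j 1) \<bullet> t = 0} \<union> {t. (axis i 1 + axis j 1) \<bullet> t = 0})"
    by (auto simp: regular_def inner_axis' inner_diff_left inner_add_left eq_neg_iff_add_eq_0)
  moreover have "negligible \<dots>"
  proof -
    have UN: "negligible (\<Union>j\<in>J. S j)" if "\<And>j. j \<in> J \<Longrightarrow> negligible (S j)" for J :: "'n set" and S :: "'n \<Rightarrow> (real^'n) set"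
      using that by (intro negligible_Union) auto
    have A: "negligible {t::real^'n. axis j 1 \<bullet> t = 0}" for j
      by (rule negligible_hyperplane) (simp add: axis_eq_0_iff)
    have B: "negligible {t::real^'n. (axis i 1 - axis j 1) \<bullet> t = 0}" "negligible {t::real^'n. (axis i 1 + axis j 1) \<bullet> t = 0}"
      if "j \<in> UNIV - {i}" for i j
    proof -
      have "axis i 1 - axis j 1 \<noteq> (0::real^'n)" "axis i 1 + axis j 1 \<noteq> (0::real^'n)"
        using that by (auto simp: vec_eq_iff axis_def)
      then show "negligible {t::real^'n. (axis i 1 - axis j 1) \<bullet> t = 0}" "negligible {t::real^'n. (axis i 1 + axis j 1) \<bullet> t = 0}"
        by (auto intro: negligible_hyperplane)
    qed
    show ?thesis by (intro negligible_Un UN A B)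
  qed
  ultimately show ?thesis by (rule negligible_subset[rotated])
qed

text \<open>The part of \<open>U\<close> where \<open>F\<close> and \<open>G\<close> differ is open
  and contained in the null set of non-regular points, hence empty. Through this lemma the closed
  formulas off the walls decide identities everywhere.\<close>

lemma continuous_eq_regular:
  fixes F G :: "real^'n \<Rightarrow> complex"
  assumes "continuous_on UNIV F" "continuous_on UNIV G" "open U" "t \<in> U" "\<And>t. t \<in> U \<Longrightarrow> regular t \<Longrightarrow> F t = G t"
  shows "F t = G t"
proof (rule ccontr)
  assume "F t \<noteq> G t"
  let ?S = "U \<inter> {t. F t \<noteq> G t}"
  have "open ?S" using assms by (intro open_Int open_Collect_neq) auto
  moreover have "?S \<noteq> {}" using \<open>F t \<noteq> G t\<close> assms(4) by auto
  moreover have "negligible ?S" using assms(5) by (intro negligible_subset[OF negligible_not_regular]) auto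
  ultimately show False using open_not_negligible by blast
qed

lemma regular_reflections:
  "regular t \<Longrightarrow> regular (swap_coords i j t)"
  "regular t \<Longrightarrow> i \<noteq> j \<Longrightarrow> regular (neg_swap_coords i j t)"
  "regular t \<Longrightarrow> regular (neg_coord j t)"
  by (auto simp: regular_def reflection_nth eq_neg_iff_add_eq_0 neg_eq_iff_add_eq_0 add.commute)

lemma partial_cong_open:
  assumes "open S" "t \<in> S" "\<And>u. u \<in> S \<Longrightarrow> F u = G u"
  shows "partial j F t = partial j G t"
proof -
  have "(F has_derivative F') (at t) \<longleftrightarrow> (G has_derivative F') (at t)" for F'
    using has_derivative_transform_within_open[OF _ assms(1,2), of F F' UNIV G]
      has_derivative_transform_within_open[OF _ assms(1,2), of G F' UNIV F] assms(3) by auto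
  then show ?thesis by (simp add: partial_def frechet_derivative_def)
qed

lemma partial_add:
  "F differentiable (at t) \<Longrightarrow> G differentiable (at t) \<Longrightarrow> partial j (\<lambda>u. F u + G u) t = partial j F t + partial j G t"
  using has_derivative_partial_eq[OF has_derivative_add, of F "frechet_derivative F (at t)" t G "frechet_derivative G (at t)" j]
  by (simp add: frechet_derivative_works partial_def)

lemma partial_cmult:
  assumes "F differentiable (at t)" shows "partial j (\<lambda>u. c * F u) t = c * partial j F t"
proof -
  have "(F has_derivative frechet_derivative F (at t)) (at t)" using assms by (simp add: frechet_derivative_works)
  then have "((\<lambda>u. c * F u) has_derivative (\<lambda>v. c * frechet_derivative F (at t) v)) (at t)"
    by (rule has_derivative_mult_right)
  from has_derivative_partial_eq[OF this] show ?thesis by (simp add: partial_def)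
qed

lemma partial_sum:
  assumes "\<And>k. k \<in> K \<Longrightarrow> F k differentiable (at t)"
  shows "partial j (\<lambda>u. \<Sum>k\<in>K. F k u) t = (\<Sum>k\<in>K. partial j (F k) t)"
proof -
  have "((\<lambda>u. \<Sum>k\<in>K. F k u) has_derivative (\<lambda>v. \<Sum>k\<in>K. frechet_derivative (F k) (at t) v)) (at t)"
    using assms by (intro has_derivative_sum) (simp add: frechet_derivative_works)
  from has_derivative_partial_eq[OF this] show ?thesis by (simp add: partial_def)
qed

section \<open>Commutators of partial derivatives with reflection operators\<close>

definition dirder :: "(real^'n \<Rightarrow> complex) \<Rightarrow> real^'n \<Rightarrow> real^'n \<Rightarrow> complex" where
  "dirder f t v = (\<Sum>i\<in>UNIV. of_real (v $ i) * partial i f t)"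

lemma dirder_axis [simp]: "dirder f t (axis m 1) = partial m f t"
  by (simp add: dirder_def axis_def if_distrib if_distribR cong: if_cong)

lemma dirder_minus: "dirder f t (- v) = - dirder f t v"
  by (simp add: dirder_def sum_negf)

lemma compose_linear_has_derivative:
  fixes f :: "real^'n \<Rightarrow> complex"
  assumes f: "smooth f" and s: "linear (s :: real^'n \<Rightarrow> real^'n)"
  shows "((\<lambda>u. f (s u)) has_derivative (\<lambda>v. dirder f (s t) (s v))) (at t)"
  unfolding dirder_def
  using has_derivative_compose[OF bounded_linear_imp_has_derivative smooth_has_derivative[OF f], of s]
    s by (simp add: linear_conv_bounded_linear)

lemma refl_op_has_derivative:
  fixes f :: "real^'n \<Rightarrow> complex"
  assumes c: "(c has_derivative c') (at t)" and f: "smooth f" and s: "linear s"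
  shows "(refl_op c e s f has_derivative (\<lambda>v. of_real (c' v) * (f t - f (s t))
    + of_real (c t) * (dirder f t v - dirder f (s t) (s v)) - of_real e * dirder f (s t) (s v))) (at t)"
proof -
  have d: "(f has_derivative (\<lambda>v. dirder f t v)) (at t)"
    unfolding dirder_def by (rule smooth_has_derivative[OF f])
  note ds = compose_linear_has_derivative[OF f s]
  show ?thesis unfolding refl_op_def[abs_def]
    by (rule derivative_eq_intros d ds has_derivative_of_real c refl | simp add: algebra_simps)+
qed

lemma coth_has_derivative:
  assumes "(p has_derivative p') (at t)" "p t \<noteq> 0"
  shows "((\<lambda>u. coth (p u)) has_derivative (\<lambda>v. (1 - (coth (p t))\<^sup>2) * p' v)) (at t)"
proof -
  have "(coth has_real_derivative (1 - (coth x)\<^sup>2)) (at x)" if "x \<noteq> 0" for x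
    unfolding coth_def[abs_def] using that
    by (auto intro!: derivative_eq_intros simp: field_simps power2_eq_square)
  from has_derivative_compose[OF assms(1) this[OF assms(2), unfolded has_field_derivative_def]]
  show ?thesis .
qed

lemma reflection_axis:
  "i \<noteq> j \<Longrightarrow> swap_coords i j (axis m 1) = axis (if m = i then j else if m = j then i else m) 1"
  "i \<noteq> j \<Longrightarrow> neg_swap_coords i j (axis m 1) = (if m = i then - axis j 1 else if m = j then - axis i 1 else axis m 1)"
  "neg_coord j (axis m 1) = (if m = j then - axis m 1 else axis m 1)"
  by (auto simp: vec_eq_iff reflection_nth axis_def)

lemma regularD: "regular t \<Longrightarrow> t $ j \<noteq> 0" "regular t \<Longrightarrow> i \<noteq> j \<Longrightarrow> t $ i - t $ j \<noteq> 0" "regular t \<Longrightarrow> i \<noteq> j \<Longrightarrow> t $ i + t $ j \<noteq> 0"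
  by (auto simp: regular_def add_eq_0_iff2)

lemma coord_has_derivative: "((\<lambda>u::real^'n. u $ i) has_derivative (\<lambda>v. v $ i)) (at t)"
  using bounded_linear_imp_has_derivative[OF bounded_linear_vec_nth] .

lemma minus_op_has_derivative:
  assumes "regular t" "smooth f" "i \<noteq> j"
  shows "(minus_op i j f has_derivative (\<lambda>v. of_real ((1 - (coth (t $ i - t $ j))\<^sup>2) * (v $ i - v $ j)) * (f t - f (swap_coords i j t))
    + of_real (coth (t $ i - t $ j)) * (dirder f t v - dirder f (swap_coords i j t) (swap_coords i j v))
    - of_real (ord_sign i j) * dirder f (swap_coords i j t) (swap_coords i j v))) (at t)"
  unfolding minus_op_def
  by (intro refl_op_has_derivative coth_has_derivative has_derivative_diff coord_has_derivative assms linear_swap_coords regularD)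

lemma plus_op_has_derivative:
  assumes "regular t" "smooth f" "i \<noteq> j"
  shows "(plus_op i j f has_derivative (\<lambda>v. of_real ((1 - (coth (t $ i + t $ j))\<^sup>2) * (v $ i + v $ j)) * (f t - f (neg_swap_coords i j t))
    + of_real (coth (t $ i + t $ j)) * (dirder f t v - dirder f (neg_swap_coords i j t) (neg_swap_coords i j v))
    - of_real 1 * dirder f (neg_swap_coords i j t) (neg_swap_coords i j v))) (at t)"
  unfolding plus_op_def
  by (intro refl_op_has_derivative coth_has_derivative has_derivative_add coord_has_derivative assms linear_neg_swap_coords regularD)

lemma sign_op_has_derivative:
  assumes "regular t" "smooth f"
  shows "(sign_op b \<iota> j f has_derivative (\<lambda>v. of_real (\<iota> * ((1 - (coth (2 * t $ j))\<^sup>2) * (2 * v $ j)) + b * ((1 - (coth (t $ j))\<^sup>2) * v $ j)) * (f t - f (neg_coord j t))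
    + of_real (\<iota> * coth (2 * t $ j) + b * coth (t $ j)) * (dirder f t v - dirder f (neg_coord j t) (neg_coord j v))
    - of_real (\<iota> + b) * dirder f (neg_coord j t) (neg_coord j v))) (at t)"
  unfolding sign_op_def
  by (intro refl_op_has_derivative coth_has_derivative has_derivative_add has_derivative_mult_right coord_has_derivative assms linear_neg_coord)
    (use regularD(1)[OF assms(1), of j] in auto)

lemma pair_op_differentiable: "regular t \<Longrightarrow> smooth f \<Longrightarrow> i \<noteq> j \<Longrightarrow> pair_op i j f differentiable (at t)"
  unfolding pair_op_def[abs_def]
  by (intro differentiable_add differentiableI[OF minus_op_has_derivative] differentiableI[OF plus_op_has_derivative])

lemma sign_op_differentiable: "regular t \<Longrightarrow> smooth f \<Longrightarrow> sign_op b \<iota> j f differentiable (at t)"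
  by (rule differentiableI[OF sign_op_has_derivative])

lemma partial_pair_op:
  assumes "regular t" "smooth f" "i \<noteq> j"
  shows "partial m (pair_op i j f) t = partial m (minus_op i j f) t + partial m (plus_op i j f) t"
  unfolding pair_op_def[abs_def]
  by (intro partial_add differentiableI[OF minus_op_has_derivative] differentiableI[OF plus_op_has_derivative] assms)

lemma partial_pair_op_distinct:
  assumes "regular t" "smooth f" "i \<noteq> j" "m \<noteq> i" "m \<noteq> j"
  shows "partial m (pair_op i j f) t = pair_op i j (partial m f) t"
proof -
  have ax: "axis m 1 $ i = (0::real)" "axis m 1 $ j = (0::real)" using assms by (auto simp: axis_def)
  show ?thesis
    unfolding partial_pair_op[OF assms(1-3)] has_derivative_partial_eq[OF minus_op_has_derivative[OF assms(1-3)]]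
      has_derivative_partial_eq[OF plus_op_has_derivative[OF assms(1-3)]]
    using assms by (simp add: reflection_axis ax pair_op_def minus_op_def plus_op_def refl_op_def)
qed

lemma partial_sign_op_distinct:
  assumes "regular t" "smooth f" "m \<noteq> j"
  shows "partial m (sign_op b \<iota> j f) t = sign_op b \<iota> j (partial m f) t"
proof -
  have ax: "axis m 1 $ j = (0::real)" using assms by (auto simp: axis_def)
  show ?thesis
    unfolding has_derivative_partial_eq[OF sign_op_has_derivative[OF assms(1-2)]]
    using assms by (simp add: reflection_axis ax sign_op_def refl_op_def)
qed

text \<open>The vector \<open>axis i 1 + axis j 1\<close> is fixed by the swap, and
  \<open>axis i 1 - axis j 1\<close> by the negative swap. So the sum of the two partial derivatives
  commutes with \<open>minus_op i j\<close> and their difference with \<open>plus_op i j\<close>;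
  the sign in \<open>minus_op j i\<close> makes both statements fit together.\<close>

lemma partial_pair_op_opposite:
  assumes "regular t" "smooth f" "i \<noteq> j"
  shows "partial i (pair_op j i f) t - pair_op j i (partial i f) t = partial j (pair_op i j f) t - pair_op i j (partial j f) t"
proof -
  note a = assms(1,2) assms(3)
  have d: "j \<noteq> i" using assms by simp
  have ax: "axis i 1 $ j = (0::real)" "axis j 1 $ i = (0::real)" "axis i 1 $ i = (1::real)" "axis j 1 $ j = (1::real)"
    using assms by (auto simp: axis_def)
  have os: "ord_sign j i = - ord_sign i j" using assms(3) by (auto simp: ord_sign_def)
  show ?thesis
    unfolding partial_pair_op[OF assms(1-3)] partial_pair_op[OF assms(1,2) d]
      has_derivative_partial_eq[OF minus_op_has_derivative[OF a]] has_derivative_partial_eq[OF plus_op_has_derivative[OF a]]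
      has_derivative_partial_eq[OF minus_op_has_derivative[OF a(1,2) d]] has_derivative_partial_eq[OF plus_op_has_derivative[OF a(1,2) d]]
    unfolding pair_op_def minus_op_def plus_op_def refl_op_def swap_coords_commute[of j i] neg_swap_coords_commute[of j i]
      coth_diff_commute[of "t $ j" "t $ i"] add.commute[of "t $ j" "t $ i"] os
    using assms d by (simp add: reflection_axis ax dirder_minus) (simp add: algebra_simps)
qed

lemma partial_dunkl_part_commutator:
  fixes t :: "real^'n::{finite,wellorder}"
  assumes reg: "regular t" and f: "smooth f" and d: "i \<noteq> j"
  shows "partial i (dunkl_part a b \<iota> j f) t - dunkl_part a b \<iota> j (partial i f) t =
    of_real (a / 2) * (partial i (pair_op j i f) t - pair_op j i (partial i f) t)"
proof -
  have df: "(\<lambda>u. of_real (a / 2) * (\<Sum>k\<in>UNIV - {j}. pair_op j k f u)) differentiable (at t)"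
    by (intro differentiable_mult differentiable_const differentiable_sum) (auto intro!: pair_op_differentiable reg f)
  have ds: "(\<lambda>u. \<Sum>k\<in>UNIV - {j}. pair_op j k f u) differentiable (at t)"
    by (intro differentiable_sum) (auto intro!: pair_op_differentiable reg f)
  have 1: "partial i (dunkl_part a b \<iota> j f) t =
      of_real (a / 2) * (\<Sum>k\<in>UNIV - {j}. partial i (pair_op j k f) t) + partial i (sign_op b \<iota> j f) t"
    unfolding dunkl_part_def[abs_def]
    by (subst partial_add[OF df sign_op_differentiable[OF reg f]], subst partial_cmult[OF ds], subst partial_sum)
      (auto intro!: pair_op_differentiable reg f)
  have 2: "partial i (sign_op b \<iota> j f) t = sign_op b \<iota> j (partial i f) t"
    by (rule partial_sign_op_distinct[OF reg f d])
  have "(\<Sum>k\<in>UNIV - {j}. partial i (pair_op j k f) t) - (\<Sum>k\<in>UNIV - {j}. pair_op j k (partial i f) t)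
      = (\<Sum>k\<in>UNIV - {j}. if k = i then partial i (pair_op j i f) t - pair_op j i (partial i f) t else 0)"
    unfolding sum_subtractf[symmetric]
    by (intro sum.cong refl) (use d in \<open>auto simp: partial_pair_op_distinct[OF reg f]\<close>)
  also have "\<dots> = partial i (pair_op j i f) t - pair_op j i (partial i f) t" using d by simp
  finally show ?thesis unfolding 1 2 dunkl_part_def by algebra
qed

lemma dunkl_part_cong:
  fixes t :: "real^'n::{finite,wellorder}"
  assumes "regular t" "\<And>u. regular u \<Longrightarrow> F u = G u"
  shows "dunkl_part a b \<iota> j F t = dunkl_part a b \<iota> j G t"
  unfolding dunkl_part_def pair_op_def minus_op_def plus_op_def sign_op_def refl_op_def
  using assms by (simp add: regular_reflections cong: sum.cong_simp)

lemma dunkl_part_differentiable: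
  fixes t :: "real^'n::{finite,wellorder}"
  assumes reg: "regular t" and f: "smooth f"
  shows "dunkl_part a b \<iota> j f differentiable (at t)"
  unfolding dunkl_part_def[abs_def]
  by (intro differentiable_add differentiable_mult differentiable_const differentiable_sum sign_op_differentiable reg f)
    (auto intro!: pair_op_differentiable reg f)

lemma cherednik_twice_regular:
  fixes t :: "real^'n::{finite,wellorder}"
  assumes reg: "regular t" and f: "smooth f"
  shows "cherednik a b \<iota> i (cherednik a b \<iota> j f) t = partial i (partial j f) t + partial i (dunkl_part a b \<iota> j f) t
    + dunkl_part a b \<iota> i (partial j f) t + dunkl_part a b \<iota> i (dunkl_part a b \<iota> j f) t"
proof -
  \<comment> \<open>The closed formula for \<open>cherednik\<close> holds on an open set, so it may
    be differentiated.\<close>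
  have "partial i (cherednik a b \<iota> j f) t = partial i (\<lambda>u. partial j f u + dunkl_part a b \<iota> j f u) t"
    by (rule partial_cong_open[OF open_regular]) (auto simp: reg cherednik_regular)
  also have "\<dots> = partial i (partial j f) t + partial i (dunkl_part a b \<iota> j f) t"
    by (intro partial_add smooth_differentiable smooth_partial f dunkl_part_differentiable reg)
  finally have 1: "partial i (cherednik a b \<iota> j f) t = partial i (partial j f) t + partial i (dunkl_part a b \<iota> j f) t" .
  have "dunkl_part a b \<iota> i (cherednik a b \<iota> j f) t = dunkl_part a b \<iota> i (\<lambda>u. partial j f u + dunkl_part a b \<iota> j f u) t"
    by (rule dunkl_part_cong[OF reg]) (simp add: cherednik_regular)
  also have "\<dots> = dunkl_part a b \<iota> i (partial j f) t + dunkl_part a b \<iota> i (dunkl_part a b \<iota> j f) t"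
    by (rule linear_op_add[OF linear_op_dunkl_part])
  finally show ?thesis using 1 by (simp add: cherednik_regular[OF reg])
qed

text \<open>With \<open>S\<close> for \<open>dunkl_part\<close>, the commutator splits into the
  commutators of the two derivatives and of the two \<open>S\<close>, which vanish, and the
  difference of the mixed commutators. The latter come from the pair \<open>i\<close>,
  \<open>j\<close> alone and agree by \<open>partial_pair_op_opposite\<close>.\<close>

lemma cherednik_commute:
  fixes f :: "real^'n::{finite,wellorder} \<Rightarrow> complex"
  assumes f: "smooth f"
  shows "cherednik a b \<iota> i (cherednik a b \<iota> j f) = cherednik a b \<iota> j (cherednik a b \<iota> i f)"
proof (cases "i = j")
  case False
  show ?thesis
  proof
    fix t
    show "cherednik a b \<iota> i (cherednik a b \<iota> j f) t = cherednik a b \<iota> j (cherednik a b \<iota> i f) t"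
    proof (rule continuous_eq_regular[where U=UNIV])
      fix t :: "real^'n::{finite,wellorder}" assume reg: "regular t"
      show "cherednik a b \<iota> i (cherednik a b \<iota> j f) t = cherednik a b \<iota> j (cherednik a b \<iota> i f) t"
        using partial_dunkl_part_commutator[OF reg f False, of a b \<iota>]
          partial_dunkl_part_commutator[OF reg f False[symmetric], of a b \<iota>]
          partial_pair_op_opposite[OF reg f False]
        unfolding cherednik_twice_regular[OF reg f] partial_commute[OF f, of i j] dunkl_part_commute[OF reg False, of a b \<iota> f]
        by simp algebra
    qed (intro smooth_continuous smooth_cherednik f | simp)+
  qed
qed simp

subsection \<open>Equivariance under the Weyl group\<close>

lemma cherednik_add:
  fixes f g :: "real^'n::{finite,wellorder} \<Rightarrow> complex"
  assumes f: "smooth f" and g: "smooth g"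
  shows "cherednik a b \<iota> j (\<lambda>u. f u + g u) t = cherednik a b \<iota> j f t + cherednik a b \<iota> j g t"
proof (rule continuous_eq_regular[where U=UNIV])
  fix t :: "real^'n::{finite,wellorder}" assume "regular t"
  then show "cherednik a b \<iota> j (\<lambda>u. f u + g u) t = cherednik a b \<iota> j f t + cherednik a b \<iota> j g t"
    using f g by (simp add: cherednik_regular partial_add smooth_differentiable linear_op_add[OF linear_op_dunkl_part])
qed (intro smooth_continuous smooth_cherednik smooth_add f g | simp)+

lemma cherednik_cmult:
  fixes f :: "real^'n::{finite,wellorder} \<Rightarrow> complex"
  assumes f: "smooth f"
  shows "cherednik a b \<iota> j (\<lambda>u. c * f u) t = c * cherednik a b \<iota> j f t"
proof (rule continuous_eq_regular[where U=UNIV])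
  fix t :: "real^'n::{finite,wellorder}" assume "regular t"
  then show "cherednik a b \<iota> j (\<lambda>u. c * f u) t = c * cherednik a b \<iota> j f t"
    using f by (simp add: cherednik_regular partial_cmult smooth_differentiable linear_op_cmult[OF linear_op_dunkl_part] algebra_simps)
qed (intro smooth_continuous smooth_cherednik smooth_mult smooth_const f | simp)+

lemma norm_reflections [simp]:
  "norm (swap_coords i j t) = norm t" "i \<noteq> j \<Longrightarrow> norm (neg_swap_coords i j t) = norm t" "norm (neg_coord j t) = norm t"
proof -
  have s: "swap_coords i j t \<bullet> swap_coords i j t = t \<bullet> t"
  proof -
    let ?p = "\<lambda>k. if k = i then j else if k = j then i else k"
    show ?thesis unfolding inner_vec_def
      by (rule sum.reindex_bij_witness[of _ ?p ?p]) (auto simp: reflection_nth)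
  qed
  then show "norm (swap_coords i j t) = norm t" by (simp add: norm_eq)
  show "norm (neg_coord j t) = norm t" by (auto simp: norm_eq inner_vec_def reflection_nth intro!: sum.cong)
  assume "i \<noteq> j"
  then have "neg_swap_coords i j t \<bullet> neg_swap_coords i j t = swap_coords i j t \<bullet> swap_coords i j t"
    unfolding inner_vec_def by (intro sum.cong) (auto simp: reflection_nth)
  with s show "norm (neg_swap_coords i j t) = norm t" by (simp add: norm_eq)
qed

text \<open>A ball rather than an arbitrary compact set: the reflections are isometries, so one
  radius serves for all images under the operators.\<close>

definition supported_in :: "real \<Rightarrow> (real^'n \<Rightarrow> complex) \<Rightarrow> bool" where
  "supported_in R f \<longleftrightarrow> (\<forall>t. norm t > R \<longrightarrow> f t = 0)"

lemma supported_in_cherednik: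
  fixes f :: "real^'n::{finite,wellorder} \<Rightarrow> complex"
  assumes f: "smooth f" and R: "supported_in R f"
  shows "supported_in R (cherednik a b \<iota> j f)"
  unfolding supported_in_def
proof (intro allI impI)
  fix t :: "real^'n::{finite,wellorder}" assume "norm t > R"
  have o: "open {t::real^'n::{finite,wellorder}. norm t > R}" by (intro open_Collect_less continuous_intros)
  show "cherednik a b \<iota> j f t = 0"
  proof (rule continuous_eq_regular[of _ "\<lambda>_. 0" "{t. norm t > R}"])
    fix t :: "real^'n::{finite,wellorder}" assume t: "t \<in> {t. norm t > R}" and reg: "regular t"
    have "partial j f t = partial j (\<lambda>u. 0 * f u) t"
      using R by (intro partial_cong_open[OF o t]) (auto simp: supported_in_def)
    then have "partial j f t = 0" using partial_cmult[OF smooth_differentiable[OF f], of j 0 t] by simp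
    moreover have "dunkl_part a b \<iota> j f t = 0"
      using R t unfolding dunkl_part_def pair_op_def minus_op_def plus_op_def sign_op_def refl_op_def supported_in_def
      by (simp add: sum.neutral)
    ultimately show "cherednik a b \<iota> j f t = 0" by (simp add: cherednik_regular[OF reg])
  qed (use o \<open>norm t > R\<close> in \<open>auto intro: smooth_continuous smooth_cherednik f\<close>)
qed

section \<open>Relations between Cherednik operators and simple reflections\<close>

lemma reflection_involution [simp]:
  "swap_coords i j (swap_coords i j t) = t" "i \<noteq> j \<Longrightarrow> neg_swap_coords i j (neg_swap_coords i j t) = t" "neg_coord j (neg_coord j t) = t"
  by (auto simp: vec_eq_iff reflection_nth)

lemma refl_op_conj:
  assumes "c1 (s t) = c2 t" "s1 (s t) = s (s2 t)"
  shows "refl_op c1 e s1 f (s t) = refl_op c2 e s2 (\<lambda>u. f (s u)) t"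
  by (simp add: refl_op_def assms)

lemma partial_compose:
  fixes f :: "real^'n \<Rightarrow> complex" and s :: "real^'n \<Rightarrow> real^'n"
  shows "smooth f \<Longrightarrow> linear s \<Longrightarrow> partial m (\<lambda>u. f (s u)) t = dirder f (s t) (s (axis m 1))"
  by (rule has_derivative_partial_eq[OF compose_linear_has_derivative])

text \<open>For these pairs the swap is a simple reflection: it permutes the positive roots other
  than \<open>axis i 1 - axis j 1\<close>.\<close>

definition adjacent :: "'n::linorder \<Rightarrow> 'n \<Rightarrow> bool" where
  "adjacent i j \<longleftrightarrow> i < j \<and> (\<forall>k. \<not> (i < k \<and> k < j))"

lemma ord_sign_adjacent:
  "adjacent i j \<Longrightarrow> k \<noteq> i \<Longrightarrow> k \<noteq> j \<Longrightarrow> ord_sign i k = ord_sign j k"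
  "adjacent i j \<Longrightarrow> k \<noteq> i \<Longrightarrow> k \<noteq> j \<Longrightarrow> ord_sign k i = ord_sign k j"
  unfolding adjacent_def ord_sign_def by (metis less_linear less_trans)+

lemma sign_op_swap: "sign_op b \<iota> (if k = i then j else if k = j then i else k) (\<lambda>u. f (swap_coords i j u)) t = sign_op b \<iota> k f (swap_coords i j t)"
  unfolding sign_op_def by (rule refl_op_conj[symmetric]) (auto simp: reflection_nth vec_eq_iff)

lemma pair_op_swap:
  assumes "adjacent i j" "k \<noteq> l" "{k, l} \<noteq> {i, j}"
  shows "pair_op k l f (swap_coords i j t) =
    pair_op (if k = i then j else if k = j then i else k) (if l = i then j else if l = j then i else l) (\<lambda>u. f (swap_coords i j u)) t"
proof -
  let ?p = "\<lambda>k. if k = i then j else if k = j then i else k"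
  have d: "i \<noteq> j" using assms(1) by (auto simp: adjacent_def)
  have o: "ord_sign (?p k) (?p l) = ord_sign k l"
    using ord_sign_adjacent[OF assms(1), of k] ord_sign_adjacent[OF assms(1), of l] assms(2,3) d by auto
  have 1: "minus_op k l f (swap_coords i j t) = minus_op (?p k) (?p l) (\<lambda>u. f (swap_coords i j u)) t"
    unfolding minus_op_def o by (rule refl_op_conj) (use assms d in \<open>auto simp: reflection_nth vec_eq_iff\<close>)
  have 2: "plus_op k l f (swap_coords i j t) = plus_op (?p k) (?p l) (\<lambda>u. f (swap_coords i j u)) t"
    unfolding plus_op_def by (rule refl_op_conj) (use assms d in \<open>auto simp: reflection_nth vec_eq_iff\<close>)
  show ?thesis unfolding pair_op_def 1 2 ..
qed

text \<open>The swap reverses its own root, which is the one place where \<open>ord_sign\<close>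
  changes; the discrepancy \<open>2 * ord_sign i j\<close> times the coefficient
  \<open>a / 2\<close> is the term \<open>a\<close> of \<open>dunkl_part_swap\<close>.\<close>

lemma pair_op_swap_self:
  assumes "i \<noteq> j"
  shows "pair_op i j f (swap_coords i j t) = pair_op j i (\<lambda>u. f (swap_coords i j u)) t - 2 * of_real (ord_sign i j) * f t"
proof -
  have o: "ord_sign j i = - ord_sign i j" using assms by (auto simp: ord_sign_def)
  have p: "plus_op i j f (swap_coords i j t) = plus_op j i (\<lambda>u. f (swap_coords i j u)) t"
    unfolding plus_op_def by (rule refl_op_conj) (use assms in \<open>auto simp: reflection_nth vec_eq_iff\<close>)
  show ?thesis unfolding pair_op_def p
    by (simp add: minus_op_def refl_op_def o reflection_nth swap_coords_commute[of j i] algebra_simps)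
qed

lemma dunkl_part_swap:
  fixes t :: "real^'n::{finite,wellorder}"
  assumes adj: "adjacent i j"
  shows "dunkl_part a b \<iota> i f (swap_coords i j t) = dunkl_part a b \<iota> j (\<lambda>u. f (swap_coords i j u)) t - of_real a * f t"
    and "k \<noteq> i \<Longrightarrow> k \<noteq> j \<Longrightarrow> dunkl_part a b \<iota> k f (swap_coords i j t) = dunkl_part a b \<iota> k (\<lambda>u. f (swap_coords i j u)) t"
proof -
  have d: "i \<noteq> j" "ord_sign i j = 1" using adj by (auto simp: adjacent_def ord_sign_def)
  define K where "K = UNIV - {i, j}"
  have K: "UNIV - {i} = insert j K" "UNIV - {j} = insert i K" "i \<notin> K" "j \<notin> K" "finite K"
    using d by (auto simp: K_def)
  have "(\<Sum>k\<in>K. pair_op i k f (swap_coords i j t)) = (\<Sum>k\<in>K. pair_op j k (\<lambda>u. f (swap_coords i j u)) t)"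
  proof (rule sum.cong)
    fix k assume "k \<in> K"
    then show "pair_op i k f (swap_coords i j t) = pair_op j k (\<lambda>u. f (swap_coords i j u)) t"
      using pair_op_swap[OF adj, of i k f t] d by (auto simp: K_def)
  qed simp
  then show "dunkl_part a b \<iota> i f (swap_coords i j t) = dunkl_part a b \<iota> j (\<lambda>u. f (swap_coords i j u)) t - of_real a * f t"
    unfolding dunkl_part_def K using K d sign_op_swap[of b \<iota> i i j f t, symmetric]
    by (simp add: pair_op_swap_self algebra_simps)
  assume k: "k \<noteq> i" "k \<noteq> j"
  let ?p = "\<lambda>k. if k = i then j else if k = j then i else k"
  have "(\<Sum>l\<in>UNIV - {k}. pair_op k l f (swap_coords i j t)) = (\<Sum>l\<in>UNIV - {k}. pair_op k l (\<lambda>u. f (swap_coords i j u)) t)"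
  proof (rule sum.reindex_bij_witness[of _ ?p ?p])
    fix l assume "l \<in> UNIV - {k}"
    moreover have "?p k = k" "{k, l} \<noteq> {i, j}" using k by auto
    ultimately show "pair_op k (?p l) (\<lambda>u. f (swap_coords i j u)) t = pair_op k l f (swap_coords i j t)"
      using pair_op_swap[OF adj, of k l f t] k by auto
  qed (use k in auto)
  then show "dunkl_part a b \<iota> k f (swap_coords i j t) = dunkl_part a b \<iota> k (\<lambda>u. f (swap_coords i j u)) t"
    unfolding dunkl_part_def using k sign_op_swap[of b \<iota> k i j f t] by simp
qed

text \<open>The cross relations of a graded Hecke algebra: a simple swap interchanges
  \<open>D\<^sub>i\<close> and \<open>D\<^sub>j\<close> up to the multiplicity of its root.\<close>

lemma cherednik_swap:
  fixes f :: "real^'n::{finite,wellorder} \<Rightarrow> complex"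
  assumes adj: "adjacent i j" and f: "smooth f"
  shows "cherednik a b \<iota> i f (swap_coords i j t) = cherednik a b \<iota> j (\<lambda>u. f (swap_coords i j u)) t - of_real a * f t"
    and "cherednik a b \<iota> j f (swap_coords i j t) = cherednik a b \<iota> i (\<lambda>u. f (swap_coords i j u)) t + of_real a * f t"
    and "k \<noteq> i \<Longrightarrow> k \<noteq> j \<Longrightarrow> cherednik a b \<iota> k f (swap_coords i j t) = cherednik a b \<iota> k (\<lambda>u. f (swap_coords i j u)) t"
proof -
  have d: "i \<noteq> j" using adj by (auto simp: adjacent_def)
  note sc = smooth_compose_linear[OF linear_swap_coords]
  have 1: "cherednik a b \<iota> i g (swap_coords i j t) = cherednik a b \<iota> j (\<lambda>u. g (swap_coords i j u)) t - of_real a * g t"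
    if g: "smooth g" for g t
  proof (rule continuous_eq_regular[where U=UNIV])
    fix t :: "real^'n::{finite,wellorder}" assume reg: "regular t"
    show "cherednik a b \<iota> i g (swap_coords i j t) = cherednik a b \<iota> j (\<lambda>u. g (swap_coords i j u)) t - of_real a * g t"
      using d by (simp add: cherednik_regular reg regular_reflections dunkl_part_swap[OF adj] partial_compose[OF g linear_swap_coords] reflection_axis)
  qed (intro smooth_continuous smooth_diff smooth_mult smooth_const sc smooth_cherednik g | simp)+
  show "cherednik a b \<iota> i f (swap_coords i j t) = cherednik a b \<iota> j (\<lambda>u. f (swap_coords i j u)) t - of_real a * f t"
    by (rule 1[OF f])
  show "cherednik a b \<iota> j f (swap_coords i j t) = cherednik a b \<iota> i (\<lambda>u. f (swap_coords i j u)) t + of_real a * f t"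
    using 1[OF sc[OF f], of i j "swap_coords i j t"] by simp
  assume k: "k \<noteq> i" "k \<noteq> j"
  show "cherednik a b \<iota> k f (swap_coords i j t) = cherednik a b \<iota> k (\<lambda>u. f (swap_coords i j u)) t"
  proof (rule continuous_eq_regular[where U=UNIV])
    fix t :: "real^'n::{finite,wellorder}" assume reg: "regular t"
    show "cherednik a b \<iota> k f (swap_coords i j t) = cherednik a b \<iota> k (\<lambda>u. f (swap_coords i j u)) t"
      using d k by (simp add: cherednik_regular reg regular_reflections dunkl_part_swap[OF adj] partial_compose[OF f linear_swap_coords] reflection_axis)
  qed (intro smooth_continuous sc smooth_cherednik f | simp)+
qed

text \<open>The index \<open>m\<close> is the largest one, which makes the sign change a simple
  reflection. It interchanges the roots \<open>axis k 1 - axis m 1\<close> and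
  \<open>axis k 1 + axis m 1\<close>, and their signs agree because \<open>k < m\<close>. For
  \<open>k = m\<close> the roles of the two indices are reversed, whence the factor
  \<open>- 1\<close>.\<close>

lemma pair_op_neg_coord:
  assumes "\<And>k. k \<le> m" "k \<noteq> l"
  shows "pair_op k l f (neg_coord m t) = (if k = m then -1 else 1) * pair_op k l (\<lambda>u. f (neg_coord m u)) t"
proof -
  have neg: "coth (- x - y) = - coth (x + y)" "coth (- x + y) = - coth (x - y)" for x y
    using coth_minus[of "x + y"] coth_minus[of "x - y"] by simp_all
  consider "k \<noteq> m" "l \<noteq> m" | "l = m" | "k = m" by blast
  then show ?thesis
  proof cases
    case 1
    have "minus_op k l f (neg_coord m t) = minus_op k l (\<lambda>u. f (neg_coord m u)) t"
      unfolding minus_op_def by (rule refl_op_conj) (use assms 1 in \<open>auto simp: reflection_nth vec_eq_iff\<close>)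
    moreover have "plus_op k l f (neg_coord m t) = plus_op k l (\<lambda>u. f (neg_coord m u)) t"
      unfolding plus_op_def by (rule refl_op_conj) (use assms 1 in \<open>auto simp: reflection_nth vec_eq_iff\<close>)
    ultimately show ?thesis using 1 by (simp add: pair_op_def)
  next
    case 2
    then have o: "ord_sign k l = 1" using assms by (auto simp: ord_sign_def less_le)
    have "minus_op k l f (neg_coord m t) = plus_op k l (\<lambda>u. f (neg_coord m u)) t"
      unfolding minus_op_def plus_op_def o by (rule refl_op_conj) (use assms 2 in \<open>auto simp: reflection_nth vec_eq_iff\<close>)
    moreover have "plus_op k l f (neg_coord m t) = minus_op k l (\<lambda>u. f (neg_coord m u)) t"
      unfolding minus_op_def plus_op_def o by (rule refl_op_conj) (use assms 2 in \<open>auto simp: reflection_nth vec_eq_iff\<close>)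
    ultimately show ?thesis using 2 assms by (simp add: pair_op_def)
  next
    case 3
    then have o: "ord_sign k l = -1" using assms by (auto simp: ord_sign_def not_less)
    have s: "swap_coords k l (neg_coord k t) = neg_coord k (neg_swap_coords k l t)"
      "neg_swap_coords k l (neg_coord k t) = neg_coord k (swap_coords k l t)"
      using assms by (auto simp: vec_eq_iff reflection_nth)
    show ?thesis using 3 assms
      by (simp add: pair_op_def minus_op_def plus_op_def refl_op_def o[unfolded 3] s[unfolded 3] reflection_nth neg coth_diff_commute[of "t $ l" "t $ m"] algebra_simps)
  qed
qed

text \<open>The cross relation for the remaining simple reflection; the constant
  \<open>2 * (\<iota> + b)\<close> comes from the two roots proportional to
  \<open>axis m 1\<close>.\<close>

lemma cherednik_neg_coord:
  fixes f :: "real^'n::{finite,wellorder} \<Rightarrow> complex"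
  assumes top: "\<And>k. k \<le> m" and f: "smooth f"
  shows "cherednik a b \<iota> m f (neg_coord m t) = - cherednik a b \<iota> m (\<lambda>u. f (neg_coord m u)) t - of_real (2 * (\<iota> + b)) * f t"
    and "k \<noteq> m \<Longrightarrow> cherednik a b \<iota> k f (neg_coord m t) = cherednik a b \<iota> k (\<lambda>u. f (neg_coord m u)) t"
proof -
  note sc = smooth_compose_linear[OF linear_neg_coord]
  show "cherednik a b \<iota> m f (neg_coord m t) = - cherednik a b \<iota> m (\<lambda>u. f (neg_coord m u)) t - of_real (2 * (\<iota> + b)) * f t"
  proof (rule continuous_eq_regular[where U=UNIV])
    fix t :: "real^'n::{finite,wellorder}" assume reg: "regular t"
    have "(\<Sum>k\<in>UNIV - {m}. pair_op m k f (neg_coord m t)) = (\<Sum>k\<in>UNIV - {m}. - pair_op m k (\<lambda>u. f (neg_coord m u)) t)"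
      by (rule sum.cong) (auto simp: pair_op_neg_coord[OF top])
    then show "cherednik a b \<iota> m f (neg_coord m t) = - cherednik a b \<iota> m (\<lambda>u. f (neg_coord m u)) t - of_real (2 * (\<iota> + b)) * f t"
      by (simp add: cherednik_regular reg regular_reflections partial_compose[OF f linear_neg_coord] reflection_axis dirder_minus
          dunkl_part_def sum_negf sign_op_def refl_op_def reflection_nth algebra_simps)
  next
    have "smooth (\<lambda>t. (-1) * cherednik a b \<iota> m (\<lambda>u. f (neg_coord m u)) t - of_real (2 * (\<iota> + b)) * f t)"
      by (intro smooth_diff smooth_mult smooth_const sc smooth_cherednik f)
    then show "continuous_on UNIV (\<lambda>t. - cherednik a b \<iota> m (\<lambda>u. f (neg_coord m u)) t - of_real (2 * (\<iota> + b)) * f t)"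
      by (simp add: smooth_continuous)
  qed (intro smooth_continuous sc smooth_cherednik f | simp)+
  assume k: "k \<noteq> m"
  show "cherednik a b \<iota> k f (neg_coord m t) = cherednik a b \<iota> k (\<lambda>u. f (neg_coord m u)) t"
  proof (rule continuous_eq_regular[where U=UNIV])
    fix t :: "real^'n::{finite,wellorder}" assume reg: "regular t"
    have "(\<Sum>l\<in>UNIV - {k}. pair_op k l f (neg_coord m t)) = (\<Sum>l\<in>UNIV - {k}. pair_op k l (\<lambda>u. f (neg_coord m u)) t)"
      by (rule sum.cong) (use k in \<open>auto simp: pair_op_neg_coord[OF top]\<close>)
    moreover have "sign_op b \<iota> k f (neg_coord m t) = sign_op b \<iota> k (\<lambda>u. f (neg_coord m u)) t"
      unfolding sign_op_def by (rule refl_op_conj) (use k in \<open>auto simp: reflection_nth vec_eq_iff\<close>)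
    ultimately show "cherednik a b \<iota> k f (neg_coord m t) = cherednik a b \<iota> k (\<lambda>u. f (neg_coord m u)) t"
      using k by (simp add: cherednik_regular reg regular_reflections partial_compose[OF f linear_neg_coord] reflection_axis dunkl_part_def)
  qed (intro smooth_continuous sc smooth_cherednik f | simp)+
qed

section \<open>Factors and products of Cherednik operators\<close>

definition shift_op ::
  "real \<Rightarrow> real \<Rightarrow> real \<Rightarrow> complex \<Rightarrow> 'n::{finite,wellorder} \<Rightarrow>
     (real^'n::{finite,wellorder} \<Rightarrow> complex) \<Rightarrow> real^'n::{finite,wellorder} \<Rightarrow> complex" where
  "shift_op a b \<iota> c j f t = cherednik a b \<iota> j f t + c * f t"

text \<open>The parameter is the square \<open>q\<close> of the shift \<open>c\<close>, since the
  product over all indices is a polynomial in it.\<close>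

definition factor_op ::
  "real \<Rightarrow> real \<Rightarrow> real \<Rightarrow> complex \<Rightarrow> 'n::{finite,wellorder} \<Rightarrow>
     (real^'n::{finite,wellorder} \<Rightarrow> complex) \<Rightarrow> real^'n::{finite,wellorder} \<Rightarrow> complex" where
  "factor_op a b \<iota> q j f t = cherednik a b \<iota> j (cherednik a b \<iota> j f) t - q * f t"

lemma cherednik_diff:
  fixes f g :: "real^'n::{finite,wellorder} \<Rightarrow> complex"
  assumes f: "smooth f" and g: "smooth g"
  shows "cherednik a b \<iota> j (\<lambda>u. f u - g u) t = cherednik a b \<iota> j f t - cherednik a b \<iota> j g t"
  using cherednik_add[OF f smooth_mult[OF smooth_const[of "-1"] g], of a b \<iota> j t] cherednik_cmult[OF g, of a b \<iota> j "-1" t]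
  by simp

lemma cherednik_sum:
  fixes F :: "'k \<Rightarrow> real^'n::{finite,wellorder} \<Rightarrow> complex"
  shows "(\<And>k. k \<in> K \<Longrightarrow> smooth (F k)) \<Longrightarrow> cherednik a b \<iota> j (\<lambda>u. \<Sum>k\<in>K. F k u) t = (\<Sum>k\<in>K. cherednik a b \<iota> j (F k) t)"
proof (induction K rule: infinite_finite_induct)
  case (insert x K)
  then show ?case by (simp add: cherednik_add smooth_sum)
qed (use cherednik_cmult[OF smooth_const[of 0], of a b \<iota> j 0 t] in auto)

lemma smooth_shift_op: "smooth f \<Longrightarrow> smooth (shift_op a b \<iota> c j f)"
  unfolding shift_op_def[abs_def] by (intro smooth_add smooth_mult smooth_const smooth_cherednik)

lemma smooth_factor_op: "smooth f \<Longrightarrow> smooth (factor_op a b \<iota> q j f)"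
  unfolding factor_op_def[abs_def] by (intro smooth_diff smooth_mult smooth_const smooth_cherednik)

lemma supported_in_shift_op: "smooth f \<Longrightarrow> supported_in R f \<Longrightarrow> supported_in R (shift_op a b \<iota> c j f)"
  using supported_in_cherednik[of f R a b \<iota> j] by (simp add: supported_in_def shift_op_def)

lemma shift_op_commute:
  fixes f :: "real^'n::{finite,wellorder} \<Rightarrow> complex"
  assumes f: "smooth f"
  shows "shift_op a b \<iota> c i (shift_op a b \<iota> d j f) = shift_op a b \<iota> d j (shift_op a b \<iota> c i f)"
proof
  fix t
  have *: "shift_op a b \<iota> c i (shift_op a b \<iota> d j f) t = cherednik a b \<iota> i (cherednik a b \<iota> j f) t
    + d * cherednik a b \<iota> i f t + c * cherednik a b \<iota> j f t + c * d * f t" for i j c d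
    unfolding shift_op_def[abs_def]
    by (simp add: cherednik_add cherednik_cmult smooth_cherednik smooth_mult smooth_const f algebra_simps)
  show "shift_op a b \<iota> c i (shift_op a b \<iota> d j f) t = shift_op a b \<iota> d j (shift_op a b \<iota> c i f) t"
    unfolding * cherednik_commute[OF f, of a b \<iota> i j] by simp
qed

lemma factor_op_shift_op:
  fixes f :: "real^'n::{finite,wellorder} \<Rightarrow> complex"
  assumes f: "smooth f"
  shows "factor_op a b \<iota> (c\<^sup>2) j f = shift_op a b \<iota> c j (shift_op a b \<iota> (- c) j f)"
  unfolding shift_op_def[abs_def] factor_op_def[abs_def]
  by (rule ext) (simp add: cherednik_diff cherednik_cmult smooth_cherednik smooth_mult smooth_const f power2_eq_square algebra_simps)

lemma factor_op_commute:
  fixes f :: "real^'n::{finite,wellorder} \<Rightarrow> complex"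
  assumes f: "smooth f"
  shows "factor_op a b \<iota> q i (factor_op a b \<iota> q j f) = factor_op a b \<iota> q j (factor_op a b \<iota> q i f)"
proof -
  \<comment> \<open>Over the complex numbers \<open>q\<close> is a square, so both factors split
    into linear ones, which commute.\<close>
  have "factor_op a b \<iota> ((csqrt q)\<^sup>2) i (factor_op a b \<iota> ((csqrt q)\<^sup>2) j f) = factor_op a b \<iota> ((csqrt q)\<^sup>2) j (factor_op a b \<iota> ((csqrt q)\<^sup>2) i f)"
    using f by (simp add: factor_op_shift_op smooth_shift_op shift_op_commute del: power2_csqrt)
  then show ?thesis by simp
qed

text \<open>\<open>S\<close> stands for smoothness: the operators are known to commute only on this
  class, and it has to be preserved on the way.\<close>

lemma foldr_extract:
  assumes closed: "\<And>x f. S f \<Longrightarrow> S (N x f)" and comm: "\<And>x y f. S f \<Longrightarrow> N x (N y f) = N y (N x f)"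
  shows "x \<in> set L \<Longrightarrow> S f \<Longrightarrow> foldr N L f = N x (foldr N (remove1 x L) f)"
proof (induction L)
  case (Cons y L)
  have S: "S (foldr N L' f)" for L' by (induction L') (auto intro: Cons.prems closed)
  show ?case using Cons comm[OF S] by auto
qed simp

text \<open>The target order is dictated by the adjoints, which take the outermost operator first:
  all \<open>P\<close> with increasing index, followed by all \<open>Q\<close> with decreasing
  index.\<close>

lemma foldr_compose_commuting:
  assumes closed: "\<And>x f. S f \<Longrightarrow> S (P x f)" "\<And>x f. S f \<Longrightarrow> S (Q x f)"
    and comm: "\<And>x y f. S f \<Longrightarrow> P x (Q y f) = Q y (P x f)" "\<And>x y f. S f \<Longrightarrow> Q x (Q y f) = Q y (Q x f)"
  shows "S f \<Longrightarrow> foldr (\<lambda>x f. P x (Q x f)) L f = foldr P L (foldr Q (rev L) f)"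
proof (induction L arbitrary: f)
  case (Cons y L)
  have SP: "S (foldr P L' g)" if "S g" for L' g by (induction L') (auto intro: that closed)
  have SQ: "S (foldr Q L' g)" if "S g" for L' g by (induction L') (auto intro: that closed)
  have QP: "Q y (foldr P L' g) = foldr P L' (Q y g)" if "S g" for L' g
    by (induction L') (auto simp: comm(1)[symmetric] SP that)
  have QQ: "Q y (foldr Q L' g) = foldr Q L' (Q y g)" if "S g" for L' g
    by (induction L') (auto simp: comm(2)[of _ y] SQ that)
  show ?case using Cons by (simp add: QP SQ QQ)
qed simp

definition prod_op ::
  "real \<Rightarrow> real \<Rightarrow> real \<Rightarrow> complex \<Rightarrow>
     (real^'n::{finite,wellorder} \<Rightarrow> complex) \<Rightarrow> real^'n::{finite,wellorder} \<Rightarrow> complex" where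
  "prod_op a b \<iota> q = foldr (factor_op a b \<iota> q) (sorted_list_of_set UNIV)"

lemma bs_operator_prod_op:
  "bs_operator a b \<iota> \<delta> = (prod_op a b \<iota> ((\<delta> + of_real (rho a b \<iota> (Min (UNIV :: 'n set))))\<^sup>2)
     :: (real^'n::{finite,wellorder} \<Rightarrow> complex) \<Rightarrow> _)"
proof -
  have "(bs_factor a b \<iota> \<delta> :: 'n \<Rightarrow> _) = factor_op a b \<iota> ((\<delta> + of_real (rho a b \<iota> (Min (UNIV :: 'n set))))\<^sup>2)"
    by (intro ext) (simp add: bs_factor_def factor_op_def)
  then show ?thesis by (simp add: bs_operator_def prod_op_def)
qed

lemma prod_op_shift_op:
  fixes f :: "real^'n::{finite,wellorder} \<Rightarrow> complex"
  assumes f: "smooth f"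
  shows "prod_op a b \<iota> (c\<^sup>2) f = foldr (shift_op a b \<iota> c) (sorted_list_of_set UNIV)
     (foldr (shift_op a b \<iota> (- c)) (rev (sorted_list_of_set UNIV)) f)"
proof -
  have "foldr (factor_op a b \<iota> (c\<^sup>2)) L f = foldr (\<lambda>j f. shift_op a b \<iota> c j (shift_op a b \<iota> (- c) j f)) L f" for L
  proof (induction L)
    case (Cons j L)
    have "smooth (foldr (factor_op a b \<iota> (c\<^sup>2)) L f)" by (induction L) (auto intro: f smooth_factor_op)
    then show ?case using Cons by (simp add: factor_op_shift_op)
  qed simp
  also have "foldr (\<lambda>j f. shift_op a b \<iota> c j (shift_op a b \<iota> (- c) j f)) L f
      = foldr (shift_op a b \<iota> c) L (foldr (shift_op a b \<iota> (- c)) (rev L) f)" for L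
    by (rule foldr_compose_commuting[where S=smooth]) (auto intro: smooth_shift_op shift_op_commute f)
  finally show ?thesis unfolding prod_op_def .
qed

text \<open>This separates the parameter from the function: the coefficients are fixed smooth
  functions in the same ball, so a continuation in \<delta> can be applied to each of them although
  the operator itself varies with \<delta>.\<close>

lemma prod_op_polynomial:
  fixes f :: "real^'n::{finite,wellorder} \<Rightarrow> complex"
  assumes f: "smooth f" "supported_in R f"
  shows "\<exists>F N. (\<forall>k. smooth (F k) \<and> supported_in R (F k)) \<and> (\<forall>q. prod_op a b \<iota> q f = (\<lambda>t. \<Sum>k\<le>(N::nat). q ^ k * F k t))"
proof -
  have "\<exists>F N. (\<forall>k. smooth (F k) \<and> supported_in R (F k)) \<and>
     (\<forall>q. foldr (factor_op a b \<iota> q) L f = (\<lambda>t. \<Sum>k\<le>(N::nat). q ^ k * F k t))" for L :: "'n list"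
  proof (induction L)
    case Nil
    show ?case using f by (intro exI[of _ "\<lambda>_. f"] exI[of _ 0]) auto
  next
    case (Cons j L)
    then obtain F N where F: "\<And>k. smooth (F k)" "\<And>k. supported_in R (F k)"
      and e: "\<And>q. foldr (factor_op a b \<iota> q) L f = (\<lambda>t. \<Sum>k\<le>(N::nat). q ^ k * F k t)" by blast
    let ?D = "cherednik a b \<iota> j"
    \<comment> \<open>The coefficient of \<open>q ^ k\<close> in
      \<open>(D\<^sub>j\<^sup>2 - q)\<close> applied to the sum. The first condition cuts off
      \<open>F (Suc N)\<close>, which does not belong to the sum; the second one removes
      \<open>F (k - 1)\<close> at \<open>k = 0\<close>, where the subtraction truncates.\<close>
    define G where "G k = (\<lambda>t. (if k \<le> N then 1 else 0) * ?D (?D (F k)) t - (if k = 0 then 0 else 1) * F (k - 1) t)" for k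
    have "smooth (G k)" for k
      unfolding G_def by (intro smooth_diff smooth_mult smooth_const smooth_cherednik F)
    moreover have "supported_in R (G k)" for k
      using supported_in_cherednik[OF smooth_cherednik[OF F(1)] supported_in_cherednik[OF F], of a b \<iota> j a b \<iota> j k] F(2)
      by (simp add: supported_in_def G_def)
    moreover have "foldr (factor_op a b \<iota> q) (j # L) f = (\<lambda>t. \<Sum>k\<le>Suc N. q ^ k * G k t)" for q
    proof
      fix t
      have D: "?D (\<lambda>t. \<Sum>k\<le>N. q ^ k * H k t) = (\<lambda>t. \<Sum>k\<le>N. q ^ k * ?D (H k) t)" if "\<And>k. smooth (H k)" for H
        by (rule ext) (simp add: cherednik_sum smooth_mult smooth_const that cherednik_cmult)
      have "foldr (factor_op a b \<iota> q) (j # L) f t = (\<Sum>k\<le>N. q ^ k * ?D (?D (F k)) t) - q * (\<Sum>k\<le>N. q ^ k * F k t)"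
        by (simp add: factor_op_def e D F smooth_cherednik)
      also have "(\<Sum>k\<le>N. q ^ k * ?D (?D (F k)) t) = (\<Sum>k\<le>Suc N. q ^ k * ((if k \<le> N then 1 else 0) * ?D (?D (F k)) t))"
        by simp
      also have "q * (\<Sum>k\<le>N. q ^ k * F k t) = (\<Sum>k\<le>Suc N. q ^ k * ((if k = 0 then 0 else 1) * F (k - 1) t))"
        by (subst sum.atMost_Suc_shift) (simp add: sum_distrib_left mult.assoc)
      finally show "foldr (factor_op a b \<iota> q) (j # L) f t = (\<Sum>k\<le>Suc N. q ^ k * G k t)"
        by (simp only: G_def right_diff_distrib sum_subtractf)
    qed
    ultimately show ?case by blast
  qed
  then show ?thesis unfolding prod_op_def by blast
qed

lemma smooth_prod_op: "smooth f \<Longrightarrow> smooth (prod_op a b \<iota> q f)"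
  and supported_in_prod_op: "smooth f \<Longrightarrow> supported_in R f \<Longrightarrow> supported_in R (prod_op a b \<iota> q f)"
proof -
  show "smooth f \<Longrightarrow> smooth (prod_op a b \<iota> q f)"
  proof -
    assume f: "smooth f"
    have "smooth (foldr (factor_op a b \<iota> q) L f)" for L by (induction L) (auto intro: f smooth_factor_op)
    then show ?thesis by (simp add: prod_op_def)
  qed
  assume f: "smooth f" "supported_in R f"
  obtain F N where "\<And>k. supported_in R (F k)" "\<And>q. prod_op a b \<iota> q f = (\<lambda>t. \<Sum>k\<le>(N::nat). q ^ k * F k t)"
    using prod_op_polynomial[OF f] by metis
  then show "supported_in R (prod_op a b \<iota> q f)" by (simp add: supported_in_def sum.neutral)
qed

section \<open>Equivariance of the product under all root reflections\<close>

definition intertwines :: "real \<Rightarrow> real \<Rightarrow> real \<Rightarrow> complex \<Rightarrow> (real^'n::{finite,wellorder} \<Rightarrow> real^'n::{finite,wellorder}) \<Rightarrow> bool" where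
  "intertwines a b \<iota> q s \<longleftrightarrow> linear s \<and> (\<forall>f t. smooth f \<longrightarrow> prod_op a b \<iota> q f (s t) = prod_op a b \<iota> q (\<lambda>u. f (s u)) t)"

lemma intertwines_compose: "intertwines a b \<iota> q s1 \<Longrightarrow> intertwines a b \<iota> q s2 \<Longrightarrow> intertwines a b \<iota> q (\<lambda>t. s1 (s2 t))"
proof -
  assume 1: "intertwines a b \<iota> q s1" and 2: "intertwines a b \<iota> q s2"
  have "prod_op a b \<iota> q f (s1 (s2 t)) = prod_op a b \<iota> q (\<lambda>u. f (s1 (s2 u))) t" if f: "smooth f" for f t
  proof -
    have "smooth (\<lambda>u. f (s1 u))" using 1 f smooth_compose_linear by (auto simp: intertwines_def)
    then show ?thesis using 1 2 f by (simp add: intertwines_def)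
  qed
  then show ?thesis using 1 2 linear_compose[of s2 s1] by (simp add: intertwines_def o_def)
qed

lemma cherednik_add_cmult:
  fixes f g :: "real^'n::{finite,wellorder} \<Rightarrow> complex"
  assumes "smooth f" "smooth g"
  shows "cherednik a b \<iota> j (\<lambda>u. f u + c * g u) = (\<lambda>u. cherednik a b \<iota> j f u + c * cherednik a b \<iota> j g u)"
  using assms by (auto simp: cherednik_add cherednik_cmult smooth_mult smooth_const)

lemma factor_op_add_cmult:
  fixes f g :: "real^'n::{finite,wellorder} \<Rightarrow> complex"
  assumes f: "smooth f" and g: "smooth g"
  shows "factor_op a b \<iota> q j (\<lambda>u. f u + c * g u) t = factor_op a b \<iota> q j f t + c * factor_op a b \<iota> q j g t"
  unfolding factor_op_def cherednik_add_cmult[OF f g] cherednik_add_cmult[OF smooth_cherednik[OF f] smooth_cherednik[OF g]]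
  by (simp add: algebra_simps)

lemma factor_op_cherednik_commute:
  fixes g :: "real^'n::{finite,wellorder} \<Rightarrow> complex"
  assumes g: "smooth g"
  shows "factor_op a b \<iota> q j (cherednik a b \<iota> k g) = cherednik a b \<iota> k (factor_op a b \<iota> q j g)"
proof
  fix t
  have "cherednik a b \<iota> k (factor_op a b \<iota> q j g) t =
      cherednik a b \<iota> k (cherednik a b \<iota> j (cherednik a b \<iota> j g)) t - q * cherednik a b \<iota> k g t"
    unfolding factor_op_def[abs_def]
      cherednik_diff[OF smooth_cherednik[OF smooth_cherednik[OF g]] smooth_mult[OF smooth_const g]] cherednik_cmult[OF g] ..
  then show "factor_op a b \<iota> q j (cherednik a b \<iota> k g) t = cherednik a b \<iota> k (factor_op a b \<iota> q j g) t"
    unfolding cherednik_commute[OF smooth_cherednik[OF g, of a b \<iota> j], of a b \<iota> k j] cherednik_commute[OF g, of a b \<iota> k j]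
    by (simp add: factor_op_def)
qed

text \<open>Applying the cross relation twice leaves the correction
  \<open>a (D\<^sub>i + D\<^sub>j)\<close>, with opposite signs for \<open>i\<close> and
  \<open>j\<close>; this is what lets it cancel in the product.\<close>

lemma factor_op_swap:
  fixes f :: "real^'n::{finite,wellorder} \<Rightarrow> complex" and a b \<iota> :: real and q :: complex
  assumes adj: "adjacent i j" and f: "smooth f"
  defines "s \<equiv> swap_coords i j" and "N \<equiv> factor_op a b \<iota> q" and "D \<equiv> cherednik a b \<iota>"
  shows "N i f (s t) = N j (\<lambda>u. f (s u)) t - of_real a * (D i f t + D j f t)"
    and "N j f (s t) = N i (\<lambda>u. f (s u)) t + of_real a * (D i f t + D j f t)"
    and "k \<noteq> i \<Longrightarrow> k \<noteq> j \<Longrightarrow> N k f (s t) = N k (\<lambda>u. f (s u)) t"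
proof -
  note S = smooth_cherednik smooth_compose_linear[OF linear_swap_coords] smooth_mult smooth_const f
  have i: "(\<lambda>u. D i f (s u)) = (\<lambda>u. D j (\<lambda>u. f (s u)) u - of_real a * f u)"
    and j: "(\<lambda>u. D j f (s u)) = (\<lambda>u. D i (\<lambda>u. f (s u)) u + of_real a * f u)"
    using cherednik_swap(1,2)[OF adj f] unfolding s_def D_def by auto
  show "N i f (s t) = N j (\<lambda>u. f (s u)) t - of_real a * (D i f t + D j f t)"
    using cherednik_swap(1)[OF adj S(1)[OF f], of a b \<iota> a b \<iota> i t] i
    unfolding N_def factor_op_def D_def s_def
    by (simp add: cherednik_diff cherednik_cmult S algebra_simps)
  show "N j f (s t) = N i (\<lambda>u. f (s u)) t + of_real a * (D i f t + D j f t)"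
    using cherednik_swap(2)[OF adj S(1)[OF f], of a b \<iota> a b \<iota> j t] j
    unfolding N_def factor_op_def D_def s_def
    by (simp add: cherednik_add cherednik_cmult S algebra_simps)
  assume k: "k \<noteq> i" "k \<noteq> j"
  have kk: "(\<lambda>u. D k f (s u)) = (\<lambda>u. D k (\<lambda>u. f (s u)) u)"
    using cherednik_swap(3)[OF adj f k] unfolding s_def D_def by auto
  show "N k f (s t) = N k (\<lambda>u. f (s u)) t"
    using cherednik_swap(3)[OF adj S(1)[OF f] k, of a b \<iota> a b \<iota> k t] kk
    unfolding N_def factor_op_def D_def s_def by simp
qed

text \<open>As the factors commute, those of \<open>i\<close> and \<open>j\<close> can be placed
  outermost, and all others pass the swap unchanged. The two corrections of
  \<open>factor_op_swap\<close> then cancel, because the factor of \<open>j\<close> commutes with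
  \<open>D\<^sub>i\<close> and \<open>D\<^sub>j\<close>.\<close>

lemma intertwines_adjacent:
  fixes i j :: "'n::{finite,wellorder}"
  assumes adj: "adjacent i j"
  shows "intertwines a b \<iota> q (swap_coords i j)"
  unfolding intertwines_def
proof (intro conjI allI impI linear_swap_coords)
  fix f :: "real^'n::{finite,wellorder} \<Rightarrow> complex" and t
  assume f: "smooth f"
  have d: "i \<noteq> j" using adj by (auto simp: adjacent_def)
  let ?N = "factor_op a b \<iota> q" and ?D = "cherednik a b \<iota>" and ?s = "swap_coords i j"
  define L where "L = remove1 j (remove1 i (sorted_list_of_set (UNIV :: 'n set)))"
  have L: "i \<notin> set L" "j \<notin> set L" by (auto simp: L_def)
  have M: "prod_op a b \<iota> q g = ?N i (?N j (foldr ?N L g))" if g: "smooth g" for g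
  proof -
    have "prod_op a b \<iota> q g = ?N i (foldr ?N (remove1 i (sorted_list_of_set (UNIV :: 'n set))) g)"
      unfolding prod_op_def by (rule foldr_extract[where S=smooth]) (auto intro: smooth_factor_op factor_op_commute g)
    also have "foldr ?N (remove1 i (sorted_list_of_set (UNIV :: 'n set))) g = ?N j (foldr ?N L g)"
      unfolding L_def by (rule foldr_extract[where S=smooth]) (use d in \<open>auto intro: smooth_factor_op factor_op_commute g\<close>)
    finally show ?thesis .
  qed
  have sL: "smooth (foldr ?N L' g)" if "smooth g" for L' g by (induction L') (auto intro: that smooth_factor_op)
  have rest: "(\<lambda>u. foldr ?N L' f (?s u)) = foldr ?N L' (\<lambda>u. f (?s u))" if "i \<notin> set L'" "j \<notin> set L'" for L'
    using that
  proof (induction L')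
    case (Cons k L')
    have "foldr ?N (k # L') f (?s u) = ?N k (\<lambda>u. foldr ?N L' f (?s u)) u" for u
      using factor_op_swap(3)[OF adj sL[OF f], of k] Cons.prems by auto
    then show ?case using Cons by auto
  qed simp
  define g where "g = foldr ?N L f"
  have g: "smooth g" unfolding g_def by (rule sL[OF f])
  note S = smooth_factor_op smooth_cherednik smooth_compose_linear[OF linear_swap_coords] smooth_mult smooth_const smooth_add g
  have j: "(\<lambda>u. ?N j g (?s u)) = (\<lambda>u. ?N i (\<lambda>u. g (?s u)) u + of_real a * (?D i g u + ?D j g u))"
    by (rule ext) (rule factor_op_swap(2)[OF adj g])
  have Nadd: "?N j (\<lambda>u. ?N i (\<lambda>u. g (?s u)) u + of_real a * (?D i g u + ?D j g u)) t
      = ?N j (?N i (\<lambda>u. g (?s u))) t + of_real a * (?N j (?D i g) t + ?N j (?D j g) t)"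
  proof -
    have s: "smooth (?N i (\<lambda>u. g (?s u)))" "smooth (\<lambda>u. ?D i g u + ?D j g u)" "smooth (?D i g)" "smooth (?D j g)"
      by (intro S)+
    show ?thesis
      unfolding factor_op_add_cmult[OF s(1,2)] using factor_op_add_cmult[OF s(3,4), of a b \<iota> q j 1 t] by simp
  qed
  have ND: "?N j (?D k g) = ?D k (?N j g)" for k by (rule factor_op_cherednik_commute[OF g])
  have "prod_op a b \<iota> q f (?s t) = ?N i (?N j g) (?s t)" by (simp add: M[OF f] g_def)
  also have "\<dots> = ?N j (\<lambda>u. ?N j g (?s u)) t - of_real a * (?D i (?N j g) t + ?D j (?N j g) t)"
    by (rule factor_op_swap(1)[OF adj]) (intro S)
  also have "\<dots> = ?N j (?N i (\<lambda>u. g (?s u))) t"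
    unfolding j Nadd ND by (simp add: algebra_simps)
  also have "?N j (?N i (\<lambda>u. g (?s u))) t = ?N i (?N j (\<lambda>u. g (?s u))) t"
    using factor_op_commute[OF smooth_compose_linear[OF linear_swap_coords g], of a b \<iota> q j i i j] by simp
  also have "?N i (?N j (\<lambda>u. g (?s u))) t = prod_op a b \<iota> q (\<lambda>u. f (?s u)) t"
    unfolding g_def rest[OF L] using M[OF smooth_compose_linear[OF linear_swap_coords f]] by simp
  finally show "prod_op a b \<iota> q f (?s t) = prod_op a b \<iota> q (\<lambda>u. f (?s u)) t" .
qed

text \<open>Here each single factor is equivariant: in the square of \<open>D\<^sub>m\<close> the
  sign and the constant of the cross relation cancel.\<close>

lemma intertwines_top:
  fixes m :: "'n::{finite,wellorder}"
  assumes top: "\<And>k. k \<le> m"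
  shows "intertwines a b \<iota> q (neg_coord m)"
  unfolding intertwines_def
proof (intro conjI allI impI linear_neg_coord)
  fix f :: "real^'n::{finite,wellorder} \<Rightarrow> complex" and t
  assume f: "smooth f"
  let ?N = "factor_op a b \<iota> q" and ?D = "cherednik a b \<iota>" and ?s = "neg_coord m"
  note sc = smooth_compose_linear[OF linear_neg_coord]
  have N: "?N k g (?s u) = ?N k (\<lambda>u. g (?s u)) u" if g: "smooth g" for k g u
  proof (cases "k = m")
    case True
    define c where "c = complex_of_real (2 * (\<iota> + b))"
    define h where "h = ?D m (\<lambda>u. g (?s u))"
    have h: "smooth h" unfolding h_def by (rule smooth_cherednik[OF sc[OF g]])
    have e: "(\<lambda>u. ?D m g (?s u)) = (\<lambda>u. - 1 * h u - c * g u)"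
      unfolding h_def c_def by (rule ext) (simp only: cherednik_neg_coord(1)[OF top g] mult_minus1)
    have "?D m (?D m g) (?s u) = - ?D m (\<lambda>u. ?D m g (?s u)) u - c * ?D m g u"
      unfolding c_def by (rule cherednik_neg_coord(1)[OF top smooth_cherednik[OF g]])
    also have "\<dots> = ?D m h u"
      unfolding e cherednik_diff[OF smooth_mult[OF smooth_const h] smooth_mult[OF smooth_const g]] cherednik_cmult[OF h] cherednik_cmult[OF g]
      by simp
    finally have "?D m (?D m g) (?s u) = ?D m h u" .
    then show ?thesis using True by (simp add: factor_op_def h_def)
  next
    case False
    have e: "(\<lambda>u. ?D k g (?s u)) = ?D k (\<lambda>u. g (?s u))"
      by (rule ext) (rule cherednik_neg_coord(2)[OF top g False])
    show ?thesis
      using cherednik_neg_coord(2)[OF top smooth_cherednik[OF g] False, of a b \<iota> a b \<iota> k u] e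
      by (simp add: factor_op_def)
  qed
  have sL: "smooth (foldr ?N L g)" if "smooth g" for L g by (induction L) (auto intro: that smooth_factor_op)
  have "(\<lambda>u. foldr ?N L f (?s u)) = foldr ?N L (\<lambda>u. f (?s u))" for L
  proof (induction L)
    case (Cons k L)
    have "foldr ?N (k # L) f (?s u) = ?N k (\<lambda>u. foldr ?N L f (?s u)) u" for u
      using N[OF sL[OF f]] by simp
    then show ?case using Cons by auto
  qed simp
  from fun_cong[OF this[of "sorted_list_of_set UNIV"], of t]
  show "prod_op a b \<iota> q f (?s t) = prod_op a b \<iota> q (\<lambda>u. f (?s u)) t"
    unfolding prod_op_def .
qed

text \<open>Every transposition is a product of adjacent ones, by induction on the number of indices
  strictly between, with \<open>(i j) = (i k) (k j) (i k)\<close> for any such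
  \<open>k\<close>.\<close>

lemma intertwines_swap:
  fixes i j :: "'n::{finite,wellorder}"
  shows "intertwines a b \<iota> q (swap_coords i j)"
proof -
  have *: "i < j \<Longrightarrow> intertwines a b \<iota> q (swap_coords i j)" for i j :: 'n
  proof (induction "card {i<..<j}" arbitrary: i j rule: less_induct)
    case less
    show ?case
    proof (cases "adjacent i j")
      case True then show ?thesis by (rule intertwines_adjacent)
    next
      case False
      then obtain k where k: "i < k" "k < j" using less.prems unfolding adjacent_def by blast
      have "{i<..<k} \<subseteq> {i<..<j}" "{k<..<j} \<subseteq> {i<..<j}"
        by (rule subsetI, metis greaterThanLessThan_iff k less_trans)+
      moreover have "k \<in> {i<..<j}" "k \<notin> {i<..<k}" "k \<notin> {k<..<j}" using k by simp_all
      ultimately have "{i<..<k} \<subset> {i<..<j}" "{k<..<j} \<subset> {i<..<j}" by blast+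
      then have c: "card {i<..<k} < card {i<..<j}" "card {k<..<j} < card {i<..<j}"
        by (simp_all only: psubset_card_mono finite)
      have e: "swap_coords i j = (\<lambda>t. swap_coords i k (swap_coords k j (swap_coords i k t)))"
      proof (intro ext iffD2[OF vec_eq_iff] allI)
        fix t :: "real^'n::{finite,wellorder}" and l :: 'n
        have d: "i \<noteq> k" "k \<noteq> j" "i \<noteq> j" using k by auto
        show "swap_coords i j t $ l = swap_coords i k (swap_coords k j (swap_coords i k t)) $ l"
          unfolding reflection_nth using d by simp
      qed
      note ik = less.hyps[OF c(1) k(1)] and kj = less.hyps[OF c(2) k(2)]
      show ?thesis unfolding e by (rule intertwines_compose[OF ik intertwines_compose[OF kj ik]])
    qed
  qed
  consider "i < j" | "j < i" | "i = j" using less_linear[of i j] by blast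
  then show ?thesis
  proof cases
    case 1 then show ?thesis by (rule *)
  next
    case 2 then show ?thesis by (subst swap_coords_commute) (rule *)
  next
    case 3
    then have "swap_coords i j = (\<lambda>t. t)" by (simp add: swap_coords_def fun_eq_iff vec_eq_iff)
    then show ?thesis by (simp add: intertwines_def linear_ident)
  qed
qed

lemma intertwines_neg_coord:
  fixes j :: "'n::{finite,wellorder}"
  shows "intertwines a b \<iota> q (neg_coord j)"
proof -
  define m where "m = Max (UNIV :: 'n set)"
  have m: "k \<le> m" for k by (simp add: m_def)
  have e: "neg_coord j = (\<lambda>t. swap_coords j m (neg_coord m (swap_coords j m t)))"
    by (auto simp: fun_eq_iff vec_eq_iff reflection_nth)
  show ?thesis unfolding e
    by (rule intertwines_compose[OF intertwines_swap intertwines_compose[OF intertwines_top[OF m] intertwines_swap]])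
qed

lemma intertwines_neg_swap:
  fixes i j :: "'n::{finite,wellorder}"
  assumes "i \<noteq> j"
  shows "intertwines a b \<iota> q (neg_swap_coords i j)"
proof -
  have e: "neg_swap_coords i j = (\<lambda>t. swap_coords i j (neg_coord i (neg_coord j t)))"
    using assms by (auto simp: fun_eq_iff vec_eq_iff reflection_nth)
  show ?thesis unfolding e
    by (rule intertwines_compose[OF intertwines_swap intertwines_compose[OF intertwines_neg_coord intertwines_neg_coord]])
qed

lemma root_reflection_scaled_axis:
  assumes "c \<noteq> 0"
  shows "root_reflection (c *\<^sub>R axis j 1 :: real^'n) = neg_coord j"
proof
  fix t :: "real^'n"
  have "root_reflection (c *\<^sub>R axis j 1) t = t - (2 * t $ j) *\<^sub>R axis j 1"
    using assms by (simp add: root_reflection_def inner_axis' inner_axis_axis)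
  then show "root_reflection (c *\<^sub>R axis j 1) t = neg_coord j t" by (simp add: neg_coord_eq)
qed

lemma root_reflection_two_axes:
  assumes d: "i \<noteq> j" and e: "e * e = 1" and s: "s = 1 \<or> s = -1"
  shows "root_reflection (e *\<^sub>R (axis i 1 + s *\<^sub>R axis j 1) :: real^'n) =
    (if s = 1 then neg_swap_coords i j else swap_coords i j)"
proof
  fix t :: "real^'n"
  define v :: "real^'n" where "v = axis i 1 + s *\<^sub>R axis j 1"
  have ax: "axis i 1 \<bullet> axis j (1::real) = 0" "axis j 1 \<bullet> axis i (1::real) = 0"
    using d by (auto simp: inner_axis_axis)
  have vv: "v \<bullet> v = 2" using s d d[symmetric] by (auto simp: v_def inner_add_left inner_add_right inner_diff_left inner_diff_right ax inner_axis_axis)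
  have vt: "v \<bullet> t = t $ i + s * t $ j" by (simp add: v_def inner_add_left inner_axis')
  have "root_reflection (e *\<^sub>R v) t = t - (e * e * (v \<bullet> t)) *\<^sub>R v"
    by (simp add: root_reflection_def vv mult.assoc[symmetric] e)
  then have "root_reflection (e *\<^sub>R v) t = t - (t $ i + s * t $ j) *\<^sub>R v" by (simp add: e vt)
  then show "root_reflection (e *\<^sub>R (axis i 1 + s *\<^sub>R axis j 1)) t = (if s = 1 then neg_swap_coords i j else swap_coords i j) t"
    using s d by (auto simp: v_def neg_swap_coords_eq swap_coords_eq)
qed

lemma root_reflection_cases:
  fixes \<alpha> :: "real^'n"
  assumes "\<alpha> \<in> roots a b \<iota>"
  obtains i j where "i \<noteq> j" "root_reflection \<alpha> = swap_coords i j"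
  | i j where "i \<noteq> j" "root_reflection \<alpha> = neg_swap_coords i j"
  | j where "root_reflection \<alpha> = neg_coord j"
proof -
  let ?A = "\<exists>i j. i \<noteq> j \<and> (\<exists>e\<in>{1, -1}. \<exists>e'\<in>{1, -1}. \<alpha> = e *\<^sub>R axis i 1 + e' *\<^sub>R axis j 1)"
    and ?B = "\<exists>j. \<exists>e\<in>{1, -1}. \<alpha> = e *\<^sub>R axis j 1" and ?C = "\<exists>j. \<exists>e\<in>{2, -2}. \<alpha> = e *\<^sub>R axis j 1"
  have "?A \<or> ?B \<or> ?C"
  proof (rule ccontr)
    assume "\<not> (?A \<or> ?B \<or> ?C)"
    then have "\<not> ?A" "\<not> ?B" "\<not> ?C" by (simp_all only: de_Morgan_disj simp_thms)
    then have "root_mult a b \<iota> \<alpha> = 0" unfolding root_mult_def by (simp only: if_False)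
    then show False using assms by (simp add: roots_def)
  qed
  then show thesis
  proof (elim disjE exE bexE conjE)
    fix i j e e' assume d: "i \<noteq> j" and e: "e \<in> {1, -1}" "e' \<in> {1, -1::real}" and \<alpha>: "\<alpha> = e *\<^sub>R axis i 1 + e' *\<^sub>R axis j 1"
    have "\<alpha> = e *\<^sub>R (axis i 1 + (e * e') *\<^sub>R axis j 1)" using e by (auto simp: \<alpha>)
    moreover have "e * e = 1" "e * e' = 1 \<or> e * e' = -1" using e by auto
    ultimately have "root_reflection \<alpha> = (if e * e' = 1 then neg_swap_coords i j else swap_coords i j)"
      using root_reflection_two_axes[OF d] by metis
    then show thesis using that(1,2) d by (cases "e * e' = 1") auto
  next
    fix j e assume "e \<in> {1, -1::real}" "\<alpha> = e *\<^sub>R axis j 1"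
    then show thesis using that(3)[of j] root_reflection_scaled_axis[of e j] by auto
  next
    fix j e assume "e \<in> {2, -2::real}" "\<alpha> = e *\<^sub>R axis j 1"
    then show thesis using that(3)[of j] root_reflection_scaled_axis[of e j] by auto
  qed
qed

lemma intertwines_root_reflection: "\<alpha> \<in> roots a' b' \<iota>' \<Longrightarrow> intertwines a b \<iota> q (root_reflection \<alpha>)"
proof -
  assume "\<alpha> \<in> roots a' b' \<iota>'"
  then show ?thesis
    by (cases rule: root_reflection_cases) (simp_all only: intertwines_swap intertwines_neg_coord intertwines_neg_swap not_False_eq_True)
qed

lemma compact_support_iff: "compact (closure {t. f t \<noteq> 0}) \<longleftrightarrow> (\<exists>R. supported_in R f)"
proof -
  have "compact (closure {t. f t \<noteq> 0}) \<longleftrightarrow> bounded {t. f t \<noteq> 0}"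
    by (metis bounded_closure bounded_subset closed_closure closure_subset compact_eq_bounded_closed)
  then show ?thesis unfolding bounded_iff supported_in_def by (meson mem_Collect_eq not_le)
qed

lemma prod_op_test_functions:
  fixes f :: "real^'n::{finite,wellorder} \<Rightarrow> complex"
  assumes "f \<in> test_functions a b \<iota>"
  shows "prod_op a b \<iota> q f \<in> test_functions a b \<iota>"
proof -
  have f: "smooth f" and inv: "\<And>w t. w \<in> weyl_group a b \<iota> \<Longrightarrow> f (w t) = f t"
    using assms by (auto simp: test_functions_def)
  obtain R where R: "supported_in R f" using assms unfolding test_functions_def mem_Collect_eq compact_support_iff by blast
  have "prod_op a b \<iota> q f (w t) = prod_op a b \<iota> q f t" if "w \<in> weyl_group a b \<iota>" for w t
    using that
  proof (induction arbitrary: t)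
    case (weyl_step w \<alpha>)
    have "root_reflection \<alpha> \<circ> id \<in> weyl_group a b \<iota>"
      by (intro weyl_group.intros weyl_step)
    then have e: "(\<lambda>u. f (root_reflection \<alpha> u)) = f" using inv[of "root_reflection \<alpha>"] by auto
    show ?case
      using intertwines_root_reflection[OF weyl_step.hyps(2), of a b \<iota> q] f e weyl_step.IH by (simp add: intertwines_def)
  qed simp
  then show ?thesis
    using smooth_prod_op[OF f, of a b \<iota> q] supported_in_prod_op[OF f R, of a b \<iota> q]
    unfolding test_functions_def compact_support_iff by blast
qed

subsection \<open>Adjoints of the Cherednik operators\<close>

lemma nn_integral_translate:
  fixes \<phi> :: "'a::euclidean_space \<Rightarrow> ennreal"
  assumes [measurable]: "\<phi> \<in> borel_measurable borel"
  shows "(\<integral>\<^sup>+t. \<phi> (t + c) \<partial>lborel) = (\<integral>\<^sup>+t. \<phi> t \<partial>lborel)"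
proof -
  have "(\<integral>\<^sup>+t. \<phi> t \<partial>lborel) = (\<integral>\<^sup>+t. \<phi> t \<partial>distr lborel borel ((+) c))" by (simp add: lborel_distr_plus)
  also have "\<dots> = (\<integral>\<^sup>+t. \<phi> (c + t) \<partial>lborel)" by (subst nn_integral_distr) auto
  finally show ?thesis by (simp add: add.commute)
qed

text \<open>Tonelli and translation invariance. This reduces an integral over the whole space to
  integrals over unit segments in a direction \<open>v\<close>, without a change of
  coordinates.\<close>

lemma nn_integral_average_translates:
  fixes \<phi> :: "'a::euclidean_space \<Rightarrow> ennreal"
  assumes [measurable]: "\<phi> \<in> borel_measurable borel"
  shows "(\<integral>\<^sup>+t. (\<integral>\<^sup>+s. indicator {0..1::real} s * \<phi> (t + s *\<^sub>R v) \<partial>lborel) \<partial>lborel) = (\<integral>\<^sup>+t. \<phi> t \<partial>lborel)"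
proof -
  have "(\<integral>\<^sup>+t. (\<integral>\<^sup>+s. indicator {0..1::real} s * \<phi> (t + s *\<^sub>R v) \<partial>lborel) \<partial>lborel)
      = (\<integral>\<^sup>+s. (\<integral>\<^sup>+t. indicator {0..1::real} s * \<phi> (t + s *\<^sub>R v) \<partial>lborel) \<partial>lborel)"
    by (rule lborel_pair.Fubini') measurable
  also have "\<dots> = (\<integral>\<^sup>+s. indicator {0..1::real} s * (\<integral>\<^sup>+t. \<phi> t \<partial>lborel) \<partial>lborel)"
    by (simp add: nn_integral_cmult nn_integral_translate)
  also have "\<dots> = (\<integral>\<^sup>+t. \<phi> t \<partial>lborel)" by (simp add: nn_integral_multc)
  finally show ?thesis .
qed

text \<open>Averaging \<open>K\<close> over a unit segment in direction \<open>v\<close> gives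
  \<open>H (t + v) - H t\<close>, whose integral vanishes by translation invariance. The finite sets
  \<open>S\<close> allow a line to cross walls where \<open>H\<close> is continuous but not
  differentiable.\<close>

lemma integral_line_derivative_eq_0:
  fixes H K :: "'a::euclidean_space \<Rightarrow> complex"
  assumes H: "integrable lborel H" and K: "integrable lborel K"
    and line: "AE t in lborel. \<exists>S. finite S \<and> continuous_on {0..1} (\<lambda>s. H (t + s *\<^sub>R v)) \<and>
      (\<forall>s\<in>{0..1} - S. ((\<lambda>s. H (t + s *\<^sub>R v)) has_vector_derivative K (t + s *\<^sub>R v)) (at s))"
  shows "integral\<^sup>L lborel K = 0"
proof -
  have [measurable]: "H \<in> borel_measurable borel" "K \<in> borel_measurable borel"
    using H K by auto
  let ?F = "\<lambda>(t, s). indicator {0..1::real} s *\<^sub>R K (t + s *\<^sub>R v)"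
  have tr: "integral\<^sup>L lborel (\<lambda>t. G (t + c)) = integral\<^sup>L lborel G" "integrable lborel (\<lambda>t. G (t + c))"
    if "integrable lborel G" for G :: "'a \<Rightarrow> complex" and c
  proof -
    have [measurable]: "G \<in> borel_measurable borel" using that by auto
    have "integrable (distr lborel borel ((+) c)) G" using that by (simp add: lborel_distr_plus)
    then show "integrable lborel (\<lambda>t. G (t + c))" by (subst (asm) integrable_distr_eq) (auto simp: add.commute)
    have "integral\<^sup>L lborel G = integral\<^sup>L (distr lborel borel ((+) c)) G" by (simp add: lborel_distr_plus)
    also have "\<dots> = integral\<^sup>L lborel (\<lambda>t. G (c + t))" by (subst integral_distr) auto
    finally show "integral\<^sup>L lborel (\<lambda>t. G (t + c)) = integral\<^sup>L lborel G" by (simp add: add.commute)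
  qed
  have F: "integrable (lborel \<Otimes>\<^sub>M lborel) ?F"
  proof (rule integrableI_bounded)
    have "(\<integral>\<^sup>+x. norm (?F x) \<partial>(lborel \<Otimes>\<^sub>M lborel)) = (\<integral>\<^sup>+t. (\<integral>\<^sup>+s. norm (?F (t, s)) \<partial>lborel) \<partial>lborel)"
      by (rule lborel.nn_integral_fst[symmetric]) measurable
    also have "\<dots> = (\<integral>\<^sup>+t. (\<integral>\<^sup>+s. indicator {0..1::real} s * ennreal (norm (K (t + s *\<^sub>R v))) \<partial>lborel) \<partial>lborel)"
      by (intro nn_integral_cong) (auto simp: ennreal_mult split: split_indicator)
    also have "\<dots> = (\<integral>\<^sup>+t. ennreal (norm (K t)) \<partial>lborel)"
      by (rule nn_integral_average_translates) measurable
    also have "\<dots> < \<infinity>" using K by (simp add: integrable_iff_bounded)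
    finally show "(\<integral>\<^sup>+x. norm (?F x) \<partial>(lborel \<Otimes>\<^sub>M lborel)) < \<infinity>" .
  qed measurable
  have "(\<integral>t. (\<integral>s. indicator {0..1::real} s *\<^sub>R K (t + s *\<^sub>R v) \<partial>lborel) \<partial>lborel) = (\<integral>t. H (t + v) - H t \<partial>lborel)"
  proof (rule integral_cong_AE)
    show "AE t in lborel. (\<integral>s. indicator {0..1::real} s *\<^sub>R K (t + s *\<^sub>R v) \<partial>lborel) = H (t + v) - H t"
      using line lborel_pair.AE_integrable_fst[OF F]
    proof eventually_elim
      case (elim t)
      then obtain S where S: "finite S" "continuous_on {0..1} (\<lambda>s. H (t + s *\<^sub>R v))"
        "\<And>s. s \<in> {0..1} - S \<Longrightarrow> ((\<lambda>s. H (t + s *\<^sub>R v)) has_vector_derivative K (t + s *\<^sub>R v)) (at s)" by blast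
      have "((\<lambda>s. K (t + s *\<^sub>R v)) has_integral (H (t + 1 *\<^sub>R v) - H (t + 0 *\<^sub>R v))) {0..1}"
        by (rule fundamental_theorem_of_calculus_strong[OF S(1) _ S(3) S(2)]) auto
      then have "((\<lambda>s. if s \<in> {0..1} then K (t + s *\<^sub>R v) else 0) has_integral (H (t + v) - H t)) UNIV"
        by (simp only: has_integral_restrict_UNIV scaleR_one scaleR_zero_left add_0_right)
      also have "(\<lambda>s. if s \<in> {0..1} then K (t + s *\<^sub>R v) else 0) = (\<lambda>s. indicator {0..1::real} s *\<^sub>R K (t + s *\<^sub>R v))"
        by auto
      finally have 1: "((\<lambda>s. indicator {0..1::real} s *\<^sub>R K (t + s *\<^sub>R v)) has_integral (H (t + v) - H t)) UNIV" .
      \<comment> \<open>The fundamental theorem produces a gauge integral; Lebesgue integrability,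
        known on almost every line by Fubini, identifies the two.\<close>
      have "integrable lborel (\<lambda>s. indicator {0..1::real} s *\<^sub>R K (t + s *\<^sub>R v))" using elim(2) by simp
      from has_integral_integral_lborel[OF this] 1 show ?case by (rule has_integral_unique)
    qed
  qed measurable
  also have "\<dots> = 0" using tr[OF H, of v] H by simp
  finally have "0 = (\<integral>t. (\<integral>s. indicator {0..1::real} s *\<^sub>R K (t + s *\<^sub>R v) \<partial>lborel) \<partial>lborel)" by simp
  also have "\<dots> = (\<integral>s. (\<integral>t. indicator {0..1::real} s *\<^sub>R K (t + s *\<^sub>R v) \<partial>lborel) \<partial>lborel)"
    using lborel_pair.Fubini_integral[OF F] by simp
  also have "\<dots> = (\<integral>s. indicator {0..1::real} s *\<^sub>R integral\<^sup>L lborel K \<partial>lborel)"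
    by (simp add: tr[OF K])
  also have "\<dots> = integral\<^sup>L lborel K" by simp
  finally show ?thesis by simp
qed

section \<open>Local integrability of powers of sinh\<close>

lemma borel_measurable_sinh [measurable]: "(sinh :: real \<Rightarrow> real) \<in> borel_measurable borel"
  by (intro borel_measurable_continuous_onI continuous_intros)

lemma nn_integral_powr_finite:
  fixes q R :: real
  assumes "q > -1" "R \<ge> 0"
  shows "(\<integral>\<^sup>+x. ennreal (indicator {-R..R} x * \<bar>x\<bar> powr q) \<partial>lborel) < \<infinity>"
proof -
  define g where "g = (\<lambda>x::real. if x \<in> {0<..R} then x powr q else 0)"
  have gm: "g \<in> borel_measurable borel" unfolding g_def by measurable
  then have [measurable]: "(\<lambda>x. ennreal (g x)) \<in> borel_measurable borel" by measurable
  obtain I where "((\<lambda>x. x powr q) has_integral I) {0<..R}"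
    using integrable_on_powr_from_0'[OF assms] by (auto simp: integrable_on_def)
  then have "(g has_integral I) UNIV" by (simp only: g_def has_integral_restrict_UNIV)
  then have g: "(\<integral>\<^sup>+x. ennreal (g x) \<partial>lborel) = ennreal I"
    by (intro nn_integral_has_integral_lborel) (auto simp: g_def)
  have g': "(\<integral>\<^sup>+x. ennreal (g (- x)) \<partial>lborel) = ennreal I"
    using nn_integral_real_affine[of "\<lambda>x. ennreal (g x)" "-1" 0] g by simp
  have "(\<integral>\<^sup>+x. ennreal (indicator {-R..R} x * \<bar>x\<bar> powr q) \<partial>lborel) \<le> (\<integral>\<^sup>+x. ennreal (g x) + ennreal (g (- x)) \<partial>lborel)"
    by (rule nn_integral_mono) (auto split: split_indicator simp: abs_if g_def)
  also have "\<dots> = ennreal I + ennreal I" using g g' by (subst nn_integral_add) (auto simp: g_def)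
  also have "\<dots> < \<infinity>" by simp
  finally show ?thesis .
qed

lemma abs_le_abs_sinh: "\<bar>x\<bar> \<le> \<bar>sinh (x::real)\<bar>"
proof -
  have *: "y \<le> sinh y" if "y \<ge> 0" for y :: real
  proof -
    have "(\<lambda>x. sinh x - x) 0 \<le> (\<lambda>x. sinh x - x) y"
      by (rule DERIV_nonneg_imp_nondecreasing[OF that])
        (auto intro!: exI derivative_eq_intros simp: cosh_real_ge_1)
    then show ?thesis by simp
  qed
  show ?thesis using *[of x] *[of "-x"] by (cases "x \<ge> 0") auto
qed

lemma nn_integral_sinh_powr_finite:
  fixes q R :: real
  assumes q: "q > -1" and R: "R \<ge> 0"
  shows "(\<integral>\<^sup>+x. ennreal (indicator {-R..R} x * \<bar>sinh x\<bar> powr q) \<partial>lborel) < \<infinity>"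
proof (cases "q \<ge> 0")
  case True
  have "(\<integral>\<^sup>+x. ennreal (indicator {-R..R} x * \<bar>sinh x\<bar> powr q) \<partial>lborel) \<le> (\<integral>\<^sup>+x. ennreal (sinh R powr q) * indicator {-R..R} x \<partial>lborel)"
  proof (rule nn_integral_mono)
    fix x :: real
    have "\<bar>sinh x\<bar> powr q \<le> sinh R powr q" if "x \<in> {-R..R}"
    proof (rule powr_mono2)
      show "\<bar>sinh x\<bar> \<le> sinh R" using that sinh_real_le_iff[of x R] sinh_real_le_iff[of "-x" R] by (auto simp: abs_le_iff)
    qed (use True in auto)
    then show "ennreal (indicator {-R..R} x * \<bar>sinh x\<bar> powr q) \<le> ennreal (sinh R powr q) * indicator {-R..R} x"
      by (auto split: split_indicator)
  qed
  also have "\<dots> < \<infinity>" using R by (simp add: nn_integral_cmult_indicator ennreal_mult_less_top)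
  finally show ?thesis .
next
  case False
  have "(\<integral>\<^sup>+x. ennreal (indicator {-R..R} x * \<bar>sinh x\<bar> powr q) \<partial>lborel) \<le> (\<integral>\<^sup>+x. ennreal (indicator {-R..R} x * \<bar>x\<bar> powr q) \<partial>lborel)"
  proof (rule nn_integral_mono, rule ennreal_leI, rule mult_left_mono)
    fix x :: real
    show "\<bar>sinh x\<bar> powr q \<le> \<bar>x\<bar> powr q"
      using False abs_le_abs_sinh[of x] by (cases "x = 0") (auto intro!: powr_mono2')
  qed auto
  also have "\<dots> < \<infinity>" by (rule nn_integral_powr_finite[OF assms])
  finally show ?thesis .
qed

text \<open>Averaging in a direction with \<open>l v = 1\<close> makes \<open>l\<close> run through
  \<open>s + l t\<close>, so the inner integral is the one-dimensional one, up to a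
  translation.\<close>

lemma nn_integral_sinh_linear_finite:
  fixes l :: "'a::euclidean_space \<Rightarrow> real" and q R :: real
  assumes l: "linear l" "l v = 1" and q: "q > -1"
  shows "(\<integral>\<^sup>+t. ennreal (indicator (cball 0 R) t * \<bar>sinh (l t)\<bar> powr q) \<partial>lborel) < \<infinity>"
proof -
  have bl: "bounded_linear l" using l by (simp add: linear_conv_bounded_linear)
  then have cl: "continuous_on UNIV l" by (simp add: linear_continuous_on)
  then have [measurable]: "l \<in> borel_measurable borel" by (rule borel_measurable_continuous_onI)
  have [measurable]: "cball (0::'a) R \<in> sets borel" for R by simp
  obtain B where B: "B > 0" "\<And>t. \<bar>l t\<bar> \<le> norm t * B" using bounded_linear.pos_bounded[OF bl] by auto
  \<comment> \<open>If some \<open>t + s *\<^sub>R v\<close> with \<open>0 \<le> s \<le> 1\<close>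
    lies in the ball of radius \<open>R\<close>, then \<open>t\<close> lies in the ball of radius
    \<open>R'\<close>; \<open>Q\<close> bounds \<open>l\<close> on the smaller ball and is cut off
    at \<open>0\<close> for negative \<open>R\<close>.\<close>
  define R' where "R' = R + norm v"
  define Q where "Q = max 0 (R * B)"
  let ?C = "\<integral>\<^sup>+x. ennreal (indicator {-Q..Q} x * \<bar>sinh x\<bar> powr q) \<partial>lborel"
  have C: "?C < \<infinity>" by (rule nn_integral_sinh_powr_finite[OF q]) (simp add: Q_def)
  have "(\<integral>\<^sup>+t. ennreal (indicator (cball 0 R) t * \<bar>sinh (l t)\<bar> powr q) \<partial>lborel) =
     (\<integral>\<^sup>+t. (\<integral>\<^sup>+s. indicator {0..1::real} s * ennreal (indicator (cball 0 R) (t + s *\<^sub>R v) * \<bar>sinh (l (t + s *\<^sub>R v))\<bar> powr q) \<partial>lborel) \<partial>lborel)"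
    by (rule nn_integral_average_translates[symmetric]) measurable
  also have "\<dots> \<le> (\<integral>\<^sup>+t. ?C * indicator (cball (0::'a) R') t \<partial>lborel)"
  proof (rule nn_integral_mono)
    fix t
    have "(\<integral>\<^sup>+s. indicator {0..1::real} s * ennreal (indicator (cball 0 R) (t + s *\<^sub>R v) * \<bar>sinh (l (t + s *\<^sub>R v))\<bar> powr q) \<partial>lborel)
       \<le> (\<integral>\<^sup>+s. indicator (cball 0 R') t * ennreal (indicator {-Q..Q} (s + l t) * \<bar>sinh (s + l t)\<bar> powr q) \<partial>lborel)"
    proof (rule nn_integral_mono)
      fix s :: real
      have e: "l (t + s *\<^sub>R v) = s + l t" using l by (simp add: linear_add linear_cmul)
      show "indicator {0..1::real} s * ennreal (indicator (cball 0 R) (t + s *\<^sub>R v) * \<bar>sinh (l (t + s *\<^sub>R v))\<bar> powr q)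
        \<le> indicator (cball 0 R') t * ennreal (indicator {-Q..Q} (s + l t) * \<bar>sinh (s + l t)\<bar> powr q)"
      proof (cases "s \<in> {0..1} \<and> t + s *\<^sub>R v \<in> cball 0 R")
        case True
        have "norm t \<le> norm (t + s *\<^sub>R v) + norm (s *\<^sub>R v)" by (metis add_diff_cancel_right' norm_triangle_ineq4)
        also have "norm (s *\<^sub>R v) \<le> 1 * norm v" unfolding norm_scaleR using True by (intro mult_right_mono) auto
        finally have "t \<in> cball 0 R'" using True by (simp add: R'_def)
        moreover have "\<bar>s + l t\<bar> \<le> Q"
        proof -
          have "\<bar>s + l t\<bar> \<le> norm (t + s *\<^sub>R v) * B" using B(2)[of "t + s *\<^sub>R v"] e by simp
          also have "\<dots> \<le> R * B" using True B by (intro mult_right_mono) auto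
          finally show ?thesis by (simp add: Q_def)
        qed
        ultimately show ?thesis using True e by (auto simp: abs_le_iff split: split_indicator)
      qed (auto split: split_indicator)
    qed
    also have "\<dots> = indicator (cball 0 R') t * (\<integral>\<^sup>+s. ennreal (indicator {-Q..Q} (s + l t) * \<bar>sinh (s + l t)\<bar> powr q) \<partial>lborel)"
      by (rule nn_integral_cmult) measurable
    also have "(\<integral>\<^sup>+s. ennreal (indicator {-Q..Q} (s + l t) * \<bar>sinh (s + l t)\<bar> powr q) \<partial>lborel) = ?C"
      by (rule nn_integral_translate) measurable
    finally show "(\<integral>\<^sup>+s. indicator {0..1::real} s * ennreal (indicator (cball 0 R) (t + s *\<^sub>R v) * \<bar>sinh (l (t + s *\<^sub>R v))\<bar> powr q) \<partial>lborel)
       \<le> ?C * indicator (cball 0 R') t" by (simp add: mult.commute)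
  qed
  also have "\<dots> = ?C * emeasure lborel (cball 0 R' :: 'a set)" by (simp add: nn_integral_cmult_indicator)
  also have "\<dots> < \<infinity>" using C emeasure_lborel_cball_finite[of "0::'a" R'] by (simp add: ennreal_mult_less_top)
  finally show ?thesis .
qed

lemma nn_integral_sinh_prod_finite:
  fixes q R :: real
  assumes q: "q > -1"
  shows "(\<integral>\<^sup>+t. ennreal (indicator (cball 0 R) t * (\<Prod>j\<in>UNIV. \<bar>sinh (t $ j)\<bar> powr q)) \<partial>(lborel :: (real^'n) measure)) < \<infinity>"
proof -
  define Q where "Q = max 0 R"
  let ?f = "\<lambda>x. ennreal (indicator {-Q..Q} x * \<bar>sinh x\<bar> powr q)"
  have pr: "(\<Prod>b\<in>Basis. F (t \<bullet> b)) = (\<Prod>j\<in>UNIV. F (t $ j))" for t :: "real^'n" and F :: "real \<Rightarrow> ennreal"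
  proof -
    have "(\<Prod>j\<in>UNIV. F (t $ j)) = (\<Prod>b\<in>Basis. F (t \<bullet> b))"
    proof -
      have B: "(Basis :: (real^'n) set) = (\<lambda>j. axis j 1) ` UNIV" by (auto simp: Basis_vec_def)
      show ?thesis unfolding B by (simp add: prod.reindex inj_on_def axis_eq_axis inner_axis)
    qed
    then show ?thesis by simp
  qed
  have "(\<integral>\<^sup>+t. ennreal (indicator (cball 0 R) t * (\<Prod>j\<in>UNIV. \<bar>sinh (t $ j)\<bar> powr q)) \<partial>(lborel :: (real^'n) measure))
     \<le> (\<integral>\<^sup>+t. (\<Prod>b\<in>Basis. ?f (t \<bullet> b)) \<partial>(lborel :: (real^'n) measure))"
  proof (rule nn_integral_mono)
    fix t :: "real^'n"
    show "ennreal (indicator (cball 0 R) t * (\<Prod>j\<in>UNIV. \<bar>sinh (t $ j)\<bar> powr q)) \<le> (\<Prod>b\<in>Basis. ?f (t \<bullet> b))"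
    proof (cases "t \<in> cball 0 R")
      case True
      have "t $ j \<in> {-Q..Q}" for j using component_le_norm_cart[of t j] True by (auto simp: Q_def abs_le_iff)
      then show ?thesis unfolding pr[of ?f t] using True by (simp add: prod_ennreal)
    qed auto
  qed
  also have "\<dots> = (\<Prod>b\<in>(Basis :: (real^'n) set). \<integral>\<^sup>+x. ?f x \<partial>lborel)"
    by (rule nn_integral_lborel_prod) auto
  also have "\<dots> < \<infinity>"
    using nn_integral_sinh_powr_finite[OF q, of Q] by (simp add: Q_def power_less_top_ennreal)
  finally show ?thesis .
qed

section \<open>Invariance under reflections and the weight function\<close>

lemma distr_lborel_reflection:
  fixes s :: "real^'n::{finite,wellorder} \<Rightarrow> real^'n::{finite,wellorder}"
  assumes s: "linear s" and n: "\<And>t. norm (s t) = norm t" and i: "\<And>t. s (s t) = t"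
  shows "distr lborel borel s = lborel"
proof -
  have cs: "continuous_on UNIV s" using s by (simp add: linear_continuous_on linear_conv_bounded_linear)
  then have [measurable]: "s \<in> borel_measurable borel" by (rule borel_measurable_continuous_onI)
  have orth: "orthogonal_transformation s" using s n by (simp add: orthogonal_transformation)
  have "lborel = distr lborel borel s"
  proof (rule lborel_eqI)
    fix l u :: "real^'n::{finite,wellorder}" assume lu: "\<And>b. b \<in> Basis \<Longrightarrow> l \<bullet> b \<le> u \<bullet> b"
    have im: "s -` B = s ` B" for B
    proof (intro equalityI subsetI)
      fix x assume "x \<in> s -` B"
      then have "s (s x) \<in> s ` B" by blast
      then show "x \<in> s ` B" by (simp add: i)
    next
      fix x assume "x \<in> s ` B"
      then show "x \<in> s -` B" using i by force
    qed
    have lm: "box l u \<in> lmeasurable" by simp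
    have o: "open (s -` box l u)" using cs open_vimage by blast
    have "emeasure (distr lborel borel s) (box l u) = emeasure lborel (s -` box l u)"
      by (subst emeasure_distr) auto
    also have "\<dots> = emeasure lebesgue (s ` box l u)" unfolding im[symmetric] using o by (subst emeasure_completion) auto
    also have "\<dots> = ennreal (measure lebesgue (s ` box l u))"
      by (rule emeasure_eq_measure2[OF measurable_orthogonal_image[OF orth lm]])
    also have "\<dots> = ennreal (measure lebesgue (box l u))" by (simp only: measure_orthogonal_image[OF orth lm])
    also have "\<dots> = (\<Prod>b\<in>Basis. (u - l) \<bullet> b)" using lu by (simp add: measure_lborel_box)
    finally show "emeasure (distr lborel borel s) (box l u) = (\<Prod>b\<in>Basis. (u - l) \<bullet> b)" .
  qed auto
  then show ?thesis by simp
qed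

lemma integral_lborel_reflection:
  fixes s :: "real^'n::{finite,wellorder} \<Rightarrow> real^'n::{finite,wellorder}" and G :: "real^'n::{finite,wellorder} \<Rightarrow> complex"
  assumes "linear s" "\<And>t. norm (s t) = norm t" "\<And>t. s (s t) = t" and G: "integrable lborel G"
  shows "integrable lborel (\<lambda>t. G (s t))" "integral\<^sup>L lborel (\<lambda>t. G (s t)) = integral\<^sup>L lborel G"
proof -
  have cs: "continuous_on UNIV s" using assms(1) by (simp add: linear_continuous_on linear_conv_bounded_linear)
  then have [measurable]: "s \<in> borel_measurable borel" by (rule borel_measurable_continuous_onI)
  have [measurable]: "G \<in> borel_measurable borel" using G by auto
  note d = distr_lborel_reflection[OF assms(1-3)]
  have "integrable (distr lborel borel s) G" using G by (simp add: d)
  then show "integrable lborel (\<lambda>t. G (s t))" by (subst (asm) integrable_distr_eq) auto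
  have "integral\<^sup>L lborel G = integral\<^sup>L (distr lborel borel s) G" by (simp add: d)
  also have "\<dots> = integral\<^sup>L lborel (\<lambda>t. G (s t))" by (subst integral_distr) auto
  finally show "integral\<^sup>L lborel (\<lambda>t. G (s t)) = integral\<^sup>L lborel G" by simp
qed

text \<open>The exponent \<open>0\<close> is separated because \<open>0 powr 0 = 0\<close>, whereas
  an absent root has to contribute the factor \<open>1\<close> everywhere for the weight to be
  continuous.\<close>

definition sinh_pow :: "real \<Rightarrow> real \<Rightarrow> real" where
  "sinh_pow k x = (if k = 0 then 1 else \<bar>2 * sinh x\<bar> powr k)"

text \<open>A continuous version of the density of \<mu>. Each root in two indices is counted for
  both orders of the pair with exponent \<open>a / 2\<close>, so that invariance under reflections
  is a mere reindexing.\<close>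

definition weight :: "real \<Rightarrow> real \<Rightarrow> real \<Rightarrow> real^'n \<Rightarrow> real" where
  "weight a b \<iota> t = (\<Prod>j\<in>UNIV. sinh_pow (2 * b) (t $ j) * sinh_pow \<iota> (2 * t $ j)) *
    (\<Prod>(i, k)\<in>{(i, k). i \<noteq> k}. sinh_pow (a / 2) (t $ i - t $ k)) *
    (\<Prod>(i, k)\<in>{(i, k). i \<noteq> k}. sinh_pow (a / 2) (t $ i + t $ k))"

lemma sinh_pow_minus [simp]: "sinh_pow k (- x) = sinh_pow k x"
  by (simp add: sinh_pow_def)

lemma sinh_pow_diff_commute: "sinh_pow k (x - y) = sinh_pow k (y - x)"
  using sinh_pow_minus[of k "x - y"] by simp

lemma sinh_pow_eq: "x \<noteq> 0 \<Longrightarrow> sinh_pow k x = \<bar>2 * sinh x\<bar> powr k"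
  by (simp add: sinh_pow_def)

lemma sinh_pow_double: "sinh_pow (a / 2) x * sinh_pow (a / 2) x = sinh_pow a x"
  by (auto simp: sinh_pow_def simp flip: powr_add)

lemma continuous_sinh_pow:
  assumes "k \<ge> 0" "continuous_on S f"
  shows "continuous_on S (\<lambda>t. sinh_pow k (f t))"
proof (cases "k = 0")
  case False
  have "continuous_on S (\<lambda>t. \<bar>2 * sinh (f t)\<bar> powr k)"
    using assms False by (intro continuous_on_powr' continuous_intros) auto
  then show ?thesis using False by (simp add: sinh_pow_def)
qed (simp add: sinh_pow_def)

lemma continuous_weight:
  assumes "a \<ge> 0" "b \<ge> 0" "\<iota> \<ge> 0"
  shows "continuous_on UNIV (weight a b \<iota> :: real^'n \<Rightarrow> real)"
  unfolding weight_def[abs_def] split_beta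
  using assms by (intro continuous_intros continuous_sinh_pow) auto

lemma weight_swap: "weight a b \<iota> (swap_coords i j t) = weight a b \<iota> (t::real^'n)"
proof -
  let ?p = "\<lambda>k. if k = i then j else if k = j then i else k"
  have s: "swap_coords i j t $ k = t $ ?p k" for k by (simp add: reflection_nth)
  have 1: "(\<Prod>k\<in>UNIV. F (swap_coords i j t $ k)) = (\<Prod>k\<in>UNIV. F (t $ k))" for F :: "real \<Rightarrow> real"
    unfolding s by (rule prod.reindex_bij_witness[of _ ?p ?p]) auto
  have 2: "(\<Prod>(k, l)\<in>{(k, l). k \<noteq> l}. F (swap_coords i j t $ k) (swap_coords i j t $ l)) = (\<Prod>(k, l)\<in>{(k, l). k \<noteq> l}. F (t $ k) (t $ l))"
    for F :: "real \<Rightarrow> real \<Rightarrow> real"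
    unfolding s by (rule prod.reindex_bij_witness[of _ "map_prod ?p ?p" "map_prod ?p ?p"]) (auto split: if_splits)
  show ?thesis unfolding weight_def
    using 1[of "\<lambda>x. sinh_pow (2 * b) x * sinh_pow \<iota> (2 * x)"] 2[of "\<lambda>x y. sinh_pow (a / 2) (x - y)"] 2[of "\<lambda>x y. sinh_pow (a / 2) (x + y)"]
    by simp
qed

lemma weight_neg_coord: "weight a b \<iota> (neg_coord m t) = weight a b \<iota> (t::real^'n)"
proof -
  have c: "weight a b \<iota> t = (\<Prod>j\<in>UNIV. sinh_pow (2 * b) (t $ j) * sinh_pow \<iota> (2 * t $ j)) *
    (\<Prod>(i, k)\<in>{(i, k). i \<noteq> k}. sinh_pow (a / 2) (t $ i - t $ k) * sinh_pow (a / 2) (t $ i + t $ k))" for t :: "real^'n"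
    by (simp add: weight_def split_beta prod.distrib mult.assoc)
  have n: "sinh_pow k (- x - y) = sinh_pow k (x + y)" "sinh_pow k (- x + y) = sinh_pow k (x - y)" for k x y
    using sinh_pow_minus[of k "x + y"] sinh_pow_minus[of k "x - y"] by simp_all
  show ?thesis unfolding c
    by (intro arg_cong2[of _ _ _ _ "(*)"] prod.cong refl) (auto simp: reflection_nth n sinh_pow_diff_commute[of _ "t $ m"])
qed

lemma weight_neg_swap: "i \<noteq> j \<Longrightarrow> weight a b \<iota> (neg_swap_coords i j t) = weight a b \<iota> (t::real^'n)"
proof -
  assume "i \<noteq> j"
  then have "neg_swap_coords i j t = swap_coords i j (neg_coord i (neg_coord j t))"
    by (auto simp: vec_eq_iff reflection_nth)
  then show ?thesis by (simp add: weight_swap weight_neg_coord)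
qed

text \<open>Isolates the zero of the weight on one wall; it has to compensate the pole of
  \<open>coth (t $ j - t $ k)\<close> there.\<close>

lemma weight_factor_minus:
  assumes "a \<ge> 0" "b \<ge> 0" "\<iota> \<ge> 0" "j \<noteq> k"
  shows "\<exists>h. continuous_on UNIV h \<and> (\<forall>t::real^'n. weight a b \<iota> t = sinh_pow a (t $ j - t $ k) * h t)"
proof -
  let ?P = "{(i, k). i \<noteq> k} :: ('n \<times> 'n) set"
  define h where "h t = (\<Prod>j\<in>UNIV. sinh_pow (2 * b) (t $ j) * sinh_pow \<iota> (2 * t $ j)) *
    (\<Prod>(i, k)\<in>?P - {(j, k), (k, j)}. sinh_pow (a / 2) (t $ i - t $ k)) *
    (\<Prod>(i, k)\<in>?P. sinh_pow (a / 2) (t $ i + t $ k))" for t :: "real^'n"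
  have "continuous_on UNIV h"
    unfolding h_def[abs_def] split_beta using assms by (intro continuous_intros continuous_sinh_pow) auto
  moreover have "weight a b \<iota> t = sinh_pow a (t $ j - t $ k) * h t" for t
  proof -
    have "(\<Prod>(i, k)\<in>?P. sinh_pow (a / 2) (t $ i - t $ k)) =
      (\<Prod>(i, k)\<in>?P - {(j, k), (k, j)}. sinh_pow (a / 2) (t $ i - t $ k)) * (\<Prod>(i, k)\<in>{(j, k), (k, j)}. sinh_pow (a / 2) (t $ i - t $ k))"
      by (rule prod.subset_diff) (use assms in auto)
    also have "(\<Prod>(i, k)\<in>{(j, k), (k, j)}. sinh_pow (a / 2) (t $ i - t $ k)) = sinh_pow a (t $ j - t $ k)"
      using assms sinh_pow_double[of a "t $ j - t $ k"] by (simp add: sinh_pow_diff_commute[of _ "t $ k" "t $ j"])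
    finally show ?thesis by (simp add: weight_def h_def)
  qed
  ultimately show ?thesis by blast
qed

lemma weight_factor_plus:
  assumes "a \<ge> 0" "b \<ge> 0" "\<iota> \<ge> 0" "j \<noteq> k"
  shows "\<exists>h. continuous_on UNIV h \<and> (\<forall>t::real^'n. weight a b \<iota> t = sinh_pow a (t $ j + t $ k) * h t)"
proof -
  obtain h where h: "continuous_on UNIV h" "\<And>t::real^'n. weight a b \<iota> t = sinh_pow a (t $ j - t $ k) * h t"
    using weight_factor_minus[OF assms] by blast
  have "weight a b \<iota> t = sinh_pow a (t $ j + t $ k) * h (neg_coord k t)" for t
    using h(2)[of "neg_coord k t"] assms by (simp add: weight_neg_coord reflection_nth)
  moreover have "continuous_on UNIV (\<lambda>t. h (neg_coord k t))"
    by (rule continuous_on_compose2[OF h(1)])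
      (auto intro!: linear_continuous_on simp: linear_neg_coord linear_conv_bounded_linear[symmetric])
  ultimately show ?thesis by (intro exI[of _ "\<lambda>t. h (neg_coord k t)"]) blast
qed

text \<open>Off the walls the weight is the exponential of a combination of the functions
  \<open>ln \<bar>2 * sinh x\<bar>\<close>, which have derivative \<open>coth x\<close> on both
  sides of \<open>0\<close>.\<close>

lemma weight_line_derivative:
  fixes t :: "real^'n"
  assumes reg: "regular (t + s *\<^sub>R axis j 1)"
  defines "y \<equiv> t + s *\<^sub>R axis j 1"
  shows "((\<lambda>s. weight a b \<iota> (t + s *\<^sub>R axis j 1)) has_real_derivative
    weight a b \<iota> y * (2 * (\<iota> * coth (2 * y $ j) + b * coth (y $ j))
      + a * (\<Sum>k\<in>UNIV - {j}. coth (y $ j - y $ k) + coth (y $ j + y $ k)))) (at s)"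
proof -
  let ?P = "{(i, k). i \<noteq> k} :: ('n \<times> 'n) set"
  define l where "l x = ln \<bar>2 * sinh x\<bar>" for x :: real
  have dl: "((\<lambda>s. l (p s)) has_real_derivative coth (p s) * p') (at s)"
    if "(p has_real_derivative p') (at s)" "p s \<noteq> 0" for p p' s
  proof -
    have "(l has_real_derivative coth x) (at x)" if "x \<noteq> 0" for x
    proof (cases "x > 0")
      case True
      have "((\<lambda>x. ln (2 * sinh x)) has_real_derivative coth x) (at x)"
        using True by (auto intro!: derivative_eq_intros simp: coth_def)
      then show ?thesis
        by (rule has_field_derivative_transform_within_open[where S="{0<..}"]) (use True in \<open>auto simp: l_def\<close>)
    next
      case False
      have "((\<lambda>x. ln (- 2 * sinh x)) has_real_derivative coth x) (at x)"
        using False that by (auto intro!: derivative_eq_intros simp: coth_def)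
      then show ?thesis
        by (rule has_field_derivative_transform_within_open[where S="{..<0}"]) (use False that in \<open>auto simp: l_def\<close>)
    qed
    from DERIV_chain2[OF this that(1)] that(2) show ?thesis by blast
  qed
  define L where "L y = (\<Sum>i\<in>UNIV. 2 * b * l (y $ i) + \<iota> * l (2 * y $ i)) +
    (\<Sum>p\<in>?P. a / 2 * l (y $ fst p - y $ snd p)) + (\<Sum>p\<in>?P. a / 2 * l (y $ fst p + y $ snd p))" for y :: "real^'n"
  have wL: "weight a b \<iota> y = exp (L y)" if "regular y" for y :: "real^'n"
  proof -
    have e: "sinh_pow k x = exp (k * l x)" if "x \<noteq> 0" for k x
      using that by (simp add: sinh_pow_eq l_def powr_def)
    have 1: "(\<Prod>j\<in>UNIV. sinh_pow (2 * b) (y $ j) * sinh_pow \<iota> (2 * y $ j)) = exp (\<Sum>i\<in>UNIV. 2 * b * l (y $ i) + \<iota> * l (2 * y $ i))"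
      unfolding exp_sum[OF finite] using regularD(1)[OF that] by (intro prod.cong refl) (simp add: e exp_add)
    have 2: "(\<Prod>(i, k)\<in>?P. sinh_pow (a / 2) (y $ i - y $ k)) = exp (\<Sum>p\<in>?P. a / 2 * l (y $ fst p - y $ snd p))"
      unfolding exp_sum[OF finite] split_beta using regularD(2)[OF that] by (intro prod.cong refl e) auto
    have 3: "(\<Prod>(i, k)\<in>?P. sinh_pow (a / 2) (y $ i + y $ k)) = exp (\<Sum>p\<in>?P. a / 2 * l (y $ fst p + y $ snd p))"
      unfolding exp_sum[OF finite] split_beta using regularD(3)[OF that] by (intro prod.cong refl e) auto
    show ?thesis unfolding weight_def 1 2 3 L_def by (simp add: exp_add)
  qed
  let ?e = "\<lambda>i. if i = j then 1 else 0 :: real"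
  have co: "(t + s *\<^sub>R axis j 1) $ i = t $ i + s * ?e i" for s i by (simp add: axis_def)
  have reg': "t $ i + s * ?e i \<noteq> 0" "i \<noteq> k \<Longrightarrow> (t $ i + s * ?e i) - (t $ k + s * ?e k) \<noteq> 0"
    "i \<noteq> k \<Longrightarrow> (t $ i + s * ?e i) + (t $ k + s * ?e k) \<noteq> 0" for i k
    using regularD[OF reg] unfolding co by blast+
  have yc: "y $ i = t $ i + s * ?e i" for i unfolding y_def co ..
  have d1: "((\<lambda>s. l (t $ i + s * ?e i)) has_real_derivative coth (t $ i + s * ?e i) * ?e i) (at s)" for i
    using reg'(1)[of i] by (intro dl) (auto intro!: derivative_eq_intros)
  have d2: "((\<lambda>s. l (2 * (t $ i + s * ?e i))) has_real_derivative coth (2 * (t $ i + s * ?e i)) * (2 * ?e i)) (at s)" for i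
    using reg'(1)[of i] by (intro dl) (auto intro!: derivative_eq_intros)
  have d3: "((\<lambda>s. l ((t $ i + s * ?e i) - (t $ k + s * ?e k))) has_real_derivative coth ((t $ i + s * ?e i) - (t $ k + s * ?e k)) * (?e i - ?e k)) (at s)"
    if "i \<noteq> k" for i k
    using reg'(2)[OF that] by (intro dl) (auto intro!: derivative_eq_intros)
  have d4: "((\<lambda>s. l ((t $ i + s * ?e i) + (t $ k + s * ?e k))) has_real_derivative coth ((t $ i + s * ?e i) + (t $ k + s * ?e k)) * (?e i + ?e k)) (at s)"
    if "i \<noteq> k" for i k
    using reg'(3)[OF that] by (intro dl) (auto intro!: derivative_eq_intros)
  define S1 where "S1 = (\<Sum>i\<in>UNIV. 2 * b * (coth (y $ i) * ?e i) + \<iota> * (coth (2 * y $ i) * (2 * ?e i)))"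
  define S2 where "S2 = (\<Sum>p\<in>?P. a / 2 * (coth (y $ fst p - y $ snd p) * (?e (fst p) - ?e (snd p))))"
  define S3 where "S3 = (\<Sum>p\<in>?P. a / 2 * (coth (y $ fst p + y $ snd p) * (?e (fst p) + ?e (snd p))))"
  have dL: "((\<lambda>s. L (t + s *\<^sub>R axis j 1)) has_real_derivative (S1 + S2 + S3)) (at s)"
    unfolding L_def co S1_def S2_def S3_def yc
    by (intro DERIV_add DERIV_sum DERIV_cmult d1 d2 d3 d4) auto
  have pairs: "(\<Sum>p\<in>?P. F p) = (\<Sum>i\<in>UNIV. \<Sum>k\<in>UNIV - {i}. F (i, k))" for F :: "'n \<times> 'n \<Rightarrow> real"
  proof -
    have "?P = Sigma UNIV (\<lambda>i. UNIV - {i})" by auto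
    then show ?thesis by (simp add: sum.Sigma)
  qed
  have split: "(\<Sum>i\<in>UNIV. G i) = G j + (\<Sum>k\<in>UNIV - {j}. G k)" for G :: "'n \<Rightarrow> real"
    by (rule sum.remove) auto
  have one: "(\<Sum>k\<in>UNIV - {i}. G k * ?e k) = (if i = j then 0 else G j)" for G :: "'n \<Rightarrow> real" and i
    by (auto simp: if_distrib[of "\<lambda>x. _ * x"] cong: if_cong)
  have S1: "S1 = 2 * (\<iota> * coth (2 * y $ j) + b * coth (y $ j))"
    unfolding S1_def split by (simp add: sum.neutral algebra_simps)
  \<comment> \<open>Here \<open>\<sigma>\<close> is the sign of the second coordinate in the root.
    The index \<open>j\<close> occurs once as first and once as second entry of an ordered pair; in
    both uses below the two contributions agree, which turns \<open>a / 2\<close> into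
    \<open>a\<close>.\<close>
  have two: "(\<Sum>p\<in>?P. a / 2 * (G (fst p) (snd p) * (?e (fst p) + \<sigma> * ?e (snd p)))) = a / 2 * (\<Sum>k\<in>UNIV - {j}. G j k + \<sigma> * G k j)"
    for G :: "'n \<Rightarrow> 'n \<Rightarrow> real" and \<sigma> :: real
  proof -
    have "(\<Sum>k\<in>UNIV - {i}. G i k * (?e i + \<sigma> * ?e k)) = ?e i * (\<Sum>k\<in>UNIV - {i}. G i k) + \<sigma> * (if i = j then 0 else G i j)" for i
      unfolding one[symmetric, where G="\<lambda>k. G i k" and i=i] by (simp add: sum.distrib sum_distrib_left algebra_simps)
    then have "(\<Sum>p\<in>?P. a / 2 * (G (fst p) (snd p) * (?e (fst p) + \<sigma> * ?e (snd p))))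
       = a / 2 * (\<Sum>i\<in>UNIV. ?e i * (\<Sum>k\<in>UNIV - {i}. G i k) + \<sigma> * (if i = j then 0 else G i j))"
      by (simp only: pairs fst_conv snd_conv sum_distrib_left[symmetric])
    also have "\<dots> = a / 2 * (\<Sum>k\<in>UNIV - {j}. G j k + \<sigma> * G k j)"
      unfolding split by (simp add: sum.distrib sum_distrib_left)
    finally show ?thesis .
  qed
  have S2: "S2 = a * (\<Sum>k\<in>UNIV - {j}. coth (y $ j - y $ k))"
    using two[of "\<lambda>i k. coth (y $ i - y $ k)" "-1"] unfolding S2_def
    by (simp add: coth_diff_commute[of "y $ k" "y $ j" for k] sum_distrib_left[symmetric] flip: mult_2)
  have S3: "S3 = a * (\<Sum>k\<in>UNIV - {j}. coth (y $ j + y $ k))"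
    using two[of "\<lambda>i k. coth (y $ i + y $ k)" "1"] unfolding S3_def
    by (simp add: add.commute[of "y $ k" "y $ j" for k] sum_distrib_left[symmetric] flip: mult_2)
  have "((\<lambda>s. exp (L (t + s *\<^sub>R axis j 1))) has_real_derivative exp (L y) * (S1 + S2 + S3)) (at s)"
    using DERIV_chain2[OF DERIV_exp dL] by (simp add: y_def)
  then have "((\<lambda>s. weight a b \<iota> (t + s *\<^sub>R axis j 1)) has_real_derivative exp (L y) * (S1 + S2 + S3)) (at s)"
  proof (rule has_field_derivative_transform_within_open)
    have "continuous_on UNIV (\<lambda>s. t + s *\<^sub>R axis j (1::real))" by (intro continuous_intros)
    from open_vimage[OF open_regular this] show "open ((\<lambda>s. t + s *\<^sub>R axis j (1::real)) -` {t. regular t})" .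
  qed (use reg wL in auto)
  then show ?thesis using reg unfolding S1 S2 S3 by (simp add: wL y_def sum.distrib distrib_left add.assoc)
qed

section \<open>Integrability against test functions\<close>

lemma AE_regular: "AE t in lborel. regular t"
proof -
  have "{t. \<not> regular t} \<in> null_sets lebesgue"
    using negligible_not_regular by (simp add: negligible_iff_null_sets)
  then have "AE t in completion lborel. regular t" by (rule AE_I') auto
  then show ?thesis by (simp add: AE_completion_iff)
qed

lemma borel_measurable_coth [measurable]: "coth \<in> borel_measurable borel"
proof -
  have [measurable]: "(cosh :: real \<Rightarrow> real) \<in> borel_measurable borel"
    by (intro borel_measurable_continuous_onI continuous_intros)
  show ?thesis unfolding coth_def[abs_def] by measurable
qed

text \<open>Local integrability in the form in which it is consumed; unlike boundedness it tolerates
  the poles of coth against the weight, and it is stable under sums.\<close>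

definition test_integrable :: "real \<Rightarrow> (real^'n \<Rightarrow> real) \<Rightarrow> bool" where
  "test_integrable R \<phi> \<longleftrightarrow> (\<forall>G. continuous_on UNIV G \<longrightarrow> supported_in R G \<longrightarrow>
     integrable lborel (\<lambda>t. complex_of_real (\<phi> t) * G t))"

lemma continuous_supported_bounded:
  fixes G :: "real^'n \<Rightarrow> complex"
  assumes "continuous_on UNIV G" "supported_in R G"
  obtains M where "M \<ge> 0" "\<And>t. norm (G t) \<le> M * indicator (cball 0 R) t"
proof -
  have "compact (G ` cball 0 R)"
    by (intro compact_continuous_image continuous_on_subset[OF assms(1)]) auto
  then have "bounded (G ` cball 0 R)" by (rule compact_imp_bounded)
  then obtain M where "\<forall>x\<in>G ` cball 0 R. norm x \<le> M" unfolding bounded_iff by blast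
  then have M: "\<And>t. t \<in> cball 0 R \<Longrightarrow> norm (G t) \<le> M" by blast
  show thesis
    by (rule that[of "max 0 M"]) (use M assms(2) in \<open>force simp: supported_in_def split: split_indicator\<close>)+
qed

lemma test_integrableI:
  fixes \<phi> :: "real^'n \<Rightarrow> real"
  assumes [measurable]: "\<phi> \<in> borel_measurable borel"
    and fin: "(\<integral>\<^sup>+t. ennreal (indicator (cball 0 R) t * \<bar>\<phi> t\<bar>) \<partial>lborel) < \<infinity>"
  shows "test_integrable R \<phi>"
  unfolding test_integrable_def
proof (intro allI impI)
  fix G :: "real^'n \<Rightarrow> complex"
  assume G: "continuous_on UNIV G" "supported_in R G"
  obtain M where M: "M \<ge> 0" "\<And>t. norm (G t) \<le> M * indicator (cball 0 R) t"
    using continuous_supported_bounded[OF G] by blast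
  have [measurable]: "G \<in> borel_measurable borel" by (rule borel_measurable_continuous_onI[OF G(1)])
  have [measurable]: "cball (0::real^'n) R \<in> sets borel" by simp
  show "integrable lborel (\<lambda>t. complex_of_real (\<phi> t) * G t)"
  proof (rule integrableI_bounded)
    have "(\<integral>\<^sup>+t. ennreal (norm (complex_of_real (\<phi> t) * G t)) \<partial>lborel)
       \<le> (\<integral>\<^sup>+t. ennreal M * ennreal (indicator (cball 0 R) t * \<bar>\<phi> t\<bar>) \<partial>lborel)"
    proof (rule nn_integral_mono)
      fix t
      have "norm (complex_of_real (\<phi> t) * G t) \<le> \<bar>\<phi> t\<bar> * (M * indicator (cball 0 R) t)"
        unfolding norm_mult norm_of_real by (intro mult_left_mono M) auto
      then show "ennreal (norm (complex_of_real (\<phi> t) * G t)) \<le> ennreal M * ennreal (indicator (cball 0 R) t * \<bar>\<phi> t\<bar>)"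
        using M(1) by (simp add: ennreal_mult[symmetric] ennreal_leI mult_ac)
    qed
    also have "\<dots> = ennreal M * (\<integral>\<^sup>+t. ennreal (indicator (cball 0 R) t * \<bar>\<phi> t\<bar>) \<partial>lborel)"
      by (rule nn_integral_cmult) measurable
    also have "\<dots> < \<infinity>" using fin by (simp add: ennreal_mult_less_top)
    finally show "(\<integral>\<^sup>+t. ennreal (norm (complex_of_real (\<phi> t) * G t)) \<partial>lborel) < \<infinity>" .
  qed measurable
qed

lemma test_integrable_mono:
  fixes \<phi> \<psi> :: "real^'n \<Rightarrow> real"
  assumes [measurable]: "\<phi> \<in> borel_measurable borel" "\<psi> \<in> borel_measurable borel"
    and le: "\<And>t. regular t \<Longrightarrow> norm t \<le> R \<Longrightarrow> \<bar>\<phi> t\<bar> \<le> C * \<psi> t" and C: "C \<ge> 0"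
    and fin: "(\<integral>\<^sup>+t. ennreal (indicator (cball 0 R) t * \<psi> t) \<partial>lborel) < \<infinity>"
  shows "test_integrable R \<phi>"
proof (rule test_integrableI)
  have [measurable]: "cball (0::real^'n) R \<in> sets borel" by simp
  have "(\<integral>\<^sup>+t. ennreal (indicator (cball 0 R) t * \<bar>\<phi> t\<bar>) \<partial>lborel) \<le> (\<integral>\<^sup>+t. ennreal C * ennreal (indicator (cball 0 R) t * \<psi> t) \<partial>lborel)"
    by (rule nn_integral_mono_AE, rule AE_mp[OF AE_regular], rule AE_I2)
      (use le C in \<open>auto simp: ennreal_mult'[symmetric] ennreal_leI split: split_indicator\<close>)
  also have "\<dots> = ennreal C * (\<integral>\<^sup>+t. ennreal (indicator (cball 0 R) t * \<psi> t) \<partial>lborel)"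
    by (rule nn_integral_cmult) measurable
  also have "\<dots> < \<infinity>" using fin by (simp add: ennreal_mult_less_top)
  finally show "(\<integral>\<^sup>+t. ennreal (indicator (cball 0 R) t * \<bar>\<phi> t\<bar>) \<partial>lborel) < \<infinity>" .
qed fact

lemma test_integrable_bounded:
  fixes \<phi> :: "real^'n \<Rightarrow> real"
  assumes "\<phi> \<in> borel_measurable borel" "\<And>t. regular t \<Longrightarrow> norm t \<le> R \<Longrightarrow> \<bar>\<phi> t\<bar> \<le> C"
  shows "test_integrable R \<phi>"
proof (rule test_integrable_mono[where \<psi>="\<lambda>_. 1" and C="max 0 C"])
  have "(\<integral>\<^sup>+t. ennreal (indicator (cball 0 R) t * 1) \<partial>(lborel :: (real^'n) measure)) = emeasure lborel (cball 0 R :: (real^'n) set)"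
    by (simp add: ennreal_indicator)
  then show "(\<integral>\<^sup>+t. ennreal (indicator (cball 0 R) t * 1) \<partial>(lborel :: (real^'n) measure)) < \<infinity>"
    using emeasure_lborel_cball_finite[of "0::real^'n" R] by simp
qed (use assms in \<open>auto simp: le_max_iff_disj\<close>)

lemma test_integrable_add: "test_integrable R \<phi> \<Longrightarrow> test_integrable R \<psi> \<Longrightarrow> test_integrable R (\<lambda>t. \<phi> t + \<psi> t)"
  and test_integrable_cmult: "test_integrable R \<phi> \<Longrightarrow> test_integrable R (\<lambda>t. c * \<phi> t)"
  unfolding test_integrable_def by (simp_all add: distrib_right mult.assoc)

lemma test_integrable_sum:
  "(\<And>k. k \<in> K \<Longrightarrow> test_integrable R (F k)) \<Longrightarrow> test_integrable R (\<lambda>t. \<Sum>k\<in>K. F k t)"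
  unfolding test_integrable_def by (simp add: sum_distrib_right)

lemma continuous_bounded_cball:
  fixes u :: "real^'n \<Rightarrow> real"
  assumes "continuous_on UNIV u"
  obtains C where "C \<ge> 0" "\<And>t. norm t \<le> R \<Longrightarrow> \<bar>u t\<bar> \<le> C"
proof -
  have "compact (u ` cball 0 R)"
    by (intro compact_continuous_image continuous_on_subset[OF assms]) auto
  then have "bounded (u ` cball 0 R)" by (rule compact_imp_bounded)
  then obtain C where "\<forall>x\<in>u ` cball 0 R. norm x \<le> C" unfolding bounded_iff by blast
  then have C: "\<And>t. t \<in> cball 0 R \<Longrightarrow> norm (u t) \<le> C" by blast
  show thesis by (rule that[of "max 0 C"]) (use C in \<open>auto simp: le_max_iff_disj\<close>)
qed

text \<open>The product of \<open>coth (l t)\<close> and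
  \<open>\<bar>sinh (l t)\<bar> powr a\<close> is \<open>cosh (l t)\<close> times
  \<open>\<bar>sinh (l t)\<bar> powr (a - 1)\<close> up to sign, which is locally integrable for
  \<open>a > 0\<close>. For \<open>a = 0\<close> the leading factor \<open>a\<close> removes the
  term, which is why it is part of the function.\<close>

lemma test_integrable_singular:
  fixes l u h :: "real^'n \<Rightarrow> real"
  assumes a: "a \<ge> 0" and l: "linear l" "l v = 1" and l0: "\<And>t. regular t \<Longrightarrow> l t \<noteq> 0"
    and u: "continuous_on UNIV u" and h: "continuous_on UNIV h"
  shows "test_integrable R (\<lambda>t. a * coth (l t) * (sinh_pow a (l t) * h t) * u t)"
proof (cases "a = 0")
  case True
  then show ?thesis by (simp add: test_integrable_def)
next
  case False
  with a have a: "a > 0" by simp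
  have cl: "continuous_on UNIV l" using l by (simp add: linear_continuous_on linear_conv_bounded_linear)
  have [measurable]: "l \<in> borel_measurable borel" "u \<in> borel_measurable borel" "h \<in> borel_measurable borel"
    using cl u h by (auto intro: borel_measurable_continuous_onI)
  have "continuous_on UNIV (\<lambda>t. a * 2 powr a * cosh (l t) * h t * u t)"
    using cl u h by (intro continuous_intros)
  then obtain C where C: "C \<ge> 0" "\<And>t. norm t \<le> R \<Longrightarrow> \<bar>a * 2 powr a * cosh (l t) * h t * u t\<bar> \<le> C"
    using continuous_bounded_cball by blast
  show ?thesis
  proof (rule test_integrable_mono[where C=C and \<psi>="\<lambda>t. \<bar>sinh (l t)\<bar> powr (a - 1)"])
    show "(\<integral>\<^sup>+t. ennreal (indicator (cball 0 R) t * \<bar>sinh (l t)\<bar> powr (a - 1)) \<partial>lborel) < \<infinity>"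
      by (rule nn_integral_sinh_linear_finite[OF l]) (use a in simp)
    fix t :: "real^'n" assume t: "regular t" "norm t \<le> R"
    have s: "sinh (l t) \<noteq> 0" using l0[OF t(1)] by simp
    have p: "\<bar>2 * sinh (l t)\<bar> powr a = 2 powr a * (\<bar>sinh (l t)\<bar> powr (a - 1) * \<bar>sinh (l t)\<bar>)"
      using s by (simp add: abs_mult powr_mult powr_diff)
    have "\<bar>a * coth (l t) * (sinh_pow a (l t) * h t) * u t\<bar>
        = \<bar>a * 2 powr a * cosh (l t) * h t * u t\<bar> * \<bar>sinh (l t)\<bar> powr (a - 1)"
      unfolding sinh_pow_eq[OF l0[OF t(1)]] p unfolding abs_mult coth_def abs_divide using s by simp
    also have "\<dots> \<le> C * \<bar>sinh (l t)\<bar> powr (a - 1)"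
      by (intro mult_right_mono C t) auto
    finally show "\<bar>a * coth (l t) * (sinh_pow a (l t) * h t) * u t\<bar> \<le> C * \<bar>sinh (l t)\<bar> powr (a - 1)" .
  next
    have [measurable]: "sinh_pow a \<in> borel_measurable borel" unfolding sinh_pow_def[abs_def] by measurable
    show "(\<lambda>t. a * coth (l t) * (sinh_pow a (l t) * h t) * u t) \<in> borel_measurable borel" by measurable
    show "(\<lambda>t. \<bar>sinh (l t)\<bar> powr (a - 1)) \<in> borel_measurable borel" by measurable
  qed (rule C)
qed

lemma test_integrable_pair:
  fixes u :: "real^'n \<Rightarrow> real"
  assumes "a \<ge> 0" "b \<ge> 0" "\<iota> \<ge> 0" "j \<noteq> k" and u: "continuous_on UNIV u"
  shows "test_integrable R (\<lambda>t. a / 2 * coth (t $ j - t $ k) * weight a b \<iota> t * u t)"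
    and "test_integrable R (\<lambda>t. a / 2 * coth (t $ j + t $ k) * weight a b \<iota> t * u t)"
proof -
  obtain h where h: "continuous_on UNIV h" "\<And>t::real^'n. weight a b \<iota> t = sinh_pow a (t $ j - t $ k) * h t"
    using weight_factor_minus[OF assms(1-4)] by blast
  have "test_integrable R (\<lambda>t. a * coth (t $ j - t $ k) * (sinh_pow a (t $ j - t $ k) * h t) * u t)"
    by (rule test_integrable_singular[where v="axis j 1"])
      (use assms h regularD(2) in \<open>auto intro!: linearI simp: axis_def algebra_simps\<close>)
  from test_integrable_cmult[OF this, of "1/2"]
  show "test_integrable R (\<lambda>t. a / 2 * coth (t $ j - t $ k) * weight a b \<iota> t * u t)" by (simp add: h mult.assoc)
  obtain h where h: "continuous_on UNIV h" "\<And>t::real^'n. weight a b \<iota> t = sinh_pow a (t $ j + t $ k) * h t"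
    using weight_factor_plus[OF assms(1-4)] by blast
  have "test_integrable R (\<lambda>t. a * coth (t $ j + t $ k) * (sinh_pow a (t $ j + t $ k) * h t) * u t)"
    by (rule test_integrable_singular[where v="axis j 1"])
      (use assms h regularD(3) in \<open>auto intro!: linearI simp: axis_def algebra_simps\<close>)
  from test_integrable_cmult[OF this, of "1/2"]
  show "test_integrable R (\<lambda>t. a / 2 * coth (t $ j + t $ k) * weight a b \<iota> t * u t)" by (simp add: h mult.assoc)
qed

text \<open>The substitution of \<open>s t\<close> for \<open>t\<close> moves the reflection from
  \<open>G\<close> to \<open>u\<close>; the weight is invariant and \<open>c\<close> is odd, so
  \<open>c (1 - s)\<close> becomes \<open>c (1 + s)\<close>.\<close>

lemma integral_refl_op:
  fixes s :: "real^'n::{finite,wellorder} \<Rightarrow> real^'n::{finite,wellorder}" and u w c :: "real^'n::{finite,wellorder} \<Rightarrow> real"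
  assumes s: "linear s" "\<And>t. norm (s t) = norm t" "\<And>t. s (s t) = t"
    and w: "\<And>t. w (s t) = w t" and c: "\<And>t. c (s t) = - c t"
    and ti: "test_integrable R (\<lambda>t. c t * w t * u t)" "test_integrable R (\<lambda>t. c t * w t * u (s t))"
      "test_integrable R (\<lambda>t. w t * u (s t))"
    and G: "continuous_on UNIV G" "supported_in R G"
  shows "integrable lborel (\<lambda>t. of_real (w t * u t) * refl_op c e s G t)" (is ?A)
    and "integrable lborel (\<lambda>t. of_real (w t * (c t * u t + c t * u (s t) - e * u (s t))) * G t)" (is ?B)
    and "integral\<^sup>L lborel (\<lambda>t. of_real (w t * u t) * refl_op c e s G t) =
      integral\<^sup>L lborel (\<lambda>t. of_real (w t * (c t * u t + c t * u (s t) - e * u (s t))) * G t)"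
proof -
  have i1: "integrable lborel (\<lambda>t. complex_of_real (c t * w t * u t) * G t)"
    using ti(1) G by (simp add: test_integrable_def)
  \<comment> \<open>Composed with \<open>s\<close>, this is the part of the integrand in which
    \<open>G\<close> is evaluated at \<open>s t\<close>.\<close>
  define Q where "Q t = complex_of_real (c t * w t * u (s t) + (- e) * (w t * u (s t))) * G t" for t
  have iQ: "integrable lborel Q"
    using test_integrable_add[OF ti(2) test_integrable_cmult[OF ti(3), of "- e"]] G
    unfolding Q_def[abs_def] by (simp only: test_integrable_def)
  note r = integral_lborel_reflection[OF s iQ]
  have e1: "(\<lambda>t. of_real (w t * u t) * refl_op c e s G t) = (\<lambda>t. complex_of_real (c t * w t * u t) * G t + Q (s t))"
    by (rule ext) (simp add: Q_def refl_op_def s w c algebra_simps)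
  have e2: "(\<lambda>t. of_real (w t * (c t * u t + c t * u (s t) - e * u (s t))) * G t) = (\<lambda>t. complex_of_real (c t * w t * u t) * G t + Q t)"
    by (rule ext) (simp add: Q_def algebra_simps)
  show ?A unfolding e1 using i1 r(1) by (rule Bochner_Integration.integrable_add)
  show ?B unfolding e2 using i1 iQ by (rule Bochner_Integration.integrable_add)
  show "integral\<^sup>L lborel (\<lambda>t. of_real (w t * u t) * refl_op c e s G t) =
      integral\<^sup>L lborel (\<lambda>t. of_real (w t * (c t * u t + c t * u (s t) - e * u (s t))) * G t)"
    unfolding e1 e2 using i1 iQ r by simp
qed

text \<open>Integration by parts in the direction of \<open>axis j 1\<close>; \<open>v\<close> is
  the derivative of \<open>w * u\<close>. The poles on \<open>t\<^sub>j = t\<^sub>k\<close> and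
  \<open>t\<^sub>j = - t\<^sub>k\<close> are absorbed by the weight, the one on
  \<open>t\<^sub>j = 0\<close> by \<open>u\<close>, as the bound \<open>bgu\<close>
  expresses.\<close>

lemma integral_weight_partial:
  fixes u u' :: "real^'n \<Rightarrow> real" and g :: "real^'n \<Rightarrow> complex"
  assumes par: "a \<ge> 0" "b \<ge> 0" "\<iota> \<ge> 0"
    and u: "continuous_on UNIV u" and u'm: "u' \<in> borel_measurable borel"
    and du: "\<And>t s. regular (t + s *\<^sub>R axis j 1) \<Longrightarrow> ((\<lambda>s. u (t + s *\<^sub>R axis j 1)) has_real_derivative u' (t + s *\<^sub>R axis j 1)) (at s)"
    and bu': "\<And>t. regular t \<Longrightarrow> norm t \<le> R \<Longrightarrow> \<bar>u' t\<bar> \<le> C"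
    and bgu: "\<And>t. regular t \<Longrightarrow> norm t \<le> R \<Longrightarrow> \<bar>(\<iota> * coth (2 * t $ j) + b * coth (t $ j)) * u t\<bar> \<le> C"
    and g: "smooth g" "supported_in R g" and pg: "supported_in R (partial j g)"
  defines "w \<equiv> weight a b \<iota>"
  defines "v \<equiv> \<lambda>t. u' t * w t + (2 * ((\<iota> * coth (2 * t $ j) + b * coth (t $ j)) * w t * u t) +
      (\<Sum>k\<in>UNIV - {j}. 2 * (a / 2 * coth (t $ j - t $ k) * w t * u t + a / 2 * coth (t $ j + t $ k) * w t * u t)))"
  shows "integrable lborel (\<lambda>t. of_real (v t) * g t)" and "integrable lborel (\<lambda>t. of_real (w t * u t) * partial j g t)"
    and "integral\<^sup>L lborel (\<lambda>t. of_real (w t * u t) * partial j g t) = - integral\<^sup>L lborel (\<lambda>t. of_real (v t) * g t)"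
proof -
  have cw: "continuous_on UNIV w" unfolding w_def by (rule continuous_weight[OF par])
  note cg = smooth_continuous[OF g(1)] and cpg = smooth_continuous[OF smooth_partial[OF g(1)]]
  have [measurable]: "w \<in> borel_measurable borel" "u \<in> borel_measurable borel" "u' \<in> borel_measurable borel"
    using cw u u'm by (auto intro: borel_measurable_continuous_onI)
  obtain Cw where Cw: "Cw \<ge> 0" "\<And>t. norm t \<le> R \<Longrightarrow> \<bar>w t\<bar> \<le> Cw" using continuous_bounded_cball[OF cw] by blast
  have C1: "\<bar>u' t * w t\<bar> \<le> C * Cw" if "regular t" "norm t \<le> R" for t
    unfolding abs_mult using bu'[OF that] Cw that by (intro mult_mono) auto
  have C2: "\<bar>(\<iota> * coth (2 * t $ j) + b * coth (t $ j)) * w t * u t\<bar> \<le> C * Cw" if "regular t" "norm t \<le> R" for t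
  proof -
    have "\<bar>(\<iota> * coth (2 * t $ j) + b * coth (t $ j)) * u t\<bar> * \<bar>w t\<bar> \<le> C * Cw"
      using bgu[OF that] Cw that by (intro mult_mono) auto
    then show ?thesis by (simp add: abs_mult mult_ac)
  qed
  have tv: "test_integrable R v" unfolding v_def
  proof (intro test_integrable_add test_integrable_cmult test_integrable_sum)
    show "test_integrable R (\<lambda>t. u' t * w t)" by (rule test_integrable_bounded[OF _ C1]) measurable
    show "test_integrable R (\<lambda>t. (\<iota> * coth (2 * t $ j) + b * coth (t $ j)) * w t * u t)"
      by (rule test_integrable_bounded[OF _ C2]) measurable
  qed (unfold w_def, (intro test_integrable_pair par u; blast)+)
  have twu: "test_integrable R (\<lambda>t. w t * u t)"
  proof -
    have "continuous_on UNIV (\<lambda>t. w t * u t)" using cw u by (intro continuous_intros)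
    then obtain C where "\<And>t. norm t \<le> R \<Longrightarrow> \<bar>w t * u t\<bar> \<le> C" using continuous_bounded_cball by blast
    then show ?thesis by (intro test_integrable_bounded[where C=C]) (auto simp: )
  qed
  show i1: "integrable lborel (\<lambda>t. of_real (v t) * g t)" using tv cg g(2) by (simp add: test_integrable_def)
  show i2: "integrable lborel (\<lambda>t. of_real (w t * u t) * partial j g t)" using twu cpg pg by (simp only: test_integrable_def)
  have i3: "integrable lborel (\<lambda>t. of_real (w t * u t) * g t)" using twu cg g(2) by (simp only: test_integrable_def)
  have "integral\<^sup>L lborel (\<lambda>t. of_real (v t) * g t + of_real (w t * u t) * partial j g t) = 0"
  proof (rule integral_line_derivative_eq_0[OF i3 _ AE_mp[OF AE_regular AE_I2], where v="axis j 1"])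
    show "integrable lborel (\<lambda>t. of_real (v t) * g t + of_real (w t * u t) * partial j g t)"
      using i1 i2 by (rule Bochner_Integration.integrable_add)
    fix t :: "real^'n"
    \<comment> \<open>The parameters at which the line meets a wall involving the coordinate
      \<open>j\<close>; the other walls are avoided along the whole line because \<open>t\<close> is
      regular.\<close>
    define S where "S = {- (t $ j)} \<union> (\<Union>k\<in>UNIV - {j}. {t $ k - t $ j, - t $ k - t $ j})"
    have reg: "regular (t + s *\<^sub>R axis j 1)" if "regular t" "s \<notin> S" for s
    proof -
      have c: "(t + s *\<^sub>R axis j 1) $ i = (if i = j then t $ j + s else t $ i)" for i by (simp add: axis_def)
      have "t $ j + s \<noteq> 0" "\<And>k. k \<noteq> j \<Longrightarrow> t $ j + s \<noteq> t $ k \<and> t $ j + s \<noteq> - t $ k"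
        using that(2) by (auto simp: S_def algebra_simps add_eq_0_iff)
      note n = this
      have n': "t $ j + s \<noteq> t $ k" "t $ k \<noteq> t $ j + s" "t $ j + s \<noteq> - t $ k" "t $ k \<noteq> - (t $ j + s)" if "k \<noteq> j" for k
        using n(2)[OF that] by auto
      have r: "t $ i \<noteq> 0" "i \<noteq> k \<Longrightarrow> t $ i \<noteq> t $ k" "i \<noteq> k \<Longrightarrow> t $ i \<noteq> - t $ k" for i k
        using that(1) unfolding regular_def by blast+
      show ?thesis unfolding regular_def c
      proof (intro conjI allI impI)
        fix i show "(if i = j then t $ j + s else t $ i) \<noteq> 0" using n(1) r(1) by simp
      next
        fix i k :: 'n assume ik: "i \<noteq> k"
        show "(if i = j then t $ j + s else t $ i) \<noteq> (if k = j then t $ j + s else t $ k)"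
          using ik n'(1)[of k] n'(2)[of i] r(2)[OF ik] by (cases "i = j"; cases "k = j") simp_all
        show "(if i = j then t $ j + s else t $ i) \<noteq> - (if k = j then t $ j + s else t $ k)"
          using ik n'(3)[of k] n'(4)[of i] r(3)[OF ik] by (cases "i = j"; cases "k = j") simp_all
      qed
    qed
    have ci: "continuous_on {0..1} (\<lambda>s. f (t + s *\<^sub>R axis j (1::real)))" if "continuous_on UNIV f" for f :: "real^'n \<Rightarrow> 'z::topological_space"
      by (rule continuous_on_compose2[OF that]) (auto intro!: continuous_intros)
    have D: "((\<lambda>s. of_real (w (t + s *\<^sub>R axis j 1) * u (t + s *\<^sub>R axis j 1)) * g (t + s *\<^sub>R axis j 1)) has_vector_derivative
          of_real (v (t + s *\<^sub>R axis j 1)) * g (t + s *\<^sub>R axis j 1) +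
          of_real (w (t + s *\<^sub>R axis j 1) * u (t + s *\<^sub>R axis j 1)) * partial j g (t + s *\<^sub>R axis j 1)) (at s)"
      if r: "regular (t + s *\<^sub>R axis j 1)" for s
    proof -
      let ?y = "t + s *\<^sub>R axis j 1"
      have "((\<lambda>s. w (t + s *\<^sub>R axis j 1) * u (t + s *\<^sub>R axis j 1)) has_real_derivative v ?y) (at s)"
        unfolding w_def
        by (rule DERIV_cong[OF DERIV_mult[OF weight_line_derivative[OF r] du[OF r]]])
          (simp add: v_def w_def sum_distrib_left sum_distrib_right sum.distrib algebra_simps)
      then have d: "((\<lambda>s. complex_of_real (w (t + s *\<^sub>R axis j 1) * u (t + s *\<^sub>R axis j 1))) has_vector_derivative of_real (v ?y)) (at s)"
        by (rule has_vector_derivative_of_real)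
      show ?thesis
        using has_vector_derivative_mult[OF d smooth_line_derivative[OF g(1)]] by (simp add: add.commute)
    qed
    show "regular t \<longrightarrow> (\<exists>S. finite S \<and> continuous_on {0..1} (\<lambda>s. of_real (w (t + s *\<^sub>R axis j 1) * u (t + s *\<^sub>R axis j 1)) * g (t + s *\<^sub>R axis j 1)) \<and>
      (\<forall>s\<in>{0..1} - S. ((\<lambda>s. of_real (w (t + s *\<^sub>R axis j 1) * u (t + s *\<^sub>R axis j 1)) * g (t + s *\<^sub>R axis j 1)) has_vector_derivative
          of_real (v (t + s *\<^sub>R axis j 1)) * g (t + s *\<^sub>R axis j 1) +
          of_real (w (t + s *\<^sub>R axis j 1) * u (t + s *\<^sub>R axis j 1)) * partial j g (t + s *\<^sub>R axis j 1)) (at s)))"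
    proof (intro impI exI[of _ S] conjI ballI)
      show "finite S" by (simp add: S_def)
      show "continuous_on {0..1} (\<lambda>s. of_real (w (t + s *\<^sub>R axis j 1) * u (t + s *\<^sub>R axis j 1)) * g (t + s *\<^sub>R axis j 1))"
        by (intro continuous_on_mult continuous_on_of_real ci cw u cg)
    qed (use D reg in blast)
  qed
  then have "integral\<^sup>L lborel (\<lambda>t. of_real (v t) * g t) + integral\<^sup>L lborel (\<lambda>t. of_real (w t * u t) * partial j g t) = 0"
    unfolding Bochner_Integration.integral_add[OF i1 i2] .
  then show "integral\<^sup>L lborel (\<lambda>t. of_real (w t * u t) * partial j g t) = - integral\<^sup>L lborel (\<lambda>t. of_real (v t) * g t)"
    by (subst eq_neg_iff_add_eq_0, subst add.commute)
qed

lemma supported_in_partial: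
  fixes g :: "real^'n \<Rightarrow> complex"
  assumes g: "smooth g" and R: "supported_in R g"
  shows "supported_in R (partial j g)"
  unfolding supported_in_def
proof (intro allI impI)
  fix t :: "real^'n" assume "norm t > R"
  have o: "open {t::real^'n. norm t > R}" by (intro open_Collect_less continuous_intros)
  have "partial j g t = partial j (\<lambda>u. 0 * g u) t"
    using R \<open>norm t > R\<close> by (intro partial_cong_open[OF o]) (auto simp: supported_in_def)
  then show "partial j g t = 0" using partial_cmult[OF smooth_differentiable[OF g], of j 0 t] by simp
qed

lemma test_integrable_continuous:
  fixes u :: "real^'n \<Rightarrow> real"
  assumes "continuous_on UNIV u" shows "test_integrable R u"
proof -
  obtain C where "\<And>t. norm t \<le> R \<Longrightarrow> \<bar>u t\<bar> \<le> C" using continuous_bounded_cball[OF assms] by blast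
  then show ?thesis
    by (intro test_integrable_bounded[where C=C]) (auto intro: borel_measurable_continuous_onI assms)
qed

text \<open>The left side of \<open>adj\<close> is the adjoint of \<open>D\<^sub>j + c\<close>
  applied to \<open>u\<close>. The derivative of the weight contributes \<open>- 2 * coth\<close>
  and the adjoint reflection term \<open>coth (1 + s)\<close>; together they are
  \<open>- coth (1 - s)\<close>, so the adjoint is again of Cherednik form.\<close>

lemma integral_shift_op:
  fixes u u' v :: "real^'n::{finite,wellorder} \<Rightarrow> real" and g :: "real^'n::{finite,wellorder} \<Rightarrow> complex"
  assumes par: "a \<ge> 0" "b \<ge> 0" "\<iota> \<ge> 0"
    and u: "continuous_on UNIV u" and v: "continuous_on UNIV v" and u'm: "u' \<in> borel_measurable borel"
    and du: "\<And>t s. regular (t + s *\<^sub>R axis j 1) \<Longrightarrow> ((\<lambda>s. u (t + s *\<^sub>R axis j 1)) has_real_derivative u' (t + s *\<^sub>R axis j 1)) (at s)"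
    and bu': "\<And>t. regular t \<Longrightarrow> norm t \<le> R \<Longrightarrow> \<bar>u' t\<bar> \<le> C"
    and bgu: "\<And>t. regular t \<Longrightarrow> norm t \<le> R \<Longrightarrow> \<bar>(\<iota> * coth (2 * t $ j) + b * coth (t $ j)) * u t\<bar> \<le> C"
    and g: "smooth g" "supported_in R g"
    and adj: "\<And>t. regular t \<Longrightarrow>
      c * u t - u' t
      - a / 2 * (\<Sum>k\<in>UNIV - {j}. coth (t $ j - t $ k) * (u t - u (swap_coords j k t)) + ord_sign j k * u (swap_coords j k t)
          + coth (t $ j + t $ k) * (u t - u (neg_swap_coords j k t)) + u (neg_swap_coords j k t))
      - ((\<iota> * coth (2 * t $ j) + b * coth (t $ j)) * (u t - u (neg_coord j t)) + (\<iota> + b) * u (neg_coord j t)) = \<kappa> * v t"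
  shows "integral\<^sup>L lborel (\<lambda>t. of_real (weight a b \<iota> t * u t) * shift_op a b \<iota> (of_real c) j g t) =
    of_real \<kappa> * integral\<^sup>L lborel (\<lambda>t. of_real (weight a b \<iota> t * v t) * g t)"
proof -
  define w :: "real^'n::{finite,wellorder} \<Rightarrow> real" where "w = weight a b \<iota>"
  define gj where "gj t = \<iota> * coth (2 * t $ j) + b * coth (t $ j)" for t :: "real^'n::{finite,wellorder}"
  define cm where "cm k t = a / 2 * coth (t $ j - t $ k)" for k and t :: "real^'n::{finite,wellorder}"
  define cp where "cp k t = a / 2 * coth (t $ j + t $ k)" for k and t :: "real^'n::{finite,wellorder}"
  define K where "K = UNIV - {j}"
  have K: "k \<in> K \<Longrightarrow> j \<noteq> k" for k by (auto simp: K_def)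
  have cw: "continuous_on UNIV w" unfolding w_def by (rule continuous_weight[OF par])
  have [measurable]: "w \<in> borel_measurable borel" "u \<in> borel_measurable borel" "v \<in> borel_measurable borel"
    using cw u v by (auto intro: borel_measurable_continuous_onI)
  note cg = smooth_continuous[OF g(1)]
  have lc: "continuous_on UNIV s" if "linear s" for s :: "real^'n::{finite,wellorder} \<Rightarrow> real^'n::{finite,wellorder}"
    using that by (simp add: linear_continuous_on linear_conv_bounded_linear)
  have us: "continuous_on UNIV (\<lambda>t. u (s t))" if "linear s" for s :: "real^'n::{finite,wellorder} \<Rightarrow> real^'n::{finite,wellorder}"
    by (rule continuous_on_compose2[OF u lc[OF that]]) auto
  have tus: "test_integrable R (\<lambda>t. w t * u (s t))" if "linear s" for s :: "real^'n::{finite,wellorder} \<Rightarrow> real^'n::{finite,wellorder}"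
    by (intro test_integrable_continuous continuous_on_mult cw us that)
  have twu: "test_integrable R (\<lambda>t. w t * u t)"
    by (intro test_integrable_continuous continuous_on_mult cw u)
  define vm where "vm k t = w t * (cm k t * u t + cm k t * u (swap_coords j k t) - a / 2 * ord_sign j k * u (swap_coords j k t))" for k t
  define vp where "vp k t = w t * (cp k t * u t + cp k t * u (neg_swap_coords j k t) - a / 2 * u (neg_swap_coords j k t))" for k t
  define vs where "vs t = w t * (gj t * u t + gj t * u (neg_coord j t) - (\<iota> + b) * u (neg_coord j t))" for t
  define v0 where "v0 t = u' t * w t + (2 * (gj t * w t * u t) + (\<Sum>k\<in>K. 2 * (cm k t * w t * u t + cp k t * w t * u t)))" for t
  note G = cg g(2)
  have m: "integrable lborel (\<lambda>t. of_real (w t * u t) * refl_op (cm k) (a / 2 * ord_sign j k) (swap_coords j k) g t)"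
    "integrable lborel (\<lambda>t. of_real (vm k t) * g t)"
    "integral\<^sup>L lborel (\<lambda>t. of_real (w t * u t) * refl_op (cm k) (a / 2 * ord_sign j k) (swap_coords j k) g t) = integral\<^sup>L lborel (\<lambda>t. of_real (vm k t) * g t)"
    if k: "k \<in> K" for k
  proof -
    have c: "cm k (swap_coords j k t) = - cm k t" for t
      using K[OF k] coth_diff_commute[of "t $ k" "t $ j"] by (simp add: cm_def reflection_nth)
    have t1: "test_integrable R (\<lambda>t. cm k t * w t * u t)" "test_integrable R (\<lambda>t. cm k t * w t * u (swap_coords j k t))"
      unfolding cm_def w_def by (intro test_integrable_pair(1)[OF par K[OF k]] u us linear_swap_coords)+
    have w: "w (swap_coords j k t) = w t" for t unfolding w_def by (rule weight_swap)
    note r = integral_refl_op[OF linear_swap_coords norm_reflections(1) reflection_involution(1) w c t1 tus[OF linear_swap_coords] G]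
    show "integrable lborel (\<lambda>t. of_real (w t * u t) * refl_op (cm k) (a / 2 * ord_sign j k) (swap_coords j k) g t)"
      "integrable lborel (\<lambda>t. of_real (vm k t) * g t)"
      "integral\<^sup>L lborel (\<lambda>t. of_real (w t * u t) * refl_op (cm k) (a / 2 * ord_sign j k) (swap_coords j k) g t) = integral\<^sup>L lborel (\<lambda>t. of_real (vm k t) * g t)"
      unfolding vm_def by (rule r)+
  qed
  have p: "integrable lborel (\<lambda>t. of_real (w t * u t) * refl_op (cp k) (a / 2) (neg_swap_coords j k) g t)"
    "integrable lborel (\<lambda>t. of_real (vp k t) * g t)"
    "integral\<^sup>L lborel (\<lambda>t. of_real (w t * u t) * refl_op (cp k) (a / 2) (neg_swap_coords j k) g t) = integral\<^sup>L lborel (\<lambda>t. of_real (vp k t) * g t)"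
    if k: "k \<in> K" for k
  proof -
    have c: "cp k (neg_swap_coords j k t) = - cp k t" for t
      using K[OF k] coth_minus[of "t $ k + t $ j"] by (simp add: cp_def reflection_nth add.commute)
    have t1: "test_integrable R (\<lambda>t. cp k t * w t * u t)" "test_integrable R (\<lambda>t. cp k t * w t * u (neg_swap_coords j k t))"
      unfolding cp_def w_def by (intro test_integrable_pair(2)[OF par K[OF k]] u us linear_neg_swap_coords)+
    have w: "w (neg_swap_coords j k t) = w t" for t unfolding w_def by (rule weight_neg_swap[OF K[OF k]])
    note r = integral_refl_op[OF linear_neg_swap_coords norm_reflections(2)[OF K[OF k]] reflection_involution(2)[OF K[OF k]] w c t1 tus[OF linear_neg_swap_coords] G]
    show "integrable lborel (\<lambda>t. of_real (w t * u t) * refl_op (cp k) (a / 2) (neg_swap_coords j k) g t)"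
      "integrable lborel (\<lambda>t. of_real (vp k t) * g t)"
      "integral\<^sup>L lborel (\<lambda>t. of_real (w t * u t) * refl_op (cp k) (a / 2) (neg_swap_coords j k) g t) = integral\<^sup>L lborel (\<lambda>t. of_real (vp k t) * g t)"
      unfolding vp_def by (rule r)+
  qed
  obtain Cw where Cw: "Cw \<ge> 0" "\<And>t. norm t \<le> R \<Longrightarrow> \<bar>w t\<bar> \<le> Cw" using continuous_bounded_cball[OF cw] by blast
  have gjm [measurable]: "gj \<in> borel_measurable borel" unfolding gj_def[abs_def] by measurable
  have bs: "\<bar>gj t * w t * u t\<bar> \<le> C * Cw" if "regular t" "norm t \<le> R" for t
  proof -
    have "\<bar>gj t * u t\<bar> * \<bar>w t\<bar> \<le> C * Cw"
      using bgu[OF that] Cw that unfolding gj_def by (intro mult_mono) auto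
    then show ?thesis by (simp add: abs_mult mult_ac)
  qed
  have gn: "gj (neg_coord j t) = - gj t" for t by (simp add: gj_def reflection_nth)
  have wn: "w (neg_coord j t) = w t" for t unfolding w_def by (rule weight_neg_coord)
  have s: "integrable lborel (\<lambda>t. of_real (w t * u t) * refl_op gj (\<iota> + b) (neg_coord j) g t)"
    "integrable lborel (\<lambda>t. of_real (vs t) * g t)"
    "integral\<^sup>L lborel (\<lambda>t. of_real (w t * u t) * refl_op gj (\<iota> + b) (neg_coord j) g t) = integral\<^sup>L lborel (\<lambda>t. of_real (vs t) * g t)"
  proof -
    have [measurable]: "(\<lambda>t. u (neg_coord j t)) \<in> borel_measurable borel"
      by (intro borel_measurable_continuous_onI us linear_neg_coord)
    have t1: "test_integrable R (\<lambda>t. gj t * w t * u t)" by (rule test_integrable_bounded[OF _ bs]) measurable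
    have t2: "test_integrable R (\<lambda>t. gj t * w t * u (neg_coord j t))"
    proof (rule test_integrable_bounded[where C="C * Cw"])
      fix t :: "real^'n::{finite,wellorder}" assume "regular t" "norm t \<le> R"
      then show "\<bar>gj t * w t * u (neg_coord j t)\<bar> \<le> C * Cw"
        using bs[of "neg_coord j t"] by (simp add: gn wn regular_reflections)
    qed measurable
    note r = integral_refl_op[OF linear_neg_coord norm_reflections(3) reflection_involution(3) wn gn t1 t2 tus[OF linear_neg_coord] G]
    show "integrable lborel (\<lambda>t. of_real (w t * u t) * refl_op gj (\<iota> + b) (neg_coord j) g t)"
      "integrable lborel (\<lambda>t. of_real (vs t) * g t)"
      "integral\<^sup>L lborel (\<lambda>t. of_real (w t * u t) * refl_op gj (\<iota> + b) (neg_coord j) g t) = integral\<^sup>L lborel (\<lambda>t. of_real (vs t) * g t)"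
      unfolding vs_def by (rule r)+
  qed
  note q = integral_weight_partial[OF par u u'm du bu' bgu g supported_in_partial[OF g],
      folded w_def gj_def, folded cm_def cp_def K_def, folded v0_def]
  have wu: "integrable lborel (\<lambda>t. of_real (w t * u t) * g t)" using twu G by (simp only: test_integrable_def)
  \<comment> \<open>The common value of two integrals: \<open>?L\<close> is the integrand before and
    \<open>?M\<close> after each term has been moved to \<open>u\<close> separately.\<close>
  let ?X = "- integral\<^sup>L lborel (\<lambda>t. of_real (v0 t) * g t)
    + (\<Sum>k\<in>K. integral\<^sup>L lborel (\<lambda>t. of_real (vm k t) * g t) + integral\<^sup>L lborel (\<lambda>t. of_real (vp k t) * g t))
    + integral\<^sup>L lborel (\<lambda>t. of_real (vs t) * g t) + of_real c * integral\<^sup>L lborel (\<lambda>t. of_real (w t * u t) * g t)"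
  let ?L = "\<lambda>t. of_real (w t * u t) * partial j g t
    + (\<Sum>k\<in>K. of_real (w t * u t) * refl_op (cm k) (a / 2 * ord_sign j k) (swap_coords j k) g t
        + of_real (w t * u t) * refl_op (cp k) (a / 2) (neg_swap_coords j k) g t)
    + of_real (w t * u t) * refl_op gj (\<iota> + b) (neg_coord j) g t + of_real c * (of_real (w t * u t) * g t)"
  let ?M = "\<lambda>t. - (of_real (v0 t) * g t)
    + (\<Sum>k\<in>K. of_real (vm k t) * g t + of_real (vp k t) * g t)
    + of_real (vs t) * g t + of_real c * (of_real (w t * u t) * g t)"
  have hbi: "has_bochner_integral lborel f x" if "integrable lborel f" "integral\<^sup>L lborel f = x" for f :: "real^'n::{finite,wellorder} \<Rightarrow> complex" and x
    using that has_bochner_integral_integrable by blast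
  have HL: "has_bochner_integral lborel ?L ?X"
    by (intro has_bochner_integral_add has_bochner_integral_sum has_bochner_integral_mult_right hbi q(2,3) m p s wu refl)
  have HM: "has_bochner_integral lborel ?M ?X"
    by (intro has_bochner_integral_add has_bochner_integral_sum has_bochner_integral_mult_right has_bochner_integral_minus hbi q(1) m(2) p(2) s(2) wu refl)
  have "integral\<^sup>L lborel (\<lambda>t. of_real (w t * u t) * shift_op a b \<iota> (of_real c) j g t) = integral\<^sup>L lborel ?L"
  proof (rule integral_cong_AE)
    have "continuous_on UNIV (\<lambda>t. of_real (w t * u t) * shift_op a b \<iota> (of_real c) j g t)"
      by (intro continuous_on_mult continuous_on_of_real cw u smooth_continuous smooth_shift_op g)
    then show "(\<lambda>t. of_real (w t * u t) * shift_op a b \<iota> (of_real c) j g t) \<in> borel_measurable lborel"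
      by (simp add: borel_measurable_continuous_onI)
    show "?L \<in> borel_measurable lborel" using HL by (rule borel_measurable_has_bochner_integral)
    show "AE t in lborel. of_real (w t * u t) * shift_op a b \<iota> (of_real c) j g t = ?L t"
      using AE_regular
    proof eventually_elim
      case (elim t)
      have "dunkl_part a b \<iota> j g t = (\<Sum>k\<in>K. refl_op (cm k) (a / 2 * ord_sign j k) (swap_coords j k) g t
          + refl_op (cp k) (a / 2) (neg_swap_coords j k) g t) + refl_op gj (\<iota> + b) (neg_coord j) g t"
        unfolding dunkl_part_def K_def sum_distrib_left
        by (intro arg_cong2[of _ _ _ _ "(+)"] sum.cong refl)
          (simp_all add: pair_op_def minus_op_def plus_op_def sign_op_def refl_op_def cm_def cp_def gj_def algebra_simps add_divide_distrib diff_divide_distrib)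
      then show ?case
        unfolding shift_op_def cherednik_regular[OF elim] by (simp add: distrib_left sum_distrib_left)
    qed
  qed
  also have "\<dots> = ?X" using HL by (rule has_bochner_integral_integral_eq)
  also have "\<dots> = integral\<^sup>L lborel ?M" using HM by (rule has_bochner_integral_integral_eq[symmetric])
  also have "\<dots> = integral\<^sup>L lborel (\<lambda>t. of_real \<kappa> * (of_real (w t * v t) * g t))"
  proof (rule integral_cong_AE)
    show "?M \<in> borel_measurable lborel" using HM by (rule borel_measurable_has_bochner_integral)
    have [measurable]: "g \<in> borel_measurable borel" by (rule borel_measurable_continuous_onI[OF cg])
    show "(\<lambda>t. of_real \<kappa> * (of_real (w t * v t) * g t)) \<in> borel_measurable lborel" by measurable
    show "AE t in lborel. ?M t = of_real \<kappa> * (of_real (w t * v t) * g t)"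
      using AE_regular
    proof eventually_elim
      case (elim t)
      have "- v0 t + (\<Sum>k\<in>K. vm k t + vp k t) + vs t + c * (w t * u t) = w t * (\<kappa> * v t)"
        unfolding adj[OF elim, symmetric] v0_def vm_def vp_def vs_def gj_def[symmetric] K_def[symmetric] cm_def cp_def
        by (simp add: sum_distrib_left sum.distrib sum_subtractf algebra_simps flip: sum_negf) (simp add: sum_negf)
      note e = this
      have "?M t = complex_of_real (- v0 t + (\<Sum>k\<in>K. vm k t + vp k t) + vs t + c * (w t * u t)) * g t"
        by (simp add: algebra_simps sum_distrib_left)
      then show ?case unfolding e by (simp add: mult_ac)
    qed
  qed
  finally show ?thesis by (simp add: w_def)
qed

subsection \<open>Action on powers of SH\<close>

text \<open>The state \<open>n\<close> counts the factors acquired by a coordinate: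
  \<open>\<bar>sinh x\<bar> powr \<delta>\<close> times \<open>1\<close>, then
  \<open>1 - coth x\<close>, then \<open>(1 - coth x) * (- 1 - coth x)\<close>. Avoiding coth in the
  formulas makes them continuous at \<open>x = 0\<close>; \<open>profile_deriv\<close> and
  \<open>profile_coth\<close> extend the derivative and the product with coth in the same
  way.\<close>

definition profile :: "real \<Rightarrow> nat \<Rightarrow> real \<Rightarrow> real" where
  "profile \<delta> n x = (if n = 0 then \<bar>sinh x\<bar> powr \<delta>
     else if n = 1 then \<bar>sinh x\<bar> powr \<delta> - sinh x * cosh x * \<bar>sinh x\<bar> powr (\<delta> - 2)
     else \<bar>sinh x\<bar> powr (\<delta> - 2))"

definition profile_deriv :: "real \<Rightarrow> nat \<Rightarrow> real \<Rightarrow> real" where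
  "profile_deriv \<delta> n x = (if n = 0 then \<delta> * (sinh x * cosh x * \<bar>sinh x\<bar> powr (\<delta> - 2))
     else if n = 1 then \<bar>sinh x\<bar> powr (\<delta> - 2) + \<delta> * (sinh x * cosh x * \<bar>sinh x\<bar> powr (\<delta> - 2) - (cosh x)\<^sup>2 * \<bar>sinh x\<bar> powr (\<delta> - 2))
     else (\<delta> - 2) * (sinh x * cosh x * \<bar>sinh x\<bar> powr (\<delta> - 4)))"

definition profile_coth :: "real \<Rightarrow> nat \<Rightarrow> real \<Rightarrow> real" where
  "profile_coth \<delta> n x = (if n = 0 then sinh x * cosh x * \<bar>sinh x\<bar> powr (\<delta> - 2)
     else if n = 1 then sinh x * cosh x * \<bar>sinh x\<bar> powr (\<delta> - 2) - (cosh x)\<^sup>2 * \<bar>sinh x\<bar> powr (\<delta> - 2)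
     else sinh x * cosh x * \<bar>sinh x\<bar> powr (\<delta> - 4))"

definition profile_factor :: "nat \<Rightarrow> real \<Rightarrow> real" where
  "profile_factor n c = (if n = 0 then 1 else if n = 1 then 1 - c else c\<^sup>2 - 1)"

lemma continuous_abs_sinh_powr:
  assumes "p > 0" "continuous_on S f"
  shows "continuous_on S (\<lambda>t. \<bar>sinh (f t :: real)\<bar> powr p)"
  using assms by (intro continuous_on_powr' continuous_intros) auto

text \<open>The lowest exponent is \<open>\<delta> - 4\<close>, in the derivative and the coth
  multiple of the last state; this is the origin of the bound on \<delta>.\<close>

lemma continuous_profile:
  assumes "\<delta> > 4" "continuous_on S f"
  shows "continuous_on S (\<lambda>t. profile \<delta> n (f t))" "continuous_on S (\<lambda>t. profile_deriv \<delta> n (f t))" "continuous_on S (\<lambda>t. profile_coth \<delta> n (f t))"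
  unfolding profile_def profile_deriv_def profile_coth_def
  by (cases "n = 0"; cases "n = 1"; insert assms; auto intro!: continuous_intros continuous_abs_sinh_powr)+

lemma abs_sinh_powr_shift:
  fixes x p :: real
  assumes "x \<noteq> 0"
  shows "\<bar>sinh x\<bar> powr (p - 2) = ((coth x)\<^sup>2 - 1) * \<bar>sinh x\<bar> powr p"
    and "sinh x * cosh x * \<bar>sinh x\<bar> powr (p - 2) = coth x * \<bar>sinh x\<bar> powr p"
    and "(cosh x)\<^sup>2 * \<bar>sinh x\<bar> powr (p - 2) = (coth x)\<^sup>2 * \<bar>sinh x\<bar> powr p"
proof -
  have s: "sinh x \<noteq> 0" using assms by simp
  have p: "\<bar>sinh x\<bar> powr p = \<bar>sinh x\<bar> powr (p - 2) * (sinh x)\<^sup>2"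
    using powr_add[of "\<bar>sinh x\<bar>" "p - 2" 2] s by simp
  have c: "(cosh x)\<^sup>2 = (sinh x)\<^sup>2 + 1" by (rule cosh_square_eq)
  show "\<bar>sinh x\<bar> powr (p - 2) = ((coth x)\<^sup>2 - 1) * \<bar>sinh x\<bar> powr p"
    using s by (simp add: p coth_def power_divide c field_simps)
  show "sinh x * cosh x * \<bar>sinh x\<bar> powr (p - 2) = coth x * \<bar>sinh x\<bar> powr p"
    using s by (simp add: p coth_def power2_eq_square)
  show "(cosh x)\<^sup>2 * \<bar>sinh x\<bar> powr (p - 2) = (coth x)\<^sup>2 * \<bar>sinh x\<bar> powr p"
    using s by (simp add: p coth_def power_divide)
qed

lemma profile_eq:
  assumes "x \<noteq> 0"
  shows "profile \<delta> n x = profile_factor n (coth x) * \<bar>sinh x\<bar> powr \<delta>"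
  unfolding profile_def profile_factor_def abs_sinh_powr_shift(2,3)[OF assms] unfolding abs_sinh_powr_shift(1)[OF assms] by (simp add: algebra_simps)

lemma profile_coth_eq:
  assumes "x \<noteq> 0"
  shows "profile_coth \<delta> n x = coth x * profile \<delta> n x"
proof -
  have 4: "sinh x * cosh x * \<bar>sinh x\<bar> powr (\<delta> - 4) = coth x * \<bar>sinh x\<bar> powr (\<delta> - 2)"
    using abs_sinh_powr_shift(2)[OF assms, of "\<delta> - 2"] by simp
  show ?thesis
    unfolding profile_def profile_coth_def 4 abs_sinh_powr_shift(2,3)[OF assms] by (simp add: algebra_simps power2_eq_square)
qed

lemma profile_deriv_eq:
  assumes "x \<noteq> 0"
  shows "profile_deriv \<delta> n x = (if n = 0 then \<delta> * coth x
     else if n = 1 then (coth x)\<^sup>2 - 1 + \<delta> * coth x * (1 - coth x) else (\<delta> - 2) * coth x * ((coth x)\<^sup>2 - 1)) * \<bar>sinh x\<bar> powr \<delta>"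
proof -
  have 4: "sinh x * cosh x * \<bar>sinh x\<bar> powr (\<delta> - 4) = coth x * \<bar>sinh x\<bar> powr (\<delta> - 2)"
    using abs_sinh_powr_shift(2)[OF assms, of "\<delta> - 2"] by simp
  show ?thesis
    unfolding profile_deriv_def 4 abs_sinh_powr_shift(2,3)[OF assms] unfolding abs_sinh_powr_shift(1)[OF assms] by (simp add: algebra_simps power2_eq_square)
qed

lemma profile_has_derivative:
  assumes x: "x \<noteq> 0"
  shows "(profile \<delta> n has_real_derivative profile_deriv \<delta> n x) (at x)"
proof -
  have dc: "(coth has_real_derivative (1 - (coth x)\<^sup>2)) (at x)"
    using coth_has_derivative[of "\<lambda>x. x" "\<lambda>x. x" x] x by (simp add: has_field_derivative_def has_derivative_ident)
  have dp: "((\<lambda>x. \<bar>sinh x\<bar> powr p) has_real_derivative p * coth x * \<bar>sinh x\<bar> powr p) (at x)" for p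
  proof -
    have "((\<lambda>x. exp (p * ln \<bar>sinh x\<bar>)) has_real_derivative exp (p * ln \<bar>sinh x\<bar>) * (p * coth x)) (at x)"
    proof (cases "x > 0")
      case True
      have "((\<lambda>x. exp (p * ln (sinh x))) has_real_derivative exp (p * ln (sinh x)) * (p * coth x)) (at x)"
        using True by (auto intro!: derivative_eq_intros simp: coth_def)
      then have "((\<lambda>x. exp (p * ln \<bar>sinh x\<bar>)) has_real_derivative exp (p * ln (sinh x)) * (p * coth x)) (at x)"
        by (rule has_field_derivative_transform_within_open[where S="{0<..}"]) (use True in auto)
      then show ?thesis using True by simp
    next
      case False
      have "((\<lambda>x. exp (p * ln (- sinh x))) has_real_derivative exp (p * ln (- sinh x)) * (p * coth x)) (at x)"
        using False x by (auto intro!: derivative_eq_intros simp: coth_def)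
      then have "((\<lambda>x. exp (p * ln \<bar>sinh x\<bar>)) has_real_derivative exp (p * ln (- sinh x)) * (p * coth x)) (at x)"
        by (rule has_field_derivative_transform_within_open[where S="{..<0}"]) (use False x in auto)
      then show ?thesis using False x by simp
    qed
    then have "((\<lambda>x. \<bar>sinh x\<bar> powr p) has_real_derivative exp (p * ln \<bar>sinh x\<bar>) * (p * coth x)) (at x)"
      by (rule has_field_derivative_transform_within_open[where S="UNIV - {0}"]) (use x in \<open>auto simp: powr_def open_delete\<close>)
    then show ?thesis using x by (simp add: powr_def mult_ac)
  qed
  consider "n = 0" | "n = 1" | "n \<noteq> 0" "n \<noteq> 1" by blast
  then show ?thesis
  proof cases
    case 1
    then show ?thesis using dp[of \<delta>] by (simp add: profile_def[abs_def] profile_deriv_eq[OF x])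
  next
    case 2
    have "((\<lambda>x. (1 - coth x) * \<bar>sinh x\<bar> powr \<delta>) has_real_derivative profile_deriv \<delta> n x) (at x)"
      unfolding profile_deriv_eq[OF x] 2
      by (rule DERIV_cong[OF DERIV_mult[OF DERIV_diff[OF DERIV_const dc] dp]]) (simp add: algebra_simps)
    then show ?thesis
      by (rule has_field_derivative_transform_within_open[where S="UNIV - {0}"]) (use x 2 in \<open>auto simp: profile_eq profile_factor_def open_delete\<close>)
  next
    case 3
    then show ?thesis
      using dp[of "\<delta> - 2"] by (simp add: profile_def[abs_def] profile_deriv_eq[OF x] abs_sinh_powr_shift(1)[OF x] mult.assoc)
  qed
qed

definition profile_prod :: "real \<Rightarrow> ('n \<Rightarrow> nat) \<Rightarrow> real^'n \<Rightarrow> real" where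
  "profile_prod \<delta> n t = (\<Prod>i\<in>UNIV. profile \<delta> (n i) (t $ i))"

lemma continuous_profile_prod: "\<delta> > 4 \<Longrightarrow> continuous_on UNIV (profile_prod \<delta> n)"
  unfolding profile_prod_def[abs_def] by (intro continuous_on_prod continuous_profile) (auto intro: continuous_intros)

lemma coth_double: "x \<noteq> 0 \<Longrightarrow> coth (2 * x) = (coth x + tanh x) / 2"
  unfolding coth_def tanh_def sinh_double cosh_double by (simp add: field_simps power2_eq_square)

lemma profile_prod_remove: "profile_prod \<delta> n t = profile \<delta> (n j) (t $ j) * (\<Prod>i\<in>UNIV - {j}. profile \<delta> (n i) (t $ i))"
  unfolding profile_prod_def by (rule prod.remove) auto

text \<open>Continuity of the profiles provides all analytic hypotheses of
  \<open>integral_shift_op\<close>, so that only the algebraic identity \<open>adj\<close> remains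
  to be checked.\<close>

lemma integral_shift_op_profile:
  fixes g :: "real^'n::{finite,wellorder} \<Rightarrow> complex"
  assumes par: "a \<ge> 0" "b \<ge> 0" "\<iota> \<ge> 0" and \<delta>: "\<delta> > 4" and g: "smooth g" "supported_in R g"
    and adj: "\<And>t. regular t \<Longrightarrow>
      c * profile_prod \<delta> n t - profile_deriv \<delta> (n j) (t $ j) * (\<Prod>i\<in>UNIV - {j}. profile \<delta> (n i) (t $ i))
      - a / 2 * (\<Sum>k\<in>UNIV - {j}. coth (t $ j - t $ k) * (profile_prod \<delta> n t - profile_prod \<delta> n (swap_coords j k t))
          + ord_sign j k * profile_prod \<delta> n (swap_coords j k t)
          + coth (t $ j + t $ k) * (profile_prod \<delta> n t - profile_prod \<delta> n (neg_swap_coords j k t)) + profile_prod \<delta> n (neg_swap_coords j k t))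
      - ((\<iota> * coth (2 * t $ j) + b * coth (t $ j)) * (profile_prod \<delta> n t - profile_prod \<delta> n (neg_coord j t)) + (\<iota> + b) * profile_prod \<delta> n (neg_coord j t))
      = \<kappa> * profile_prod \<delta> n' t"
  shows "integral\<^sup>L lborel (\<lambda>t. of_real (weight a b \<iota> t * profile_prod \<delta> n t) * shift_op a b \<iota> (of_real c) j g t) =
    of_real \<kappa> * integral\<^sup>L lborel (\<lambda>t. of_real (weight a b \<iota> t * profile_prod \<delta> n' t) * g t)"
proof -
  define u' where "u' t = profile_deriv \<delta> (n j) (t $ j) * (\<Prod>i\<in>UNIV - {j}. profile \<delta> (n i) (t $ i))" for t :: "real^'n::{finite,wellorder}"
  \<comment> \<open>The continuous extension of \<open>(\<iota> * coth (2 * t $ j) + b * coth (t $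
    j)) * profile_prod \<delta> n t\<close>, by means of
    \<open>coth (2 * x) = (coth x + tanh x) / 2\<close>.\<close>
  define B where "B t = (\<iota> * ((profile_coth \<delta> (n j) (t $ j) + tanh (t $ j) * profile \<delta> (n j) (t $ j)) / 2) + b * profile_coth \<delta> (n j) (t $ j))
      * (\<Prod>i\<in>UNIV - {j}. profile \<delta> (n i) (t $ i))" for t :: "real^'n::{finite,wellorder}"
  have cu': "continuous_on UNIV u'"
    unfolding u'_def[abs_def] by (intro continuous_on_mult continuous_on_prod continuous_profile \<delta> continuous_intros)
  have "continuous_on UNIV B"
    unfolding B_def[abs_def] using cosh_real_nonzero by (intro continuous_on_mult continuous_on_prod continuous_profile \<delta> continuous_intros) auto
  then obtain C2 where C2: "\<And>t. norm t \<le> R \<Longrightarrow> \<bar>B t\<bar> \<le> C2" using continuous_bounded_cball by blast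
  obtain C1 where C1: "\<And>t. norm t \<le> R \<Longrightarrow> \<bar>u' t\<bar> \<le> C1" using continuous_bounded_cball[OF cu'] by blast
  show ?thesis
  proof (rule integral_shift_op[where u'=u' and C="max C1 C2", OF par continuous_profile_prod[OF \<delta>] continuous_profile_prod[OF \<delta>] _ _ _ _ g])
    show "u' \<in> borel_measurable borel" by (rule borel_measurable_continuous_onI[OF cu'])
    show "\<bar>u' t\<bar> \<le> max C1 C2" if "norm t \<le> R" for t using C1[OF that] by simp
    show "\<bar>(\<iota> * coth (2 * t $ j) + b * coth (t $ j)) * profile_prod \<delta> n t\<bar> \<le> max C1 C2" if "regular t" "norm t \<le> R" for t
    proof -
      have x: "t $ j \<noteq> 0" using regularD(1)[OF that(1)] .
      have "(\<iota> * coth (2 * t $ j) + b * coth (t $ j)) * profile_prod \<delta> n t = B t"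
        unfolding profile_prod_remove[of \<delta> n t j] B_def coth_double[OF x] profile_coth_eq[OF x] by (simp add: algebra_simps add_divide_distrib)
      then show ?thesis using C2[OF that(2)] by simp
    qed
    show "((\<lambda>s. profile_prod \<delta> n (t + s *\<^sub>R axis j 1)) has_real_derivative u' (t + s *\<^sub>R axis j 1)) (at s)"
      if r: "regular (t + s *\<^sub>R axis j 1)" for t s
    proof -
      have x: "t $ j + s \<noteq> 0" using regularD(1)[OF r, of j] by (simp add: axis_def)
      have "((\<lambda>s. profile \<delta> (n j) (t $ j + s)) has_real_derivative profile_deriv \<delta> (n j) (t $ j + s) * 1) (at s)"
        by (rule DERIV_chain2[where g="\<lambda>s. t $ j + s", OF profile_has_derivative[OF x]]) (auto intro!: derivative_eq_intros)
      then have "((\<lambda>s. profile \<delta> (n j) (t $ j + s) * (\<Prod>i\<in>UNIV - {j}. profile \<delta> (n i) (t $ i))) has_real_derivative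
          profile_deriv \<delta> (n j) (t $ j + s) * 1 * (\<Prod>i\<in>UNIV - {j}. profile \<delta> (n i) (t $ i))) (at s)"
        by (rule DERIV_cmult_right)
      moreover have "(\<Prod>i\<in>UNIV - {j}. profile \<delta> (n i) ((t + s *\<^sub>R axis j 1) $ i)) = (\<Prod>i\<in>UNIV - {j}. profile \<delta> (n i) (t $ i))" for s
        by (intro prod.cong refl) (auto simp: axis_def)
      ultimately show ?thesis
        unfolding profile_prod_remove[of \<delta> n _ j] u'_def by (simp add: axis_def)
    qed
    show "c * profile_prod \<delta> n t - u' t
      - a / 2 * (\<Sum>k\<in>UNIV - {j}. coth (t $ j - t $ k) * (profile_prod \<delta> n t - profile_prod \<delta> n (swap_coords j k t))
          + ord_sign j k * profile_prod \<delta> n (swap_coords j k t)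
          + coth (t $ j + t $ k) * (profile_prod \<delta> n t - profile_prod \<delta> n (neg_swap_coords j k t)) + profile_prod \<delta> n (neg_swap_coords j k t))
      - ((\<iota> * coth (2 * t $ j) + b * coth (t $ j)) * (profile_prod \<delta> n t - profile_prod \<delta> n (neg_coord j t)) + (\<iota> + b) * profile_prod \<delta> n (neg_coord j t))
      = \<kappa> * profile_prod \<delta> n' t" if "regular t" for t
      using adj[OF that] unfolding u'_def .
  qed
qed

lemma coth_add_mult: "x \<noteq> 0 \<Longrightarrow> y \<noteq> 0 \<Longrightarrow> x + y \<noteq> 0 \<Longrightarrow> coth (x + y) * (coth x + coth y) = 1 + coth x * coth y"
  using coth_add_relation[of x y] by simp

lemma coth_diff_mult: "x \<noteq> 0 \<Longrightarrow> y \<noteq> 0 \<Longrightarrow> x - y \<noteq> 0 \<Longrightarrow> coth (x - y) * (coth x - coth y) = 1 - coth x * coth y"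
  using coth_add_mult[of x "- y"] by simp

text \<open>The power of \<open>\<bar>SH t\<bar>\<close> and the factors of the other coordinates
  are invariant, so a reflection only acts on the two profile factors of \<open>j\<close> and
  \<open>k\<close>.\<close>

lemma profile_prod_reflections:
  fixes t :: "real^'n" and \<delta> :: real and n :: "'n \<Rightarrow> nat"
  assumes reg: "regular t" and jk: "j \<noteq> k"
  defines "F \<equiv> (\<Prod>i\<in>UNIV. \<bar>sinh (t $ i)\<bar> powr \<delta>)"
    and "Q \<equiv> (\<Prod>i\<in>UNIV - {j} - {k}. profile_factor (n i) (coth (t $ i)))"
  shows "profile_prod \<delta> n t = profile_factor (n j) (coth (t $ j)) * profile_factor (n k) (coth (t $ k)) * (Q * F)"
    and "profile_prod \<delta> n (swap_coords j k t) = profile_factor (n j) (coth (t $ k)) * profile_factor (n k) (coth (t $ j)) * (Q * F)"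
    and "profile_prod \<delta> n (neg_swap_coords j k t) = profile_factor (n j) (- coth (t $ k)) * profile_factor (n k) (- coth (t $ j)) * (Q * F)"
proof -
  have sp: "(\<Prod>i\<in>UNIV. G i) = G j * (G k * (\<Prod>i\<in>UNIV - {j} - {k}. G i))" for G :: "_ \<Rightarrow> real"
    using jk by (simp add: prod.remove[of UNIV j] prod.remove[of "UNIV - {j}" k])
  have pe: "profile_prod \<delta> n y = (\<Prod>i\<in>UNIV. profile_factor (n i) (coth (y $ i))) * (\<Prod>i\<in>UNIV. \<bar>sinh (y $ i)\<bar> powr \<delta>)" if "regular y" for y
    unfolding profile_prod_def using regularD(1)[OF that] by (simp add: profile_eq prod.distrib)
  show "profile_prod \<delta> n t = profile_factor (n j) (coth (t $ j)) * profile_factor (n k) (coth (t $ k)) * (Q * F)"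
    unfolding pe[OF reg] Q_def F_def sp[of "\<lambda>i. profile_factor (n i) (coth (t $ i))"] by simp
  have Q: "(\<Prod>i\<in>UNIV - {j} - {k}. profile_factor (n i) (coth (swap_coords j k t $ i))) = Q"
    "(\<Prod>i\<in>UNIV - {j} - {k}. profile_factor (n i) (coth (neg_swap_coords j k t $ i))) = Q"
    unfolding Q_def by (intro prod.cong refl; simp add: reflection_nth)+
  have F: "(\<Prod>i\<in>UNIV. \<bar>sinh (swap_coords j k t $ i)\<bar> powr \<delta>) = F" "(\<Prod>i\<in>UNIV. \<bar>sinh (neg_swap_coords j k t $ i)\<bar> powr \<delta>) = F"
  proof -
    have R: "(\<Prod>i\<in>UNIV - {j} - {k}. \<bar>sinh (swap_coords j k t $ i)\<bar> powr \<delta>) = (\<Prod>i\<in>UNIV - {j} - {k}. \<bar>sinh (t $ i)\<bar> powr \<delta>)"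
      "(\<Prod>i\<in>UNIV - {j} - {k}. \<bar>sinh (neg_swap_coords j k t $ i)\<bar> powr \<delta>) = (\<Prod>i\<in>UNIV - {j} - {k}. \<bar>sinh (t $ i)\<bar> powr \<delta>)"
      by (intro prod.cong refl; simp add: reflection_nth)+
    show "(\<Prod>i\<in>UNIV. \<bar>sinh (swap_coords j k t $ i)\<bar> powr \<delta>) = F" "(\<Prod>i\<in>UNIV. \<bar>sinh (neg_swap_coords j k t $ i)\<bar> powr \<delta>) = F"
      unfolding F_def sp[of "\<lambda>i. \<bar>sinh (swap_coords j k t $ i)\<bar> powr \<delta>"] sp[of "\<lambda>i. \<bar>sinh (neg_swap_coords j k t $ i)\<bar> powr \<delta>"]
        sp[of "\<lambda>i. \<bar>sinh (t $ i)\<bar> powr \<delta>"] R using jk by (simp_all add: reflection_nth)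
  qed
  show "profile_prod \<delta> n (swap_coords j k t) = profile_factor (n j) (coth (t $ k)) * profile_factor (n k) (coth (t $ j)) * (Q * F)"
    unfolding pe[OF regular_reflections(1)[OF reg]] F sp[of "\<lambda>i. profile_factor (n i) (coth (swap_coords j k t $ i))"] Q
    using jk by (simp add: reflection_nth)
  show "profile_prod \<delta> n (neg_swap_coords j k t) = profile_factor (n j) (- coth (t $ k)) * profile_factor (n k) (- coth (t $ j)) * (Q * F)"
    unfolding pe[OF regular_reflections(2)[OF reg jk]] F sp[of "\<lambda>i. profile_factor (n i) (coth (neg_swap_coords j k t $ i))"] Q
    using jk by (simp add: reflection_nth)
qed

lemma profile_prod_neg:
  fixes t :: "real^'n" and \<delta> :: real and n :: "'n \<Rightarrow> nat"
  assumes reg: "regular t"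
  shows "profile_prod \<delta> n t = profile_factor (n j) (coth (t $ j)) * (\<bar>sinh (t $ j)\<bar> powr \<delta> * (\<Prod>i\<in>UNIV - {j}. profile \<delta> (n i) (t $ i)))"
    and "profile_prod \<delta> n (neg_coord j t) = profile_factor (n j) (- coth (t $ j)) * (\<bar>sinh (t $ j)\<bar> powr \<delta> * (\<Prod>i\<in>UNIV - {j}. profile \<delta> (n i) (t $ i)))"
proof -
  have x: "t $ j \<noteq> 0" "- (t $ j) \<noteq> 0" using regularD(1)[OF reg] by auto
  have R: "(\<Prod>i\<in>UNIV - {j}. profile \<delta> (n i) (neg_coord j t $ i)) = (\<Prod>i\<in>UNIV - {j}. profile \<delta> (n i) (t $ i))"
    by (intro prod.cong refl) (simp add: reflection_nth)
  show "profile_prod \<delta> n t = profile_factor (n j) (coth (t $ j)) * (\<bar>sinh (t $ j)\<bar> powr \<delta> * (\<Prod>i\<in>UNIV - {j}. profile \<delta> (n i) (t $ i)))"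
    unfolding profile_prod_remove[of \<delta> n t j] profile_eq[OF x(1)] by simp
  show "profile_prod \<delta> n (neg_coord j t) = profile_factor (n j) (- coth (t $ j)) * (\<bar>sinh (t $ j)\<bar> powr \<delta> * (\<Prod>i\<in>UNIV - {j}. profile \<delta> (n i) (t $ i)))"
    unfolding profile_prod_remove[of \<delta> n "neg_coord j t" j] R using profile_eq[OF x(2)] by (simp add: reflection_nth)
qed

text \<open>These are the four constellations met by the recursion: the first two in the first
  stage, the last two in the second one. In each the addition theorem removes the coth of sums and
  differences, and what is left is the profile product times a constant or
  \<open>2 * coth (t $ j)\<close>.\<close>

lemma profile_pair_terms:
  fixes t :: "real^'n::{finite,wellorder}" and \<delta> :: real and n :: "'n \<Rightarrow> nat"
  assumes reg: "regular t" and jk: "j \<noteq> k"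
  defines "X \<equiv> coth (t $ j - t $ k) * (profile_prod \<delta> n t - profile_prod \<delta> n (swap_coords j k t))
          + ord_sign j k * profile_prod \<delta> n (swap_coords j k t)
          + coth (t $ j + t $ k) * (profile_prod \<delta> n t - profile_prod \<delta> n (neg_swap_coords j k t)) + profile_prod \<delta> n (neg_swap_coords j k t)"
  shows "n j = 0 \<Longrightarrow> n k = 1 \<Longrightarrow> k < j \<Longrightarrow> X = 2 * coth (t $ j) * profile_prod \<delta> n t"
    and "n j = 0 \<Longrightarrow> n k = 0 \<Longrightarrow> j < k \<Longrightarrow> X = 2 * profile_prod \<delta> n t"
    and "n j = 1 \<Longrightarrow> n k = 1 \<Longrightarrow> k < j \<Longrightarrow> X = - 2 * profile_prod \<delta> n t"
    and "n j = 1 \<Longrightarrow> n k = 2 \<Longrightarrow> j < k \<Longrightarrow> X = 2 * coth (t $ j) * profile_prod \<delta> n t"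
proof -
  define x y where "x = coth (t $ j)" and "y = coth (t $ k)"
  define c d where "c = coth (t $ j - t $ k)" and "d = coth (t $ j + t $ k)"
  have c: "c * (x - y) = 1 - x * y" and d: "d * (x + y) = 1 + x * y"
    unfolding c_def d_def x_def y_def using regularD[OF reg] jk by (auto intro!: coth_diff_mult coth_add_mult)
  define M where "M = (\<Prod>i\<in>UNIV - {j} - {k}. profile_factor (n i) (coth (t $ i))) * (\<Prod>i\<in>UNIV. \<bar>sinh (t $ i)\<bar> powr \<delta>)"
  note pr = profile_prod_reflections[OF reg jk, of \<delta> n, folded M_def x_def y_def]
  have i1: "c * ((1 - y) * M - (1 - x) * M) - (1 - x) * M + d * ((1 - y) * M - (1 + x) * M) + (1 + x) * M = 2 * x * ((1 - y) * M)"
    using c d by algebra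
  have i3: "c * ((1 - x) * (1 - y) * M - (1 - y) * (1 - x) * M) - (1 - y) * (1 - x) * M
      + d * ((1 - x) * (1 - y) * M - (1 + y) * (1 + x) * M) + (1 + y) * (1 + x) * M = - 2 * ((1 - x) * (1 - y) * M)"
    using c d by algebra
  have i4: "c * ((1 - x) * (y\<^sup>2 - 1) * M - (1 - y) * (x\<^sup>2 - 1) * M) + (1 - y) * (x\<^sup>2 - 1) * M
      + d * ((1 - x) * (y\<^sup>2 - 1) * M - (1 + y) * (x\<^sup>2 - 1) * M) + (1 + y) * (x\<^sup>2 - 1) * M = 2 * x * ((1 - x) * (y\<^sup>2 - 1) * M)"
    using c d by algebra
  note X = X_def[unfolded pr, folded c_def d_def]
  show "n j = 0 \<Longrightarrow> n k = 1 \<Longrightarrow> k < j \<Longrightarrow> X = 2 * coth (t $ j) * profile_prod \<delta> n t"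
    unfolding X pr x_def[symmetric] using i1 by (auto simp: profile_factor_def ord_sign_def dest: less_asym)
  show "n j = 0 \<Longrightarrow> n k = 0 \<Longrightarrow> j < k \<Longrightarrow> X = 2 * profile_prod \<delta> n t"
    unfolding X pr by (simp add: profile_factor_def ord_sign_def)
  show "n j = 1 \<Longrightarrow> n k = 1 \<Longrightarrow> k < j \<Longrightarrow> X = - 2 * profile_prod \<delta> n t"
    unfolding X pr using i3 by (auto simp: profile_factor_def ord_sign_def dest: less_asym)
  show "n j = 1 \<Longrightarrow> n k = 2 \<Longrightarrow> j < k \<Longrightarrow> X = 2 * coth (t $ j) * profile_prod \<delta> n t"
    unfolding X pr x_def[symmetric] using i4 by (simp add: profile_factor_def ord_sign_def)
qed

section \<open>The two stages of the recursion\<close>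

lemma sum_less_greater:
  fixes j :: "'n::{finite,wellorder}" and A B :: real
  shows "(\<Sum>k\<in>UNIV - {j}. if k < j then A else B) = real (card {k. k < j}) * A + real (card {k. j < k}) * B"
proof -
  have "UNIV - {j} = {k. k < j} \<union> {k. j < k}" by auto
  then have "(\<Sum>k\<in>UNIV - {j}. if k < j then A else B) = (\<Sum>k\<in>{k. k < j} \<union> {k. j < k}. if k < j then A else B)" by simp
  also have "\<dots> = (\<Sum>k\<in>{k. k < j}. if k < j then A else B) + (\<Sum>k\<in>{k. j < k}. if k < j then A else B)"
    by (rule sum.union_disjoint) (auto dest: less_asym)
  also have "(\<Sum>k\<in>{k. k < j}. if k < j then A else B) = real (card {k. k < j}) * A" by simp
  also have "(\<Sum>k\<in>{k. j < k}. if k < j then A else B) = (\<Sum>k\<in>{k. j < k}. B)"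
    by (rule sum.cong) (auto dest: less_asym)
  finally show ?thesis by simp
qed

text \<open>The leading coefficient is split at \<open>j\<close>, so that its parts can be matched
  with the pair terms for \<open>k < j\<close> and for \<open>k > j\<close>.\<close>

lemma rho_Min:
  fixes j :: "'n::{finite,wellorder}"
  shows "rho a b \<iota> (Min (UNIV :: 'n set)) = \<iota> + b + a * (real (card {k. k < j}) + real (card {k. j < k}))"
proof -
  have "{k. Min (UNIV :: 'n set) < k} = UNIV - {Min UNIV}"
    by (auto simp: less_le)
  then have 1: "card {k. Min (UNIV :: 'n set) < k} = card (UNIV :: 'n set) - 1" by simp
  have "(UNIV :: 'n set) = insert j ({k. k < j} \<union> {k. j < k})" by auto
  then have "card (UNIV :: 'n set) = card (insert j ({k. k < j} \<union> {k. j < k}))" by (rule arg_cong)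
  also have "\<dots> = Suc (card ({k. k < j} \<union> {k. j < k}))" by (rule card_insert_disjoint) auto
  also have "card ({k. k < j} \<union> {k. j < k}) = card {k. k < j} + card {k. j < k}"
    by (rule card_Un_disjoint) (auto dest: less_asym)
  finally show ?thesis using 1 by (simp add: rho_def)
qed

text \<open>The profile product is even in \<open>t $ j\<close>, so the sign change contributes only
  \<open>\<iota> + b\<close>. This and the terms with \<open>k > j\<close> cancel against
  \<open>\<rho>\<^sub>1\<close>; the rest of \<open>\<rho>\<^sub>1\<close> joins the terms with
  \<open>k < j\<close> to form multiples of \<open>1 - coth (t $ j)\<close>.\<close>

lemma first_stage:
  fixes g :: "real^'n::{finite,wellorder} \<Rightarrow> complex" and j :: 'n
  assumes par: "a \<ge> 0" "b \<ge> 0" "\<iota> \<ge> 0" and \<delta>: "\<delta> > 4" and g: "smooth g" "supported_in R g"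
  defines "n \<equiv> \<lambda>i. if i < j then 1 else 0"
  shows "integral\<^sup>L lborel (\<lambda>t. of_real (weight a b \<iota> t * profile_prod \<delta> n t) *
      shift_op a b \<iota> (of_real (\<delta> + rho a b \<iota> (Min (UNIV :: 'n set)))) j g t) =
    of_real (\<delta> + a * card {k. k < j}) * integral\<^sup>L lborel (\<lambda>t. of_real (weight a b \<iota> t * profile_prod \<delta> (n(j := 1)) t) * g t)"
proof (rule integral_shift_op_profile[OF par \<delta> g])
  fix t :: "real^'n::{finite,wellorder}" assume reg: "regular t"
  have x: "t $ j \<noteq> 0" using regularD(1)[OF reg] .
  define P where "P = \<bar>sinh (t $ j)\<bar> powr \<delta> * (\<Prod>i\<in>UNIV - {j}. profile \<delta> (n i) (t $ i))"
  have nj: "n j = 0" by (simp add: n_def)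
  have u: "profile_prod \<delta> n t = P" "profile_prod \<delta> n (neg_coord j t) = P"
    unfolding profile_prod_neg[OF reg, of \<delta> n j] P_def nj by (simp_all add: profile_factor_def)
  have d: "profile_deriv \<delta> (n j) (t $ j) * (\<Prod>i\<in>UNIV - {j}. profile \<delta> (n i) (t $ i)) = \<delta> * coth (t $ j) * P"
    unfolding profile_deriv_eq[OF x] nj P_def by simp
  have "(\<Prod>i\<in>UNIV - {j}. profile \<delta> ((n(j := 1)) i) (t $ i)) = (\<Prod>i\<in>UNIV - {j}. profile \<delta> (n i) (t $ i))"
    by (rule prod.cong) auto
  then have v: "profile_prod \<delta> (n(j := 1)) t = (1 - coth (t $ j)) * P"
    unfolding profile_prod_neg(1)[OF reg, of \<delta> "n(j := 1)" j] P_def by (simp add: profile_factor_def)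
  have S: "(\<Sum>k\<in>UNIV - {j}. coth (t $ j - t $ k) * (profile_prod \<delta> n t - profile_prod \<delta> n (swap_coords j k t))
          + ord_sign j k * profile_prod \<delta> n (swap_coords j k t)
          + coth (t $ j + t $ k) * (profile_prod \<delta> n t - profile_prod \<delta> n (neg_swap_coords j k t)) + profile_prod \<delta> n (neg_swap_coords j k t))
     = (\<Sum>k\<in>UNIV - {j}. if k < j then 2 * coth (t $ j) * P else 2 * P)"
  proof (rule sum.cong)
    fix k assume "k \<in> UNIV - {j}"
    then have jk: "j \<noteq> k" by auto
    consider "k < j" | "j < k" "\<not> k < j" using jk less_linear[of j k] less_asym[of j k] by blast
    then show "coth (t $ j - t $ k) * (profile_prod \<delta> n t - profile_prod \<delta> n (swap_coords j k t))
          + ord_sign j k * profile_prod \<delta> n (swap_coords j k t)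
          + coth (t $ j + t $ k) * (profile_prod \<delta> n t - profile_prod \<delta> n (neg_swap_coords j k t)) + profile_prod \<delta> n (neg_swap_coords j k t)
        = (if k < j then 2 * coth (t $ j) * P else 2 * P)"
    proof cases
      case 1
      then have "n k = 1" by (simp add: n_def)
      from profile_pair_terms(1)[OF reg jk nj this 1, of \<delta>] 1 show ?thesis by (simp add: u)
    next
      case 2
      then have "n k = 0" by (simp add: n_def)
      from profile_pair_terms(2)[OF reg jk nj this 2(1), of \<delta>] 2 show ?thesis by (simp add: u)
    qed
  qed simp
  show "(\<delta> + rho a b \<iota> (Min (UNIV :: 'n set))) * profile_prod \<delta> n t - profile_deriv \<delta> (n j) (t $ j) * (\<Prod>i\<in>UNIV - {j}. profile \<delta> (n i) (t $ i))
      - a / 2 * (\<Sum>k\<in>UNIV - {j}. coth (t $ j - t $ k) * (profile_prod \<delta> n t - profile_prod \<delta> n (swap_coords j k t))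
          + ord_sign j k * profile_prod \<delta> n (swap_coords j k t)
          + coth (t $ j + t $ k) * (profile_prod \<delta> n t - profile_prod \<delta> n (neg_swap_coords j k t)) + profile_prod \<delta> n (neg_swap_coords j k t))
      - ((\<iota> * coth (2 * t $ j) + b * coth (t $ j)) * (profile_prod \<delta> n t - profile_prod \<delta> n (neg_coord j t)) + (\<iota> + b) * profile_prod \<delta> n (neg_coord j t))
      = (\<delta> + a * card {k. k < j}) * profile_prod \<delta> (n(j := 1)) t"
    unfolding S unfolding sum_less_greater d v u rho_Min[of a b \<iota> j] by (simp add: algebra_simps)
qed

text \<open>Now the terms with \<open>k < j\<close> cancel against \<open>\<rho>\<^sub>1\<close>,
  and the others combine to multiples of \<open>C\<^sup>2 - 1\<close>: with coefficient
  \<open>- 1\<close> from the derivative of coth, \<open>\<iota> + 2 * b\<close> from the sign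
  change and \<open>a\<close> for each \<open>k > j\<close>.\<close>

lemma second_stage:
  fixes g :: "real^'n::{finite,wellorder} \<Rightarrow> complex" and j :: 'n
  assumes par: "a \<ge> 0" "b \<ge> 0" "\<iota> \<ge> 0" and \<delta>: "\<delta> > 4" and g: "smooth g" "supported_in R g"
  defines "n \<equiv> \<lambda>i. if j < i then 2 else 1"
  shows "integral\<^sup>L lborel (\<lambda>t. of_real (weight a b \<iota> t * profile_prod \<delta> n t) *
      shift_op a b \<iota> (of_real (- (\<delta> + rho a b \<iota> (Min (UNIV :: 'n set))))) j g t) =
    of_real (\<delta> - 1 + \<iota> + 2 * b + a * card {k. j < k}) * integral\<^sup>L lborel (\<lambda>t. of_real (weight a b \<iota> t * profile_prod \<delta> (n(j := 2)) t) * g t)"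
proof (rule integral_shift_op_profile[OF par \<delta> g])
  fix t :: "real^'n::{finite,wellorder}" assume reg: "regular t"
  have x: "t $ j \<noteq> 0" using regularD(1)[OF reg] .
  define P where "P = \<bar>sinh (t $ j)\<bar> powr \<delta> * (\<Prod>i\<in>UNIV - {j}. profile \<delta> (n i) (t $ i))"
  define C where "C = coth (t $ j)"
  have nj: "n j = 1" by (simp add: n_def)
  have u: "profile_prod \<delta> n t = (1 - C) * P" "profile_prod \<delta> n (neg_coord j t) = (1 + C) * P"
    unfolding profile_prod_neg[OF reg, of \<delta> n j] P_def nj C_def by (simp_all add: profile_factor_def)
  have d: "profile_deriv \<delta> (n j) (t $ j) * (\<Prod>i\<in>UNIV - {j}. profile \<delta> (n i) (t $ i)) = (C\<^sup>2 - 1 + \<delta> * C * (1 - C)) * P"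
    unfolding profile_deriv_eq[OF x] nj P_def C_def by simp
  have "(\<Prod>i\<in>UNIV - {j}. profile \<delta> ((n(j := 2)) i) (t $ i)) = (\<Prod>i\<in>UNIV - {j}. profile \<delta> (n i) (t $ i))"
    by (rule prod.cong) auto
  then have v: "profile_prod \<delta> (n(j := 2)) t = (C\<^sup>2 - 1) * P"
    unfolding profile_prod_neg(1)[OF reg, of \<delta> "n(j := 2)" j] P_def C_def by (simp add: profile_factor_def)
  have S: "(\<Sum>k\<in>UNIV - {j}. coth (t $ j - t $ k) * (profile_prod \<delta> n t - profile_prod \<delta> n (swap_coords j k t))
          + ord_sign j k * profile_prod \<delta> n (swap_coords j k t)
          + coth (t $ j + t $ k) * (profile_prod \<delta> n t - profile_prod \<delta> n (neg_swap_coords j k t)) + profile_prod \<delta> n (neg_swap_coords j k t))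
     = (\<Sum>k\<in>UNIV - {j}. if k < j then - 2 * ((1 - C) * P) else 2 * C * ((1 - C) * P))"
  proof (rule sum.cong)
    fix k assume "k \<in> UNIV - {j}"
    then have jk: "j \<noteq> k" by auto
    consider "k < j" "\<not> j < k" | "j < k" "\<not> k < j" using jk less_linear[of j k] less_asym[of j k] by blast
    then show "coth (t $ j - t $ k) * (profile_prod \<delta> n t - profile_prod \<delta> n (swap_coords j k t))
          + ord_sign j k * profile_prod \<delta> n (swap_coords j k t)
          + coth (t $ j + t $ k) * (profile_prod \<delta> n t - profile_prod \<delta> n (neg_swap_coords j k t)) + profile_prod \<delta> n (neg_swap_coords j k t)
        = (if k < j then - 2 * ((1 - C) * P) else 2 * C * ((1 - C) * P))"
    proof cases
      case 1
      then have "n k = 1" by (simp add: n_def)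
      from profile_pair_terms(3)[OF reg jk nj this 1(1), of \<delta>] 1 show ?thesis by (simp add: u)
    next
      case 2
      then have "n k = 2" by (simp add: n_def)
      from profile_pair_terms(4)[OF reg jk nj this 2(1), of \<delta>] 2 show ?thesis by (simp add: u C_def)
    qed
  qed simp
  \<comment> \<open>This is \<open>2 * coth x * coth (2 * x) = (coth x)\<^sup>2 + 1\<close>, since
    the profile product changes by \<open>- 2 * C * P\<close> under the sign change.\<close>
  have G: "(\<iota> * coth (2 * t $ j) + b * coth (t $ j)) * ((1 - C) * P - (1 + C) * P) = - (\<iota> * (C\<^sup>2 + 1) + 2 * b * C\<^sup>2) * P"
  proof -
    have "C \<noteq> 0" using x cosh_real_nonzero[of "t $ j"] by (simp add: C_def coth_def)
    moreover have "tanh (t $ j) = 1 / C" by (simp add: C_def coth_def tanh_def)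
    ultimately have "2 * C * coth (2 * t $ j) = C\<^sup>2 + 1" unfolding coth_double[OF x] C_def[symmetric]
      by (simp add: field_simps power2_eq_square)
    then show ?thesis unfolding C_def[symmetric] by algebra
  qed
  show "- (\<delta> + rho a b \<iota> (Min (UNIV :: 'n set))) * profile_prod \<delta> n t - profile_deriv \<delta> (n j) (t $ j) * (\<Prod>i\<in>UNIV - {j}. profile \<delta> (n i) (t $ i))
      - a / 2 * (\<Sum>k\<in>UNIV - {j}. coth (t $ j - t $ k) * (profile_prod \<delta> n t - profile_prod \<delta> n (swap_coords j k t))
          + ord_sign j k * profile_prod \<delta> n (swap_coords j k t)
          + coth (t $ j + t $ k) * (profile_prod \<delta> n t - profile_prod \<delta> n (neg_swap_coords j k t)) + profile_prod \<delta> n (neg_swap_coords j k t))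
      - ((\<iota> * coth (2 * t $ j) + b * coth (t $ j)) * (profile_prod \<delta> n t - profile_prod \<delta> n (neg_coord j t)) + (\<iota> + b) * profile_prod \<delta> n (neg_coord j t))
      = (\<delta> - 1 + \<iota> + 2 * b + a * card {k. j < k}) * profile_prod \<delta> (n(j := 2)) t"
    unfolding S unfolding sum_less_greater d v u G rho_Min[of a b \<iota> j] by (simp add: algebra_simps power2_eq_square)
qed

lemma integral_prod_op_profile:
  fixes f :: "real^'n::{finite,wellorder} \<Rightarrow> complex"
  assumes par: "a \<ge> 0" "b \<ge> 0" "\<iota> \<ge> 0" and \<delta>: "\<delta> > 4" and f: "smooth f" "supported_in R f"
  shows "integral\<^sup>L lborel (\<lambda>t. of_real (weight a b \<iota> t * profile_prod \<delta> (\<lambda>_. 0) t) *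
      prod_op a b \<iota> ((of_real (\<delta> + rho a b \<iota> (Min (UNIV :: 'n set))))\<^sup>2) f t) =
    of_real ((\<Prod>j\<in>UNIV. \<delta> + a * card {k::'n. k < j}) * (\<Prod>j\<in>UNIV. \<delta> - 1 + \<iota> + 2 * b + a * card {k::'n. j < k})) *
      integral\<^sup>L lborel (\<lambda>t. of_real (weight a b \<iota> t * profile_prod \<delta> (\<lambda>_. 2) t) * f t)"
proof -
  define c where "c = \<delta> + rho a b \<iota> (Min (UNIV :: 'n set))"
  define L where "L = sorted_list_of_set (UNIV :: 'n set)"
  let ?S = "shift_op a b \<iota>"
  define I where "I n g = integral\<^sup>L lborel (\<lambda>t. complex_of_real (weight a b \<iota> t * profile_prod \<delta> n t) * g t)" for n and g :: "real^'n::{finite,wellorder} \<Rightarrow> complex"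
  have sm: "smooth (foldr (?S z) ys g) \<and> supported_in R (foldr (?S z) ys g)" if "smooth g" "supported_in R g" for z ys g
    using that by (induction ys) (auto intro: smooth_shift_op supported_in_shift_op)
  have Lset: "set L = UNIV" and Ld: "distinct L" and Ls: "sorted L" by (auto simp: L_def)
  \<comment> \<open>Position in the sorted list is the order of the indices, so the indices already
    treated are precisely those required by \<open>first_stage\<close> and
    \<open>second_stage\<close>.\<close>
  have less: "set xs = {i. i < j}" "set ys = {i. j < i}" if "xs @ j # ys = L" for xs j ys
  proof -
    have d: "distinct (xs @ j # ys)" and s: "sorted (xs @ j # ys)" and u: "set (xs @ j # ys) = UNIV"
      using that Lset Ld Ls by auto
    have a: "i < j" if "i \<in> set xs" for i
    proof -
      have "i \<le> j" using s that by (simp add: sorted_append)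
      moreover have "i \<noteq> j" using d that by (metis distinct_append disjoint_insert(2) list.simps(15) Int_commute insert_disjoint(1))
      ultimately show ?thesis by simp
    qed
    have b: "j < i" if "i \<in> set ys" for i
    proof -
      have "j \<le> i" using s that by (simp add: sorted_append)
      moreover have "i \<noteq> j" using d that by (metis distinct.simps(2) distinct_append)
      ultimately show ?thesis by simp
    qed
    have c: "i \<in> set xs \<or> i = j \<or> i \<in> set ys" for i
    proof -
      have "i \<in> set (xs @ j # ys)" unfolding u by simp
      then show ?thesis by auto
    qed
    have "i \<in> set xs \<longleftrightarrow> i < j" for i using a[of i] b[of i] c[of i] by force
    then show "set xs = {i. i < j}" by blast
    have "i \<in> set ys \<longleftrightarrow> j < i" for i using a[of i] b[of i] c[of i] by force
    then show "set ys = {i. j < i}" by blast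
  qed
  \<comment> \<open>\<open>xs\<close> collects the indices that have reached state \<open>1\<close>;
    the operators are taken off from the outside, in increasing order.\<close>
  have A: "I (\<lambda>i. if i \<in> set xs then 1 else 0) (foldr (?S (of_real c)) ys g) = of_real (\<Prod>j\<leftarrow>ys. \<delta> + a * card {k::'n. k < j}) * I (\<lambda>_. 1) g"
    if "xs @ ys = L" and g: "smooth g" "supported_in R g" for xs ys g
    using that(1)
  proof (induction ys arbitrary: xs)
    case Nil
    then have "set xs = UNIV" using Lset by simp
    then show ?case by simp
  next
    case (Cons j ys)
    have e: "(\<lambda>i. if i \<in> set xs then 1 else 0) = (\<lambda>i. if i < j then 1 else 0 :: nat)" using less(1)[OF Cons.prems] by simp
    have e2: "(\<lambda>i. if i < j then 1 else 0)(j := 1) = (\<lambda>i. if i \<in> set (xs @ [j]) then 1 else 0 :: nat)"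
      using less(1)[OF Cons.prems] by (simp add: fun_eq_iff)
    have "I (\<lambda>i. if i \<in> set xs then 1 else 0) (foldr (?S (of_real c)) (j # ys) g)
        = of_real (\<delta> + a * card {k. k < j}) * I (\<lambda>i. if i \<in> set (xs @ [j]) then 1 else 0) (foldr (?S (of_real c)) ys g)"
      unfolding I_def e e2[symmetric] c_def foldr.simps o_apply
      by (rule first_stage[OF par \<delta>]) (use sm[OF g] in blast)+
    then show ?case using Cons.IH[of "xs @ [j]"] Cons.prems by simp
  qed
  \<comment> \<open>\<open>xs\<close> collects the indices that have moved from state
    \<open>1\<close> to state \<open>2\<close>, now in decreasing order.\<close>
  have B: "I (\<lambda>i. if i \<in> set xs then 2 else 1) (foldr (?S (of_real (- c))) ys g) = of_real (\<Prod>j\<leftarrow>ys. \<delta> - 1 + \<iota> + 2 * b + a * card {k::'n. j < k}) * I (\<lambda>_. 2) g"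
    if "xs @ ys = rev L" and g: "smooth g" "supported_in R g" for xs ys g
    using that(1)
  proof (induction ys arbitrary: xs)
    case Nil
    then have "set xs = UNIV" using Lset by (metis append_Nil2 set_rev)
    then show ?case by simp
  next
    case (Cons j ys)
    have "rev ys @ j # rev xs = L" using arg_cong[OF Cons.prems, of rev] by simp
    then have sx: "set xs = {i. j < i}" using less(2) by (metis set_rev)
    have e: "(\<lambda>i. if i \<in> set xs then 2 else 1) = (\<lambda>i. if j < i then 2 else 1 :: nat)" using sx by simp
    have e2: "(\<lambda>i. if j < i then 2 else 1)(j := 2) = (\<lambda>i. if i \<in> set (xs @ [j]) then 2 else 1 :: nat)"
      using sx by (simp add: fun_eq_iff)
    have "I (\<lambda>i. if i \<in> set xs then 2 else 1) (foldr (?S (of_real (- c))) (j # ys) g)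
        = of_real (\<delta> - 1 + \<iota> + 2 * b + a * card {k. j < k}) * I (\<lambda>i. if i \<in> set (xs @ [j]) then 2 else 1) (foldr (?S (of_real (- c))) ys g)"
      unfolding I_def e e2[symmetric] c_def foldr.simps o_apply
      by (rule second_stage[OF par \<delta>]) (use sm[OF g] in blast)+
    then show ?case using Cons.IH[of "xs @ [j]"] Cons.prems by simp
  qed
  have pl: "(\<Prod>j\<leftarrow>L. G j) = (\<Prod>j\<in>UNIV. G j)" "(\<Prod>j\<leftarrow>rev L. G j) = (\<Prod>j\<in>UNIV. G j)" for G :: "'n \<Rightarrow> real"
    using Ld Lset prod.distinct_set_conv_list[of L G] prod.distinct_set_conv_list[of "rev L" G] by simp_all
  have "prod_op a b \<iota> ((of_real c)\<^sup>2) f = foldr (?S (of_real c)) L (foldr (?S (of_real (- c))) (rev L) f)"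
    unfolding L_def using prod_op_shift_op[OF f(1)] by simp
  then show ?thesis
    using A[of "[]" L "foldr (?S (of_real (- c))) (rev L) f"] B[of "[]" "rev L" f] sm[OF f] f
    unfolding c_def[symmetric] I_def[symmetric] by (simp add: pl)
qed

subsection \<open>Root density\<close>

definition root_density :: "real \<Rightarrow> real \<Rightarrow> real \<Rightarrow> real^'n::{finite,wellorder} \<Rightarrow> real" where
  "root_density a b \<iota> t = (\<Prod>\<alpha>\<in>positive_roots a b \<iota>. \<bar>2 * sinh (\<alpha> \<bullet> t)\<bar> powr root_mult a b \<iota> \<alpha>)"

lemma root_mult_values:
  fixes i j :: "'n::{finite,wellorder}"
  shows "i \<noteq> j \<Longrightarrow> root_mult a b \<iota> (axis i 1 - axis j 1 :: real^'n::{finite,wellorder}) = a"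
    and "i \<noteq> j \<Longrightarrow> root_mult a b \<iota> (axis i 1 + axis j 1 :: real^'n::{finite,wellorder}) = a"
    and "root_mult a b \<iota> (axis j 1 :: real^'n::{finite,wellorder}) = 2 * b"
    and "root_mult a b \<iota> (2 *\<^sub>R axis j 1 :: real^'n::{finite,wellorder}) = \<iota>"
proof -
  let ?A = "\<lambda>\<alpha>::real^'n::{finite,wellorder}. \<exists>i j. i \<noteq> j \<and> (\<exists>e\<in>{1, -1}. \<exists>e'\<in>{1, -1}. \<alpha> = e *\<^sub>R axis i 1 + e' *\<^sub>R axis j 1)"
  have m: "?A (axis i 1 - axis j 1)" if "i \<noteq> j" for i j
    using that by (intro exI[of _ i] exI[of _ j] conjI bexI[of _ 1] bexI[of _ "-1"]) auto
  have p: "?A (axis i 1 + axis j 1)" if "i \<noteq> j" for i j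
    using that by (intro exI[of _ i] exI[of _ j] conjI bexI[of _ 1]) auto
  have n: "\<not> ?A (c *\<^sub>R axis j 1)" for c j
  proof
    assume "?A (c *\<^sub>R axis j 1)"
    then obtain i k e e' where d: "i \<noteq> k" and e: "e \<in> {1, -1::real}" "e' \<in> {1, -1::real}"
      and eq: "c *\<^sub>R axis j 1 = e *\<^sub>R axis i 1 + e' *\<^sub>R (axis k 1 :: real^'n::{finite,wellorder})" by blast
    have "(c *\<^sub>R axis j 1 :: real^'n::{finite,wellorder}) $ i = e" "(c *\<^sub>R axis j 1 :: real^'n::{finite,wellorder}) $ k = e'"
      using d unfolding eq by (simp_all add: axis_def)
    then have "i = j" "k = j" using e by (auto simp: axis_def split: if_splits)
    then show False using d by simp
  qed
  show "i \<noteq> j \<Longrightarrow> root_mult a b \<iota> (axis i 1 - axis j 1 :: real^'n::{finite,wellorder}) = a"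
    unfolding root_mult_def using m[of i j] by (simp only: if_True simp_thms)
  show "i \<noteq> j \<Longrightarrow> root_mult a b \<iota> (axis i 1 + axis j 1 :: real^'n::{finite,wellorder}) = a"
    unfolding root_mult_def using p[of i j] by (simp only: if_True simp_thms)
  have B: "\<exists>k. \<exists>e\<in>{1, -1}. axis j 1 = e *\<^sub>R (axis k 1 :: real^'n::{finite,wellorder})"
    by (intro exI[of _ j] bexI[of _ 1]) auto
  show "root_mult a b \<iota> (axis j 1 :: real^'n::{finite,wellorder}) = 2 * b"
    unfolding root_mult_def using n[of 1 j] B by (simp only: if_True if_False simp_thms scaleR_one)
  have nB: "\<not> (\<exists>k. \<exists>e\<in>{1, -1}. 2 *\<^sub>R axis j 1 = e *\<^sub>R (axis k 1 :: real^'n::{finite,wellorder}))"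
  proof
    assume "\<exists>k. \<exists>e\<in>{1, -1}. 2 *\<^sub>R axis j 1 = e *\<^sub>R (axis k 1 :: real^'n::{finite,wellorder})"
    then obtain k e where e: "e \<in> {1, -1::real}" and eq: "2 *\<^sub>R axis j 1 = e *\<^sub>R (axis k 1 :: real^'n::{finite,wellorder})" by blast
    have "(2 *\<^sub>R axis j 1 :: real^'n::{finite,wellorder}) $ j = 2" by (simp add: axis_def)
    then show False using e unfolding eq by (auto simp: axis_def split: if_splits)
  qed
  have C: "\<exists>k. \<exists>e\<in>{2, -2}. 2 *\<^sub>R axis j 1 = e *\<^sub>R (axis k 1 :: real^'n::{finite,wellorder})"
    by (intro exI[of _ j] bexI[of _ 2]) auto
  show "root_mult a b \<iota> (2 *\<^sub>R axis j 1 :: real^'n::{finite,wellorder}) = \<iota>"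
    unfolding root_mult_def using n[of 2 j] nB C by (simp only: if_True if_False simp_thms)
qed

text \<open>The leading coefficient of a root in two indices is the one at the smaller index, so
  positivity forces it to be \<open>1\<close>.\<close>

lemma positive_roots_subset:
  fixes \<alpha> :: "real^'n::{finite,wellorder}"
  assumes "\<alpha> \<in> positive_roots a b \<iota>"
  shows "(\<exists>i j. i < j \<and> (\<alpha> = axis i 1 - axis j 1 \<or> \<alpha> = axis i 1 + axis j 1)) \<or> (\<exists>j. \<alpha> = axis j 1 \<or> \<alpha> = 2 *\<^sub>R axis j 1)"
proof -
  from assms obtain m where r: "\<alpha> \<in> roots a b \<iota>" and m: "\<alpha> $ m > 0" "\<And>l. l < m \<Longrightarrow> \<alpha> $ l = 0"
    by (auto simp: positive_roots_def)
  let ?A = "\<exists>i j. i \<noteq> j \<and> (\<exists>e\<in>{1, -1}. \<exists>e'\<in>{1, -1}. \<alpha> = e *\<^sub>R axis i 1 + e' *\<^sub>R axis j 1)"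
    and ?B = "\<exists>j. \<exists>e\<in>{1, -1}. \<alpha> = e *\<^sub>R axis j 1" and ?C = "\<exists>j. \<exists>e\<in>{2, -2}. \<alpha> = e *\<^sub>R axis j 1"
  have lead: "e = 1" if ij: "i < j" and e: "e \<in> {1, -1::real}" and eq: "\<alpha> = e *\<^sub>R axis i 1 + e' *\<^sub>R axis j 1" for i j e e'
  proof -
    have ai: "\<alpha> $ i = e" using ij less_imp_neq[OF ij] by (simp add: eq axis_def)
    have "m = i"
    proof (rule ccontr)
      assume "m \<noteq> i"
      then consider "m < i" | "i < m" by (meson linorder_neqE)
      then show False
      proof cases
        case 1
        then have "m \<noteq> i" "m \<noteq> j" using ij by auto
        then have "\<alpha> $ m = 0" by (simp add: eq axis_def)
        then show False using m(1) by simp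
      next
        case 2
        then show False using m(2)[OF 2] ai e by auto
      qed
    qed
    then show ?thesis using m(1) ai e by auto
  qed
  have ax: "c > 0" if "\<alpha> = c *\<^sub>R axis j 1" for c j
    using m(1) that by (auto simp: axis_def split: if_splits)
  have "?A \<or> ?B \<or> ?C"
  proof (rule ccontr)
    assume "\<not> (?A \<or> ?B \<or> ?C)"
    then have "\<not> ?A" "\<not> ?B" "\<not> ?C" by (simp_all only: de_Morgan_disj simp_thms)
    then have "root_mult a b \<iota> \<alpha> = 0" unfolding root_mult_def by (simp only: if_False)
    then show False using r by (simp add: roots_def)
  qed
  then show ?thesis
  proof (elim disjE exE bexE conjE)
    fix i j e e' assume d: "i \<noteq> j" and e: "e \<in> {1, -1}" "e' \<in> {1, -1::real}" and eq: "\<alpha> = e *\<^sub>R axis i 1 + e' *\<^sub>R axis j 1"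
    consider "i < j" | "j < i" using d by (meson linorder_neqE)
    then show ?thesis
    proof cases
      case 1
      then have "\<alpha> = axis i 1 - axis j 1 \<or> \<alpha> = axis i 1 + axis j 1" using lead[OF 1 e(1) eq] eq e(2) by auto
      then show ?thesis using 1 by blast
    next
      case 2
      have "\<alpha> = axis j 1 - axis i 1 \<or> \<alpha> = axis j 1 + axis i 1"
        using lead[OF 2 e(2), of e] eq e(1) by (auto simp: add.commute)
      then show ?thesis using 2 by blast
    qed
  next
    fix j e assume "e \<in> {1, -1::real}" and eq: "\<alpha> = e *\<^sub>R axis j 1"
    then have "e = 1" using ax[OF eq] by auto
    then show ?thesis using eq by auto
  next
    fix j e assume "e \<in> {2, -2::real}" and eq: "\<alpha> = e *\<^sub>R axis j 1"
    then have "e = 2" using ax[OF eq] by auto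
    then show ?thesis using eq by auto
  qed
qed

lemma prod_distinct_pairs:
  fixes h :: "'n::{finite,linorder} \<Rightarrow> 'n \<Rightarrow> real"
  shows "(\<Prod>(i, k)\<in>{(i, k). i \<noteq> k}. h i k) = (\<Prod>(i, k)\<in>{(i, k). i < k}. h i k * h k i)"
proof -
  have "{(i, k). i \<noteq> k} = {(i, k). i < k} \<union> {(i, k). k < (i::'n)}"
    by (rule set_eqI) (simp add: split_beta neq_iff)
  then have "(\<Prod>(i, k)\<in>{(i, k). i \<noteq> k}. h i k) = (\<Prod>(i, k)\<in>{(i, k). i < k} \<union> {(i, k). k < i}. h i k)" by simp
  also have "\<dots> = (\<Prod>(i, k)\<in>{(i, k). i < k}. h i k) * (\<Prod>(i, k)\<in>{(i, k). k < i}. h i k)"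
  proof (rule prod.union_disjoint)
    show "{(i, k). i < k} \<inter> {(i, k). k < i} = ({} :: ('n \<times> 'n) set)"
      by (intro equals0I) (clarsimp, meson less_asym)
  qed simp_all
  also have "(\<Prod>(i, k)\<in>{(i, k). k < i}. h i k) = (\<Prod>(i, k)\<in>{(i, k). i < k}. h k i)"
    by (rule prod.reindex_bij_witness[of _ prod.swap prod.swap]) (simp_all add: split_beta)
  also have "(\<Prod>(i, k)\<in>{(i, k). i < k}. h i k) * (\<Prod>(i, k)\<in>{(i, k). i < k}. h k i) = (\<Prod>(i, k)\<in>{(i, k). i < k}. h i k * h k i)"
    by (simp add: split_beta prod.distrib)
  finally show ?thesis .
qed

text \<open>Off the walls a root vector of multiplicity zero would contribute the factor
  \<open>1\<close>, so the product over the positive roots may be extended to all candidates,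
  whether or not they are roots.\<close>

lemma root_density_eq_weight:
  fixes t :: "real^'n::{finite,wellorder}"
  assumes reg: "regular t"
  shows "root_density a b \<iota> t = weight a b \<iota> t"
proof -
  let ?L = "{(i, j). i < j} :: ('n \<times> 'n) set"
  define Cm where "Cm = (\<lambda>(i, j). axis i 1 - axis j 1 :: real^'n::{finite,wellorder}) ` ?L"
  define Cp where "Cp = (\<lambda>(i, j). axis i 1 + axis j 1 :: real^'n::{finite,wellorder}) ` ?L"
  define C1 where "C1 = range (\<lambda>j. axis j 1 :: real^'n::{finite,wellorder})"
  define C2 where "C2 = range (\<lambda>j. 2 *\<^sub>R axis j 1 :: real^'n::{finite,wellorder})"
  let ?f = "\<lambda>\<alpha>::real^'n::{finite,wellorder}. \<bar>2 * sinh (\<alpha> \<bullet> t)\<bar> powr root_mult a b \<iota> \<alpha>"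
  have fin: "finite Cm" "finite Cp" "finite C1" "finite C2" by (simp_all add: Cm_def Cp_def C1_def C2_def)
  have cand: "(\<exists>i j. i < j \<and> (\<alpha> = axis i 1 - axis j 1 \<or> \<alpha> = axis i 1 + axis j 1)) \<or> (\<exists>j. \<alpha> = axis j 1 \<or> \<alpha> = 2 *\<^sub>R axis j 1)"
    if "\<alpha> \<in> Cm \<union> Cp \<union> C1 \<union> C2" for \<alpha>
    using that unfolding Cm_def Cp_def C1_def C2_def by (elim UnE imageE) auto
  have pos: "\<exists>i. \<alpha> $ i > 0 \<and> (\<forall>j<i. \<alpha> $ j = 0)" if \<alpha>: "\<alpha> \<in> Cm \<union> Cp \<union> C1 \<union> C2" for \<alpha> :: "real^'n::{finite,wellorder}"
  proof -
    consider i j where "i < j" "\<alpha> = axis i 1 - axis j 1 \<or> \<alpha> = axis i 1 + axis j 1" | j where "\<alpha> = axis j 1 \<or> \<alpha> = 2 *\<^sub>R axis j 1"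
      using cand[OF \<alpha>] by blast
    then show ?thesis
    proof cases
      case 1
      have l: "l \<noteq> i" "l \<noteq> j" if "l < i" for l using that 1(1) by auto
      have "i \<noteq> j" using 1(1) by simp
      then show ?thesis using 1(2) l by (intro exI[of _ i]) (auto simp: axis_def)
    next
      case 2
      have l: "l \<noteq> j" if "l < j" for l using that by auto
      show ?thesis using 2 l by (intro exI[of _ j]) (auto simp: axis_def)
    qed
  qed
  have at: "(axis i 1 - axis j 1) \<bullet> t = t $ i - t $ j" "(axis i 1 + axis j 1) \<bullet> t = t $ i + t $ j"
    "axis j 1 \<bullet> t = t $ j" "(2 *\<^sub>R axis j 1) \<bullet> t = 2 * t $ j" for i j
    by (simp_all add: inner_diff_left inner_add_left inner_axis')
  have nz: "\<alpha> \<bullet> t \<noteq> 0" if \<alpha>: "\<alpha> \<in> Cm \<union> Cp \<union> C1 \<union> C2" for \<alpha> :: "real^'n::{finite,wellorder}"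
  proof -
    consider i j where "i < j" "\<alpha> = axis i 1 - axis j 1 \<or> \<alpha> = axis i 1 + axis j 1" | j where "\<alpha> = axis j 1 \<or> \<alpha> = 2 *\<^sub>R axis j 1"
      using cand[OF \<alpha>] by blast
    then show ?thesis
    proof cases
      case 1
      then have "i \<noteq> j" by simp
      from regularD(2,3)[OF reg this] 1(2) show ?thesis by (elim disjE) (simp_all add: at)
    next
      case 2
      then show ?thesis using regularD(1)[OF reg, of j] by (elim disjE) (simp_all add: at)
    qed
  qed
  have "root_density a b \<iota> t = (\<Prod>\<alpha>\<in>Cm \<union> Cp \<union> C1 \<union> C2. ?f \<alpha>)"
    unfolding root_density_def
  proof (rule prod.mono_neutral_left)
    show "positive_roots a b \<iota> \<subseteq> Cm \<union> Cp \<union> C1 \<union> C2"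
    proof
      fix \<alpha> :: "real^'n::{finite,wellorder}" assume "\<alpha> \<in> positive_roots a b \<iota>"
      moreover have "axis i 1 - axis j 1 \<in> Cm" "axis i 1 + axis j 1 \<in> Cp" if "i < j" for i j
        unfolding Cm_def Cp_def using that by (auto intro!: image_eqI[where x="(i, j)"])
      moreover have "axis j 1 \<in> C1" "2 *\<^sub>R axis j 1 \<in> C2" for j by (auto simp: C1_def C2_def)
      ultimately show "\<alpha> \<in> Cm \<union> Cp \<union> C1 \<union> C2" using positive_roots_subset[of \<alpha> a b \<iota>] by blast
    qed
    show "\<forall>\<alpha>\<in>Cm \<union> Cp \<union> C1 \<union> C2 - positive_roots a b \<iota>. ?f \<alpha> = 1"
    proof
      fix \<alpha> assume \<alpha>: "\<alpha> \<in> Cm \<union> Cp \<union> C1 \<union> C2 - positive_roots a b \<iota>"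
      then have "\<alpha> \<notin> roots a b \<iota>" using pos[of \<alpha>] unfolding positive_roots_def by blast
      then have "root_mult a b \<iota> \<alpha> = 0" by (simp add: roots_def)
      then show "?f \<alpha> = 1" using nz[of \<alpha>] \<alpha> by simp
    qed
  qed (use fin in simp)
  also have "\<dots> = (\<Prod>\<alpha>\<in>Cm. ?f \<alpha>) * (\<Prod>\<alpha>\<in>Cp. ?f \<alpha>) * (\<Prod>\<alpha>\<in>C1. ?f \<alpha>) * (\<Prod>\<alpha>\<in>C2. ?f \<alpha>)"
  proof -
    \<comment> \<open>The coordinate sum and the squared length tell the four families of candidates
      apart.\<close>
    define s where "s \<alpha> = (\<Sum>i\<in>UNIV. \<alpha> $ i)" for \<alpha> :: "real^'n::{finite,wellorder}"
    define q where "q \<alpha> = (\<Sum>i\<in>UNIV. (\<alpha> $ i)\<^sup>2)" for \<alpha> :: "real^'n::{finite,wellorder}"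
    have se: "(\<Sum>i\<in>UNIV. axis j x $ i) = x" for j :: 'n and x :: real
      by (simp add: axis_def if_distrib if_distribR cong: if_cong)
    have qe: "q (axis i 1 - axis j 1) = 2" "q (axis i 1 + axis j 1) = 2" "q (axis j 1) = 1" "q (2 *\<^sub>R axis j 1) = 4" if "i \<noteq> j" for i j
    proof -
      have q: "q \<alpha> = \<alpha> \<bullet> \<alpha>" for \<alpha> by (simp add: q_def inner_vec_def power2_eq_square)
      show "q (axis i 1 - axis j 1) = 2" "q (axis i 1 + axis j 1) = 2" "q (axis j 1) = 1" "q (2 *\<^sub>R axis j 1) = 4"
        using that that[symmetric] by (simp_all add: q inner_diff_left inner_diff_right inner_add_left inner_add_right inner_axis_axis)
    qed
    have q1: "q (axis j 1) = 1" "q (2 *\<^sub>R axis j 1) = 4" for j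
      by (simp_all add: q_def axis_def if_distrib if_distribR power2_eq_square cong: if_cong)
    have "s \<alpha> = 0 \<and> q \<alpha> = 2" if "\<alpha> \<in> Cm" for \<alpha>
      using that qe less_imp_neq unfolding Cm_def s_def by (fastforce simp: sum_subtractf se)
    moreover have "s \<alpha> = 2 \<and> q \<alpha> = 2" if "\<alpha> \<in> Cp" for \<alpha>
      using that qe less_imp_neq unfolding Cp_def s_def by (fastforce simp: sum.distrib se)
    moreover have "q \<alpha> = 1" if "\<alpha> \<in> C1" for \<alpha> using that q1 by (auto simp: C1_def)
    moreover have "q \<alpha> = 4" if "\<alpha> \<in> C2" for \<alpha> using that q1 by (auto simp: C2_def)
    ultimately have "Cm \<inter> Cp = {}" "(Cm \<union> Cp) \<inter> C1 = {}" "(Cm \<union> Cp \<union> C1) \<inter> C2 = {}" by force+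
    then show ?thesis using fin by (simp add: prod.union_disjoint)
  qed
  also have "(\<Prod>\<alpha>\<in>Cm. ?f \<alpha>) = (\<Prod>(i, j)\<in>?L. sinh_pow a (t $ i - t $ j))"
  proof -
    have inj: "inj_on (\<lambda>(i, j). axis i 1 - axis j 1 :: real^'n::{finite,wellorder}) ?L"
    proof (rule inj_onI, clarify)
      fix i j k l :: 'n assume l: "i < j" "k < l" and e: "axis i 1 - axis j 1 = (axis k 1 - axis l 1 :: real^'n::{finite,wellorder})"
      have v: "(axis i 1 - axis j 1 :: real^'n::{finite,wellorder}) $ x = (axis k 1 - axis l 1 :: real^'n::{finite,wellorder}) $ x" for x using e by simp
      have ne: "i \<noteq> j" "k \<noteq> l" using l by auto
      show "i = k \<and> j = l"
        using v[of i] v[of j] ne by (simp add: axis_def split: if_splits)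
    qed
    show ?thesis unfolding Cm_def prod.reindex[OF inj] o_def split_beta
      by (rule prod.cong) (use regularD(2)[OF reg] in \<open>auto simp: at root_mult_values sinh_pow_eq less_imp_neq\<close>)
  qed
  also have "\<dots> = (\<Prod>(i, k)\<in>{(i, k). i \<noteq> k}. sinh_pow (a / 2) (t $ i - t $ k))"
    unfolding prod_distinct_pairs
    by (rule prod.cong) (auto simp: sinh_pow_double sinh_pow_diff_commute[of _ "t $ k" "t $ i" for i k])
  also have "(\<Prod>\<alpha>\<in>Cp. ?f \<alpha>) = (\<Prod>(i, j)\<in>?L. sinh_pow a (t $ i + t $ j))"
  proof -
    have inj: "inj_on (\<lambda>(i, j). axis i 1 + axis j 1 :: real^'n::{finite,wellorder}) ?L"
    proof (rule inj_onI, clarify)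
      fix i j k l :: 'n assume l: "i < j" "k < l" and e: "axis i 1 + axis j 1 = (axis k 1 + axis l 1 :: real^'n::{finite,wellorder})"
      have v: "(axis i 1 + axis j 1 :: real^'n::{finite,wellorder}) $ x = (axis k 1 + axis l 1 :: real^'n::{finite,wellorder}) $ x" for x using e by simp
      have ne: "i \<noteq> j" "k \<noteq> l" using l by auto
      have "{i, j} = {k, l}"
        using v[of i] v[of j] v[of k] v[of l] ne by (auto simp: axis_def split: if_splits)
      then show "i = k \<and> j = l" using l by (metis doubleton_eq_iff less_asym)
    qed
    show ?thesis unfolding Cp_def prod.reindex[OF inj] o_def split_beta
      by (rule prod.cong) (use regularD(3)[OF reg] in \<open>auto simp: at root_mult_values sinh_pow_eq less_imp_neq\<close>)
  qed
  also have "\<dots> = (\<Prod>(i, k)\<in>{(i, k). i \<noteq> k}. sinh_pow (a / 2) (t $ i + t $ k))"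
    unfolding prod_distinct_pairs
    by (rule prod.cong) (auto simp: sinh_pow_double add.commute[of "t $ k" "t $ i" for i k])
  also have "(\<Prod>\<alpha>\<in>C1. ?f \<alpha>) = (\<Prod>j\<in>UNIV. sinh_pow (2 * b) (t $ j))"
    unfolding C1_def using regularD(1)[OF reg]
    by (subst prod.reindex) (auto simp: inj_on_def axis_eq_axis at root_mult_values sinh_pow_eq)
  also have "(\<Prod>\<alpha>\<in>C2. ?f \<alpha>) = (\<Prod>j\<in>UNIV. sinh_pow \<iota> (2 * t $ j))"
  proof -
    have inj: "inj (\<lambda>j. 2 *\<^sub>R axis j 1 :: real^'n::{finite,wellorder})" by (auto simp: inj_on_def axis_eq_axis)
    show ?thesis unfolding C2_def prod.reindex[OF inj] o_def
      by (intro prod.cong refl, subst sinh_pow_eq) (use regularD(1)[OF reg] in \<open>simp_all only: at root_mult_values, simp\<close>)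
  qed
  finally show ?thesis by (simp add: weight_def prod.distrib)
qed

subsection \<open>Analytic continuation\<close>

text \<open>The recursion is proved for large real parameters; a real ray in the domain already
  suffices for the identity theorem.\<close>

lemma half_plane_identity:
  fixes f g :: "complex \<Rightarrow> complex"
  assumes f: "f holomorphic_on {z. Re z > s}" and g: "g holomorphic_on {z. Re z > s}"
    and eq: "\<And>x::real. x > x0 \<Longrightarrow> x > s \<Longrightarrow> f (of_real x) = g (of_real x)" and w: "Re w > s"
  shows "f w = g w"
proof -
  define x1 where "x1 = max s x0"
  have "f w - g w = 0"
  proof (rule analytic_continuation[of "\<lambda>z. f z - g z" "{z. Re z > s}" "of_real ` {x1<..}" "of_real (x1 + 1)"])
    show "complex_of_real (x1 + 1) islimpt of_real ` {x1<..}"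
      unfolding islimpt_approachable
    proof (intro allI impI)
      fix e :: real assume "e > 0"
      then show "\<exists>x'\<in>complex_of_real ` {x1<..}. x' \<noteq> complex_of_real (x1 + 1) \<and> dist x' (complex_of_real (x1 + 1)) < e"
        by (intro bexI[of _ "of_real (x1 + 1 + e / 2)"]) (auto simp: dist_norm simp flip: of_real_add of_real_diff)
    qed
  qed (use f g eq w in \<open>auto intro: holomorphic_on_diff open_halfspace_Re_gt convex_connected convex_halfspace_Re_gt simp: x1_def\<close>)
  then show ?thesis by simp
qed

text \<open>The exponential series in \<open>z - z0\<close> is integrated term by term. With
  \<open>r\<close> the radius of the disc, all partial sums are dominated through \<open>exp (r *
  \<bar>L t\<bar>) \<le> exp (r * L t) + exp (- (r * L t))\<close>, which only shifts the exponent
  to two admissible real points.\<close>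

lemma laplace_transform_holomorphic:
  fixes \<phi> :: "'a \<Rightarrow> complex" and L :: "'a \<Rightarrow> real"
  assumes [measurable]: "\<phi> \<in> borel_measurable M" "L \<in> borel_measurable M"
    and int: "\<And>x. x > \<sigma> \<Longrightarrow> integrable M (\<lambda>t. of_real (exp (x * L t)) * \<phi> t)"
  shows "(\<lambda>z. integral\<^sup>L M (\<lambda>t. exp (z * of_real (L t)) * \<phi> t)) holomorphic_on {z. Re z > \<sigma>}"
proof -
  define F where "F z = integral\<^sup>L M (\<lambda>t. exp (z * of_real (L t)) * \<phi> t)" for z :: complex
  have ball: "F holomorphic_on ball z0 ((Re z0 - \<sigma>) / 2)" if z0: "Re z0 > \<sigma>" for z0
  proof (rule power_series_holomorphic)
    fix w assume w: "w \<in> ball z0 ((Re z0 - \<sigma>) / 2)"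
    \<comment> \<open>Half the distance to the boundary, so that \<open>Re z0 - r\<close> and
      \<open>Re z0 + r\<close> both exceed \<open>\<sigma>\<close>.\<close>
    define r where "r = (Re z0 - \<sigma>) / 2"
    define h where "h = w - z0"
    have hr: "norm h \<le> r" using w by (simp add: h_def r_def dist_norm norm_minus_commute)
    have r0: "r > 0" using z0 by (simp add: r_def)
    let ?B = "\<lambda>t. norm (of_real (exp ((Re z0 + r) * L t)) * \<phi> t) + norm (of_real (exp ((Re z0 - r) * L t)) * \<phi> t)"
    define fn where "fn n t = (h * of_real (L t)) ^ n / of_nat (fact n) * (exp (z0 * of_real (L t)) * \<phi> t)" for n t
    have iB: "integrable M ?B"
      by (intro Bochner_Integration.integrable_add integrable_norm int) (use z0 r0 in \<open>simp_all add: r_def field_simps\<close>)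
    have [measurable]: "fn n \<in> borel_measurable M" for n unfolding fn_def[abs_def] by measurable
    have nf: "norm (fn n t) = (norm h * \<bar>L t\<bar>) ^ n / fact n * norm (exp (z0 * of_real (L t)) * \<phi> t)" for n t
      by (simp add: fn_def norm_mult norm_divide norm_power)
    have es: "(\<lambda>n. (norm h * \<bar>L t\<bar>) ^ n / fact n) sums exp (norm h * \<bar>L t\<bar>)" for t
      using exp_converges[of "norm h * \<bar>L t\<bar>"] by (simp add: divide_inverse mult.commute)
    have bound: "exp (norm h * \<bar>L t\<bar>) * norm (exp (z0 * of_real (L t)) * \<phi> t) \<le> ?B t" for t
    proof -
      have "exp (norm h * \<bar>L t\<bar>) \<le> exp (r * \<bar>L t\<bar>)" using hr by (simp add: mult_right_mono)
      also have "\<dots> \<le> exp (r * L t) + exp (- (r * L t))" by (cases "L t \<ge> 0") auto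
      finally have "exp (norm h * \<bar>L t\<bar>) * norm (exp (z0 * of_real (L t)) * \<phi> t)
         \<le> (exp (r * L t) + exp (- (r * L t))) * norm (exp (z0 * of_real (L t)) * \<phi> t)"
        by (rule mult_right_mono) simp
      also have "\<dots> = ?B t"
        by (simp add: norm_mult norm_inverse algebra_simps exp_add exp_diff exp_minus divide_inverse)
      finally show ?thesis .
    qed
    have part: "(\<Sum>n<N. norm (fn n t)) \<le> ?B t" for N t
    proof -
      have "(\<Sum>n<N. norm (fn n t)) = (\<Sum>n<N. (norm h * \<bar>L t\<bar>) ^ n / fact n) * norm (exp (z0 * of_real (L t)) * \<phi> t)"
        by (simp only: nf sum_distrib_right)
      also have "\<dots> \<le> exp (norm h * \<bar>L t\<bar>) * norm (exp (z0 * of_real (L t)) * \<phi> t)"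
      proof (rule mult_right_mono)
        have "(\<Sum>n<N. (norm h * \<bar>L t\<bar>) ^ n / fact n) \<le> (\<Sum>n. (norm h * \<bar>L t\<bar>) ^ n / fact n)"
          by (rule sum_le_suminf[OF sums_summable[OF es]]) auto
        also have "\<dots> = exp (norm h * \<bar>L t\<bar>)" by (rule sums_unique[OF es, symmetric])
        finally show "(\<Sum>n<N. (norm h * \<bar>L t\<bar>) ^ n / fact n) \<le> exp (norm h * \<bar>L t\<bar>)" .
      qed simp
      also note bound
      finally show ?thesis .
    qed
    have ifn: "integrable M (fn n)" for n
    proof (rule Bochner_Integration.integrable_bound[OF iB])
      have "norm (fn n t) \<le> norm (?B t)" for t
      proof -
        have "norm (fn n t) \<le> (\<Sum>k<Suc n. norm (fn k t))" by (simp add: sum_nonneg)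
        also have "\<dots> \<le> ?B t" by (rule part)
        finally show ?thesis by simp
      qed
      then show "AE t in M. norm (fn n t) \<le> norm (?B t)" by simp
    qed measurable
    have s: "(\<lambda>n. integral\<^sup>L M (fn n)) sums integral\<^sup>L M (\<lambda>t. \<Sum>n. fn n t)"
    proof (rule sums_integral[OF ifn])
      show "AE t in M. summable (\<lambda>n. norm (fn n t))"
        unfolding nf using es by (intro AE_I2 summable_mult2) (auto simp: sums_iff)
      show "summable (\<lambda>n. integral\<^sup>L M (\<lambda>t. norm (fn n t)))"
      proof (rule summableI_nonneg_bounded)
        fix N
        have "(\<Sum>n<N. integral\<^sup>L M (\<lambda>t. norm (fn n t))) = integral\<^sup>L M (\<lambda>t. \<Sum>n<N. norm (fn n t))"
          by (rule Bochner_Integration.integral_sum[symmetric]) (use ifn in auto)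
        also have "\<dots> \<le> integral\<^sup>L M ?B"
          by (rule integral_mono) (use ifn iB part in auto)
        finally show "(\<Sum>n<N. integral\<^sup>L M (\<lambda>t. norm (fn n t))) \<le> integral\<^sup>L M ?B" .
      qed auto
    qed
    have "(\<Sum>n. fn n t) = exp (w * of_real (L t)) * \<phi> t" for t
    proof -
      have "(\<lambda>n. (h * of_real (L t)) ^ n / of_nat (fact n)) sums exp (h * of_real (L t))"
        using exp_converges[of "h * complex_of_real (L t)"] by (simp add: scaleR_conv_of_real divide_inverse mult.commute)
      from sums_mult2[OF this, of "exp (z0 * of_real (L t)) * \<phi> t"]
      have "(\<lambda>n. fn n t) sums (exp (h * of_real (L t)) * (exp (z0 * of_real (L t)) * \<phi> t))" by (simp only: fn_def)
      also have "exp (h * of_real (L t)) * (exp (z0 * of_real (L t)) * \<phi> t) = exp (w * of_real (L t)) * \<phi> t"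
        by (simp add: h_def mult.assoc[symmetric] exp_add[symmetric] algebra_simps)
      finally show ?thesis by (rule sums_unique[symmetric])
    qed
    moreover have "integral\<^sup>L M (fn n) = integral\<^sup>L M (\<lambda>t. of_real (L t) ^ n / of_nat (fact n) * (exp (z0 * of_real (L t)) * \<phi> t)) * (w - z0) ^ n" for n
    proof -
      have "fn n = (\<lambda>t. (of_real (L t) ^ n / of_nat (fact n) * (exp (z0 * of_real (L t)) * \<phi> t)) * h ^ n)"
        by (auto simp: fn_def power_mult_distrib)
      then show ?thesis by (simp add: h_def)
    qed
    ultimately show "(\<lambda>n. integral\<^sup>L M (\<lambda>t. of_real (L t) ^ n / of_nat (fact n) * (exp (z0 * of_real (L t)) * \<phi> t)) * (w - z0) ^ n) sums F w"
      using s by (simp add: F_def)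
  qed
  have "F holomorphic_on (\<Union>z0\<in>{z. Re z > \<sigma>}. ball z0 ((Re z0 - \<sigma>) / 2))"
    by (rule holomorphic_on_UN_open) (auto intro: ball)
  then show ?thesis unfolding F_def[symmetric]
    by (rule holomorphic_on_subset) auto
qed

text \<open>Near \<open>t $ j = 0\<close> the function behaves like a power of
  \<open>\<bar>sinh (t $ j)\<bar>\<close> with exponent \<open>2 * b + \<iota> + x\<close>;
  integrability of this power is the condition \<open>x > - 1 - \<iota> - 2 * b\<close>. The
  remaining factors \<open>h\<close> are continuous.\<close>

lemma test_integrable_weight_SH:
  assumes par: "a \<ge> 0" "b \<ge> 0" "\<iota> \<ge> 0" and x: "x > - 1 - \<iota> - 2 * b"
  shows "test_integrable R (\<lambda>t::real^'n. weight a b \<iota> t * \<bar>SH t\<bar> powr x)"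
proof -
  define q where "q = 2 * b + \<iota> + x"
  define h where "h t = (\<Prod>j\<in>UNIV. 2 powr (2 * b) * (4 * cosh (t $ j)) powr \<iota>) *
    ((\<Prod>(i, k)\<in>{(i, k). i \<noteq> k}. sinh_pow (a / 2) (t $ i - t $ k)) *
    (\<Prod>(i, k)\<in>{(i, k). i \<noteq> k}. sinh_pow (a / 2) (t $ i + t $ k)))" for t :: "real^'n"
  have pos: "4 * cosh y \<noteq> 0" for y :: real using cosh_real_pos[of y] by simp
  have ch: "continuous_on UNIV h"
    unfolding h_def[abs_def] split_beta using par pos
    by (intro continuous_intros continuous_sinh_pow) (auto simp: cosh_real_pos less_imp_neq)
  have cw: "continuous_on UNIV (weight a b \<iota> :: real^'n \<Rightarrow> real)" by (rule continuous_weight[OF par])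
  have [measurable]: "(weight a b \<iota> :: real^'n \<Rightarrow> real) \<in> borel_measurable borel" using cw by (rule borel_measurable_continuous_onI)
  obtain C where C: "C \<ge> 0" "\<And>t. norm t \<le> R \<Longrightarrow> \<bar>h t\<bar> \<le> C" using continuous_bounded_cball[OF ch] by blast
  show ?thesis
  proof (rule test_integrable_mono[where C=C and \<psi>="\<lambda>t::real^'n. \<Prod>j\<in>UNIV. \<bar>sinh (t $ j)\<bar> powr q"])
    show "(\<integral>\<^sup>+t. ennreal (indicator (cball 0 R) t * (\<Prod>j\<in>UNIV. \<bar>sinh (t $ j)\<bar> powr q)) \<partial>(lborel :: (real^'n) measure)) < \<infinity>"
      by (rule nn_integral_sinh_prod_finite) (use x in \<open>simp add: q_def\<close>)
    fix t :: "real^'n" assume t: "regular t" "norm t \<le> R"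
    have f: "sinh_pow (2 * b) y * sinh_pow \<iota> (2 * y) * \<bar>sinh y\<bar> powr x = 2 powr (2 * b) * (4 * cosh y) powr \<iota> * \<bar>sinh y\<bar> powr q"
      if "y \<noteq> 0" for y
    proof -
      have 1: "sinh_pow (2 * b) y = 2 powr (2 * b) * \<bar>sinh y\<bar> powr (2 * b)"
        using that by (simp add: sinh_pow_eq abs_mult powr_mult)
      have "\<bar>2 * sinh (2 * y)\<bar> = (4 * cosh y) * \<bar>sinh y\<bar>"
        using cosh_real_pos[of y] by (simp add: sinh_double abs_mult)
      then have 2: "sinh_pow \<iota> (2 * y) = (4 * cosh y) powr \<iota> * \<bar>sinh y\<bar> powr \<iota>"
        using that cosh_real_pos[of y] by (simp add: sinh_pow_eq powr_mult)
      show ?thesis unfolding 1 2 q_def powr_add by simp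
    qed
    have "weight a b \<iota> t * \<bar>SH t\<bar> powr x = (\<Prod>j\<in>UNIV. \<bar>sinh (t $ j)\<bar> powr q) * h t"
    proof -
      have "\<bar>SH t\<bar> powr x = (\<Prod>j\<in>UNIV. \<bar>sinh (t $ j)\<bar> powr x)"
        by (simp add: SH_def abs_prod prod_powr_distrib)
      then have "(\<Prod>j\<in>UNIV. sinh_pow (2 * b) (t $ j) * sinh_pow \<iota> (2 * t $ j)) * \<bar>SH t\<bar> powr x
          = (\<Prod>j\<in>UNIV. sinh_pow (2 * b) (t $ j) * sinh_pow \<iota> (2 * t $ j) * \<bar>sinh (t $ j)\<bar> powr x)"
        by (simp add: prod.distrib)
      also have "\<dots> = (\<Prod>j\<in>UNIV. 2 powr (2 * b) * (4 * cosh (t $ j)) powr \<iota> * \<bar>sinh (t $ j)\<bar> powr q)"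
        by (intro prod.cong refl f regularD(1)[OF t(1)])
      finally have e: "(\<Prod>j\<in>UNIV. sinh_pow (2 * b) (t $ j) * sinh_pow \<iota> (2 * t $ j)) * \<bar>SH t\<bar> powr x
          = (\<Prod>j\<in>UNIV. 2 powr (2 * b) * (4 * cosh (t $ j)) powr \<iota>) * (\<Prod>j\<in>UNIV. \<bar>sinh (t $ j)\<bar> powr q)"
        by (simp only: prod.distrib)
      have "weight a b \<iota> t * \<bar>SH t\<bar> powr x = ((\<Prod>j\<in>UNIV. sinh_pow (2 * b) (t $ j) * sinh_pow \<iota> (2 * t $ j)) * \<bar>SH t\<bar> powr x) *
        ((\<Prod>(i, k)\<in>{(i, k). i \<noteq> k}. sinh_pow (a / 2) (t $ i - t $ k)) * (\<Prod>(i, k)\<in>{(i, k). i \<noteq> k}. sinh_pow (a / 2) (t $ i + t $ k)))"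
        by (simp only: weight_def mult_ac)
      then show ?thesis unfolding e h_def by (simp only: mult_ac)
    qed
    then have "\<bar>weight a b \<iota> t * \<bar>SH t\<bar> powr x\<bar> = \<bar>h t\<bar> * (\<Prod>j\<in>UNIV. \<bar>sinh (t $ j)\<bar> powr q)"
      by (simp add: abs_mult abs_prod)
    also have "\<dots> \<le> C * (\<Prod>j\<in>UNIV. \<bar>sinh (t $ j)\<bar> powr q)"
      by (intro mult_right_mono C t prod_nonneg) auto
    finally show "\<bar>weight a b \<iota> t * \<bar>SH t\<bar> powr x\<bar> \<le> C * (\<Prod>j\<in>UNIV. \<bar>sinh (t $ j)\<bar> powr q)" .
  next
    show "(\<lambda>t::real^'n. weight a b \<iota> t * \<bar>SH t\<bar> powr x) \<in> borel_measurable borel" unfolding SH_def by measurable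
    show "(\<lambda>t::real^'n. \<Prod>j\<in>UNIV. \<bar>sinh (t $ j)\<bar> powr q) \<in> borel_measurable borel" by measurable
  qed (rule C)
qed

section \<open>The unnormalized integral and the normalizing factor\<close>

definition mellin :: "real \<Rightarrow> real \<Rightarrow> real \<Rightarrow> (real^'n \<Rightarrow> complex) \<Rightarrow> complex \<Rightarrow> complex" where
  "mellin a b \<iota> f \<delta> = integral\<^sup>L lborel (\<lambda>t. of_real (weight a b \<iota> t) * zeta_integrand \<delta> f t)"

lemma mellin_facts:
  fixes f :: "real^'n \<Rightarrow> complex"
  assumes par: "a \<ge> 0" "b \<ge> 0" "\<iota> \<ge> 0" and f: "continuous_on UNIV f" "supported_in R f"
  shows "Re \<delta> > - 1 - \<iota> - 2 * b \<Longrightarrow> integrable lborel (\<lambda>t. of_real (weight a b \<iota> t) * zeta_integrand \<delta> f t)"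
    and "mellin a b \<iota> f holomorphic_on {\<delta>. Re \<delta> > - 1 - \<iota> - 2 * b}"
    and "zeta_integrand \<delta> f \<in> borel_measurable borel"
proof -
  have cw: "continuous_on UNIV (weight a b \<iota> :: real^'n \<Rightarrow> real)" by (rule continuous_weight[OF par])
  have [measurable]: "(weight a b \<iota> :: real^'n \<Rightarrow> real) \<in> borel_measurable borel" using cw by (rule borel_measurable_continuous_onI)
  have [measurable]: "f \<in> borel_measurable borel" using f(1) by (rule borel_measurable_continuous_onI)
  have [measurable]: "(SH :: real^'n \<Rightarrow> real) \<in> borel_measurable borel" unfolding SH_def[abs_def] by measurable
  have ze: "zeta_integrand \<delta> f t = (if SH t = 0 then 0 else exp (\<delta> * of_real (ln \<bar>SH t\<bar>)) * f t)" for \<delta> t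
    by (simp add: zeta_integrand_def powr_def Ln_of_real)
  show zm: "zeta_integrand \<delta> f \<in> borel_measurable borel" for \<delta> unfolding ze[abs_def] by measurable
  have ti: "integrable lborel (\<lambda>t. complex_of_real (weight a b \<iota> t * \<bar>SH t\<bar> powr x) * f t)" if "x > - 1 - \<iota> - 2 * b" for x
    using test_integrable_weight_SH[OF par that, of R, where 'n='n] f by (simp only: test_integrable_def)
  show "integrable lborel (\<lambda>t. of_real (weight a b \<iota> t) * zeta_integrand \<delta> f t)" if d: "Re \<delta> > - 1 - \<iota> - 2 * b" for \<delta>
  proof (rule Bochner_Integration.integrable_bound[OF ti[OF d]])
    show "(\<lambda>t. of_real (weight a b \<iota> t) * zeta_integrand \<delta> f t) \<in> borel_measurable lborel" using zm by measurable
    have "norm (of_real (weight a b \<iota> t) * zeta_integrand \<delta> f t) \<le> norm (complex_of_real (weight a b \<iota> t * \<bar>SH t\<bar> powr Re \<delta>) * f t)" for t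
      by (simp add: ze norm_mult powr_def)
    then show "AE t in lborel. norm (of_real (weight a b \<iota> t) * zeta_integrand \<delta> f t) \<le> norm (complex_of_real (weight a b \<iota> t * \<bar>SH t\<bar> powr Re \<delta>) * f t)"
      by simp
  qed
  \<comment> \<open>On \<open>SH t = 0\<close> the integrand is \<open>0\<close> by the convention
    for \<open>0 powr \<delta>\<close>, while the exponential is not; so \<open>\<phi>\<close>
    carries the zero.\<close>
  define \<phi> where "\<phi> t = (if SH t = 0 then 0 else of_real (weight a b \<iota> t) * f t)" for t
  have [measurable]: "\<phi> \<in> borel_measurable borel" unfolding \<phi>_def[abs_def] by measurable
  have "(\<lambda>z. integral\<^sup>L lborel (\<lambda>t. exp (z * of_real (ln \<bar>SH t\<bar>)) * \<phi> t)) holomorphic_on {z. Re z > - 1 - \<iota> - 2 * b}"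
  proof (rule laplace_transform_holomorphic)
    fix x assume x: "x > - 1 - \<iota> - 2 * b"
    have "(\<lambda>t. complex_of_real (exp (x * ln \<bar>SH t\<bar>)) * \<phi> t) = (\<lambda>t. complex_of_real (weight a b \<iota> t * \<bar>SH t\<bar> powr x) * f t)"
      by (rule ext) (simp add: \<phi>_def powr_def exp_of_real[symmetric])
    then show "integrable lborel (\<lambda>t. complex_of_real (exp (x * ln \<bar>SH t\<bar>)) * \<phi> t)" using ti[OF x] by simp
  qed measurable
  also have "(\<lambda>z. integral\<^sup>L lborel (\<lambda>t. exp (z * of_real (ln \<bar>SH t\<bar>)) * \<phi> t)) = mellin a b \<iota> f"
    unfolding mellin_def[abs_def] by (intro ext arg_cong[where f="integral\<^sup>L lborel"]) (simp add: ze \<phi>_def)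
  finally show "mellin a b \<iota> f holomorphic_on {\<delta>. Re \<delta> > - 1 - \<iota> - 2 * b}" .
qed

lemma zeta_eq_mellin:
  fixes f :: "real^'n::{finite,wellorder} \<Rightarrow> complex"
  assumes par: "a \<ge> 0" "b \<ge> 0" "\<iota> \<ge> 0" and f: "continuous_on UNIV f" "supported_in R f" and d: "Re \<delta> > - 1 - \<iota> - 2 * b"
  shows "integrable (root_measure a b \<iota>) (zeta_integrand \<delta> f)"
    and "zeta a b \<iota> \<delta> f = 1 / zeta_norm CARD('n) a b \<iota> \<delta> * mellin a b \<iota> f \<delta>"
proof -
  note F = mellin_facts[OF par f]
  have rm: "root_measure a b \<iota> = density lborel (\<lambda>t::real^'n::{finite,wellorder}. ennreal (root_density a b \<iota> t))"
    by (simp add: root_measure_def root_density_def)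
  have [measurable]: "(root_density a b \<iota> :: real^'n::{finite,wellorder} \<Rightarrow> real) \<in> borel_measurable borel"
    unfolding root_density_def[abs_def] by measurable
  have [measurable]: "zeta_integrand \<delta> f \<in> borel_measurable borel" by (rule F(3))
  have [measurable]: "(weight a b \<iota> :: real^'n::{finite,wellorder} \<Rightarrow> real) \<in> borel_measurable borel"
    by (rule borel_measurable_continuous_onI[OF continuous_weight[OF par]])
  have nn: "AE t in lborel. 0 \<le> root_density a b \<iota> (t::real^'n::{finite,wellorder})"
    by (simp add: root_density_def prod_nonneg)
  have ae: "AE t in lborel. root_density a b \<iota> t *\<^sub>R zeta_integrand \<delta> f t = of_real (weight a b \<iota> t) * zeta_integrand \<delta> f t"
    using AE_regular by eventually_elim (simp add: root_density_eq_weight scaleR_conv_of_real[where 'a=complex])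
  have "integrable lborel (\<lambda>t. root_density a b \<iota> t *\<^sub>R zeta_integrand \<delta> f t)"
    by (subst integrable_cong_AE[OF _ _ ae]) (use F(1)[OF d] in auto)
  then show "integrable (root_measure a b \<iota>) (zeta_integrand \<delta> f)"
    unfolding rm by (subst integrable_density) (use nn in auto)
  have "integral\<^sup>L (root_measure a b \<iota>) (zeta_integrand \<delta> f) = integral\<^sup>L lborel (\<lambda>t. root_density a b \<iota> t *\<^sub>R zeta_integrand \<delta> f t)"
    unfolding rm by (subst integral_density) (use nn in auto)
  also have "\<dots> = mellin a b \<iota> f \<delta>"
    unfolding mellin_def by (rule integral_cong_AE[OF _ _ ae]) measurable
  finally show "zeta a b \<iota> \<delta> f = 1 / zeta_norm CARD('n) a b \<iota> \<delta> * mellin a b \<iota> f \<delta>" by (simp add: zeta_def)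
qed

text \<open>The number of indices below \<open>j\<close>, as well as above \<open>j\<close>, takes
  each value from \<open>0\<close> to \<open>r - 1\<close> exactly once.\<close>

lemma prod_card_less:
  fixes G :: "nat \<Rightarrow> 'b::comm_monoid_mult"
  shows "(\<Prod>j\<in>(UNIV :: 'n::{finite,wellorder} set). G (card {k. k < j})) = (\<Prod>i<CARD('n). G i)"
    and "(\<Prod>j\<in>(UNIV :: 'n::{finite,wellorder} set). G (card {k. j < k})) = (\<Prod>i<CARD('n). G i)"
proof -
  have *: "(\<Prod>j\<in>UNIV. G (c j)) = (\<Prod>i<CARD('n). G i)" if c: "inj c" "\<And>j. c j < CARD('n)" for c :: "'n \<Rightarrow> nat"
  proof -
    have "range c = {..<CARD('n)}"
      by (rule card_subset_eq) (use c card_image[OF c(1)] in auto)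
    then have "(\<Prod>i<CARD('n). G i) = (\<Prod>i\<in>range c. G i)" by simp
    also have "\<dots> = (\<Prod>j\<in>UNIV. G (c j))" by (simp add: prod.reindex[OF c(1)])
    finally show ?thesis by simp
  qed
  have lt: "card {k. k < i} < card {k. k < j}" "card {k. j < k} < card {k. i < k}" if "i < j" for i j :: 'n
  proof -
    have "{k. k < i} \<subseteq> {k. k < j}" "i \<in> {k. k < j}" "i \<notin> {k. k < i}"
      by (intro Collect_mono impI less_trans[OF _ that]) (simp_all only: mem_Collect_eq that less_irrefl not_False_eq_True)
    then have "{k. k < i} \<subset> {k. k < j}" by blast
    then show "card {k. k < i} < card {k. k < j}" by (simp only: psubset_card_mono finite)
    have "{k. j < k} \<subseteq> {k. i < k}" "j \<in> {k. i < k}" "j \<notin> {k. j < k}"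
      by (intro Collect_mono impI less_trans[OF that]) (simp_all only: mem_Collect_eq that less_irrefl not_False_eq_True)
    then have "{k. j < k} \<subset> {k. i < k}" by blast
    then show "card {k. j < k} < card {k. i < k}" by (simp only: psubset_card_mono finite)
  qed
  have b: "card A < CARD('n)" if "j \<notin> A" for A and j :: 'n
  proof -
    have "A \<subset> UNIV" using that by blast
    then show ?thesis by (simp only: psubset_card_mono finite)
  qed
  show "(\<Prod>j\<in>(UNIV :: 'n set). G (card {k. k < j})) = (\<Prod>i<CARD('n). G i)"
  proof (rule *)
    show "inj (\<lambda>j::'n. card {k. k < j})"
    proof (rule injI, rule ccontr)
      fix x y :: 'n assume e: "card {k. k < x} = card {k. k < y}" and "x \<noteq> y"
      then consider "x < y" | "y < x" by (meson linorder_neqE)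
      then show False by cases (use lt(1)[of x y] lt(1)[of y x] e in simp_all)
    qed
    show "card {k. k < j} < CARD('n)" for j :: 'n by (rule b[of j]) (simp only: mem_Collect_eq less_irrefl not_False_eq_True)
  qed
  show "(\<Prod>j\<in>(UNIV :: 'n set). G (card {k. j < k})) = (\<Prod>i<CARD('n). G i)"
  proof (rule *)
    show "inj (\<lambda>j::'n. card {k. j < k})"
    proof (rule injI, rule ccontr)
      fix x y :: 'n assume e: "card {k. x < k} = card {k. y < k}" and "x \<noteq> y"
      then consider "x < y" | "y < x" by (meson linorder_neqE)
      then show False by cases (use lt(2)[of x y] lt(2)[of y x] e in simp_all)
    qed
    show "card {k. j < k} < CARD('n)" for j :: 'n by (rule b[of j]) (simp only: mem_Collect_eq less_irrefl not_False_eq_True)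
  qed
qed

text \<open>The reciprocal of the normalization through the entire function \<open>rGamma\<close>,
  with the factors of each Gindikin Gamma function reindexed by \<open>i = r - j\<close>.\<close>

definition zeta_norm_inv :: "nat \<Rightarrow> real \<Rightarrow> real \<Rightarrow> real \<Rightarrow> complex \<Rightarrow> complex" where
  "zeta_norm_inv r a b \<iota> \<delta> = (\<Prod>i<r. rGamma ((\<delta> + of_real (a * real i)) / 2 + 1)) *
    (\<Prod>i<r. rGamma ((\<delta> - 1 + of_real (\<iota> + 2 * b) + of_real (a * real i)) / 2 + 1))"

text \<open>This includes the poles: there \<open>Gamma\<close> is \<open>0\<close> by convention
  and \<open>inverse 0 = 0\<close> is the value of \<open>rGamma\<close>.\<close>

lemma zeta_norm_inv_eq: "1 / zeta_norm r a b \<iota> \<delta> = zeta_norm_inv r a b \<iota> \<delta>"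
proof -
  have g: "1 / gindikin_Gamma r a (x / 2 + of_real (a / 2 * (real r - 1)) + 1) = (\<Prod>i<r. rGamma ((x + of_real (a * real i)) / 2 + 1))" for x
  proof -
    have arg: "(x + of_real (a * real (r - j))) / 2 + 1 = x / 2 + of_real (a / 2 * (real r - 1)) + 1 - of_real (a / 2 * (real j - 1))"
      if j: "j \<in> {1..r}" for j
    proof -
      have "a * real (r - j) / 2 = a / 2 * (real r - 1) - a / 2 * (real j - 1)"
        using j by (simp add: of_nat_diff algebra_simps diff_divide_distrib)
      then have "complex_of_real (a * real (r - j)) / 2 = of_real (a / 2 * (real r - 1)) - of_real (a / 2 * (real j - 1))"
        by (simp only: of_real_diff[symmetric] of_real_divide[symmetric] of_real_numeral[symmetric, where 'a=complex])
      then show ?thesis by (simp only: add_divide_distrib) (simp only: add.commute add.left_commute add_diff_eq)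
    qed
    have "(\<Prod>j=1..r. Gamma (x / 2 + of_real (a / 2 * (real r - 1)) + 1 - of_real (a / 2 * (real j - 1)))) = (\<Prod>i<r. Gamma ((x + of_real (a * real i)) / 2 + 1))"
    proof (rule prod.reindex_bij_witness[of _ "\<lambda>i. r - i" "\<lambda>j. r - j"])
      fix j assume "j \<in> {1..r}"
      then show "Gamma ((x + of_real (a * real (r - j))) / 2 + 1) = Gamma (x / 2 + of_real (a / 2 * (real r - 1)) + 1 - of_real (a / 2 * (real j - 1)))"
        by (simp only: arg)
    qed auto
    then show ?thesis unfolding gindikin_Gamma_def rGamma_inverse_Gamma divide_inverse by (simp only: mult_1_left prod_inversef[unfolded o_def])
  qed
  have m: "1 / (A * B) = (1 / A) * (1 / B)" for A B :: complex by simp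
  show ?thesis
    unfolding zeta_norm_def m g zeta_norm_inv_def by (rule refl)
qed

lemma zeta_norm_inv_holomorphic: "zeta_norm_inv r a b \<iota> holomorphic_on A"
  unfolding zeta_norm_inv_def[abs_def] by (intro holomorphic_intros) auto

text \<open>The functional equation \<open>z * rGamma (z + 1) = rGamma z\<close> at
  \<open>z = (x + a * i) / 2\<close>; each of the \<open>2 * r\<close> denominators \<open>2\<close>
  is collected in \<open>4 ^ r\<close>.\<close>

lemma zeta_norm_inv_shift:
  "zeta_norm_inv r a b \<iota> (\<delta> - 2) * 4 ^ r = zeta_norm_inv r a b \<iota> \<delta> *
    ((\<Prod>i<r. \<delta> + of_real (a * real i)) * (\<Prod>i<r. \<delta> - 1 + of_real (\<iota> + 2 * b) + of_real (a * real i)))"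
proof -
  have g: "(\<Prod>i<r. rGamma ((x - 2 + of_real (a * real i)) / 2 + 1)) * 2 ^ r
      = (\<Prod>i<r. rGamma ((x + of_real (a * real i)) / 2 + 1)) * (\<Prod>i<r. x + of_real (a * real i))" for x :: complex
  proof -
    have "(\<Prod>i<r. rGamma ((x - 2 + of_real (a * real i)) / 2 + 1)) * 2 ^ r = (\<Prod>i<r. rGamma ((x - 2 + of_real (a * real i)) / 2 + 1) * 2)"
      by (simp add: prod.distrib)
    also have "\<dots> = (\<Prod>i<r. rGamma ((x + of_real (a * real i)) / 2 + 1) * (x + of_real (a * real i)))"
    proof (rule prod.cong)
      fix i
      have e: "(x - 2 + of_real (a * real i)) / 2 + 1 = (x + of_real (a * real i)) / 2" by (simp add: field_simps)
      show "rGamma ((x - 2 + of_real (a * real i)) / 2 + 1) * 2 = rGamma ((x + of_real (a * real i)) / 2 + 1) * (x + of_real (a * real i))"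
        unfolding e rGamma_plus1[of "(x + of_real (a * real i)) / 2", symmetric] by simp
    qed simp
    finally show ?thesis by (simp add: prod.distrib)
  qed
  have e: "\<delta> - 2 - 1 + of_real (\<iota> + 2 * b) = (\<delta> - 1 + of_real (\<iota> + 2 * b)) - 2" by simp
  have f: "(4::complex) ^ r = 2 ^ r * 2 ^ r" by (simp flip: power_mult_distrib)
  have m: "A * B * (C * C) = P * Q * (X * Y)" if "A * C = P * X" "B * C = Q * Y" for A B C P Q X Y :: complex
    using that by algebra
  show ?thesis
    unfolding zeta_norm_inv_def e f by (rule m[OF g g])
qed

section \<open>Recursion and continuation\<close>

lemma mellin_sum:
  fixes F :: "nat \<Rightarrow> real^'n \<Rightarrow> complex"
  assumes par: "a \<ge> 0" "b \<ge> 0" "\<iota> \<ge> 0" and F: "\<And>k. continuous_on UNIV (F k)" "\<And>k. supported_in R (F k)"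
    and d: "Re \<delta> > - 1 - \<iota> - 2 * b"
  shows "mellin a b \<iota> (\<lambda>t. \<Sum>k\<le>N. c k * F k t) \<delta> = (\<Sum>k\<le>N. c k * mellin a b \<iota> (F k) \<delta>)"
proof -
  have "(\<lambda>t. complex_of_real (weight a b \<iota> t) * zeta_integrand \<delta> (\<lambda>t. \<Sum>k\<le>N. c k * F k t) t)
      = (\<lambda>t. \<Sum>k\<le>N. c k * (of_real (weight a b \<iota> t) * zeta_integrand \<delta> (F k) t))"
    by (rule ext) (simp add: zeta_integrand_def sum_distrib_left mult_ac)
  then show ?thesis unfolding mellin_def
    using mellin_facts(1)[OF par F d] by (simp add: Bochner_Integration.integral_sum)
qed

text \<open>The scalar \<open>B\<close> of the two stages is the one by which the normalizing factor
  changes in \<open>zeta_norm_inv_shift\<close>, up to \<open>4 ^ r\<close>.\<close>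

lemma mellin_recursion:
  fixes f :: "real^'n::{finite,wellorder} \<Rightarrow> complex" and x :: real
  assumes par: "a \<ge> 0" "b \<ge> 0" "\<iota> \<ge> 0" and f: "smooth f" "supported_in R f" and x: "x > 4"
  shows "zeta_norm_inv CARD('n) a b \<iota> x * mellin a b \<iota> (prod_op a b \<iota> ((of_real x + of_real (rho a b \<iota> (Min (UNIV :: 'n set))))\<^sup>2) f) x
    = 4 ^ CARD('n) * (zeta_norm_inv CARD('n) a b \<iota> (of_real x - 2) * mellin a b \<iota> f (of_real x - 2))"
proof -
  have P: "profile_prod x (\<lambda>_. 0) t = \<bar>SH t\<bar> powr x" "profile_prod x (\<lambda>_. 2) t = \<bar>SH t\<bar> powr (x - 2)" for t :: "real^'n::{finite,wellorder}"
    by (simp_all add: profile_prod_def profile_def SH_def abs_prod prod_powr_distrib)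
  have z: "zeta_integrand (of_real y) g t = of_real (\<bar>SH t\<bar> powr y) * g t" for y g and t :: "real^'n::{finite,wellorder}"
    by (simp add: zeta_integrand_def powr_of_real)
  have m: "mellin a b \<iota> g (of_real y) = integral\<^sup>L lborel (\<lambda>t. of_real (weight a b \<iota> t * \<bar>SH t\<bar> powr y) * g t)" for y and g :: "real^'n::{finite,wellorder} \<Rightarrow> complex"
    unfolding mellin_def z by (simp add: mult.assoc)
  define B where "B = (\<Prod>i<CARD('n). x + a * real i) * (\<Prod>i<CARD('n). x - 1 + \<iota> + 2 * b + a * real i)"
  have "mellin a b \<iota> (prod_op a b \<iota> ((of_real x + of_real (rho a b \<iota> (Min (UNIV :: 'n set))))\<^sup>2) f) (of_real x)
      = of_real B * mellin a b \<iota> f (of_real (x - 2))"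
    using integral_prod_op_profile[OF par x f] unfolding m P B_def
      prod_card_less(1)[of "\<lambda>i. x + a * real i", where 'n='n] prod_card_less(2)[of "\<lambda>i. x - 1 + \<iota> + 2 * b + a * real i", where 'n='n]
    by simp
  moreover have "zeta_norm_inv CARD('n) a b \<iota> (of_real x - 2) * 4 ^ CARD('n) = zeta_norm_inv CARD('n) a b \<iota> x * of_real B"
    unfolding zeta_norm_inv_shift B_def by (simp add: algebra_simps)
  moreover have "u * M = c * (v * m)" if "M = B' * m" "v * c = u * B'" for u M c v m B' :: complex
    using that by algebra
  ultimately show ?thesis unfolding of_real_diff of_real_numeral by blast
qed

text \<open>The induction is over all \<open>f\<close> supported in the ball, because a step to the
  left for \<open>f\<close> uses the continuations of the coefficients \<open>F k\<close>.\<close>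

lemma zeta_continuation_step:
  fixes f :: "real^'n::{finite,wellorder} \<Rightarrow> complex"
  assumes par: "a \<ge> 0" "b \<ge> 0" "\<iota> \<ge> 0"
  defines "\<sigma> \<equiv> - 1 - \<iota> - 2 * b" and "Z \<equiv> \<lambda>f \<delta>. zeta_norm_inv CARD('n) a b \<iota> \<delta> * mellin a b \<iota> (f :: real^'n::{finite,wellorder} \<Rightarrow> complex) \<delta>"
  shows "smooth f \<Longrightarrow> supported_in R f \<Longrightarrow>
    \<exists>g. g holomorphic_on {\<delta>. Re \<delta> > \<sigma> - 2 * real n} \<and> (\<forall>\<delta>. Re \<delta> > \<sigma> \<longrightarrow> g \<delta> = Z f \<delta>)"
proof (induction n arbitrary: f)
  case 0
  have "Z f holomorphic_on {\<delta>. Re \<delta> > \<sigma>}"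
    unfolding Z_def \<sigma>_def
    by (intro holomorphic_on_mult zeta_norm_inv_holomorphic mellin_facts(2)[OF par smooth_continuous[OF 0(1)] 0(2)])
  then show ?case by (intro exI[of _ "Z f"]) simp
next
  case (Suc n)
  let ?r = "CARD('n)"
  define \<rho> where "\<rho> = complex_of_real (rho a b \<iota> (Min (UNIV :: 'n set)))"
  obtain F N where F: "\<And>k. smooth (F k)" "\<And>k. supported_in R (F k)"
    and Fq: "\<And>q. prod_op a b \<iota> q f = (\<lambda>t. \<Sum>k\<le>(N::nat). q ^ k * F k t)"
    using prod_op_polynomial[OF Suc.prems] by metis
  have "\<forall>k. \<exists>g. g holomorphic_on {\<delta>. Re \<delta> > \<sigma> - 2 * real n} \<and> (\<forall>\<delta>. Re \<delta> > \<sigma> \<longrightarrow> g \<delta> = Z (F k) \<delta>)"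
    using Suc.IH[OF F] by blast
  then obtain G where G: "\<And>k. G k holomorphic_on {\<delta>. Re \<delta> > \<sigma> - 2 * real n}" "\<And>k \<delta>. Re \<delta> > \<sigma> \<Longrightarrow> G k \<delta> = Z (F k) \<delta>"
    by metis
  \<comment> \<open>The recursion at \<open>\<delta> + 2\<close>, solved for the value at \<delta>;
    the shift moves the domain of each \<open>G k\<close> two units to the left.\<close>
  define g where "g \<delta> = (\<Sum>k\<le>N. ((\<delta> + 2 + \<rho>)\<^sup>2) ^ k * G k (\<delta> + 2)) / 4 ^ ?r" for \<delta>
  have Gs: "(\<lambda>\<delta>. G k (\<delta> + 2)) holomorphic_on {\<delta>. Re \<delta> > \<sigma> - 2 * real (Suc n)}" for k
  proof -
    have "(G k \<circ> (\<lambda>\<delta>. \<delta> + 2)) holomorphic_on {\<delta>. Re \<delta> > \<sigma> - 2 * real (Suc n)}"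
      by (rule holomorphic_on_compose_gen[OF _ G(1)]) (auto intro!: holomorphic_intros)
    then show ?thesis by (simp add: o_def)
  qed
  have gh: "g holomorphic_on {\<delta>. Re \<delta> > \<sigma> - 2 * real (Suc n)}"
    unfolding g_def[abs_def] by (intro holomorphic_intros Gs) auto
  have "g \<delta> = Z f \<delta>" if d: "Re \<delta> > \<sigma>" for \<delta>
  proof (rule half_plane_identity[of g \<sigma> "Z f" 2 \<delta>])
    show "g holomorphic_on {z. Re z > \<sigma>}" by (rule holomorphic_on_subset[OF gh]) auto
    show "Z f holomorphic_on {z. Re z > \<sigma>}"
      unfolding Z_def \<sigma>_def
      by (intro holomorphic_on_mult zeta_norm_inv_holomorphic mellin_facts(2)[OF par smooth_continuous[OF Suc.prems(1)] Suc.prems(2)])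
    \<comment> \<open>The bound ensures \<open>x + 2 > 4\<close>, the range of
      \<open>mellin_recursion\<close>.\<close>
    fix x :: real assume x: "x > 2" "x > \<sigma>"
    have s: "Re (complex_of_real (x + 2)) > \<sigma>" using x by simp
    have "4 ^ ?r * g x = (\<Sum>k\<le>N. ((of_real (x + 2) + \<rho>)\<^sup>2) ^ k * Z (F k) (of_real (x + 2)))"
      using G(2)[OF s] by (simp add: g_def)
    also have "\<dots> = zeta_norm_inv ?r a b \<iota> (of_real (x + 2)) * mellin a b \<iota> (prod_op a b \<iota> ((of_real (x + 2) + \<rho>)\<^sup>2) f) (of_real (x + 2))"
      unfolding Fq Z_def
      by (subst mellin_sum[OF par smooth_continuous[OF F(1)] F(2)]) (use s in \<open>simp_all add: \<sigma>_def sum_distrib_left mult_ac\<close>)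
    also have "\<dots> = 4 ^ ?r * Z f (of_real (x + 2) - 2)"
      unfolding \<rho>_def Z_def by (rule mellin_recursion[OF par Suc.prems]) (use x in simp)
    finally show "g x = Z f x" by simp
  qed (rule d)
  then show ?case using gh by blast
qed

lemma holomorphic_on_UNIV_half_planes:
  assumes "\<And>n::nat. f holomorphic_on {\<delta>. Re \<delta> > s - 2 * real n}"
  shows "f holomorphic_on UNIV"
proof -
  have "(\<Union>n::nat. {\<delta>. Re \<delta> > s - 2 * real n}) = UNIV"
  proof (rule set_eqI, simp)
    fix \<delta> :: complex
    obtain n :: nat where "(s - Re \<delta>) / 2 < real n" using reals_Archimedean2 by blast
    then show "\<exists>n::nat. s - 2 * real n < Re \<delta>" by (intro exI[of _ n]) (simp add: field_simps)
  qed
  moreover have "f holomorphic_on (\<Union>n::nat. {\<delta>. Re \<delta> > s - 2 * real n})"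
    by (rule holomorphic_on_UN_open) (auto intro: assms open_halfspace_Re_gt)
  ultimately show ?thesis by simp
qed

lemma zeta_entire_continuation:
  fixes f :: "real^'n::{finite,wellorder} \<Rightarrow> complex"
  assumes par: "a \<ge> 0" "b \<ge> 0" "\<iota> \<ge> 0" and f: "smooth f" "supported_in R f"
  shows "\<exists>g. g holomorphic_on UNIV \<and> (\<forall>\<delta>. Re \<delta> > - 1 - \<iota> - 2 * b \<longrightarrow> g \<delta> = zeta_norm_inv CARD('n) a b \<iota> \<delta> * mellin a b \<iota> f \<delta>)"
proof -
  define \<sigma> where "\<sigma> = - 1 - \<iota> - 2 * b"
  define Z where "Z \<delta> = zeta_norm_inv CARD('n) a b \<iota> \<delta> * mellin a b \<iota> f \<delta>" for \<delta>
  have "\<forall>n::nat. \<exists>g. g holomorphic_on {\<delta>. Re \<delta> > \<sigma> - 2 * real n} \<and> (\<forall>\<delta>. Re \<delta> > \<sigma> \<longrightarrow> g \<delta> = Z \<delta>)"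
    using zeta_continuation_step[OF par f] unfolding \<sigma>_def Z_def by blast
  then obtain G where G: "\<And>n::nat. G n holomorphic_on {\<delta>. Re \<delta> > \<sigma> - 2 * real n}" "\<And>n \<delta>. Re \<delta> > \<sigma> \<Longrightarrow> G n \<delta> = Z \<delta>"
    by metis
  \<comment> \<open>The index of one half plane that contains \<delta>; by \<open>eq\<close> the
    value does not depend on this choice.\<close>
  define N where "N \<delta> = nat \<lceil>(\<sigma> - Re \<delta>) / 2\<rceil> + 1" for \<delta> :: complex
  have N: "Re \<delta> > \<sigma> - 2 * real (N \<delta>)" for \<delta>
  proof -
    have "(\<sigma> - Re \<delta>) / 2 < real (N \<delta>)" unfolding N_def by linarith
    then show ?thesis by (simp add: field_simps)
  qed
  have eq: "G m \<delta> = G n \<delta>" if "Re \<delta> > \<sigma> - 2 * real m" "Re \<delta> > \<sigma> - 2 * real n" for m n \<delta>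
  proof -
    have "G m \<delta> = G n \<delta>" if "m \<le> n" "Re \<delta> > \<sigma> - 2 * real m" for m n \<delta>
    proof (rule half_plane_identity[of "G m" "\<sigma> - 2 * real m" "G n" \<sigma> \<delta>])
      show "G n holomorphic_on {z. \<sigma> - 2 * real m < Re z}"
        by (rule holomorphic_on_subset[OF G(1)]) (use that(1) in auto)
    qed (use G that in auto)
    then show ?thesis using that by (metis nat_le_linear)
  qed
  define g where "g \<delta> = G (N \<delta>) \<delta>" for \<delta>
  have gG: "g \<delta> = G n \<delta>" if "Re \<delta> > \<sigma> - 2 * real n" for n \<delta>
    unfolding g_def by (rule eq[OF N that])
  have "g holomorphic_on {\<delta>. Re \<delta> > \<sigma> - 2 * real n}" for n
    by (rule holomorphic_transform[OF G(1)]) (simp add: gG)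
  then have "g holomorphic_on UNIV" by (rule holomorphic_on_UNIV_half_planes)
  moreover have "g \<delta> = Z \<delta>" if "Re \<delta> > \<sigma>" for \<delta> using gG[of 0 \<delta>] G(2)[OF that, of 0] that by simp
  ultimately show ?thesis unfolding \<sigma>_def Z_def by blast
qed

theorem theorem3p4:
  fixes a b \<iota> :: real
  assumes "a \<ge> 0" "b \<ge> 0" "\<iota> \<ge> 0"
  shows "\<exists>Z :: complex \<Rightarrow> (real^'n::{finite,wellorder} \<Rightarrow> complex) \<Rightarrow> complex.
    (\<forall>f \<in> test_functions a b \<iota>.
       (\<lambda>\<delta>. Z \<delta> f) holomorphic_on UNIV \<and>
       (\<forall>\<delta>. Re \<delta> > - 1 - \<iota> - 2 * b \<longrightarrow>
          integrable (root_measure a b \<iota>) (zeta_integrand \<delta> f) \<and> Z \<delta> f = zeta a b \<iota> \<delta> f)) \<and>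
    (\<forall>\<delta>. \<forall>f \<in> test_functions a b \<iota>.
       bs_operator a b \<iota> \<delta> f \<in> test_functions a b \<iota> \<and>
       Z \<delta> (bs_operator a b \<iota> \<delta> f) = 2 ^ (2 * CARD('n)) * Z (\<delta> - 2) f)"
proof -
  define \<sigma> where "\<sigma> = - 1 - \<iota> - 2 * b"
  define Z0 where "Z0 f \<delta> = zeta_norm_inv CARD('n) a b \<iota> \<delta> * mellin a b \<iota> f \<delta>" for f :: "real^'n::{finite,wellorder} \<Rightarrow> complex" and \<delta>
  \<comment> \<open>The continuation is chosen for all smooth functions of compact support, because
    the recursion passes through the coefficients \<open>F k\<close> of
    \<open>prod_op_polynomial\<close>.\<close>
  define ok where "ok f \<longleftrightarrow> smooth f \<and> (\<exists>R. supported_in R f)" for f :: "real^'n::{finite,wellorder} \<Rightarrow> complex"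
  have "\<forall>f. \<exists>g. ok f \<longrightarrow> g holomorphic_on UNIV \<and> (\<forall>\<delta>. Re \<delta> > \<sigma> \<longrightarrow> g \<delta> = Z0 f \<delta>)"
    unfolding ok_def \<sigma>_def Z0_def using zeta_entire_continuation[OF assms] by meson
  then obtain Z where "\<forall>f. ok f \<longrightarrow> Z f holomorphic_on UNIV \<and> (\<forall>\<delta>. Re \<delta> > \<sigma> \<longrightarrow> Z f \<delta> = Z0 f \<delta>)"
    using choice[of "\<lambda>f g. ok f \<longrightarrow> g holomorphic_on UNIV \<and> (\<forall>\<delta>. Re \<delta> > \<sigma> \<longrightarrow> g \<delta> = Z0 f \<delta>)"] by blast
  then have Zh: "\<And>f. ok f \<Longrightarrow> Z f holomorphic_on UNIV" and ZZ: "\<And>f \<delta>. ok f \<Longrightarrow> Re \<delta> > \<sigma> \<Longrightarrow> Z f \<delta> = Z0 f \<delta>"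
    by blast+
  have Zs: "Z f holomorphic_on S" if "ok f" for f S using Zh[OF that] by (rule holomorphic_on_subset) simp
  have ok: "ok f" if "f \<in> test_functions a b \<iota>" for f
    using that unfolding test_functions_def mem_Collect_eq compact_support_iff ok_def by blast
  have rec: "Z (bs_operator a b \<iota> \<delta> f) \<delta> = 2 ^ (2 * CARD('n)) * Z f (\<delta> - 2)" if fo: "ok f" for f \<delta>
  proof -
    obtain R where f: "smooth f" "supported_in R f" using fo by (auto simp: ok_def)
    define \<rho> where "\<rho> = complex_of_real (rho a b \<iota> (Min (UNIV :: 'n set)))"
    obtain F N where F: "\<And>k. smooth (F k)" "\<And>k. supported_in R (F k)"
      and Fq: "\<And>q. prod_op a b \<iota> q f = (\<lambda>t. \<Sum>k\<le>(N::nat). q ^ k * F k t)"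
      using prod_op_polynomial[OF f] by metis
    have okF: "ok (F k)" for k using F by (auto simp: ok_def)
    have Z0F: "Z0 (prod_op a b \<iota> q f) \<delta> = (\<Sum>k\<le>N. q ^ k * Z0 (F k) \<delta>)" if "Re \<delta> > \<sigma>" for q \<delta>
      unfolding Fq Z0_def
      by (subst mellin_sum[OF assms smooth_continuous[OF F(1)] F(2)]) (use that in \<open>simp_all add: \<sigma>_def sum_distrib_left mult_ac\<close>)
    have okM: "ok (prod_op a b \<iota> q f)" for q
      unfolding ok_def using smooth_prod_op[OF f(1)] supported_in_prod_op[OF f] by blast
    \<comment> \<open>The continuations are chosen separately for each function, so linearity has to
      be recovered from the original half plane. The bound with \<open>min\<close> gives a half
      plane that contains both \<open>w\<close> and that region.\<close>
    have lin: "Z (prod_op a b \<iota> q f) w = (\<Sum>k\<le>N. q ^ k * Z (F k) w)" for q w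
    proof (rule half_plane_identity[of "Z (prod_op a b \<iota> q f)" "min \<sigma> (Re w - 1)" "\<lambda>w. \<Sum>k\<le>N. q ^ k * Z (F k) w" \<sigma> w])
      show "(\<lambda>w. \<Sum>k\<le>N. q ^ k * Z (F k) w) holomorphic_on {z. min \<sigma> (Re w - 1) < Re z}"
        by (intro holomorphic_intros Zs okF)
    qed (use Z0F okF okM Zs in \<open>auto simp: ZZ\<close>)
    \<comment> \<open>Expanded into coefficients, the left side is holomorphic in \<delta>. For real
      \<delta> above \<open>4\<close> the recursion applies, and above \<open>\<sigma> + 2\<close>
      the point \<open>\<delta> - 2\<close> lies where \<open>Z\<close> is given by the
      integral.\<close>
    have "(\<Sum>k\<le>N. ((\<delta> + \<rho>)\<^sup>2) ^ k * Z (F k) \<delta>) = 4 ^ CARD('n) * Z f (\<delta> - 2)"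
    proof (rule half_plane_identity[of "\<lambda>\<delta>. \<Sum>k\<le>N. ((\<delta> + \<rho>)\<^sup>2) ^ k * Z (F k) \<delta>" "min \<sigma> (Re \<delta> - 1)"
          "\<lambda>\<delta>. 4 ^ CARD('n) * Z f (\<delta> - 2)" "max 4 (\<sigma> + 2)" \<delta>])
      show "(\<lambda>\<delta>. \<Sum>k\<le>N. ((\<delta> + \<rho>)\<^sup>2) ^ k * Z (F k) \<delta>) holomorphic_on {z. min \<sigma> (Re \<delta> - 1) < Re z}"
        by (intro holomorphic_intros Zs okF)
      have "(Z f \<circ> (\<lambda>\<delta>. \<delta> - 2)) holomorphic_on {z. min \<sigma> (Re \<delta> - 1) < Re z}"
        by (rule holomorphic_on_compose_gen[OF _ Zh[OF fo]]) (auto intro!: holomorphic_intros)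
      then show "(\<lambda>\<delta>. 4 ^ CARD('n) * Z f (\<delta> - 2)) holomorphic_on {z. min \<sigma> (Re \<delta> - 1) < Re z}"
        by (intro holomorphic_on_mult holomorphic_on_const) (simp add: o_def)
      fix x :: real assume x: "max 4 (\<sigma> + 2) < x"
      have "(\<Sum>k\<le>N. ((of_real x + \<rho>)\<^sup>2) ^ k * Z (F k) x) = Z0 (prod_op a b \<iota> ((of_real x + \<rho>)\<^sup>2) f) x"
        using x by (subst Z0F) (simp_all add: ZZ okF)
      also have "\<dots> = 4 ^ CARD('n) * Z0 f (of_real x - 2)"
        unfolding Z0_def \<rho>_def by (rule mellin_recursion[OF assms f]) (use x in simp)
      also have "Z0 f (of_real x - 2) = Z f (of_real x - 2)" using x by (simp add: ZZ fo)
      finally show "(\<Sum>k\<le>N. ((of_real x + \<rho>)\<^sup>2) ^ k * Z (F k) x) = 4 ^ CARD('n) * Z f (of_real x - 2)" .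
    qed simp
    then show ?thesis by (simp add: bs_operator_prod_op lin \<rho>_def power_mult)
  qed
  show ?thesis
  proof (rule exI[of _ "\<lambda>\<delta> f. Z f \<delta>"], intro conjI ballI allI impI)
    fix f :: "real^'n::{finite,wellorder} \<Rightarrow> complex" assume f: "f \<in> test_functions a b \<iota>"
    have fs: "smooth f" using f by (simp add: test_functions_def)
    obtain R where R: "supported_in R f" using ok[OF f] by (auto simp: ok_def)
    show "(\<lambda>\<delta>. Z f \<delta>) holomorphic_on UNIV" using Zh[OF ok[OF f]] .
    note ze = zeta_eq_mellin[OF assms smooth_continuous[OF fs] R]
    show "integrable (root_measure a b \<iota>) (zeta_integrand \<delta> f)" if "Re \<delta> > - 1 - \<iota> - 2 * b" for \<delta>
      using ze(1)[OF that] .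
    show "Z f \<delta> = zeta a b \<iota> \<delta> f" if "Re \<delta> > - 1 - \<iota> - 2 * b" for \<delta>
      using ze(2)[OF that] ZZ[OF ok[OF f], of \<delta>] that unfolding zeta_norm_inv_eq by (simp add: \<sigma>_def Z0_def)
    show "bs_operator a b \<iota> \<delta> f \<in> test_functions a b \<iota>" for \<delta>
      unfolding bs_operator_prod_op by (rule prod_op_test_functions[OF f])
    show "Z (bs_operator a b \<iota> \<delta> f) \<delta> = 2 ^ (2 * CARD('n)) * Z f (\<delta> - 2)" for \<delta>
      by (rule rec[OF ok[OF f]])
  qed
qed

end
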